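(* Let $C$ be any hyperelliptic curve of genus $g \ge 7$, and let $H$ be the hyperelliptic line bundle on $C$. Then for each integer $n$ satisfying $2 \le n$ and $3n+1 \le g-1$, there exists a linearly stable generated coherent system $(L,V)$ of type $(1, 4n+2, 3)$ over $C$ whose associated dual span bundle $M_{V,L}$ is destabilized, in the sense of failing to be semistable, by a subsheaf isomorphic to $H^{\otimes -n}$; that is, there is an injection of sheaves $H^{\otimes -n} \hookrightarrow M_{V,L}$ with $\deg(H^{\otimes -n}) > \mu(M_{V,L})$.
   Context: Curves are smooth, projective, irreducible, over $\mathbb{C}$. The hyperelliptic line bundle $H$ is the degree $2$ line bundle with $h^0(C,H)=2$ (so $|H|=g^1_2$). A coherent system of type $(r,d,m)$ over $C$ is a pair $(E,V)$ with $E$ a vector bundle of rank $r$ and degree $d$ and $V\subseteq H^0(C,E)$ a subspace of dimension $m$; it is generated if the evaluation map $V\otimes\mathcal{O}_C\to E$ is surjective. For a generated coherent system the dual span bundle is $M_{V,E}=\mathrm{Ker}(V\otimes\mathcal{O}_C\to E)$. The slope of a bundle is $\mu=\deg/\mathrm{rk}$. A generated coherent system $(L,V)$ of type $(1,d,m)$ is linearly stable if for every proper linear subspace $W\subset V$ of dimension $w\ge 2$ one has $\frac{\deg(L_W)}{w-1} > \frac{d}{m-1}$, where $L_W$ is the image of the evaluation map $W\otimes\mathcal{O}_C\to L$. *)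

theory Defs
  imports
    "HOL-Analysis.Finite_Cartesian_Product"
    "HOL-Analysis.Abstract_Topology"
    "HOL-Algebra.Module"
    "HOL-Combinatorics.Permutations"
    "HOL-Library.FuncSet"
begin

text \<open>The homogeneous coordinates are indexed by the finite type \<open>'n\<close>, so that projective space is
  that of \<open>complex ^ 'n\<close>, of dimension \<open>CARD('n) - 1\<close>. A point is a line through the origin with
  the origin removed, that is, the set of all its vectors of homogeneous coordinates.\<close>

type_synonym 'n pt = "(complex ^ 'n) set"

definition proj_space :: "('n::finite) pt set" where
  "proj_space = {{c *s v |c. c \<noteq> 0} |v. v \<noteq> 0}"

text \<open>Homogeneous polynomials of degree \<open>d\<close>, as functions (the field is infinite).\<close>

inductive hom_poly :: "nat \<Rightarrow> (complex ^ ('n::finite) \<Rightarrow> complex) \<Rightarrow> bool" where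
  const: "hom_poly 0 (\<lambda>v. c)"
| coord: "hom_poly d P \<Longrightarrow> hom_poly (Suc d) (\<lambda>v. v $ i * P v)"
| add: "hom_poly d P \<Longrightarrow> hom_poly d Q \<Longrightarrow> hom_poly d (\<lambda>v. P v + Q v)"

definition proj_zariski :: "('n::finite) pt topology" where
  "proj_zariski = topology_generated_by
     {{p \<in> proj_space. \<forall>v\<in>p. P v \<noteq> 0} |P. \<exists>d. hom_poly d P}"

abbreviation zariski :: "('n::finite) pt set \<Rightarrow> 'n pt topology" where
  "zariski X \<equiv> subtopology proj_zariski X"

abbreviation zopen :: "('n::finite) pt set \<Rightarrow> 'n pt set \<Rightarrow> bool" where
  "zopen X U \<equiv> openin (zariski X) U"

definition irreducible_closed :: "'a topology \<Rightarrow> 'a set \<Rightarrow> bool" where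
  "irreducible_closed T S \<longleftrightarrow> S \<noteq> {} \<and> closedin T S \<and>
     (\<forall>A B. closedin T A \<and> closedin T B \<and> S \<subseteq> A \<union> B \<longrightarrow> S \<subseteq> A \<or> S \<subseteq> B)"

definition irreducible_chain :: "'a topology \<Rightarrow> nat \<Rightarrow> (nat \<Rightarrow> 'a set) \<Rightarrow> bool" where
  "irreducible_chain T k Z \<longleftrightarrow>
     (\<forall>i\<le>k. irreducible_closed T (Z i)) \<and> (\<forall>i<k. Z i \<subset> Z (Suc i))"

definition has_dimension :: "'a topology \<Rightarrow> nat \<Rightarrow> bool" where
  "has_dimension T d \<longleftrightarrow>
     (\<exists>Z. irreducible_chain T d Z) \<and> \<not> (\<exists>Z. irreducible_chain T (Suc d) Z)"

definition regular :: "('n::finite) pt set \<Rightarrow> 'n pt set \<Rightarrow> ('n pt \<Rightarrow> complex) set" where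
  "regular X U = {f \<in> extensional U.
     \<forall>p\<in>U. \<exists>W d P Q. zopen X W \<and> p \<in> W \<and> W \<subseteq> U \<and> hom_poly d P \<and> hom_poly d Q \<and>
       (\<forall>q\<in>W. \<forall>v\<in>q. Q v \<noteq> 0 \<and> f q = P v / Q v)}"

definition structure_sheaf :: "('n::finite) pt set \<Rightarrow> 'n pt set \<Rightarrow> ('n pt \<Rightarrow> complex) ring" where
  "structure_sheaf X U =
     \<lparr>carrier = regular X U,
      monoid.mult = (\<lambda>f g. \<lambda>p\<in>U. f p * g p), monoid.one = (\<lambda>p\<in>U. 1),
      ring.zero = (\<lambda>p\<in>U. 0), add = (\<lambda>f g. \<lambda>p\<in>U. f p + g p)\<rparr>"

text \<open>The germ at \<open>p\<close> of the function \<open>t\<close>, regular on \<open>W\<close>, generates the maximal ideal of the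
  local ring of \<open>X\<close> at \<open>p\<close>.\<close>

definition uniformizer :: "('n::finite) pt set \<Rightarrow> 'n pt \<Rightarrow> 'n pt set \<Rightarrow> ('n pt \<Rightarrow> complex) \<Rightarrow> bool" where
  "uniformizer X p W t \<longleftrightarrow> zopen X W \<and> p \<in> W \<and> t \<in> regular X W \<and> t p = 0 \<and>
     (\<forall>W1 f. zopen X W1 \<and> p \<in> W1 \<and> W1 \<subseteq> W \<and> f \<in> regular X W1 \<and> f p = 0 \<longrightarrow>
       (\<exists>W2 g. zopen X W2 \<and> p \<in> W2 \<and> W2 \<subseteq> W1 \<and> g \<in> regular X W2 \<and>
         (\<forall>q\<in>W2. f q = t q * g q)))"

text \<open>Smoothness of a curve is regularity of its local rings: the maximal ideals are generated by as
  many elements as the dimension, namely one.\<close>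

definition smooth_projective_curve :: "('n::finite) pt set \<Rightarrow> bool" where
  "smooth_projective_curve X \<longleftrightarrow>
     irreducible_closed proj_zariski X \<and>
     has_dimension (zariski X) 1 \<and>
     (\<forall>p\<in>X. \<exists>W t. uniformizer X p W t)"

text \<open>The function \<open>h\<close>, regular on the nonempty open set \<open>U\<close> and viewed as a rational function
  on \<open>X\<close>, has order \<open>k\<close> at \<open>p\<close>. The point \<open>p\<close> need not belong to \<open>U\<close>.\<close>

definition has_order ::
  "('n::finite) pt set \<Rightarrow> 'n pt \<Rightarrow> 'n pt set \<Rightarrow> ('n pt \<Rightarrow> complex) \<Rightarrow> int \<Rightarrow> bool" where
  "has_order X p U h k \<longleftrightarrow> (\<exists>W t u. uniformizer X p W t \<and> u \<in> regular X W \<and> u p \<noteq> 0 \<and>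
     (\<forall>q \<in> W \<inter> U. t q \<noteq> 0 \<longrightarrow> h q = u q * t q powi k))"

record ('n, 'm) sheaf =
  Sec :: "'n pt set \<Rightarrow> ('n pt \<Rightarrow> complex, 'm) module"
  Res :: "'n pt set \<Rightarrow> 'n pt set \<Rightarrow> 'm \<Rightarrow> 'm"

definition module_sheaf :: "('n::finite) pt set \<Rightarrow> ('n, 'm) sheaf \<Rightarrow> bool" where
  "module_sheaf X F \<longleftrightarrow>
     (\<forall>U. zopen X U \<longrightarrow> module (structure_sheaf X U) (Sec F U)) \<and>
     (\<forall>U V. zopen X U \<and> zopen X V \<and> V \<subseteq> U \<longrightarrow>
        Res F U V \<in> carrier (Sec F U) \<rightarrow> carrier (Sec F V) \<and>
        (\<forall>s\<in>carrier (Sec F U). \<forall>t\<in>carrier (Sec F U).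
           Res F U V (s \<oplus>\<^bsub>Sec F U\<^esub> t) = Res F U V s \<oplus>\<^bsub>Sec F V\<^esub> Res F U V t) \<and>
        (\<forall>a\<in>regular X U. \<forall>s\<in>carrier (Sec F U).
           Res F U V (a \<odot>\<^bsub>Sec F U\<^esub> s) = restrict a V \<odot>\<^bsub>Sec F V\<^esub> Res F U V s)) \<and>
     (\<forall>U. zopen X U \<longrightarrow> (\<forall>s\<in>carrier (Sec F U). Res F U U s = s)) \<and>
     (\<forall>U V W. zopen X U \<and> zopen X V \<and> zopen X W \<and> W \<subseteq> V \<and> V \<subseteq> U \<longrightarrow>
        (\<forall>s\<in>carrier (Sec F U). Res F V W (Res F U V s) = Res F U W s)) \<and>
     (\<forall>\<U>. (\<forall>V\<in>\<U>. zopen X V) \<longrightarrow>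
        (\<forall>s\<in>carrier (Sec F (\<Union>\<U>)). \<forall>t\<in>carrier (Sec F (\<Union>\<U>)).
           (\<forall>V\<in>\<U>. Res F (\<Union>\<U>) V s = Res F (\<Union>\<U>) V t) \<longrightarrow> s = t) \<and>
        (\<forall>\<sigma>. (\<forall>V\<in>\<U>. \<sigma> V \<in> carrier (Sec F V)) \<and>
             (\<forall>V\<in>\<U>. \<forall>W\<in>\<U>. Res F V (V \<inter> W) (\<sigma> V) = Res F W (V \<inter> W) (\<sigma> W)) \<longrightarrow>
           (\<exists>s\<in>carrier (Sec F (\<Union>\<U>)). \<forall>V\<in>\<U>. Res F (\<Union>\<U>) V s = \<sigma> V)))"

definition sheaf_morphism ::
  "('n::finite) pt set \<Rightarrow> ('n, 'm) sheaf \<Rightarrow> ('n, 'k) sheaf \<Rightarrow> ('n pt set \<Rightarrow> 'm \<Rightarrow> 'k) \<Rightarrow> bool" where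
  "sheaf_morphism X F G \<phi> \<longleftrightarrow>
     (\<forall>U. zopen X U \<longrightarrow>
        \<phi> U \<in> carrier (Sec F U) \<rightarrow> carrier (Sec G U) \<and>
        (\<forall>s\<in>carrier (Sec F U). \<forall>t\<in>carrier (Sec F U).
           \<phi> U (s \<oplus>\<^bsub>Sec F U\<^esub> t) = \<phi> U s \<oplus>\<^bsub>Sec G U\<^esub> \<phi> U t) \<and>
        (\<forall>a\<in>regular X U. \<forall>s\<in>carrier (Sec F U).
           \<phi> U (a \<odot>\<^bsub>Sec F U\<^esub> s) = a \<odot>\<^bsub>Sec G U\<^esub> \<phi> U s)) \<and>
     (\<forall>U V. zopen X U \<and> zopen X V \<and> V \<subseteq> U \<longrightarrow>
        (\<forall>s\<in>carrier (Sec F U). \<phi> V (Res F U V s) = Res G U V (\<phi> U s)))"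

definition sheaf_injection ::
  "('n::finite) pt set \<Rightarrow> ('n, 'm) sheaf \<Rightarrow> ('n, 'k) sheaf \<Rightarrow> ('n pt set \<Rightarrow> 'm \<Rightarrow> 'k) \<Rightarrow> bool" where
  "sheaf_injection X F G \<phi> \<longleftrightarrow> sheaf_morphism X F G \<phi> \<and>
     (\<forall>U. zopen X U \<longrightarrow> inj_on (\<phi> U) (carrier (Sec F U)))"

definition sub_sheaf :: "('n, 'm) sheaf \<Rightarrow> ('n pt set \<Rightarrow> 'm set) \<Rightarrow> ('n, 'm) sheaf" where
  "sub_sheaf F S = \<lparr>Sec = (\<lambda>U. (Sec F U)\<lparr>carrier := S U\<rparr>), Res = Res F\<rparr>"

text \<open>The sections \<open>e 0, \<dots>, e (r - 1)\<close> define an isomorphism of the free sheaf of rank \<open>r\<close> on \<open>U\<close>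
  with the restriction of \<open>F\<close> to \<open>U\<close>.\<close>

definition frame ::
  "('n::finite) pt set \<Rightarrow> ('n, 'm) sheaf \<Rightarrow> nat \<Rightarrow> 'n pt set \<Rightarrow> (nat \<Rightarrow> 'm) \<Rightarrow> bool" where
  "frame X F r U e \<longleftrightarrow> zopen X U \<and> (\<forall>i<r. e i \<in> carrier (Sec F U)) \<and>
     (\<forall>V. zopen X V \<and> V \<subseteq> U \<longrightarrow>
        bij_betw (\<lambda>a. \<Oplus>\<^bsub>Sec F V\<^esub>i\<in>{..<r}. a i \<odot>\<^bsub>Sec F V\<^esub> Res F U V (e i))
          ({..<r} \<rightarrow>\<^sub>E regular X V) (carrier (Sec F V)))"

definition vector_bundle :: "('n::finite) pt set \<Rightarrow> ('n, 'm) sheaf \<Rightarrow> nat \<Rightarrow> bool" where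
  "vector_bundle X F r \<longleftrightarrow> module_sheaf X F \<and> (\<forall>p\<in>X. \<exists>U e. p \<in> U \<and> frame X F r U e)"

definition bundle_rank :: "('n::finite) pt set \<Rightarrow> ('n, 'm) sheaf \<Rightarrow> nat" where
  "bundle_rank X F = (THE r. vector_bundle X F r)"

text \<open>The order at \<open>p\<close> of the rational section \<open>e 0 \<and> \<dots> \<and> e (r - 1)\<close> of the determinant line bundle,
  where \<open>e\<close> is a frame over the nonempty open set \<open>U\<close>: it is the order of the determinant of the
  matrix that expresses \<open>e\<close> through a frame near \<open>p\<close>.\<close>

definition det_order ::
  "('n::finite) pt set \<Rightarrow> ('n, 'm) sheaf \<Rightarrow> nat \<Rightarrow> 'n pt set \<Rightarrow> (nat \<Rightarrow> 'm) \<Rightarrow> 'n pt \<Rightarrow> int \<Rightarrow> bool" where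
  "det_order X F r U e p k \<longleftrightarrow> (\<exists>U' e' a. p \<in> U' \<and> frame X F r U' e' \<and>
     (\<forall>j<r. \<forall>i<r. a j i \<in> regular X (U \<inter> U')) \<and>
     (\<forall>j<r. Res F U (U \<inter> U') (e j) =
        (\<Oplus>\<^bsub>Sec F (U \<inter> U')\<^esub>i\<in>{..<r}. a j i \<odot>\<^bsub>Sec F (U \<inter> U')\<^esub> Res F U' (U \<inter> U') (e' i))) \<and>
     has_order X p (U \<inter> U')
       (\<lambda>q. \<Sum>\<pi> | \<pi> permutes {..<r}. of_int (sign \<pi>) * (\<Prod>j<r. a j (\<pi> j) q)) k)"

text \<open>The degree is that of the divisor of a rational section of the determinant. It does not depend on
  the frame, because principal divisors on a smooth projective curve have degree zero.\<close>

definition bundle_degree :: "('n::finite) pt set \<Rightarrow> ('n, 'm) sheaf \<Rightarrow> int" where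
  "bundle_degree X F = (THE d. \<exists>r U e ord. U \<noteq> {} \<and> frame X F r U e \<and>
     (\<forall>p\<in>X. det_order X F r U e p (ord p)) \<and> d = (\<Sum>p | p \<in> X \<and> ord p \<noteq> 0. ord p))"

definition slope :: "('n::finite) pt set \<Rightarrow> ('n, 'm) sheaf \<Rightarrow> real" where
  "slope X F = of_int (bundle_degree X F) / of_nat (bundle_rank X F)"

text \<open>On a smooth curve the nonzero coherent subsheaves of a vector bundle are its locally free
  subsheaves of positive rank.\<close>

definition semistable :: "('n::finite) pt set \<Rightarrow> ('n, 'm) sheaf \<Rightarrow> bool" where
  "semistable X F \<longleftrightarrow>
     (\<forall>S s. (\<forall>U. zopen X U \<longrightarrow> S U \<subseteq> carrier (Sec F U)) \<and> vector_bundle X (sub_sheaf F S) s \<and> 0 < s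
        \<longrightarrow> slope X (sub_sheaf F S) \<le> slope X F)"

text \<open>For a line bundle \<open>L\<close> and an integer \<open>k\<close>, a section of the \<open>k\<close>-th tensor power over \<open>U\<close> is
  given by its coordinates: for every open \<open>W \<subseteq> U\<close> and every generator \<open>e\<close> of \<open>L\<close> over \<open>W\<close>,
  \<open>s W e\<close> is the coordinate over \<open>W\<close> of the section with respect to the generator \<open>e\<^sup>k\<close>. Replacing
  \<open>e\<close> by \<open>u e\<close> with a unit \<open>u\<close> multiplies the coordinate by \<open>u\<close> to the power \<open>-k\<close>. In
  particular \<open>k = -1\<close> gives the dual of \<open>L\<close>.\<close>

abbreviation generator :: "('n::finite) pt set \<Rightarrow> ('n, 'm) sheaf \<Rightarrow> 'n pt set \<Rightarrow> 'm \<Rightarrow> bool" where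
  "generator X L W e \<equiv> frame X L 1 W (\<lambda>i. e)"

definition coordinatewise ::
  "('n::finite) pt set \<Rightarrow> ('n, 'm) sheaf \<Rightarrow> 'n pt set \<Rightarrow>
     ('n pt set \<Rightarrow> 'm \<Rightarrow> 'n pt \<Rightarrow> complex) \<Rightarrow> ('n pt set \<Rightarrow> 'm \<Rightarrow> 'n pt \<Rightarrow> complex)" where
  "coordinatewise X L U s = (\<lambda>W e. if W \<subseteq> U \<and> generator X L W e then restrict (s W e) W else undefined)"

definition tensor_power ::
  "('n::finite) pt set \<Rightarrow> ('n, 'm) sheaf \<Rightarrow> int \<Rightarrow> ('n, 'n pt set \<Rightarrow> 'm \<Rightarrow> 'n pt \<Rightarrow> complex) sheaf" where
  "tensor_power X L k =
     \<lparr>Sec = (\<lambda>U.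
        \<lparr>carrier = {s. s = coordinatewise X L U s \<and>
           (\<forall>W e. W \<subseteq> U \<and> generator X L W e \<longrightarrow>
              s W e \<in> regular X W \<and>
              (\<forall>V. zopen X V \<and> V \<subseteq> W \<longrightarrow> s V (Res L W V e) = restrict (s W e) V) \<and>
              (\<forall>u\<in>regular X W. (\<forall>q\<in>W. u q \<noteq> 0) \<longrightarrow>
                 s W (u \<odot>\<^bsub>Sec L W\<^esub> e) = (\<lambda>q\<in>W. u q powi (- k) * s W e q)))},
         monoid.mult = undefined, monoid.one = undefined,
         ring.zero = coordinatewise X L U (\<lambda>W e q. 0),
         add = (\<lambda>s t. coordinatewise X L U (\<lambda>W e q. s W e q + t W e q)),
         smult = (\<lambda>a s. coordinatewise X L U (\<lambda>W e q. a q * s W e q))\<rparr>),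
      Res = (\<lambda>U V s. coordinatewise X L V s)\<rparr>"

definition scal :: "('n::finite) pt set \<Rightarrow> ('n, 'm) sheaf \<Rightarrow> complex \<Rightarrow> 'm \<Rightarrow> 'm" where
  "scal X F c s = (\<lambda>p\<in>X. c) \<odot>\<^bsub>Sec F X\<^esub> s"

definition section_subspace :: "('n::finite) pt set \<Rightarrow> ('n, 'm) sheaf \<Rightarrow> 'm set \<Rightarrow> bool" where
  "section_subspace X F V \<longleftrightarrow> V \<subseteq> carrier (Sec F X) \<and> \<zero>\<^bsub>Sec F X\<^esub> \<in> V \<and>
     (\<forall>s\<in>V. \<forall>t\<in>V. s \<oplus>\<^bsub>Sec F X\<^esub> t \<in> V) \<and> (\<forall>c. \<forall>s\<in>V. scal X F c s \<in> V)"

definition section_dim :: "('n::finite) pt set \<Rightarrow> ('n, 'm) sheaf \<Rightarrow> 'm set \<Rightarrow> nat \<Rightarrow> bool" where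
  "section_dim X F V m \<longleftrightarrow> section_subspace X F V \<and>
     (\<exists>b. (\<forall>i<m. b i \<in> V) \<and>
        bij_betw (\<lambda>c. \<Oplus>\<^bsub>Sec F X\<^esub>i\<in>{..<m}. scal X F (c i) (b i)) ({..<m} \<rightarrow>\<^sub>E UNIV) V)"

abbreviation h0 :: "('n::finite) pt set \<Rightarrow> ('n, 'm) sheaf \<Rightarrow> nat \<Rightarrow> bool" where
  "h0 X F m \<equiv> section_dim X F (carrier (Sec F X)) m"

text \<open>A tangent vector at \<open>p\<close> is a point derivation of the local ring, evaluated on representatives
  \<open>(U, f)\<close> of germs.\<close>

type_synonym 'n tangent = "'n pt set \<Rightarrow> ('n pt \<Rightarrow> complex) \<Rightarrow> complex"

definition tangent_space :: "('n::finite) pt set \<Rightarrow> 'n pt \<Rightarrow> 'n tangent set" where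
  "tangent_space X p = {\<delta>. \<forall>U. zopen X U \<and> p \<in> U \<longrightarrow> (\<forall>f\<in>regular X U.
     (\<forall>g\<in>regular X U.
        \<delta> U (\<lambda>q\<in>U. f q + g q) = \<delta> U f + \<delta> U g \<and>
        \<delta> U (\<lambda>q\<in>U. f q * g q) = f p * \<delta> U g + g p * \<delta> U f) \<and>
     (\<forall>c. \<delta> U (\<lambda>q\<in>U. c * f q) = c * \<delta> U f) \<and>
     (\<forall>W. zopen X W \<and> p \<in> W \<and> W \<subseteq> U \<longrightarrow> \<delta> W (restrict f W) = \<delta> U f))}"

text \<open>Regular differential forms: families of linear forms on the tangent spaces that are locally of
  the form \<open>\<Sum> f\<^sub>i dg\<^sub>i\<close> with regular functions \<open>f\<^sub>i\<close> and \<open>g\<^sub>i\<close>.\<close>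

definition cotangent_sheaf :: "('n::finite) pt set \<Rightarrow> ('n, 'n pt \<Rightarrow> 'n tangent \<Rightarrow> complex) sheaf" where
  "cotangent_sheaf X =
     \<lparr>Sec = (\<lambda>U.
        \<lparr>carrier = {\<omega> \<in> extensional U. \<forall>p\<in>U. \<omega> p \<in> extensional (tangent_space X p) \<and>
           (\<exists>W k f g. zopen X W \<and> p \<in> W \<and> W \<subseteq> U \<and>
              (\<forall>i<k. f i \<in> regular X W \<and> g i \<in> regular X W) \<and>
              (\<forall>q\<in>W. \<forall>\<delta>\<in>tangent_space X q. \<omega> q \<delta> = (\<Sum>i<(k::nat). f i q * \<delta> W (g i))))},
         monoid.mult = undefined, monoid.one = undefined,
         ring.zero = (\<lambda>p\<in>U. \<lambda>\<delta>\<in>tangent_space X p. 0),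
         add = (\<lambda>\<omega> \<eta>. \<lambda>p\<in>U. \<lambda>\<delta>\<in>tangent_space X p. \<omega> p \<delta> + \<eta> p \<delta>),
         smult = (\<lambda>a \<omega>. \<lambda>p\<in>U. \<lambda>\<delta>\<in>tangent_space X p. a p * \<omega> p \<delta>)\<rparr>),
      Res = (\<lambda>U V \<omega>. restrict \<omega> V)\<rparr>"

definition has_genus :: "('n::finite) pt set \<Rightarrow> nat \<Rightarrow> bool" where
  "has_genus X g \<longleftrightarrow> h0 X (cotangent_sheaf X) g"

definition hyperelliptic_bundle :: "('n::finite) pt set \<Rightarrow> ('n, 'm) sheaf \<Rightarrow> bool" where
  "hyperelliptic_bundle X H \<longleftrightarrow> vector_bundle X H 1 \<and> bundle_degree X H = 2 \<and> h0 X H 2"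

definition coherent_system ::
  "('n::finite) pt set \<Rightarrow> ('n, 'm) sheaf \<Rightarrow> 'm set \<Rightarrow> nat \<Rightarrow> int \<Rightarrow> nat \<Rightarrow> bool" where
  "coherent_system X E V r d m \<longleftrightarrow>
     vector_bundle X E r \<and> bundle_degree X E = d \<and> section_dim X E V m"

text \<open>The sheaf \<open>V \<otimes> \<O>\<close>, realised as the sheaf of regular functions with values in \<open>V\<close>:
  \<open>tensor_rep X E V U k f v h\<close> says that \<open>h\<close> is the function on \<open>U\<close> given by the tensor
  \<open>\<Sum>i<k. v i \<otimes> f i\<close>.\<close>

definition tensor_rep ::
  "('n::finite) pt set \<Rightarrow> ('n, 'm) sheaf \<Rightarrow> 'm set \<Rightarrow> 'n pt set \<Rightarrow>
     nat \<Rightarrow> (nat \<Rightarrow> 'n pt \<Rightarrow> complex) \<Rightarrow> (nat \<Rightarrow> 'm) \<Rightarrow> ('n pt \<Rightarrow> 'm) \<Rightarrow> bool" where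
  "tensor_rep X E V U k f v h \<longleftrightarrow> (\<forall>i<k. f i \<in> regular X U \<and> v i \<in> V) \<and>
     h = (\<lambda>p\<in>U. \<Oplus>\<^bsub>Sec E X\<^esub>i\<in>{..<k}. scal X E (f i p) (v i))"

definition trivial_bundle ::
  "('n::finite) pt set \<Rightarrow> ('n, 'm) sheaf \<Rightarrow> 'm set \<Rightarrow> ('n, 'n pt \<Rightarrow> 'm) sheaf" where
  "trivial_bundle X E V =
     \<lparr>Sec = (\<lambda>U.
        \<lparr>carrier = {h. \<exists>k f v. tensor_rep X E V U k f v h},
         monoid.mult = undefined, monoid.one = undefined,
         ring.zero = (\<lambda>p\<in>U. \<zero>\<^bsub>Sec E X\<^esub>),
         add = (\<lambda>h h'. \<lambda>p\<in>U. h p \<oplus>\<^bsub>Sec E X\<^esub> h' p),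
         smult = (\<lambda>a h. \<lambda>p\<in>U. scal X E (a p) (h p))\<rparr>),
      Res = (\<lambda>U W h. restrict h W)\<rparr>"

text \<open>The evaluation map \<open>V \<otimes> \<O> \<rightarrow> E\<close>, sending \<open>\<Sum> v\<^sub>i \<otimes> f\<^sub>i\<close> to \<open>\<Sum> f\<^sub>i v\<^sub>i\<close>.\<close>

definition evaluation ::
  "('n::finite) pt set \<Rightarrow> ('n, 'm) sheaf \<Rightarrow> 'm set \<Rightarrow> 'n pt set \<Rightarrow> ('n pt \<Rightarrow> 'm) \<Rightarrow> 'm" where
  "evaluation X E V U h = (THE s. \<exists>k f v. tensor_rep X E V U k f v h \<and>
     s = (\<Oplus>\<^bsub>Sec E U\<^esub>i\<in>{..<k}. f i \<odot>\<^bsub>Sec E U\<^esub> Res E X U (v i)))"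

definition evaluation_image ::
  "('n::finite) pt set \<Rightarrow> ('n, 'm) sheaf \<Rightarrow> 'm set \<Rightarrow> ('n, 'm) sheaf" where
  "evaluation_image X E V = sub_sheaf E (\<lambda>U. {s \<in> carrier (Sec E U). \<forall>p\<in>U. \<exists>W. zopen X W \<and>
     p \<in> W \<and> W \<subseteq> U \<and> Res E U W s \<in> evaluation X E V W ` carrier (Sec (trivial_bundle X E V) W)})"

definition generated :: "('n::finite) pt set \<Rightarrow> ('n, 'm) sheaf \<Rightarrow> 'm set \<Rightarrow> bool" where
  "generated X E V \<longleftrightarrow> (\<forall>U. zopen X U \<longrightarrow>
     carrier (Sec (evaluation_image X E V) U) = carrier (Sec E U))"

definition dual_span ::
  "('n::finite) pt set \<Rightarrow> ('n, 'm) sheaf \<Rightarrow> 'm set \<Rightarrow> ('n, 'n pt \<Rightarrow> 'm) sheaf" where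
  "dual_span X E V = sub_sheaf (trivial_bundle X E V)
     (\<lambda>U. {h \<in> carrier (Sec (trivial_bundle X E V) U). evaluation X E V U h = \<zero>\<^bsub>Sec E U\<^esub>})"

definition linearly_stable :: "('n::finite) pt set \<Rightarrow> ('n, 'm) sheaf \<Rightarrow> 'm set \<Rightarrow> bool" where
  "linearly_stable X L V \<longleftrightarrow> (\<forall>m W w. section_dim X L V m \<and> section_dim X L W w \<and> W \<subset> V \<and> 2 \<le> w \<longrightarrow>
     of_int (bundle_degree X (evaluation_image X L W)) / (of_nat w - 1)
       > (of_int (bundle_degree X L) / (of_nat m - 1) :: real))"

end

theory Submission
  imports Defs "HOL-Library.Function_Algebras" "HOL-Computational_Algebra.Polynomial"
begin

text \<open>Let \<open>x\<close> be the affine coordinate defined by the pencil \<open>|H|\<close>. The subspace \<open>V\<close> of \<open>H\<^sup>0(H\<^sup>2\<^sup>n\<^sup>+\<^sup>1)\<close> is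
  spanned by the binary forms of degree \<open>2 n + 1\<close> with affine equations \<open>1\<close>, \<open>x\<^sup>n + x\<^sup>n\<^sup>+\<^sup>1\<close> and \<open>x\<^sup>2\<^sup>n\<^sup>+\<^sup>1\<close>,
  so that the coherent system is the pullback of one on the projective line. Division of \<open>x\<^sup>2\<^sup>n\<^sup>+\<^sup>1\<close> by
  \<open>x\<^sup>n + x\<^sup>n\<^sup>+\<^sup>1\<close> gives a syzygy of the three forms whose coefficients have degree \<open>n\<close> only, and a syzygy of
  degree \<open>n\<close> is an embedding of \<open>H\<^sup>-\<^sup>n\<close> into the dual span bundle, which has rank 2, degree \<open>- (4 n + 2)\<close>
  and slope \<open>- (2 n + 1) < - 2 n\<close>. For linear stability, the line bundle generated by a pencil in \<open>V\<close> has
  degree \<open>2 (d - c)\<close>, where \<open>d\<close> is the highest degree in the pencil and \<open>c\<close> that of the affine common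
  divisor. The latter divides every combination of the two polynomials with polynomial coefficients, and
  the same division produces a nonzero one of degree at most \<open>d - n - 1\<close>.

  A bundle on \<open>X\<close> is handled through generic coordinates of its sections: these are tuples of rational
  functions, and the sheaf is determined by the conditions that the tuples satisfy at each point. That
  degrees are well defined then rests on principal divisors having degree zero, which is
  proved by counting dimensions of spaces of rational functions.\<close>

section \<open>Hilbert's basis theorem\<close>

text \<open>A monomial in the middle would not do: for \<open>1\<close>, \<open>x^k\<close>,
  \<open>x^(2n+1)\<close> one of the pencils \<open>1, x^k\<close> and \<open>x^k, x^(2n+1)\<close>
  keeps degree at most \<open>n\<close> once its common divisor is removed, while linear stability
  asks for more than \<open>(2n+1)/2\<close>. The binomial has degree \<open>n + 1\<close> but
  vanishes at 0 only to order \<open>n\<close>, so both pencils keep degree \<open>n + 1\<close>. On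
  the projective line the dual span has rank 2 and odd degree \<open>-(2n+1)\<close>, hence splits
  with a summand of degree at least \<open>-n\<close>; this forces the instability, and the division
  only makes the summand explicit. H is an arbitrary locally free sheaf of modules and must first be
  recognised as the sheaf of a divisor. Counting zeros and poles requires that the globally regular
  functions form a finite-dimensional space; this finiteness is drawn from
  \<open>h^0(H) = 2\<close>. The basis theorem serves twice: it yields the minimal closed sets by
  which proper closed subsets of the curve are seen to be finite, and, through Krull's intersection
  theorem, the existence of the order of a nonzero rational function at a point.\<close>

definition subring_of :: "'r::comm_ring_1 set \<Rightarrow> bool" where
  "subring_of A \<longleftrightarrow> 1 \<in> A \<and> (\<forall>a\<in>A. \<forall>b\<in>A. a - b \<in> A \<and> a * b \<in> A)"

definition ideal_of :: "'r::comm_ring_1 set \<Rightarrow> 'r set \<Rightarrow> bool" where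
  "ideal_of A J \<longleftrightarrow> J \<subseteq> A \<and> 0 \<in> J \<and> (\<forall>a\<in>J. \<forall>b\<in>J. a + b \<in> J) \<and> (\<forall>a\<in>A. \<forall>b\<in>J. a * b \<in> J)"

definition noetherian :: "'r::comm_ring_1 set \<Rightarrow> bool" where
  "noetherian A \<longleftrightarrow> (\<forall>J. (\<forall>k::nat. ideal_of A (J k)) \<and> (\<forall>k. J k \<subseteq> J (Suc k)) \<longrightarrow>
     (\<exists>N. \<forall>k\<ge>N. J k = J N))"

text \<open>Elements \<open>a_(k-1) x^(k-1) + ... + a_0\<close> with coefficients in
  \<open>A\<close>. As \<open>x\<close> may satisfy relations over \<open>A\<close>, this form is
  not unique, and a bound on the degree takes the place of the degree.\<close>

primrec poly_below :: "'r::comm_ring_1 set \<Rightarrow> 'r \<Rightarrow> nat \<Rightarrow> 'r set" where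
  "poly_below A x 0 = {0}"
| "poly_below A x (Suc k) = {a * x ^ k + f |a f. a \<in> A \<and> f \<in> poly_below A x k}"

lemma poly_below_suc: "f \<in> poly_below A x k \<Longrightarrow> a \<in> A \<Longrightarrow> a * x ^ k + f \<in> poly_below A x (Suc k)"
  by auto

lemma poly_below_cases:
  assumes "f \<in> poly_below A x k"
  obtains "k = 0" "f = 0" | a l g where "k = Suc l" "f = a * x ^ l + g" "a \<in> A" "g \<in> poly_below A x l"
  using assms by (cases k) auto

lemma poly_below_induct [consumes 1, case_names zero suc]:
  assumes "f \<in> poly_below A x k" "P 0 0"
    and "\<And>f k a. f \<in> poly_below A x k \<Longrightarrow> P k f \<Longrightarrow> a \<in> A \<Longrightarrow> P (Suc k) (a * x ^ k + f)"
  shows "P k f"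
  using assms(1) by (induction k arbitrary: f) (use assms(2,3) in auto)

declare poly_below.simps(2) [simp del]

definition adjoin :: "'r::comm_ring_1 set \<Rightarrow> 'r \<Rightarrow> 'r set" where
  "adjoin A x = (\<Union>k. poly_below A x k)"

lemma subring_of_simps:
  assumes "subring_of A"
  shows "1 \<in> A" "0 \<in> A" "a \<in> A \<Longrightarrow> - a \<in> A" "a \<in> A \<Longrightarrow> b \<in> A \<Longrightarrow> a - b \<in> A"
    "a \<in> A \<Longrightarrow> b \<in> A \<Longrightarrow> a + b \<in> A" "a \<in> A \<Longrightarrow> b \<in> A \<Longrightarrow> a * b \<in> A"
proof -
  have *: "1 \<in> A" "\<And>a b. a \<in> A \<Longrightarrow> b \<in> A \<Longrightarrow> a - b \<in> A" "\<And>a b. a \<in> A \<Longrightarrow> b \<in> A \<Longrightarrow> a * b \<in> A"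
    using assms by (auto simp: subring_of_def)
  show "1 \<in> A" "a \<in> A \<Longrightarrow> b \<in> A \<Longrightarrow> a - b \<in> A" "a \<in> A \<Longrightarrow> b \<in> A \<Longrightarrow> a * b \<in> A"
    using * by auto
  show 0: "0 \<in> A" using *(2)[OF *(1) *(1)] by simp
  show "a \<in> A \<Longrightarrow> - a \<in> A" using *(2)[OF 0, of a] by simp
  show "a \<in> A \<Longrightarrow> b \<in> A \<Longrightarrow> a + b \<in> A" using *(2)[of a "- b"] *(2)[OF 0, of b] by simp
qed

lemma poly_below_Suc: "subring_of A \<Longrightarrow> f \<in> poly_below A x k \<Longrightarrow> f \<in> poly_below A x (Suc k)"
  using poly_below_suc[of f A x k 0] subring_of_simps(2)[of A] by simp

lemma poly_below_mono: "subring_of A \<Longrightarrow> k \<le> l \<Longrightarrow> f \<in> poly_below A x k \<Longrightarrow> f \<in> poly_below A x l"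
  by (induction l rule: nat_induct) (auto intro: poly_below_Suc simp: le_Suc_eq)

lemma poly_below_add:
  assumes A: "subring_of A"
  shows "f \<in> poly_below A x k \<Longrightarrow> g \<in> poly_below A x k \<Longrightarrow> f + g \<in> poly_below A x k"
proof (induction k arbitrary: f g)
  case 0
  then show ?case by (auto elim: poly_below_cases)
next
  case (Suc k)
  from Suc.prems(1) obtain a f' where f: "f = a * x ^ k + f'" "a \<in> A" "f' \<in> poly_below A x k"
    by (auto elim: poly_below_cases)
  from Suc.prems(2) obtain b g' where g: "g = b * x ^ k + g'" "b \<in> A" "g' \<in> poly_below A x k"
    by (auto elim: poly_below_cases)
  have "(a + b) * x ^ k + (f' + g') \<in> poly_below A x (Suc k)"
    using Suc.IH f g A by (intro poly_below_suc) (auto simp: subring_of_simps)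
  then show ?case by (simp add: f g algebra_simps)
qed

lemma poly_below_scale:
  assumes A: "subring_of A" and "c \<in> A"
  shows "f \<in> poly_below A x k \<Longrightarrow> c * f \<in> poly_below A x k"
proof (induction rule: poly_below_induct)
  case zero
  then show ?case by simp
next
  case (suc f k a)
  then have "(c * a) * x ^ k + c * f \<in> poly_below A x (Suc k)"
    using assms by (intro poly_below_suc) (auto simp: subring_of_simps)
  then show ?case by (simp add: algebra_simps)
qed

lemma poly_below_shift:
  assumes A: "subring_of A"
  shows "f \<in> poly_below A x k \<Longrightarrow> x * f \<in> poly_below A x (Suc k)"
proof (induction rule: poly_below_induct)
  case zero
  show ?case using poly_below_Suc[OF A, of 0 x 0] by simp
next
  case (suc f k a)
  then have "a * x ^ Suc k + x * f \<in> poly_below A x (Suc (Suc k))"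
    by (intro poly_below_suc) auto
  then show ?case by (simp add: algebra_simps)
qed

lemma subring_adjoin:
  assumes A: "subring_of A"
  shows "subring_of (adjoin A x)" "A \<subseteq> adjoin A x" "x \<in> adjoin A x"
proof -
  show sub: "A \<subseteq> adjoin A x"
  proof
    fix a assume "a \<in> A"
    then have "a * x ^ 0 + 0 \<in> poly_below A x (Suc 0)" by (intro poly_below_suc) auto
    then show "a \<in> adjoin A x" unfolding adjoin_def by (auto intro: exI[of _ "Suc 0"])
  qed
  have add: "f + g \<in> adjoin A x" if "f \<in> adjoin A x" "g \<in> adjoin A x" for f g
  proof -
    from that obtain k l where "f \<in> poly_below A x k" "g \<in> poly_below A x l"
      by (auto simp: adjoin_def)
    then have "f \<in> poly_below A x (max k l)" "g \<in> poly_below A x (max k l)"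
      using poly_below_mono[OF A] by (meson max.cobounded1 max.cobounded2)+
    then have "f + g \<in> poly_below A x (max k l)" using poly_below_add[OF A] by blast
    then show ?thesis by (auto simp: adjoin_def)
  qed
  have scale: "c * f \<in> adjoin A x" if "c \<in> A" "f \<in> adjoin A x" for c f
    using that poly_below_scale[OF A that(1)] unfolding adjoin_def by blast
  have shift: "x ^ k * f \<in> adjoin A x" if "f \<in> adjoin A x" for k f
  proof (induction k)
    case (Suc k)
    then obtain l where "x ^ k * f \<in> poly_below A x l" by (auto simp: adjoin_def)
    from poly_below_shift[OF A this] show ?case by (auto simp: adjoin_def algebra_simps)
  qed (use that in auto)
  have mult: "f * g \<in> adjoin A x" if "f \<in> poly_below A x k" "g \<in> adjoin A x" for f g k
    using that
  proof (induction rule: poly_below_induct)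
    case zero
    then show ?case using sub subring_of_simps(2)[OF A] by auto
  next
    case (suc f k a)
    have "a * (x ^ k * g) + f * g \<in> adjoin A x"
      by (rule add[OF scale[OF suc(2) shift[OF suc(4)]] suc(3)]) (use suc in auto)
    then show ?case by (simp add: algebra_simps)
  qed
  have one: "1 \<in> adjoin A x" using sub subring_of_simps(1)[OF A] by auto
  have "f - g \<in> adjoin A x" if "f \<in> adjoin A x" "g \<in> adjoin A x" for f g
    using add[OF that(1) scale[OF _ that(2), of "-1"]] subring_of_simps(1,3)[OF A] by auto
  then show "subring_of (adjoin A x)"
    unfolding subring_of_def using one mult by (metis UN_E adjoin_def)
  show "x \<in> adjoin A x" using shift[OF one, of 1] by simp
qed

text \<open>Hilbert's basis theorem in the form of chains. The leading coefficients in degree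
  \<open>i\<close> of the ideal \<open>J k\<close> form an ideal \<open>Ld i k\<close> that grows
  with \<open>i\<close> and with \<open>k\<close>. Once \<open>Ld i k\<close> is independent of
  \<open>k\<close> for every \<open>i\<close> at the same time, the ideals \<open>J k\<close>
  themselves are constant.\<close>

lemma noetherian_adjoin:
  assumes A: "subring_of A" and N: "noetherian A"
  shows "noetherian (adjoin A x)"
  unfolding noetherian_def
proof (intro allI impI)
  fix J :: "nat \<Rightarrow> 'a set"
  assume "(\<forall>k. ideal_of (adjoin A x) (J k)) \<and> (\<forall>k. J k \<subseteq> J (Suc k))"
  then have J: "\<And>k. ideal_of (adjoin A x) (J k)" and J1: "\<And>k. J k \<subseteq> J (Suc k)" by auto
  have Jmono: "J k \<subseteq> J l" if "k \<le> l" for k l using lift_Suc_mono_le[of J] J1 that by blast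
  define Ld where "Ld i k = {a \<in> A. \<exists>g\<in>poly_below A x i. a * x ^ i + g \<in> J k}" for i k
  have Ld_ideal: "ideal_of A (Ld i k)" for i k
    unfolding ideal_of_def
  proof (intro conjI ballI)
    show "Ld i k \<subseteq> A" by (auto simp: Ld_def)
    have "0 \<in> poly_below A x i" using poly_below_mono[OF A, of 0 i 0 x] by simp
    then show "0 \<in> Ld i k" using J[of k] subring_of_simps(2)[OF A] by (auto simp: Ld_def ideal_of_def)
  next
    fix a b assume "a \<in> Ld i k" "b \<in> Ld i k"
    then obtain f g where fg: "a \<in> A" "b \<in> A" "f \<in> poly_below A x i" "g \<in> poly_below A x i"
      "a * x ^ i + f \<in> J k" "b * x ^ i + g \<in> J k" by (auto simp: Ld_def)
    then have "(a * x ^ i + f) + (b * x ^ i + g) \<in> J k" using J[of k] by (simp add: ideal_of_def)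
    then have "(a + b) * x ^ i + (f + g) \<in> J k" by (simp add: algebra_simps)
    then show "a + b \<in> Ld i k"
      using fg poly_below_add[OF A] subring_of_simps(5)[OF A] by (auto simp: Ld_def)
  next
    fix a b assume a: "a \<in> A" and "b \<in> Ld i k"
    then obtain g where g: "b \<in> A" "g \<in> poly_below A x i" "b * x ^ i + g \<in> J k"
      by (auto simp: Ld_def)
    have "a \<in> adjoin A x" using subring_adjoin(2)[OF A] a by auto
    then have "a * (b * x ^ i + g) \<in> J k" using J[of k] g(3) by (simp add: ideal_of_def)
    then have "(a * b) * x ^ i + a * g \<in> J k" by (simp add: algebra_simps)
    then show "a * b \<in> Ld i k"
      using g a poly_below_scale[OF A] subring_of_simps(6)[OF A] by (auto simp: Ld_def)
  qed
  have Ld_mono_k: "Ld i k \<subseteq> Ld i l" if "k \<le> l" for i k l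
    using Jmono[OF that] by (auto simp: Ld_def)
  have Ld_mono_Suc: "Ld i k \<subseteq> Ld (Suc i) k" for i k
  proof
    fix a assume "a \<in> Ld i k"
    then obtain g where g: "a \<in> A" "g \<in> poly_below A x i" "a * x ^ i + g \<in> J k" by (auto simp: Ld_def)
    have "x * (a * x ^ i + g) \<in> J k"
      using J[of k] g(3) subring_adjoin(3)[OF A] by (simp add: ideal_of_def)
    then have "a * x ^ Suc i + x * g \<in> J k" by (simp add: algebra_simps)
    then show "a \<in> Ld (Suc i) k" using g poly_below_shift[OF A] by (auto simp: Ld_def)
  qed
  have Ld_mono: "Ld i k \<subseteq> Ld i' k'" if "i \<le> i'" "k \<le> k'" for i i' k k'
    using lift_Suc_mono_le[of "\<lambda>i. Ld i k"] Ld_mono_Suc Ld_mono_k[OF that(2), of i'] that(1) by blast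
  \<comment> \<open>The diagonal chain settles all degrees beyond \<open>N1\<close> at once; the
    finitely many others are settled one by one by \<open>N2\<close>.\<close>
  have "\<exists>N. \<forall>k\<ge>N. Ld k k = Ld N N"
    using N Ld_ideal Ld_mono unfolding noetherian_def by (auto dest!: spec[of _ "\<lambda>k. Ld k k"])
  then obtain N1 where N1: "\<And>k. k \<ge> N1 \<Longrightarrow> Ld k k = Ld N1 N1" by blast
  have "\<exists>N. \<forall>k\<ge>N. Ld i k = Ld i N" for i
    using N Ld_ideal Ld_mono unfolding noetherian_def by (auto dest!: spec[of _ "\<lambda>k. Ld i k"])
  then obtain N2 where N2: "\<And>i k. k \<ge> N2 i \<Longrightarrow> Ld i k = Ld i (N2 i)" by metis
  define M where "M = max N1 (Max (N2 ` {..N1}))"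
  have M1: "N1 \<le> M" by (simp add: M_def)
  have M2: "N2 i \<le> M" if "i \<le> N1" for i
    using that Max_ge[of "N2 ` {..N1}" "N2 i"] by (simp add: M_def max.coboundedI2)
  have stable: "Ld i k = Ld i M" if "k \<ge> M" for i k
  proof (cases "i \<le> N1")
    case True
    then show ?thesis using N2[of i] M2[OF True] that by (metis order_trans)
  next
    case False
    have "Ld i k = Ld N1 N1" if "k \<ge> M" for k
    proof -
      have "Ld N1 N1 \<subseteq> Ld i k" using False M1 that by (intro Ld_mono) auto
      moreover have "Ld i k \<subseteq> Ld (max i k) (max i k)" by (intro Ld_mono) auto
      moreover have "Ld (max i k) (max i k) = Ld N1 N1" using False by (intro N1) auto
      ultimately show ?thesis by auto
    qed
    then show ?thesis using that by auto
  qed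
  \<comment> \<open>Induction on the degree bound: an element of \<open>J M\<close> with the same
    leading coefficient is subtracted, which leaves a remainder in \<open>J k\<close> with a smaller
    bound.\<close>
  have "f \<in> J M" if "k \<ge> M" "f \<in> poly_below A x i" "f \<in> J k" for i k f
    using that(2,3)
  proof (induction i arbitrary: f)
    case 0
    then show ?case using J[of M] by (auto elim: poly_below_cases simp: ideal_of_def)
  next
    case (Suc i)
    from Suc.prems(1) obtain a f' where f: "f = a * x ^ i + f'" "a \<in> A" "f' \<in> poly_below A x i"
      by (auto elim: poly_below_cases)
    then have "a \<in> Ld i k" using Suc.prems(2) by (auto simp: Ld_def)
    then have "a \<in> Ld i M" using stable[OF that(1)] by simp
    then obtain g where g: "g \<in> poly_below A x i" "a * x ^ i + g \<in> J M" by (auto simp: Ld_def)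
    have m1: "- 1 \<in> A" using subring_of_simps(1,3)[OF A] by auto
    then have "- 1 \<in> adjoin A x" using subring_adjoin(2)[OF A] by auto
    then have "f + (- 1) * (a * x ^ i + g) \<in> J k"
      using J[of k] Suc.prems(2) g(2) Jmono[OF that(1)] unfolding ideal_of_def by blast
    moreover have eq: "f + (- 1) * (a * x ^ i + g) = f' + (- 1) * g" by (simp add: f algebra_simps)
    ultimately have "f' + (- 1) * g \<in> J M"
      using Suc.IH[OF poly_below_add[OF A f(3) poly_below_scale[OF A m1 g(1)]]] by (simp only:)
    then have "(f' + (- 1) * g) + (a * x ^ i + g) \<in> J M" using g(2) J[of M] unfolding ideal_of_def by blast
    then show ?case by (simp add: f algebra_simps)
  qed
  then have "J k \<subseteq> J M" if "k \<ge> M" for k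
    using that J[of k] by (auto simp: ideal_of_def adjoin_def subset_iff)
  then show "\<exists>N. \<forall>k\<ge>N. J k = J N" using Jmono by (intro exI[of _ M]) blast
qed

section \<open>Polynomial functions on affine space\<close>

inductive_set polyfuns :: "'n set \<Rightarrow> (complex ^ ('n::finite) \<Rightarrow> complex) set" for I where
  const: "(\<lambda>v. c) \<in> polyfuns I"
| coord: "i \<in> I \<Longrightarrow> (\<lambda>v. v $ i) \<in> polyfuns I"
| add: "f \<in> polyfuns I \<Longrightarrow> g \<in> polyfuns I \<Longrightarrow> (\<lambda>v. f v + g v) \<in> polyfuns I"
| mult: "f \<in> polyfuns I \<Longrightarrow> g \<in> polyfuns I \<Longrightarrow> (\<lambda>v. f v * g v) \<in> polyfuns I"

lemma subring_polyfuns: "subring_of (polyfuns I)"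
proof -
  have "f - g \<in> polyfuns I" if "f \<in> polyfuns I" "g \<in> polyfuns I" for f g
    using polyfuns.add[OF that(1) polyfuns.mult[OF polyfuns.const[of "-1"] that(2)]]
    by (simp add: fun_diff_def)
  moreover have "f * g \<in> polyfuns I" if "f \<in> polyfuns I" "g \<in> polyfuns I" for f g
    using polyfuns.mult[OF that] by (simp add: times_fun_def)
  moreover have "1 \<in> polyfuns I" using polyfuns.const[of 1 I] by (simp add: one_fun_def)
  ultimately show ?thesis by (auto simp: subring_of_def)
qed

lemma polyfuns_mono: "f \<in> polyfuns I \<Longrightarrow> I \<subseteq> I' \<Longrightarrow> f \<in> polyfuns I'"
  by (induction rule: polyfuns.induct) (auto intro: polyfuns.intros)

lemma polyfuns_insert: "polyfuns (insert i I) = adjoin (polyfuns I) (\<lambda>v. v $ i)"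
proof
  note S = subring_adjoin[OF subring_polyfuns[of I], of "\<lambda>v. v $ i"]
  show "polyfuns (insert i I) \<subseteq> adjoin (polyfuns I) (\<lambda>v. v $ i)"
  proof
    fix f assume "f \<in> polyfuns (insert i I)"
    then show "f \<in> adjoin (polyfuns I) (\<lambda>v. v $ i)"
    proof (induction rule: polyfuns.induct)
      case (add f g)
      then show ?case using subring_of_simps(5)[OF S(1), of f g] by (simp add: plus_fun_def)
    next
      case (mult f g)
      then show ?case using subring_of_simps(6)[OF S(1), of f g] by (simp add: times_fun_def)
    qed (use S in \<open>auto intro: polyfuns.intros\<close>)
  qed
  have T: "subring_of (polyfuns (insert i I))" by (rule subring_polyfuns)
  have pw: "(\<lambda>v. v $ i) ^ k \<in> polyfuns (insert i I)" for k
  proof (induction k)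
    case 0
    then show ?case using subring_of_simps(1)[OF T] by (simp only: power_0)
  next
    case (Suc k)
    then show ?case
      using subring_of_simps(6)[OF T polyfuns.coord[of i "insert i I"]] by (simp only: power_Suc insertI1)
  qed
  have "f \<in> polyfuns (insert i I)" if "f \<in> poly_below (polyfuns I) (\<lambda>v. v $ i) k" for f k
    using that
  proof (induction rule: poly_below_induct)
    case (suc f k a)
    then show ?case
      by (intro subring_of_simps(5,6)[OF T] pw polyfuns_mono[of a I "insert i I"]) auto
  qed (rule subring_of_simps(2)[OF T])
  then show "adjoin (polyfuns I) (\<lambda>v. v $ i) \<subseteq> polyfuns (insert i I)"
    by (auto simp: adjoin_def)
qed

lemma polyfuns_empty: "f \<in> polyfuns {} \<Longrightarrow> \<exists>c. f = (\<lambda>v. c)"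
  by (induction rule: polyfuns.induct) auto

text \<open>Induction on the set of variables. Without variables the ring is the field of constants,
  where a nonzero ideal is everything.\<close>

lemma noetherian_polyfuns:
  fixes I :: "'n::finite set"
  shows "noetherian (polyfuns I)"
proof (induction I rule: finite_induct[OF finite])
  case 1
  have triv: "J = {0} \<or> J = polyfuns {}" if J: "ideal_of (polyfuns {}) J"
    for J :: "(complex ^ 'n \<Rightarrow> complex) set"
  proof (cases "J = {0}")
    case False
    moreover have "0 \<in> J" using J by (simp add: ideal_of_def)
    ultimately obtain f where f: "f \<in> J" "f \<noteq> 0" by blast
    then obtain c where c: "f = (\<lambda>v. c)" using J polyfuns_empty by (auto simp: ideal_of_def)
    then have "c \<noteq> 0" using f by (auto simp: zero_fun_def)
    have "h \<in> J" if h: "h \<in> polyfuns {}" for h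
    proof -
      have "(\<lambda>v. inverse c * h v) \<in> polyfuns {}" by (intro polyfuns.mult polyfuns.const h)
      then have "(\<lambda>v. inverse c * h v) * f \<in> J" using J f(1) by (simp add: ideal_of_def)
      moreover have "(\<lambda>v. inverse c * h v) * f = h" using \<open>c \<noteq> 0\<close> by (auto simp: c fun_eq_iff)
      ultimately show ?thesis by simp
    qed
    then show ?thesis using J by (auto simp: ideal_of_def)
  qed simp
  show ?case
    unfolding noetherian_def
  proof (intro allI impI)
    fix J :: "nat \<Rightarrow> (complex ^ 'n \<Rightarrow> complex) set"
    assume a: "(\<forall>k. ideal_of (polyfuns {}) (J k)) \<and> (\<forall>k. J k \<subseteq> J (Suc k))"
    then have mono: "J k \<subseteq> J l" if "k \<le> l" for k l using lift_Suc_mono_le[of J] that by blast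
    show "\<exists>N. \<forall>k\<ge>N. J k = J N"
    proof (cases "\<forall>k. J k = {0}")
      case False
      then obtain N where "J N = polyfuns {}" using a triv by blast
      then show ?thesis using mono a by (intro exI[of _ N]) (auto simp: ideal_of_def)
    qed auto
  qed
next
  case (2 i I)
  then show ?case by (simp add: polyfuns_insert noetherian_adjoin subring_polyfuns)
qed

section \<open>Points of projective space\<close>

text \<open>An arbitrary choice of homogeneous coordinates. The vanishing of forms and the quotients
  of forms of equal degree do not depend on it, and it is for these that it is used.\<close>

definition rep :: "('n::finite) pt \<Rightarrow> complex ^ 'n" where
  "rep p = (SOME v. v \<in> p)"

lemma proj_point:
  assumes "p \<in> proj_space"
  shows "rep p \<in> p" "v \<in> p \<Longrightarrow> v \<noteq> 0" "v \<in> p \<Longrightarrow> p = {c *s v |c. c \<noteq> 0}"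
proof -
  obtain u where u: "u \<noteq> 0" "p = {c *s u |c. c \<noteq> 0}"
    using assms unfolding proj_space_def by blast
  then have "1 *s u \<in> p" by (intro iffD2[OF eqset_imp_iff[OF u(2)]] CollectI exI[of _ 1]) simp
  then show "rep p \<in> p" unfolding rep_def by (rule someI)
  show "v \<noteq> 0" if "v \<in> p" for v using that u by (auto simp: vec_eq_iff)
  show "p = {c *s v |c. c \<noteq> 0}" if v: "v \<in> p" for v
  proof -
    obtain b where b: "b \<noteq> 0" "v = b *s u" using v u by auto
    have *: "c *s u = (c / b) *s v" "c *s v = (c * b) *s u" for c
      using b by (simp_all add: vec_eq_iff)
    have "{c *s u |c. c \<noteq> 0} = {c *s v |c. c \<noteq> 0}"
    proof (intro equalityI subsetI)
      fix w assume "w \<in> {c *s u |c. c \<noteq> 0}"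
      then obtain c where "w = (c / b) *s v" "c \<noteq> 0" using *(1) by blast
      then show "w \<in> {c *s v |c. c \<noteq> 0}" using b(1) by (intro CollectI exI[of _ "c / b"]) simp
    next
      fix w assume "w \<in> {c *s v |c. c \<noteq> 0}"
      then obtain c where "w = (c * b) *s u" "c \<noteq> 0" using *(2) by blast
      then show "w \<in> {c *s u |c. c \<noteq> 0}" using b(1) by (intro CollectI exI[of _ "c * b"]) simp
    qed
    with u(2) show ?thesis by (rule trans)
  qed
qed

lemma rep_nonzero: "p \<in> proj_space \<Longrightarrow> rep p \<noteq> 0"
  using proj_point by blast

lemma proj_point_scale: "p \<in> proj_space \<Longrightarrow> v \<in> p \<Longrightarrow> \<exists>c. c \<noteq> 0 \<and> v = c *s rep p"
  using proj_point(1,3)[of p] by blast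

lemma proj_point_eqI:
  assumes "p \<in> proj_space" "q \<in> proj_space" "rep q = c *s rep p"
  shows "p = q"
proof -
  have "c \<noteq> 0" using assms rep_nonzero[of q] by (auto simp: vec_eq_iff)
  then have "rep q \<in> p" using proj_point(1,3)[OF assms(1)] assms(3) by blast
  from proj_point(3)[OF assms(1) this] proj_point(3)[OF assms(2) proj_point(1)[OF assms(2)]]
  show ?thesis by (rule trans[OF _ sym])
qed

lemma hom_poly_scale: "hom_poly d P \<Longrightarrow> P (c *s v) = c ^ d * P v"
  by (induction rule: hom_poly.induct) (simp_all add: algebra_simps)

lemma hom_poly_rep:
  assumes "hom_poly d P" "p \<in> proj_space" "v \<in> p"
  obtains c where "c \<noteq> 0" "P v = c ^ d * P (rep p)"
proof -
  obtain c where "c \<noteq> 0" "v = c *s rep p" using assms(2,3) proj_point_scale by blast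
  then show ?thesis using that[of c] hom_poly_scale[OF assms(1)] by simp
qed

lemma hom_poly_nonzero_iff:
  "hom_poly d P \<Longrightarrow> p \<in> proj_space \<Longrightarrow> v \<in> p \<Longrightarrow> P v \<noteq> 0 \<longleftrightarrow> P (rep p) \<noteq> 0"
  by (metis hom_poly_rep mult_eq_0_iff power_not_zero)

lemma hom_poly_ratio:
  assumes "hom_poly d P" "hom_poly d Q" "p \<in> proj_space" "v \<in> p"
  shows "P v / Q v = P (rep p) / Q (rep p)"
proof -
  obtain c where "c \<noteq> 0" "v = c *s rep p" using assms(3,4) proj_point_scale by blast
  then show ?thesis using hom_poly_scale[OF assms(1)] hom_poly_scale[OF assms(2)] by simp
qed

lemma hom_poly_smult: "hom_poly d P \<Longrightarrow> hom_poly d (\<lambda>v. c * P v)"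
proof (induction rule: hom_poly.induct)
  case (coord d P i)
  from hom_poly.coord[OF coord(2), of i] show ?case by (simp add: algebra_simps)
next
  case (add d P Q)
  from hom_poly.add[OF add(3,4)] show ?case by (simp add: algebra_simps)
qed (rule hom_poly.const)

lemma hom_poly_mult: "hom_poly d P \<Longrightarrow> hom_poly e Q \<Longrightarrow> hom_poly (d + e) (\<lambda>v. P v * Q v)"
proof (induction rule: hom_poly.induct)
  case (const c)
  then show ?case by (simp add: hom_poly_smult)
next
  case (coord d P i)
  from hom_poly.coord[OF coord(2)[OF coord(3)], of i] show ?case by (simp add: algebra_simps)
next
  case (add d P Q')
  from hom_poly.add[OF add(3,4)[OF add(5)]] show ?case by (simp add: algebra_simps)
qed

lemma hom_poly_coord: "hom_poly 1 (\<lambda>v. v $ i)"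
  using hom_poly.coord[OF hom_poly.const[of 1], of i] by simp

lemma hom_poly_diff: "hom_poly d P \<Longrightarrow> hom_poly d Q \<Longrightarrow> hom_poly d (\<lambda>v. P v - Q v)"
  using hom_poly.add[OF _ hom_poly_smult[of d Q "-1"], of P] by simp

lemma hom_poly_polyfuns: "hom_poly d P \<Longrightarrow> P \<in> polyfuns UNIV"
  by (induction rule: hom_poly.induct) (auto intro: polyfuns.intros polyfuns.mult[OF polyfuns.coord])

text \<open>Two distinct points have linearly independent coordinate vectors \<open>v\<close> and
  \<open>w\<close>, so some 2 x 2 minor of the pair is nonzero. With \<open>v\<close> fixed, this
  minor is a linear form in \<open>w\<close> that vanishes at \<open>v\<close>.\<close>

lemma separating_linear_form:
  assumes "p \<in> proj_space" "q \<in> proj_space" "p \<noteq> q"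
  obtains l where "hom_poly 1 l" "l (rep p) = 0" "l (rep q) \<noteq> 0"
proof -
  define v w where "v = rep p" and "w = rep q"
  obtain i where i: "v $ i \<noteq> 0" using rep_nonzero[OF assms(1)] by (auto simp: v_def vec_eq_iff)
  have "\<exists>j. v $ i * w $ j - v $ j * w $ i \<noteq> 0"
  proof (rule ccontr)
    assume "\<not> (\<exists>j. v $ i * w $ j - v $ j * w $ i \<noteq> 0)"
    then have "w = (w $ i / v $ i) *s v" using i by (auto simp: vec_eq_iff field_simps)
    then show False using proj_point_eqI[OF assms(1,2)] assms(3) by (auto simp: v_def w_def)
  qed
  then obtain j where "v $ i * w $ j - v $ j * w $ i \<noteq> 0" by blast
  then show ?thesis
    by (intro that[of "\<lambda>z. v $ i * z $ j - v $ j * z $ i"] hom_poly_diff hom_poly_smult hom_poly_coord)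
      (auto simp: v_def w_def)
qed

lemma nonvanishing_linear_form:
  assumes "p \<in> proj_space"
  obtains i where "rep p $ i \<noteq> 0"
  using rep_nonzero[OF assms] by (auto simp: vec_eq_iff)

section \<open>The Zariski topology\<close>

lemma basic_open_eq:
  "hom_poly d P \<Longrightarrow> {p \<in> proj_space. \<forall>v\<in>p. P v \<noteq> 0} = {p \<in> proj_space. P (rep p) \<noteq> 0}"
  using hom_poly_nonzero_iff proj_point(1) by blast

lemma openin_basic: "hom_poly d P \<Longrightarrow> openin proj_zariski {p \<in> proj_space. P (rep p) \<noteq> 0}"
  unfolding proj_zariski_def
  by (intro topology_generated_by_Basis) (use basic_open_eq in blast)

lemma openin_zariski_basis:
  assumes "openin proj_zariski U"
  shows "U \<subseteq> proj_space" "p \<in> U \<Longrightarrow> \<exists>d P. hom_poly d P \<and> P (rep p) \<noteq> 0 \<and>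
    (\<forall>q\<in>proj_space. P (rep q) \<noteq> 0 \<longrightarrow> q \<in> U)"
proof -
  have "generate_topology_on {{p \<in> proj_space. \<forall>v\<in>p. P v \<noteq> 0} |P. \<exists>d. hom_poly d P} U"
    using assms by (simp add: proj_zariski_def openin_topology_generated_by_iff)
  then have "U \<subseteq> proj_space \<and> (\<forall>p\<in>U. \<exists>d P. hom_poly d P \<and> P (rep p) \<noteq> 0 \<and>
    (\<forall>q\<in>proj_space. P (rep q) \<noteq> 0 \<longrightarrow> q \<in> U))"
  proof (induction rule: generate_topology_on.induct)
    case (Int a b)
    show ?case
    proof (intro conjI ballI)
      fix p assume "p \<in> a \<inter> b"
      then obtain d P e Q where "hom_poly d P" "P (rep p) \<noteq> 0" "\<forall>q\<in>proj_space. P (rep q) \<noteq> 0 \<longrightarrow> q \<in> a"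
        "hom_poly e Q" "Q (rep p) \<noteq> 0" "\<forall>q\<in>proj_space. Q (rep q) \<noteq> 0 \<longrightarrow> q \<in> b"
        using Int by blast
      then show "\<exists>d P. hom_poly d P \<and> P (rep p) \<noteq> 0 \<and> (\<forall>q\<in>proj_space. P (rep q) \<noteq> 0 \<longrightarrow> q \<in> a \<inter> b)"
        by (intro exI[of _ "d + e"] exI[of _ "\<lambda>v. P v * Q v"]) (auto intro: hom_poly_mult)
    qed (use Int in auto)
  next
    case (UN K)
    show ?case
    proof (intro conjI ballI)
      show "\<Union>K \<subseteq> proj_space" using UN by blast
      fix p assume "p \<in> \<Union>K"
      then obtain k where k: "k \<in> K" "p \<in> k" by blast
      then obtain d P where "hom_poly d P" "P (rep p) \<noteq> 0" "\<forall>q\<in>proj_space. P (rep q) \<noteq> 0 \<longrightarrow> q \<in> k"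
        using UN by blast
      then show "\<exists>d P. hom_poly d P \<and> P (rep p) \<noteq> 0 \<and> (\<forall>q\<in>proj_space. P (rep q) \<noteq> 0 \<longrightarrow> q \<in> \<Union>K)"
        using k(1) by blast
    qed
  next
    case (Basis s)
    then obtain d P where "hom_poly d P" "s = {p \<in> proj_space. \<forall>v\<in>p. P v \<noteq> 0}" by blast
    then show ?case using basic_open_eq[of d P] by (auto intro!: exI[of _ d] exI[of _ P])
  qed auto
  then show "U \<subseteq> proj_space" "p \<in> U \<Longrightarrow> \<exists>d P. hom_poly d P \<and> P (rep p) \<noteq> 0 \<and>
    (\<forall>q\<in>proj_space. P (rep q) \<noteq> 0 \<longrightarrow> q \<in> U)" by auto
qed

lemma topspace_proj_zariski: "topspace (proj_zariski :: ('n::finite) pt topology) = proj_space"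
proof
  show "topspace (proj_zariski :: 'n pt topology) \<subseteq> proj_space"
    using openin_zariski_basis(1)[OF openin_topspace] .
  show "proj_space \<subseteq> topspace (proj_zariski :: 'n pt topology)"
    using openin_subset[OF openin_basic[OF hom_poly.const[of 1]]] by auto
qed

lemma closedin_zariski_point:
  assumes "p \<in> proj_space"
  shows "closedin proj_zariski {p}"
proof -
  have "openin proj_zariski (proj_space - {p})"
  proof (subst openin_subopen, intro ballI)
    fix q assume q: "q \<in> proj_space - {p}"
    then obtain l where "hom_poly 1 l" "l (rep p) = 0" "l (rep q) \<noteq> 0"
      using separating_linear_form[OF assms, of q] by blast
    then show "\<exists>T. openin proj_zariski T \<and> q \<in> T \<and> T \<subseteq> proj_space - {p}"
      using q openin_basic[of 1 l] by (intro exI[of _ "{p \<in> proj_space. l (rep p) \<noteq> 0}"]) auto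
  qed
  then show ?thesis using assms by (simp add: closedin_def topspace_proj_zariski)
qed

text \<open>The ideal of the affine cone over \<open>C\<close>, taken among all polynomial functions
  and not only the homogeneous ones, so that it is an ideal of a ring already known to be
  Noetherian.\<close>

definition vanishing_ideal :: "('n::finite) pt set \<Rightarrow> (complex ^ 'n \<Rightarrow> complex) set" where
  "vanishing_ideal C = {f \<in> polyfuns UNIV. \<forall>p\<in>C. \<forall>v\<in>p. f v = 0}"

lemma ideal_vanishing_ideal: "ideal_of (polyfuns UNIV) (vanishing_ideal C)"
  using subring_of_simps[OF subring_polyfuns[of UNIV]]
  by (auto simp: ideal_of_def vanishing_ideal_def plus_fun_def times_fun_def)

lemma vanishing_ideal_subset:
  assumes "closedin proj_zariski C" "vanishing_ideal C \<subseteq> vanishing_ideal C'" "C' \<subseteq> proj_space"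
  shows "C' \<subseteq> C"
proof
  fix p assume p: "p \<in> C'"
  show "p \<in> C"
  proof (rule ccontr)
    assume "p \<notin> C"
    then have pC: "p \<in> proj_space - C" using p assms(3) by blast
    have C: "C \<subseteq> proj_space" using closedin_subset[OF assms(1)] by (simp add: topspace_proj_zariski)
    have "openin proj_zariski (proj_space - C)"
      using assms(1) by (simp add: closedin_def topspace_proj_zariski)
    from openin_zariski_basis(2)[OF this pC] obtain d P where P: "hom_poly d P" "P (rep p) \<noteq> 0"
      "\<forall>q\<in>proj_space. P (rep q) \<noteq> 0 \<longrightarrow> q \<in> proj_space - C" by blast
    have "P \<in> vanishing_ideal C"
      using P C hom_poly_polyfuns[OF P(1)] hom_poly_nonzero_iff[OF P(1)]
      by (auto simp: vanishing_ideal_def)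
    then have "P \<in> vanishing_ideal C'" using assms(2) by auto
    then show False using P(2) p assms(3) proj_point(1)[of p] by (auto simp: vanishing_ideal_def)
  qed
qed

text \<open>A strictly decreasing sequence of closed sets would give an increasing sequence of
  ideals that never becomes stationary. This supplies the minimal counterexample in
  \<open>proper_closed_finite\<close>.\<close>

lemma wf_zariski_closed:
  "wf {(A :: ('n::finite) pt set, B). closedin proj_zariski A \<and> closedin proj_zariski B \<and> A \<subset> B}"
  unfolding wf_iff_no_infinite_down_chain
proof
  assume "\<exists>f :: nat \<Rightarrow> 'n pt set. \<forall>i. (f (Suc i), f i) \<in>
    {(A, B). closedin proj_zariski A \<and> closedin proj_zariski B \<and> A \<subset> B}"
  then obtain f :: "nat \<Rightarrow> 'n pt set" where f': "\<forall>i. (f (Suc i), f i) \<in>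
    {(A, B). closedin proj_zariski A \<and> closedin proj_zariski B \<and> A \<subset> B}" ..
  have f: "closedin proj_zariski (f i)" "f (Suc i) \<subset> f i" for i
    using spec[OF f', of i] by simp_all
  define J where "J k = vanishing_ideal (f k)" for k
  have "\<exists>N. \<forall>k\<ge>N. J k = J N"
  proof -
    have "vanishing_ideal (f k) \<subseteq> vanishing_ideal (f (Suc k))" for k
      using f(2)[of k] unfolding vanishing_ideal_def by blast
    then show ?thesis
      using noetherian_polyfuns[of "UNIV :: 'n set", unfolded noetherian_def, THEN spec, of J]
      by (simp add: J_def ideal_vanishing_ideal)
  qed
  then obtain N where "\<forall>k\<ge>N. J k = J N" ..
  then have "J (Suc N) = J N" by (rule allE[of _ "Suc N"]) (erule mp, simp)
  then have "f N \<subseteq> f (Suc N)"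
    using closedin_subset[OF f(1)[of N]] unfolding J_def topspace_proj_zariski
    by - (rule vanishing_ideal_subset[OF f(1)[of "Suc N"]], simp_all)
  then show False using f(2)[of N] by auto
qed

section \<open>Open sets of a smooth curve\<close>

locale smooth_curve =
  fixes X :: "('n::finite) pt set"
  assumes smooth: "smooth_projective_curve X"
begin

lemma closedin_X: "closedin proj_zariski X" and X_nonempty: "X \<noteq> {}"
  and X_irreducible: "closedin proj_zariski A \<Longrightarrow> closedin proj_zariski B \<Longrightarrow> X \<subseteq> A \<union> B \<Longrightarrow> X \<subseteq> A \<or> X \<subseteq> B"
  using smooth by (auto simp: smooth_projective_curve_def irreducible_closed_def)

lemma X_proj: "X \<subseteq> proj_space"
  using closedin_subset[OF closedin_X] by (simp add: topspace_proj_zariski)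

lemma closedin_zariski_iff: "closedin (zariski X) A \<longleftrightarrow> closedin proj_zariski A \<and> A \<subseteq> X"
  using closedin_closed_subtopology[OF closedin_X] by blast

lemma topspace_zariski: "topspace (zariski X) = X"
  using X_proj by (auto simp: topspace_proj_zariski)

lemma zopen_subset: "zopen X U \<Longrightarrow> U \<subseteq> X"
  using openin_subset topspace_zariski by metis

lemma zopen_X: "zopen X X"
  using openin_topspace[of "zariski X"] topspace_zariski by metis

lemma zopen_iff: "zopen X U \<longleftrightarrow> U \<subseteq> X \<and> closedin (zariski X) (X - U)"
  by (metis openin_closedin_eq topspace_zariski)

lemma irreducible_closedin_zariski: "irreducible_closed (zariski X) X"
  using X_irreducible X_nonempty zopen_X closedin_topspace[of "zariski X"]
  unfolding irreducible_closed_def closedin_zariski_iff topspace_zariski by blast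

lemma zopen_Int_nonempty:
  assumes "zopen X U" "zopen X V" "U \<noteq> {}" "V \<noteq> {}"
  shows "U \<inter> V \<noteq> {}"
proof
  assume "U \<inter> V = {}"
  then have "X \<subseteq> (X - U) \<union> (X - V)" by auto
  then have "X \<subseteq> X - U \<or> X \<subseteq> X - V"
    using assms(1,2) by (intro X_irreducible) (auto simp: zopen_iff closedin_zariski_iff)
  then show False using assms zopen_subset by blast
qed

lemma irreducible_point: "p \<in> X \<Longrightarrow> irreducible_closed (zariski X) {p}"
  using closedin_zariski_point[of p] X_proj
  by (auto simp: irreducible_closed_def closedin_zariski_iff)

lemma no_chain2: "\<not> irreducible_chain (zariski X) 2 Z"
  using smooth by (auto simp: smooth_projective_curve_def has_dimension_def numeral_2_eq_2)

text \<open>A minimal infinite proper closed subset \<open>Z\<close> is irreducible: of two closed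
  sets covering it, one meets it in an infinite set and hence contains it. With a point below and
  \<open>X\<close> above, it would be part of a chain of length two, against dimension one.\<close>

lemma proper_closed_finite:
  assumes "closedin (zariski X) C" "C \<noteq> X"
  shows "finite C"
proof (rule ccontr)
  assume inf: "infinite C"
  define S where "S = {A. closedin (zariski X) A \<and> A \<noteq> X \<and> infinite A}"
  have "C \<in> S" using assms inf by (simp add: S_def)
  then obtain Z where Z: "Z \<in> S" and min': "\<And>A. (A, Z) \<in> {(A, B). closedin proj_zariski A \<and>
      closedin proj_zariski B \<and> A \<subset> B} \<Longrightarrow> A \<notin> S"
    by (rule wfE_min[OF wf_zariski_closed, of C S]) (rule that, assumption, blast)
  have Zc: "closedin proj_zariski Z" "Z \<subseteq> X" "Z \<noteq> X" "infinite Z"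
    using Z by (auto simp: S_def closedin_zariski_iff)
  have min: "A \<notin> S" if "closedin proj_zariski A" "A \<subset> Z" for A
    using min'[of A] that Zc(1) by blast
  have "irreducible_closed (zariski X) Z"
    unfolding irreducible_closed_def
  proof (intro conjI allI impI)
    show "Z \<noteq> {}" using Zc by auto
    show "closedin (zariski X) Z" using Z by (auto simp: S_def)
    fix A B assume AB: "closedin (zariski X) A \<and> closedin (zariski X) B \<and> Z \<subseteq> A \<union> B"
    then have "infinite (Z \<inter> A) \<or> infinite (Z \<inter> B)"
      using Zc(4) by (metis Int_Un_distrib finite_UnI inf.absorb1)
    moreover have "Z \<subseteq> D" if "infinite (Z \<inter> D)" "closedin (zariski X) D" for D
    proof (rule ccontr)
      assume "\<not> Z \<subseteq> D"
      then have "Z \<inter> D \<subset> Z" by auto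
      moreover have "closedin proj_zariski (Z \<inter> D)"
        using that(2) Zc(1) by (auto simp: closedin_zariski_iff)
      ultimately have "Z \<inter> D \<notin> S" using min by blast
      then show False
        using that Zc \<open>closedin proj_zariski (Z \<inter> D)\<close> by (auto simp: S_def closedin_zariski_iff)
    qed
    ultimately show "Z \<subseteq> A \<or> Z \<subseteq> B" using AB by blast
  qed
  moreover obtain p where p: "p \<in> Z" using Zc by (metis finite.emptyI ex_in_conv)
  moreover have "{p} \<noteq> Z" using Zc by auto
  ultimately have "irreducible_chain (zariski X) 2 (\<lambda>i. if i = 0 then {p} else if i = 1 then Z else X)"
    using Zc irreducible_point irreducible_closedin_zariski
    by (auto simp: irreducible_chain_def less_2_cases_iff)
  then show False using no_chain2 by blast
qed

lemma zopen_cofinite: "zopen X U \<Longrightarrow> U \<noteq> {} \<Longrightarrow> finite (X - U)"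
  by (rule proper_closed_finite) (auto simp: zopen_iff)

lemma finite_closed: "finite F \<Longrightarrow> F \<subseteq> X \<Longrightarrow> closedin proj_zariski F"
proof (induction rule: finite_induct)
  case (insert p F)
  then show ?case using closedin_zariski_point[of p] X_proj closedin_Un[of proj_zariski "{p}" F] by auto
qed simp

lemma zopen_diff_finite:
  assumes "zopen X U" "finite F"
  shows "zopen X (U - F)"
proof -
  have "closedin (zariski X) (F \<inter> X)"
    using finite_closed[of "F \<inter> X"] assms(2) by (auto simp: closedin_zariski_iff)
  moreover have "U - F = U - (F \<inter> X)" using zopen_subset[OF assms(1)] by auto
  ultimately show ?thesis using assms(1) openin_diff by metis
qed

lemma zopen_Int: "zopen X U \<Longrightarrow> zopen X V \<Longrightarrow> zopen X (U \<inter> V)"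
  by (rule openin_Int)

text \<open>On a finite curve a point and its complement would be disjoint nonempty open sets. The
  complement is nonempty because dimension one provides two distinct nested closed sets.\<close>

lemma infinite_X: "infinite X"
proof
  assume fin: "finite X"
  obtain Z where Z: "irreducible_chain (zariski X) 1 Z"
    using smooth by (auto simp: smooth_projective_curve_def has_dimension_def)
  then have "Z 0 \<noteq> {}" and Zc: "Z 0 \<subset> Z 1" "Z 1 \<subseteq> X"
    unfolding irreducible_chain_def irreducible_closed_def closedin_zariski_iff
    by (metis le0, metis One_nat_def zero_less_one, metis order_refl)
  then obtain p where p: "p \<in> Z 0" by blast
  have "p \<in> X" "X - {p} \<noteq> {}" using p Zc by blast+
  moreover have "zopen X {p}" using zopen_diff_finite[OF zopen_X, of "X - {p}"] fin \<open>p \<in> X\<close>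
    by (simp add: double_diff)
  moreover have "zopen X (X - {p})" using zopen_diff_finite[OF zopen_X, of "{p}"] by simp
  ultimately show False using zopen_Int_nonempty[of "{p}" "X - {p}"] by auto
qed

lemma infinite_zopen: "zopen X U \<Longrightarrow> U \<noteq> {} \<Longrightarrow> infinite U"
  using zopen_cofinite infinite_X by (metis finite_Diff2)

lemma zopen_basic: "hom_poly d P \<Longrightarrow> zopen X {p \<in> X. P (rep p) \<noteq> 0}"
proof -
  assume "hom_poly d P"
  then have "zopen X ({p \<in> proj_space. P (rep p) \<noteq> 0} \<inter> X)"
    using openin_basic by (auto simp: openin_subtopology)
  moreover have "{p \<in> proj_space. P (rep p) \<noteq> 0} \<inter> X = {p \<in> X. P (rep p) \<noteq> 0}" using X_proj by auto
  ultimately show ?thesis by simp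
qed

text \<open>The generic point as a filter: for every nonempty open \<open>U\<close> it equals
  \<open>gen X\<close>, the filter of cofinite sets. The parameter is kept because
  \<open>gen {}\<close> is trivial, so that identities between sections over the empty set hold as
  well.\<close>

definition gen :: "'n pt set \<Rightarrow> 'n pt filter" where
  "gen U = inf cofinite (principal U)"

lemma eventually_gen: "eventually P (gen U) \<longleftrightarrow> finite {p \<in> U. \<not> P p}"
  by (simp add: gen_def eventually_inf_principal eventually_cofinite)

lemma gen_mono: "V \<subseteq> U \<Longrightarrow> gen V \<le> gen U"
  by (auto simp: gen_def le_infI2)

lemma gen_zopen: "zopen X U \<Longrightarrow> U \<noteq> {} \<Longrightarrow> gen U = gen X"
proof -
  assume U: "zopen X U" "U \<noteq> {}"
  have "eventually P (gen U) = eventually P (gen X)" for P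
  proof -
    have "{p \<in> X. \<not> P p} \<subseteq> {p \<in> U. \<not> P p} \<union> (X - U)" by auto
    moreover have "{p \<in> U. \<not> P p} \<subseteq> {p \<in> X. \<not> P p}" using zopen_subset[OF U(1)] by auto
    ultimately show ?thesis
      unfolding eventually_gen using zopen_cofinite[OF U] by (meson finite_UnI finite_subset)
  qed
  then show ?thesis by (simp add: filter_eq_iff)
qed

lemma gen_empty: "gen {} = bot"
  by (simp add: gen_def)

lemma gen_nontrivial: "gen X \<noteq> bot"
  using infinite_X by (simp add: trivial_limit_def eventually_gen)

lemma eventually_zopen: "zopen X U \<Longrightarrow> U \<noteq> {} \<Longrightarrow> \<forall>\<^sub>F q in gen X. q \<in> U"
  using zopen_cofinite by (simp add: eventually_gen set_diff_eq)

lemma eventually_in_X: "\<forall>\<^sub>F q in gen X. q \<in> X"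
  by (simp add: eventually_gen)

lemma eventually_genD: "eventually P (gen X) \<Longrightarrow> zopen X U \<Longrightarrow> U \<noteq> {} \<Longrightarrow> \<exists>q\<in>U. P q"
  using infinite_zopen[of U] gen_zopen[of U] by (metis (mono_tags, lifting) eventually_gen mem_Collect_eq rev_finite_subset subsetI)

end

section \<open>Germs of regular functions\<close>

context smooth_curve
begin

text \<open>Equality as rational functions. A rational function is represented by a total function
  on points whose values at finitely many points are arbitrary; a value at a single point has a
  meaning only together with \<open>regat\<close>.\<close>

abbreviation generic_eq :: "('n pt \<Rightarrow> complex) \<Rightarrow> ('n pt \<Rightarrow> complex) \<Rightarrow> bool" (infix "\<approx>" 50) where
  "f \<approx> g \<equiv> \<forall>\<^sub>F q in gen X. f q = g q"

definition regat :: "'n pt \<Rightarrow> ('n pt \<Rightarrow> complex) \<Rightarrow> bool" where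
  "regat p f \<longleftrightarrow> (\<exists>W d P Q. zopen X W \<and> p \<in> W \<and> hom_poly d P \<and> hom_poly d Q \<and>
     (\<forall>q\<in>W. Q (rep q) \<noteq> 0 \<and> f q = P (rep q) / Q (rep q)))"

definition rat :: "('n pt \<Rightarrow> complex) \<Rightarrow> bool" where
  "rat f \<longleftrightarrow> (\<exists>d P Q. hom_poly d P \<and> hom_poly d Q \<and>
     (\<forall>\<^sub>F q in gen X. Q (rep q) \<noteq> 0 \<and> f q = P (rep q) / Q (rep q)))"

lemma regular_iff:
  assumes U: "zopen X U"
  shows "f \<in> regular X U \<longleftrightarrow> f \<in> extensional U \<and> (\<forall>p\<in>U. regat p f)"
proof -
  have "(\<exists>W d P Q. zopen X W \<and> p \<in> W \<and> W \<subseteq> U \<and> hom_poly d P \<and> hom_poly d Q \<and>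
       (\<forall>q\<in>W. \<forall>v\<in>q. Q v \<noteq> 0 \<and> f q = P v / Q v)) \<longleftrightarrow> regat p f" (is "?L \<longleftrightarrow> _")
    if p: "p \<in> U" for p
  proof
    assume ?L
    then obtain W d P Q where W: "zopen X W" "p \<in> W" "hom_poly d P" "hom_poly d Q"
       "\<forall>q\<in>W. \<forall>v\<in>q. Q v \<noteq> 0 \<and> f q = P v / Q v" by blast
    then have "\<forall>q\<in>W. Q (rep q) \<noteq> 0 \<and> f q = P (rep q) / Q (rep q)"
      using zopen_subset[OF W(1)] X_proj proj_point(1) by blast
    then show "regat p f" unfolding regat_def using W by blast
  next
    assume "regat p f"
    then obtain W d P Q where W: "zopen X W" "p \<in> W" "hom_poly d P" "hom_poly d Q"
       "\<forall>q\<in>W. Q (rep q) \<noteq> 0 \<and> f q = P (rep q) / Q (rep q)" unfolding regat_def by blast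
    have "\<forall>q\<in>W \<inter> U. \<forall>v\<in>q. Q v \<noteq> 0 \<and> f q = P v / Q v"
    proof (intro ballI)
      fix q v assume q: "q \<in> W \<inter> U" and v: "v \<in> q"
      then have "q \<in> proj_space" using zopen_subset[OF W(1)] X_proj by blast
      then show "Q v \<noteq> 0 \<and> f q = P v / Q v"
        using W(5) q hom_poly_ratio[OF W(3,4) _ v] hom_poly_nonzero_iff[OF W(4) _ v] by simp
    qed
    then show ?L using W zopen_Int[OF W(1) U] p by (intro exI[of _ "W \<inter> U"]) blast
  qed
  then show ?thesis unfolding regular_def by simp
qed

lemma regat_in_X: "regat p f \<Longrightarrow> p \<in> X"
  unfolding regat_def using zopen_subset by blast

lemma regat_local:
  assumes "regat p f" "zopen X V" "p \<in> V" "\<And>q. q \<in> V \<Longrightarrow> f q = g q"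
  shows "regat p g"
proof -
  obtain W d P Q where W: "zopen X W" "p \<in> W" "hom_poly d P" "hom_poly d Q"
     "\<forall>q\<in>W. Q (rep q) \<noteq> 0 \<and> f q = P (rep q) / Q (rep q)"
    using assms(1) unfolding regat_def by blast
  then show ?thesis
    unfolding regat_def using assms zopen_Int[OF W(1) assms(2)]
    by (intro exI[of _ "W \<inter> V"] exI[of _ d] exI[of _ P] exI[of _ Q]) auto
qed

lemma regat_restrict: "zopen X V \<Longrightarrow> p \<in> V \<Longrightarrow> regat p (restrict f V) \<longleftrightarrow> regat p f"
  using regat_local[of p f V "restrict f V"] regat_local[of p "restrict f V" V f] by auto

lemma regular_restrict:
  "zopen X U \<Longrightarrow> zopen X V \<Longrightarrow> V \<subseteq> U \<Longrightarrow> f \<in> regular X U \<Longrightarrow> restrict f V \<in> regular X V"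
  by (simp add: regular_iff regat_restrict subset_iff)

lemma regat_open: "regat p f \<Longrightarrow> \<exists>W. zopen X W \<and> p \<in> W \<and> (\<forall>q\<in>W. regat q f)"
  unfolding regat_def by blast

lemma regat_ratio:
  assumes "hom_poly d P" "hom_poly d Q" "p \<in> X" "Q (rep p) \<noteq> 0"
  shows "regat p (\<lambda>q. P (rep q) / Q (rep q))"
  unfolding regat_def
proof (intro exI conjI)
  show "zopen X {q \<in> X. Q (rep q) \<noteq> 0}" by (rule zopen_basic[OF assms(2)])
  show "\<forall>q\<in>{q \<in> X. Q (rep q) \<noteq> 0}. Q (rep q) \<noteq> 0 \<and> P (rep q) / Q (rep q) = P (rep q) / Q (rep q)"
    by simp
qed (use assms in auto)

lemma regat_const: "p \<in> X \<Longrightarrow> regat p (\<lambda>q. c)"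
  unfolding regat_def
  by (intro exI[of _ X] exI[of _ 0] exI[of _ "\<lambda>v. c"] exI[of _ "\<lambda>v. 1"])
    (simp add: zopen_X hom_poly.const)

lemma
  assumes "regat p f" "regat p g"
  shows regat_add: "regat p (\<lambda>q. f q + g q)" and regat_mult: "regat p (\<lambda>q. f q * g q)"
proof -
  obtain W d P Q where W: "zopen X W" "p \<in> W" "hom_poly d P" "hom_poly d Q"
     "\<forall>q\<in>W. Q (rep q) \<noteq> 0 \<and> f q = P (rep q) / Q (rep q)"
    using assms(1) unfolding regat_def by blast
  obtain V e R S where V: "zopen X V" "p \<in> V" "hom_poly e R" "hom_poly e S"
     "\<forall>q\<in>V. S (rep q) \<noteq> 0 \<and> g q = R (rep q) / S (rep q)"
    using assms(2) unfolding regat_def by blast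
  have QS: "hom_poly (d + e) (\<lambda>v. Q v * S v)" "hom_poly (d + e) (\<lambda>v. P v * R v)"
    "hom_poly (d + e) (\<lambda>v. P v * S v + R v * Q v)"
    using W V hom_poly_mult[of d P e S] hom_poly_mult[of e R d Q]
    by (auto intro!: hom_poly.add hom_poly_mult simp: add.commute)
  show "regat p (\<lambda>q. f q + g q)"
    unfolding regat_def
  proof (intro exI conjI)
    show "zopen X (W \<inter> V)" "p \<in> W \<inter> V" using W V zopen_Int by auto
    show "\<forall>q\<in>W \<inter> V. Q (rep q) * S (rep q) \<noteq> 0 \<and>
      f q + g q = (P (rep q) * S (rep q) + R (rep q) * Q (rep q)) / (Q (rep q) * S (rep q))"
      using W(5) V(5) by (auto simp: add_frac_eq)
  qed (use QS in auto)
  show "regat p (\<lambda>q. f q * g q)"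
    unfolding regat_def
  proof (intro exI conjI)
    show "zopen X (W \<inter> V)" "p \<in> W \<inter> V" using W V zopen_Int by auto
    show "\<forall>q\<in>W \<inter> V. Q (rep q) * S (rep q) \<noteq> 0 \<and>
      f q * g q = (P (rep q) * R (rep q)) / (Q (rep q) * S (rep q))"
      using W(5) V(5) by auto
  qed (use QS in auto)
qed

lemma regat_cmult: "regat p f \<Longrightarrow> regat p (\<lambda>q. c * f q)"
  using regat_mult[OF regat_const] regat_in_X by blast

lemma regat_diff: "regat p f \<Longrightarrow> regat p g \<Longrightarrow> regat p (\<lambda>q. f q - g q)"
  using regat_add[OF _ regat_cmult[of p g "-1"]] by simp

lemma regat_power: "regat p f \<Longrightarrow> regat p (\<lambda>q. f q ^ k)"
  by (induction k) (auto intro: regat_mult regat_const regat_in_X)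

lemma regat_sum: "p \<in> X \<Longrightarrow> (\<And>i. i \<in> I \<Longrightarrow> regat p (f i)) \<Longrightarrow> regat p (\<lambda>q. \<Sum>i\<in>I. f i q)"
  by (induction I rule: infinite_finite_induct) (auto intro: regat_add regat_const)

lemma regat_inverse:
  assumes "regat p f" "f p \<noteq> 0"
  shows "regat p (\<lambda>q. inverse (f q))"
proof -
  obtain W d P Q where W: "zopen X W" "p \<in> W" "hom_poly d P" "hom_poly d Q"
     "\<forall>q\<in>W. Q (rep q) \<noteq> 0 \<and> f q = P (rep q) / Q (rep q)"
    using assms(1) unfolding regat_def by blast
  have "p \<in> X" using W zopen_subset by blast
  then show ?thesis
    unfolding regat_def
    using W assms(2) zopen_Int[OF W(1) zopen_basic[OF W(3)]]
    by (intro exI[of _ "W \<inter> {q \<in> X. P (rep q) \<noteq> 0}"] exI[of _ d] exI[of _ Q] exI[of _ P]) auto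
qed

lemma regat_powi:
  assumes "regat p f" "f p \<noteq> 0"
  shows "regat p (\<lambda>q. f q powi k)"
  using regat_power[OF assms(1)] regat_power[OF regat_inverse[OF assms]]
  by (cases "k \<ge> 0") (auto simp: power_int_def)

lemma regat_nonzero:
  assumes "regat p f" "f p \<noteq> 0"
  obtains W where "zopen X W" "p \<in> W" "\<And>q. q \<in> W \<Longrightarrow> f q \<noteq> 0"
proof -
  obtain W d P Q where W: "zopen X W" "p \<in> W" "hom_poly d P" "hom_poly d Q"
     "\<forall>q\<in>W. Q (rep q) \<noteq> 0 \<and> f q = P (rep q) / Q (rep q)"
    using assms(1) unfolding regat_def by blast
  have "p \<in> X" using W zopen_subset by blast
  then show ?thesis
    using that[of "W \<inter> {q \<in> X. P (rep q) \<noteq> 0}"] W assms(2) zopen_Int[OF W(1) zopen_basic[OF W(3)]]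
    by auto
qed

text \<open>A nonzero value of the difference at \<open>p\<close> would persist on an open
  neighbourhood, and a nonempty open set meets every cofinite set. This identity theorem allows
  generic identities to be evaluated at a point.\<close>

lemma regat_eq:
  assumes "regat p f" "regat p g" "f \<approx> g"
  shows "f p = g p"
proof (rule ccontr)
  assume "f p \<noteq> g p"
  then obtain W where W: "zopen X W" "p \<in> W" "\<And>q. q \<in> W \<Longrightarrow> f q - g q \<noteq> 0"
    using regat_nonzero[OF regat_diff[OF assms(1,2)]] by auto
  then have "\<exists>q\<in>W. f q = g q" using eventually_genD[OF assms(3) W(1)] by blast
  then show False using W(3) by auto
qed

lemma regular_eqI:
  assumes "zopen X U" "f \<in> regular X U" "g \<in> regular X U" "\<forall>\<^sub>F q in gen U. f q = g q"
  shows "f = g"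
proof (rule extensionalityI[of _ U])
  show "f \<in> extensional U" "g \<in> extensional U" using assms by (auto simp: regular_iff)
  fix p assume p: "p \<in> U"
  then have "gen U = gen X" using gen_zopen[OF assms(1)] by blast
  then have "f \<approx> g" using assms(4) by simp
  then show "f p = g p" using regat_eq p assms by (auto simp: regular_iff)
qed

section \<open>Rational functions\<close>

lemma eventually_basic:
  assumes "hom_poly d P" "p \<in> X" "P (rep p) \<noteq> 0"
  shows "\<forall>\<^sub>F q in gen X. P (rep q) \<noteq> 0"
proof -
  have "\<forall>\<^sub>F q in gen X. q \<in> {q \<in> X. P (rep q) \<noteq> 0}"
    using assms by (intro eventually_zopen zopen_basic) auto
  then show ?thesis by (rule eventually_mono) simp
qed

lemma hom_poly_generic:
  assumes "hom_poly d P" "\<not> (\<forall>\<^sub>F q in gen X. P (rep q) = 0)"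
  shows "\<forall>\<^sub>F q in gen X. P (rep q) \<noteq> 0"
proof -
  have "{q \<in> X. P (rep q) \<noteq> 0} \<noteq> {}"
  proof
    assume "{q \<in> X. P (rep q) \<noteq> 0} = {}"
    then have "finite {q \<in> X. P (rep q) \<noteq> 0}" by (simp only: finite.emptyI)
    then show False using assms(2) by (simp add: eventually_gen)
  qed
  from eventually_zopen[OF zopen_basic[OF assms(1)] this] show ?thesis
    by eventually_elim auto
qed

lemma regat_rat: "regat p f \<Longrightarrow> rat f"
proof -
  assume "regat p f"
  then obtain W d P Q where W: "zopen X W" "p \<in> W" "hom_poly d P" "hom_poly d Q"
     "\<forall>q\<in>W. Q (rep q) \<noteq> 0 \<and> f q = P (rep q) / Q (rep q)" unfolding regat_def by blast
  then have "\<forall>\<^sub>F q in gen X. q \<in> W" by (intro eventually_zopen) auto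
  then have "\<forall>\<^sub>F q in gen X. Q (rep q) \<noteq> 0 \<and> f q = P (rep q) / Q (rep q)"
    by eventually_elim (use W in auto)
  then show ?thesis unfolding rat_def using W by blast
qed

lemma rat_cong:
  assumes "rat f" "f \<approx> g"
  shows "rat g"
proof -
  obtain d P Q where *: "hom_poly d P" "hom_poly d Q"
    "\<forall>\<^sub>F q in gen X. Q (rep q) \<noteq> 0 \<and> f q = P (rep q) / Q (rep q)"
    using assms(1) unfolding rat_def by blast
  from *(3) assms(2) have "\<forall>\<^sub>F q in gen X. Q (rep q) \<noteq> 0 \<and> g q = P (rep q) / Q (rep q)"
    by eventually_elim auto
  then show ?thesis unfolding rat_def using * by blast
qed

lemma rat_const: "rat (\<lambda>q. c)"
  using regat_rat[OF regat_const] X_nonempty by blast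

lemma
  assumes "rat f" "rat g"
  shows rat_add: "rat (\<lambda>q. f q + g q)" and rat_mult: "rat (\<lambda>q. f q * g q)"
proof -
  obtain d P Q where W: "hom_poly d P" "hom_poly d Q"
     "\<forall>\<^sub>F q in gen X. Q (rep q) \<noteq> 0 \<and> f q = P (rep q) / Q (rep q)"
    using assms(1) unfolding rat_def by blast
  obtain e R S where V: "hom_poly e R" "hom_poly e S"
     "\<forall>\<^sub>F q in gen X. S (rep q) \<noteq> 0 \<and> g q = R (rep q) / S (rep q)"
    using assms(2) unfolding rat_def by blast
  have QS: "hom_poly (d + e) (\<lambda>v. Q v * S v)" "hom_poly (d + e) (\<lambda>v. P v * R v)"
    "hom_poly (d + e) (\<lambda>v. P v * S v + R v * Q v)"
    using W V hom_poly_mult[of d P e S] hom_poly_mult[of e R d Q]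
    by (auto intro!: hom_poly.add hom_poly_mult simp: add.commute)
  show "rat (\<lambda>q. f q + g q)"
    unfolding rat_def
  proof (intro exI conjI)
    show "\<forall>\<^sub>F q in gen X. Q (rep q) * S (rep q) \<noteq> 0 \<and>
      f q + g q = (P (rep q) * S (rep q) + R (rep q) * Q (rep q)) / (Q (rep q) * S (rep q))"
      using W(3) V(3) by eventually_elim (auto simp: add_frac_eq)
  qed (use QS in auto)
  show "rat (\<lambda>q. f q * g q)"
    unfolding rat_def
  proof (intro exI conjI)
    show "\<forall>\<^sub>F q in gen X. Q (rep q) * S (rep q) \<noteq> 0 \<and>
      f q * g q = (P (rep q) * R (rep q)) / (Q (rep q) * S (rep q))"
      using W(3) V(3) by eventually_elim auto
  qed (use QS in auto)
qed

lemma rat_cmult: "rat f \<Longrightarrow> rat (\<lambda>q. c * f q)"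
  by (intro rat_mult rat_const)

lemma rat_uminus: "rat f \<Longrightarrow> rat (\<lambda>q. - f q)"
  using rat_cmult[of f "-1"] by simp

lemma rat_diff: "rat f \<Longrightarrow> rat g \<Longrightarrow> rat (\<lambda>q. f q - g q)"
  using rat_add[OF _ rat_uminus] by simp

lemma rat_power: "rat f \<Longrightarrow> rat (\<lambda>q. f q ^ k)"
  by (induction k) (auto intro: rat_mult rat_const)

lemma rat_sum: "(\<And>i. i \<in> I \<Longrightarrow> rat (f i)) \<Longrightarrow> rat (\<lambda>q. \<Sum>i\<in>I. f i q)"
  by (induction I rule: infinite_finite_induct) (auto intro: rat_add rat_const)

lemma rat_generic:
  assumes "rat f" "\<not> f \<approx> (\<lambda>q. 0)"
  shows "\<forall>\<^sub>F q in gen X. f q \<noteq> 0"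
proof -
  obtain d P Q where *: "hom_poly d P" "hom_poly d Q"
    "\<forall>\<^sub>F q in gen X. Q (rep q) \<noteq> 0 \<and> f q = P (rep q) / Q (rep q)"
    using assms(1) unfolding rat_def by blast
  have "\<not> (\<forall>\<^sub>F q in gen X. P (rep q) = 0)"
  proof
    assume "\<forall>\<^sub>F q in gen X. P (rep q) = 0"
    with *(3) have "f \<approx> (\<lambda>q. 0)" by eventually_elim auto
    then show False using assms(2) by simp
  qed
  from hom_poly_generic[OF *(1) this] *(3) show ?thesis by eventually_elim auto
qed

lemma rat_inverse:
  assumes "rat f"
  shows "rat (\<lambda>q. inverse (f q))"
proof (cases "f \<approx> (\<lambda>q. 0)")
  case True
  then have "(\<lambda>q. 0) \<approx> (\<lambda>q. inverse (f q))" by eventually_elim auto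
  then show ?thesis by (rule rat_cong[OF rat_const])
next
  case False
  obtain d P Q where *: "hom_poly d P" "hom_poly d Q"
    "\<forall>\<^sub>F q in gen X. Q (rep q) \<noteq> 0 \<and> f q = P (rep q) / Q (rep q)"
    using assms(1) unfolding rat_def by blast
  from *(3) rat_generic[OF assms False]
  have "\<forall>\<^sub>F q in gen X. P (rep q) \<noteq> 0 \<and> inverse (f q) = Q (rep q) / P (rep q)"
    by eventually_elim auto
  then show ?thesis unfolding rat_def using * by blast
qed

lemma rat_powi: "rat f \<Longrightarrow> rat (\<lambda>q. f q powi k)"
  using rat_power[of f] rat_power[OF rat_inverse, of f] by (cases "k \<ge> 0") (auto simp: power_int_def)

definition nz :: "('n pt \<Rightarrow> complex) \<Rightarrow> bool" where
  "nz f \<longleftrightarrow> rat f \<and> \<not> f \<approx> (\<lambda>q. 0)"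

lemma nz_iff: "nz f \<longleftrightarrow> rat f \<and> (\<forall>\<^sub>F q in gen X. f q \<noteq> 0)"
proof -
  have False if "\<forall>\<^sub>F q in gen X. f q \<noteq> 0" "f \<approx> (\<lambda>q. 0)"
  proof -
    from that have "\<forall>\<^sub>F q in gen X. False" by eventually_elim auto
    then show False using gen_nontrivial by (simp add: trivial_limit_def)
  qed
  then show ?thesis using rat_generic by (auto simp: nz_def)
qed

lemma nz_nonzero: "nz f \<Longrightarrow> \<forall>\<^sub>F q in gen X. f q \<noteq> 0"
  by (simp add: nz_iff)

lemma nz_inverse: "nz f \<Longrightarrow> nz (\<lambda>q. inverse (f q))"
  unfolding nz_iff by (auto intro: rat_inverse elim: eventually_mono)

section \<open>Uniformizers and orders\<close>

lemma uniformizer_props: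
  assumes "uniformizer X p W t"
  shows "p \<in> X" "regat p t" "t p = 0"
    "regat p f \<Longrightarrow> f p = 0 \<Longrightarrow> \<exists>g. regat p g \<and> f \<approx> (\<lambda>q. t q * g q)"
proof -
  have W: "zopen X W" "p \<in> W" "t \<in> regular X W" "t p = 0" using assms by (auto simp: uniformizer_def)
  then show "p \<in> X" "regat p t" "t p = 0" using zopen_subset by (auto simp: regular_iff)
  assume f: "regat p f" "f p = 0"
  obtain W1 where W1: "zopen X W1" "p \<in> W1" "\<forall>q\<in>W1. regat q f" using regat_open[OF f(1)] by blast
  define W2 where "W2 = W1 \<inter> W"
  have W2: "zopen X W2" "p \<in> W2" "W2 \<subseteq> W" using W W1 zopen_Int by (auto simp: W2_def)
  have "restrict f W2 \<in> regular X W2"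
    using W1 W2 by (auto simp: regular_iff W2_def regat_restrict)
  moreover have "restrict f W2 p = 0" using f W2 by simp
  ultimately obtain W3 g where g: "zopen X W3" "p \<in> W3" "W3 \<subseteq> W2" "g \<in> regular X W3"
    "\<forall>q\<in>W3. restrict f W2 q = t q * g q"
    using assms W2 unfolding uniformizer_def by meson
  have "\<forall>\<^sub>F q in gen X. q \<in> W3" using g by (intro eventually_zopen) auto
  moreover have "\<forall>q\<in>W3. f q = t q * g q" using g(3,5) by (metis restrict_apply' subsetD)
  ultimately have "f \<approx> (\<lambda>q. t q * g q)" by (auto elim: eventually_mono)
  moreover have "regat p g" using g by (auto simp: regular_iff)
  ultimately show "\<exists>g. regat p g \<and> f \<approx> (\<lambda>q. t q * g q)" by blast
qed

text \<open>Some quotient of linear forms vanishes at \<open>p\<close> but not generically. It is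
  generically a multiple of \<open>t\<close>, so \<open>t\<close> cannot vanish generically
  either.\<close>

lemma uniformizer_nz:
  assumes "uniformizer X p W t"
  shows "nz t"
proof -
  note t = uniformizer_props[OF assms]
  have "X \<noteq> {p}" using infinite_X by auto
  then obtain q where q: "q \<in> X" "q \<noteq> p" using t(1) by blast
  have P: "p \<in> proj_space" "q \<in> proj_space" using q t(1) X_proj by auto
  obtain l where l: "hom_poly 1 l" "l (rep p) = 0" "l (rep q) \<noteq> 0"
    using separating_linear_form[OF P] q by metis
  obtain i where i: "rep p $ i \<noteq> 0" using nonvanishing_linear_form[OF P(1)] .
  define f where "f = (\<lambda>q. l (rep q) / rep q $ i)"
  have "regat p f"
    unfolding f_def using t(1) i l by (intro regat_ratio[of 1] hom_poly_coord) auto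
  moreover have "f p = 0" using l by (simp add: f_def)
  ultimately obtain g where g: "f \<approx> (\<lambda>q. t q * g q)" using t(4) by blast
  have "\<forall>\<^sub>F q in gen X. rep q $ i \<noteq> 0"
    using eventually_basic[OF hom_poly_coord t(1) i] .
  moreover have "\<forall>\<^sub>F q in gen X. l (rep q) \<noteq> 0"
    using eventually_basic[OF l(1) q(1) l(3)] .
  ultimately have "\<forall>\<^sub>F q in gen X. t q \<noteq> 0" using g by eventually_elim (auto simp: f_def)
  then show ?thesis using regat_rat[OF t(2)] by (simp add: nz_iff)
qed

definition unif :: "'n pt \<Rightarrow> 'n pt \<Rightarrow> complex" where
  "unif p = (SOME t. \<exists>W. uniformizer X p W t)"

lemma uniformizer_unif: "p \<in> X \<Longrightarrow> \<exists>W. uniformizer X p W (unif p)"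
proof -
  assume "p \<in> X"
  then have "\<exists>t W. uniformizer X p W t" using smooth unfolding smooth_projective_curve_def by blast
  then show ?thesis unfolding unif_def by (rule someI_ex)
qed

lemma unif:
  assumes "p \<in> X"
  shows "regat p (unif p)" "unif p p = 0" "nz (unif p)"
    "regat p f \<Longrightarrow> f p = 0 \<Longrightarrow> \<exists>g. regat p g \<and> f \<approx> (\<lambda>q. unif p q * g q)"
  using uniformizer_unif[OF assms] uniformizer_props uniformizer_nz by blast+

text \<open>Membership in the fractional ideal \<open>t^k O_p\<close>, read up to generic equality.
  The zero function satisfies it for all \<open>k\<close>, which keeps sums free of case
  distinctions; that a nonzero function has an exact order is proved only in
  \<open>nz_hasord\<close>.\<close>

definition ordge :: "'n pt \<Rightarrow> ('n pt \<Rightarrow> complex) \<Rightarrow> int \<Rightarrow> bool" where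
  "ordge p f k \<longleftrightarrow> (\<exists>u. regat p u \<and> f \<approx> (\<lambda>q. u q * unif p q powi k))"

definition hasord :: "'n pt \<Rightarrow> ('n pt \<Rightarrow> complex) \<Rightarrow> int \<Rightarrow> bool" where
  "hasord p f k \<longleftrightarrow> (\<exists>u. regat p u \<and> u p \<noteq> 0 \<and> f \<approx> (\<lambda>q. u q * unif p q powi k))"

lemma ordge_cong: "ordge p f k \<Longrightarrow> f \<approx> g \<Longrightarrow> ordge p g k"
proof -
  assume "ordge p f k" and fg: "f \<approx> g"
  then obtain u where "regat p u" and u: "f \<approx> (\<lambda>q. u q * unif p q powi k)"
    unfolding ordge_def by blast
  moreover from u fg have "g \<approx> (\<lambda>q. u q * unif p q powi k)" by eventually_elim simp
  ultimately show ?thesis unfolding ordge_def by blast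
qed

lemma hasord_cong: "hasord p f k \<Longrightarrow> f \<approx> g \<Longrightarrow> hasord p g k"
proof -
  assume "hasord p f k" and fg: "f \<approx> g"
  then obtain u where "regat p u" "u p \<noteq> 0" and u: "f \<approx> (\<lambda>q. u q * unif p q powi k)"
    unfolding hasord_def by blast
  moreover from u fg have "g \<approx> (\<lambda>q. u q * unif p q powi k)" by eventually_elim simp
  ultimately show ?thesis unfolding hasord_def by blast
qed

lemma ordge_in_X: "ordge p f k \<Longrightarrow> p \<in> X"
  unfolding ordge_def using regat_in_X by blast

lemma hasord_ordge: "hasord p f k \<Longrightarrow> ordge p f k"
  unfolding hasord_def ordge_def by blast

lemma ordge_add: "ordge p f k \<Longrightarrow> ordge p g k \<Longrightarrow> ordge p (\<lambda>q. f q + g q) k"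
proof -
  assume "ordge p f k" "ordge p g k"
  then obtain u v where u: "regat p u" "f \<approx> (\<lambda>q. u q * unif p q powi k)"
    and v: "regat p v" "g \<approx> (\<lambda>q. v q * unif p q powi k)" unfolding ordge_def by blast
  from u(2) v(2) have "(\<lambda>q. f q + g q) \<approx> (\<lambda>q. (u q + v q) * unif p q powi k)"
    by eventually_elim (simp add: algebra_simps)
  then show ?thesis unfolding ordge_def using regat_add[OF u(1) v(1)] by blast
qed

lemma ordge_mult: "ordge p f k \<Longrightarrow> ordge p g l \<Longrightarrow> ordge p (\<lambda>q. f q * g q) (k + l)"
proof -
  assume a: "ordge p f k" "ordge p g l"
  then obtain u v where u: "regat p u" "f \<approx> (\<lambda>q. u q * unif p q powi k)"
    and v: "regat p v" "g \<approx> (\<lambda>q. v q * unif p q powi l)" unfolding ordge_def by blast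
  from u(2) v(2) nz_nonzero[OF unif(3)[OF ordge_in_X[OF a(1)]]]
  have "(\<lambda>q. f q * g q) \<approx> (\<lambda>q. (u q * v q) * unif p q powi (k + l))"
    by eventually_elim (simp add: power_int_add)
  then show ?thesis unfolding ordge_def using regat_mult[OF u(1) v(1)] by blast
qed

lemma hasord_mult: "hasord p f k \<Longrightarrow> hasord p g l \<Longrightarrow> hasord p (\<lambda>q. f q * g q) (k + l)"
proof -
  assume a: "hasord p f k" "hasord p g l"
  then obtain u v where u: "regat p u" "u p \<noteq> 0" "f \<approx> (\<lambda>q. u q * unif p q powi k)"
    and v: "regat p v" "v p \<noteq> 0" "g \<approx> (\<lambda>q. v q * unif p q powi l)" unfolding hasord_def by blast
  from u(3) v(3) nz_nonzero[OF unif(3)[OF regat_in_X[OF u(1)]]]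
  have "(\<lambda>q. f q * g q) \<approx> (\<lambda>q. (u q * v q) * unif p q powi (k + l))"
    by eventually_elim (simp add: power_int_add)
  then show ?thesis unfolding hasord_def using regat_mult[OF u(1) v(1)] u(2) v(2)
    by (intro exI[of _ "\<lambda>q. u q * v q"]) auto
qed

lemma hasord_inverse: "hasord p f k \<Longrightarrow> hasord p (\<lambda>q. inverse (f q)) (- k)"
proof -
  assume a: "hasord p f k"
  then obtain u where u: "regat p u" "u p \<noteq> 0" "f \<approx> (\<lambda>q. u q * unif p q powi k)"
    unfolding hasord_def by blast
  from u(3) have "(\<lambda>q. inverse (f q)) \<approx> (\<lambda>q. inverse (u q) * unif p q powi (- k))"
    by eventually_elim (simp add: power_int_minus)
  then show ?thesis unfolding hasord_def using regat_inverse[OF u(1,2)] u(2)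
    by (intro exI[of _ "\<lambda>q. inverse (u q)"]) auto
qed

lemma hasord_unit: "regat p u \<Longrightarrow> u p \<noteq> 0 \<Longrightarrow> hasord p u 0"
  unfolding hasord_def by (intro exI[of _ u]) auto

lemma hasord_const: "p \<in> X \<Longrightarrow> c \<noteq> 0 \<Longrightarrow> hasord p (\<lambda>q. c) 0"
  by (intro hasord_unit regat_const)

lemma hasord_unif: "p \<in> X \<Longrightarrow> hasord p (unif p) 1"
  unfolding hasord_def by (intro exI[of _ "\<lambda>q. 1"]) (auto intro: regat_const)

lemma hasord_in_X: "hasord p f k \<Longrightarrow> p \<in> X"
  using hasord_ordge ordge_in_X by blast

lemma hasord_power: "hasord p f k \<Longrightarrow> hasord p (\<lambda>q. f q ^ m) (int m * k)"
proof (induction m)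
  case 0
  then show ?case using hasord_const hasord_in_X by simp
next
  case (Suc m)
  then show ?case using hasord_mult[of p f k "\<lambda>q. f q ^ m" "int m * k"] by (simp add: algebra_simps)
qed

lemma hasord_powi: "hasord p f k \<Longrightarrow> hasord p (\<lambda>q. f q powi m) (m * k)"
  using hasord_power[of p f k "nat m"] hasord_power[OF hasord_inverse, of p f k "nat (- m)"]
  by (cases "m \<ge> 0") (auto simp: power_int_def)

lemma regat_ordge: "regat p f \<Longrightarrow> ordge p f 0"
  unfolding ordge_def by (intro exI[of _ f]) auto

lemma ordge_0_iff: "ordge p f 0 \<longleftrightarrow> (\<exists>u. regat p u \<and> f \<approx> u)"
  unfolding ordge_def by simp

lemma ordge_zero: "p \<in> X \<Longrightarrow> f \<approx> (\<lambda>q. 0) \<Longrightarrow> ordge p f k"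
  unfolding ordge_def by (intro exI[of _ "\<lambda>q. 0"]) (auto intro: regat_const)

lemma ordge_const: "p \<in> X \<Longrightarrow> ordge p (\<lambda>q. c) 0"
  by (intro regat_ordge regat_const)

lemma ordge_cmult: "ordge p f k \<Longrightarrow> ordge p (\<lambda>q. c * f q) k"
  using ordge_mult[OF ordge_const[OF ordge_in_X], of p f k f k c] by simp

lemma ordge_diff: "ordge p f k \<Longrightarrow> ordge p g k \<Longrightarrow> ordge p (\<lambda>q. f q - g q) k"
  using ordge_add[OF _ ordge_cmult[of p g k "-1"]] by simp

lemma ordge_sum: "p \<in> X \<Longrightarrow> (\<And>i. i \<in> I \<Longrightarrow> ordge p (f i) k) \<Longrightarrow> ordge p (\<lambda>q. \<Sum>i\<in>I. f i q) k"
  by (induction I rule: infinite_finite_induct) (auto intro: ordge_add ordge_zero)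

lemma ordge_mono:
  assumes "ordge p f l" "k \<le> l"
  shows "ordge p f k"
proof -
  have p: "p \<in> X" using ordge_in_X assms by blast
  have "ordge p (\<lambda>q. unif p q ^ nat (l - k)) 0" by (intro regat_ordge regat_power unif p)
  moreover have "ordge p (\<lambda>q. inverse (unif p q ^ nat (l - k))) (- (l - k))"
    using hasord_ordge[OF hasord_inverse[OF hasord_power[OF hasord_unif[OF p], of "nat (l - k)"]]] assms(2)
    by simp
  ultimately have "ordge p (\<lambda>q. unif p q ^ nat (l - k) * (inverse (unif p q ^ nat (l - k)) * f q)) (0 + (- (l - k) + l))"
    using assms(1) by (intro ordge_mult)
  moreover have "(\<lambda>q. unif p q ^ nat (l - k) * (inverse (unif p q ^ nat (l - k)) * f q)) \<approx> f"
    using nz_nonzero[OF unif(3)[OF p]] by eventually_elim auto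
  ultimately show ?thesis by (auto intro: ordge_cong)
qed

lemma hasord_ordge_iff:
  assumes f: "hasord p f k"
  shows "ordge p f l \<longleftrightarrow> l \<le> k"
proof
  assume "ordge p f l"
  then obtain v where v: "regat p v" "f \<approx> (\<lambda>q. v q * unif p q powi l)" unfolding ordge_def by blast
  obtain u where u: "regat p u" "u p \<noteq> 0" "f \<approx> (\<lambda>q. u q * unif p q powi k)"
    using f unfolding hasord_def by blast
  have p: "p \<in> X" using u regat_in_X by blast
  show "l \<le> k"
  proof (rule ccontr)
    assume "\<not> l \<le> k"
    then obtain m where m: "l = k + int (Suc m)" using zless_iff_Suc_zadd[of k l] by auto
    from u(3) v(2) nz_nonzero[OF unif(3)[OF p]] have "u \<approx> (\<lambda>q. v q * unif p q ^ Suc m)"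
    proof eventually_elim
      case (elim q)
      then have "u q * unif p q powi k = v q * (unif p q powi k * unif p q ^ Suc m)"
        unfolding m by (simp add: power_int_add)
      then show ?case using elim(3) by simp
    qed
    then have "u p = v p * unif p p ^ Suc m"
      by (intro regat_eq u regat_mult v regat_power unif p)
    then show False using u(2) unif(2)[OF p] by simp
  qed
qed (use hasord_ordge[OF f] ordge_mono in blast)

lemma hasord_unique: "hasord p f k \<Longrightarrow> hasord p f l \<Longrightarrow> k = l"
  using hasord_ordge_iff[of p f] hasord_ordge by (metis order_antisym order_refl)

lemma ordge_value:
  assumes "ordge p f 0"
  obtains c where "ordge p (\<lambda>q. f q - c) 1"
proof -
  obtain u where u: "regat p u" "f \<approx> u" using assms by (auto simp: ordge_0_iff)
  have p: "p \<in> X" using u regat_in_X by blast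
  obtain g where g: "regat p g" "(\<lambda>q. u q - u p) \<approx> (\<lambda>q. unif p q * g q)"
    using unif(4)[OF p regat_diff[OF u(1) regat_const[OF p]]] by auto
  from u(2) g(2) have "(\<lambda>q. f q - u p) \<approx> (\<lambda>q. g q * unif p q powi 1)"
    by eventually_elim (simp add: algebra_simps)
  then show ?thesis using that[of "u p"] g(1) unfolding ordge_def by blast
qed

text \<open>Taking \<open>f\<close> to \<open>c\<close> is a linear functional on the functions of
  order at least \<open>k\<close>, with those of order at least \<open>k + 1\<close> as its kernel.
  It will bound the growth of \<open>L(A)\<close> when a point is added to \<open>A\<close>.\<close>

lemma ordge_lead:
  assumes "ordge p f k"
  obtains c where "ordge p (\<lambda>q. f q - c * unif p q powi k) (k + 1)"
proof -
  have p: "p \<in> X" using assms ordge_in_X by blast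
  have t: "hasord p (\<lambda>q. unif p q powi m) m" for m using hasord_powi[OF hasord_unif[OF p], of m] by simp
  have "ordge p (\<lambda>q. unif p q powi (- k) * f q) 0"
    using ordge_mult[OF hasord_ordge[OF t[of "- k"]] assms] by simp
  then obtain c where c: "ordge p (\<lambda>q. unif p q powi (- k) * f q - c) 1" by (rule ordge_value)
  have "ordge p (\<lambda>q. unif p q powi k * (unif p q powi (- k) * f q - c)) (k + 1)"
    using ordge_mult[OF hasord_ordge[OF t[of k]] c] .
  moreover have "(\<lambda>q. unif p q powi k * (unif p q powi (- k) * f q - c)) \<approx> (\<lambda>q. f q - c * unif p q powi k)"
    using nz_nonzero[OF unif(3)[OF p]]
    by eventually_elim (simp add: algebra_simps power_int_minus)
  ultimately show ?thesis by (rule that[OF ordge_cong])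
qed

lemma ordge_exact:
  assumes "ordge p f k"
  shows "hasord p f k \<or> ordge p f (k + 1)"
proof -
  obtain u where u: "regat p u" "f \<approx> (\<lambda>q. u q * unif p q powi k)" using assms by (auto simp: ordge_def)
  have p: "p \<in> X" using u regat_in_X by blast
  show ?thesis
  proof (cases "u p = 0")
    case True
    then obtain g where g: "regat p g" "u \<approx> (\<lambda>q. unif p q * g q)" using unif(4)[OF p u(1)] by blast
    from u(2) g(2) nz_nonzero[OF unif(3)[OF p]] have "f \<approx> (\<lambda>q. g q * unif p q powi (k + 1))"
      by eventually_elim (simp add: power_int_add)
    then show ?thesis using g(1) unfolding ordge_def by blast
  qed (use u in \<open>auto simp: hasord_def\<close>)
qed

lemma hasord_add:
  assumes "hasord p f k" "ordge p g (k + 1)"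
  shows "hasord p (\<lambda>q. f q + g q) k"
proof -
  have "ordge p (\<lambda>q. f q + g q) k"
    using ordge_add[OF hasord_ordge[OF assms(1)] ordge_mono[OF assms(2)]] by simp
  moreover have "\<not> ordge p (\<lambda>q. f q + g q) (k + 1)"
    using ordge_diff[of p "\<lambda>q. f q + g q" "k + 1" g] assms hasord_ordge_iff[OF assms(1), of "k + 1"]
    by auto
  ultimately show ?thesis using ordge_exact by blast
qed

lemma ordge_rat: "ordge p f k \<Longrightarrow> rat f"
proof -
  assume a: "ordge p f k"
  then obtain u where u: "regat p u" "f \<approx> (\<lambda>q. u q * unif p q powi k)" unfolding ordge_def by blast
  then have "rat (\<lambda>q. u q * unif p q powi k)"
    using regat_rat rat_mult rat_powi unif(3) regat_in_X nz_def by metis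
  moreover from u(2) have "(\<lambda>q. u q * unif p q powi k) \<approx> f" by eventually_elim simp
  ultimately show ?thesis using rat_cong by blast
qed

lemma hasord_nz: "hasord p f k \<Longrightarrow> nz f"
proof -
  assume a: "hasord p f k"
  have "\<not> f \<approx> (\<lambda>q. 0)"
    using ordge_zero[OF hasord_in_X[OF a], of f "k + 1"] hasord_ordge_iff[OF a, of "k + 1"] by auto
  then show ?thesis using ordge_rat[OF hasord_ordge[OF a]] by (simp add: nz_def)
qed

end

section \<open>Existence of orders by Krull's intersection theorem\<close>

context smooth_curve
begin

text \<open>The polynomial is evaluated at the coordinate vector whose \<open>i\<close>-th entry is
  1. In this way every polynomial function, homogeneous or not, becomes regular at the points off
  the \<open>i\<close>-th coordinate hyperplane.\<close>

definition dehom :: "'n \<Rightarrow> (complex ^ 'n \<Rightarrow> complex) \<Rightarrow> 'n pt \<Rightarrow> complex" where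
  "dehom i G q = G (inverse (rep q $ i) *s rep q)"

lemma regat_dehom:
  assumes "p \<in> X" "rep p $ i \<noteq> 0"
  shows "G \<in> polyfuns UNIV \<Longrightarrow> regat p (dehom i G)"
proof (induction rule: polyfuns.induct)
  case (const c)
  then show ?case using regat_const[OF assms(1)] by (simp add: dehom_def)
next
  case (coord j)
  have "regat p (\<lambda>q. rep q $ j / rep q $ i)"
    using assms by (intro regat_ratio[of 1] hom_poly_coord) auto
  then show ?case by (simp add: dehom_def field_simps)
next
  case (add f g)
  then show ?case using regat_add by (simp add: dehom_def)
next
  case (mult f g)
  then show ?case using regat_mult by (simp add: dehom_def)
qed

lemma dehom_hom_poly: "hom_poly d P \<Longrightarrow> dehom i P q = P (rep q) / (rep q $ i) ^ d"
  by (simp add: dehom_def hom_poly_scale power_inverse field_simps)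

text \<open>The Krull intersection theorem for the local ring at \<open>p\<close>: if \<open>f = g\<^sub>k t\<^sup>k\<close> for all \<open>k\<close>, then
  the ideals generated by the \<open>g\<^sub>k\<close> increase, and once they are stationary \<open>t\<close> would be a unit.\<close>

lemma regat_hasord:
  assumes f: "regat p f" "\<not> f \<approx> (\<lambda>q. 0)"
  shows "\<exists>k. hasord p f k"
proof (rule ccontr)
  assume no: "\<not> (\<exists>k. hasord p f k)"
  have p: "p \<in> X" using f regat_in_X by blast
  define t where "t = unif p"
  note t = unif[OF p, folded t_def]
  have "ordge p f (int k)" for k
  proof (induction k)
    case 0
    show ?case using regat_ordge[OF f(1)] by simp
  next
    case (Suc k)
    then show ?case using ordge_exact[of p f "int k"] no by (auto simp: add.commute)
  qed
  then have "\<forall>k. \<exists>u. regat p u \<and> f \<approx> (\<lambda>q. u q * t q ^ k)"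
    unfolding ordge_def t_def by simp
  then obtain g where g: "\<And>k. regat p (g k)" "\<And>k. f \<approx> (\<lambda>q. g k q * t q ^ k)" by metis
  have tnz: "\<forall>\<^sub>F q in gen X. t q \<noteq> 0" by (rule nz_nonzero[OF t(3)])
  have gS: "g k \<approx> (\<lambda>q. t q * g (Suc k) q)" for k
    using g(2)[of k] g(2)[of "Suc k"] tnz by eventually_elim (auto simp: mult.commute)
  have fnz: "\<forall>\<^sub>F q in gen X. f q \<noteq> 0" by (rule rat_generic[OF regat_rat[OF f(1)] f(2)])
  have gnz: "\<forall>\<^sub>F q in gen X. g k q \<noteq> 0" for k
    using g(2)[of k] fnz by eventually_elim auto
  have "p \<in> proj_space" using p X_proj by blast
  then obtain i where i: "rep p $ i \<noteq> 0" using nonvanishing_linear_form by blast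
  \<comment> \<open>Only the polynomial ring is known to be Noetherian, so the ideal
    \<open>g_k O_p\<close> of the local ring is replaced by its inverse image under
    dehomogenization.\<close>
  define J where "J k = {G \<in> polyfuns UNIV. \<exists>h. regat p h \<and> dehom i G \<approx> (\<lambda>q. h q * g k q)}" for k
  have ideal: "ideal_of (polyfuns UNIV) (J k)" for k
    unfolding ideal_of_def
  proof (intro conjI ballI)
    show "J k \<subseteq> polyfuns UNIV" by (auto simp: J_def)
    have "dehom i 0 \<approx> (\<lambda>q. 0 * g k q)" by (simp add: dehom_def)
    then show "0 \<in> J k"
      using subring_of_simps(2)[OF subring_polyfuns[of UNIV]] regat_const[OF p, of 0]
      unfolding J_def by blast
    fix a b
    show "a + b \<in> J k" if "a \<in> J k" "b \<in> J k"
    proof -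
      from that obtain h1 h2 where h: "regat p h1" "dehom i a \<approx> (\<lambda>q. h1 q * g k q)"
        "regat p h2" "dehom i b \<approx> (\<lambda>q. h2 q * g k q)" by (auto simp: J_def)
      from h(2,4) have "dehom i (a + b) \<approx> (\<lambda>q. (h1 q + h2 q) * g k q)"
        by eventually_elim (simp add: dehom_def algebra_simps)
      moreover have "a + b \<in> polyfuns UNIV"
        using that subring_of_simps(5)[OF subring_polyfuns] unfolding J_def by blast
      ultimately show ?thesis using regat_add[OF h(1,3)] unfolding J_def by blast
    qed
    show "a * b \<in> J k" if "a \<in> polyfuns UNIV" "b \<in> J k"
    proof -
      from that obtain h where h: "regat p h" "dehom i b \<approx> (\<lambda>q. h q * g k q)" by (auto simp: J_def)
      from h(2) have "dehom i (a * b) \<approx> (\<lambda>q. (dehom i a q * h q) * g k q)"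
        by eventually_elim (simp add: dehom_def algebra_simps)
      moreover have "a * b \<in> polyfuns UNIV"
        using that subring_of_simps(6)[OF subring_polyfuns] unfolding J_def by blast
      ultimately show ?thesis
        using regat_mult[OF regat_dehom[OF p i that(1)] h(1)] unfolding J_def by blast
    qed
  qed
  have mono: "J k \<subseteq> J (Suc k)" for k
  proof
    fix G assume "G \<in> J k"
    then obtain h where h: "G \<in> polyfuns UNIV" "regat p h" "dehom i G \<approx> (\<lambda>q. h q * g k q)"
      by (auto simp: J_def)
    from h(3) gS[of k] have "dehom i G \<approx> (\<lambda>q. (h q * t q) * g (Suc k) q)"
      by eventually_elim simp
    then show "G \<in> J (Suc k)" using regat_mult[OF h(2) t(1)] h(1) unfolding J_def by blast
  qed
  obtain N where "\<forall>k\<ge>N. J k = J N"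
    using noetherian_polyfuns[of "UNIV :: 'n set", unfolded noetherian_def, THEN spec, of J]
      ideal mono by blast
  then have JN: "J (Suc N) = J N" by (rule allE[of _ "Suc N"]) (erule mp, simp)
  obtain W d P Q where W: "zopen X W" "p \<in> W" "hom_poly d P" "hom_poly d Q"
     "\<forall>q\<in>W. Q (rep q) \<noteq> 0 \<and> g (Suc N) q = P (rep q) / Q (rep q)"
    using g(1)[of "Suc N"] unfolding regat_def by blast
  have evW: "\<forall>\<^sub>F q in gen X. q \<in> W" using W by (intro eventually_zopen) auto
  have "dehom i P \<approx> (\<lambda>q. dehom i Q q * g (Suc N) q)"
    using evW by eventually_elim (use W in \<open>simp add: dehom_hom_poly\<close>)
  moreover have Qr: "regat p (dehom i Q)"
    using W by (intro regat_dehom[OF p i] hom_poly_polyfuns)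
  \<comment> \<open>The numerator of \<open>g (Suc N) = P / Q\<close> lies in
    \<open>J (Suc N) = J N\<close>, so \<open>P\<close> is a multiple of
    \<open>g N = t * g (Suc N)\<close>. Cancelling \<open>g (Suc N)\<close> makes \<open>Q\<close> a
    multiple of \<open>t\<close>, although \<open>Q\<close> does not vanish at
    \<open>p\<close>.\<close>
  ultimately have "P \<in> J (Suc N)" using hom_poly_polyfuns[OF W(3)] unfolding J_def by blast
  then have "P \<in> J N" by (simp add: JN)
  then obtain h where h: "regat p h" "dehom i P \<approx> (\<lambda>q. h q * g N q)" unfolding J_def by blast
  from \<open>dehom i P \<approx> (\<lambda>q. dehom i Q q * g (Suc N) q)\<close> h(2) gS[of N] gnz[of "Suc N"]
  have "dehom i Q \<approx> (\<lambda>q. h q * t q)"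
    by eventually_elim auto
  then have "dehom i Q p = h p * t p" by (intro regat_eq Qr regat_mult h t)
  then show False using W(2,4,5) t(2) i by (auto simp: dehom_hom_poly)
qed

lemma nz_hasord:
  assumes f: "nz f" and p: "p \<in> X"
  shows "\<exists>k. hasord p f k"
proof -
  obtain d P Q where *: "hom_poly d P" "hom_poly d Q"
    "\<forall>\<^sub>F q in gen X. Q (rep q) \<noteq> 0 \<and> f q = P (rep q) / Q (rep q)"
    using f unfolding rat_def nz_def by blast
  have "p \<in> proj_space" using p X_proj by blast
  then obtain i where i: "rep p $ i \<noteq> 0" using nonvanishing_linear_form by blast
  have reg: "regat p (dehom i P)" "regat p (dehom i Q)"
    using * by (auto intro: regat_dehom[OF p i] hom_poly_polyfuns)
  have "\<forall>\<^sub>F q in gen X. rep q $ i \<noteq> 0"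
    using eventually_basic[OF hom_poly_coord p i] .
  with *(3) nz_nonzero[OF f] have ev: "\<forall>\<^sub>F q in gen X. dehom i P q \<noteq> 0 \<and> dehom i Q q \<noteq> 0 \<and>
    f q = dehom i P q * inverse (dehom i Q q)"
    by eventually_elim (auto simp: dehom_hom_poly[OF *(1)] dehom_hom_poly[OF *(2)] field_simps)
  then have "nz (dehom i P)" "nz (dehom i Q)"
    using reg regat_rat unfolding nz_iff by (auto elim: eventually_mono)
  then obtain k l where "hasord p (dehom i P) k" "hasord p (dehom i Q) l"
    using regat_hasord reg unfolding nz_def by meson
  then have "hasord p (\<lambda>q. dehom i P q * inverse (dehom i Q q)) (k - l)"
    using hasord_mult[OF _ hasord_inverse] by fastforce
  moreover have "(\<lambda>q. dehom i P q * inverse (dehom i Q q)) \<approx> f"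
    using ev by eventually_elim simp
  ultimately show ?thesis using hasord_cong by blast
qed

definition ord :: "'n pt \<Rightarrow> ('n pt \<Rightarrow> complex) \<Rightarrow> int" where
  "ord p f = (THE k. hasord p f k)"

lemma ord_eq: "hasord p f k \<Longrightarrow> ord p f = k"
  unfolding ord_def using hasord_unique by blast

lemma hasord_ord: "nz f \<Longrightarrow> p \<in> X \<Longrightarrow> hasord p f (ord p f)"
  using nz_hasord ord_eq by blast

lemma ordge_iff: "nz f \<Longrightarrow> p \<in> X \<Longrightarrow> ordge p f k \<longleftrightarrow> k \<le> ord p f"
  using hasord_ordge_iff[OF hasord_ord] .

lemma ord_inverse: "nz f \<Longrightarrow> p \<in> X \<Longrightarrow> ord p (\<lambda>q. inverse (f q)) = - ord p f"
  by (intro ord_eq hasord_inverse hasord_ord)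

lemma ordge_mult_iff:
  assumes "hasord p g l"
  shows "ordge p (\<lambda>q. f q * g q) (k + l) \<longleftrightarrow> ordge p f k"
proof
  assume "ordge p (\<lambda>q. f q * g q) (k + l)"
  from ordge_mult[OF this hasord_ordge[OF hasord_inverse[OF assms]]]
  have "ordge p (\<lambda>q. f q * g q * inverse (g q)) k" by simp
  moreover have "(\<lambda>q. f q * g q * inverse (g q)) \<approx> f"
    using nz_nonzero[OF hasord_nz[OF assms]] by eventually_elim simp
  ultimately show "ordge p f k" using ordge_cong by blast
qed (use ordge_mult hasord_ordge[OF assms] in blast)

lemma finite_support:
  assumes f: "nz f"
  shows "finite {p \<in> X. ord p f \<noteq> 0}"
proof -
  obtain d P Q where *: "hom_poly d P" "hom_poly d Q"
    "\<forall>\<^sub>F q in gen X. Q (rep q) \<noteq> 0 \<and> f q = P (rep q) / Q (rep q)"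
    using f unfolding rat_def nz_def by blast
  from *(3) nz_nonzero[OF f] have "\<forall>\<^sub>F q in gen X. P (rep q) \<noteq> 0 \<and> Q (rep q) \<noteq> 0"
    by eventually_elim auto
  then have "finite {q \<in> X. \<not> (P (rep q) \<noteq> 0 \<and> Q (rep q) \<noteq> 0)}" by (simp only: eventually_gen)
  moreover have "{p \<in> X. ord p f \<noteq> 0} \<subseteq> {q \<in> X. \<not> (P (rep q) \<noteq> 0 \<and> Q (rep q) \<noteq> 0)}"
  proof (intro subsetI CollectI conjI)
    fix p assume p: "p \<in> {p \<in> X. ord p f \<noteq> 0}"
    then show "p \<in> X" by simp
    show "\<not> (P (rep p) \<noteq> 0 \<and> Q (rep p) \<noteq> 0)"
    proof
      assume PQ: "P (rep p) \<noteq> 0 \<and> Q (rep p) \<noteq> 0"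
      then have "hasord p (\<lambda>q. P (rep q) / Q (rep q)) 0"
        using p by (intro hasord_unit regat_ratio[OF *(1,2)]) auto
      moreover have "(\<lambda>q. P (rep q) / Q (rep q)) \<approx> f" using *(3) by eventually_elim simp
      ultimately show False using p ord_eq hasord_cong by blast
    qed
  qed
  ultimately show ?thesis by (rule rev_finite_subset)
qed

text \<open>At each point of \<open>U\<close> the value is taken from a germ that is regular there
  and agrees generically with \<open>m\<close>. Two such germs agree wherever both are regular, so
  near \<open>p\<close> all values come from one and the same germ.\<close>

lemma regular_glue:
  assumes U: "zopen X U" and m: "\<And>p. p \<in> U \<Longrightarrow> ordge p m 0"
  obtains f where "f \<in> regular X U" "\<forall>\<^sub>F q in gen U. f q = m q"
proof (cases "U = {}")
  case True
  then show ?thesis using that[of "\<lambda>p. undefined"] U by (auto simp: regular_iff gen_empty)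
next
  case False
  have "\<exists>u. regat p u \<and> m \<approx> u" if "p \<in> U" for p using m[OF that] by (simp add: ordge_0_iff)
  then obtain u where u: "\<And>p. p \<in> U \<Longrightarrow> regat p (u p)" "\<And>p. p \<in> U \<Longrightarrow> m \<approx> u p" by metis
  define f where "f = (\<lambda>p\<in>U. u p p)"
  have near: "\<exists>W. zopen X W \<and> p \<in> W \<and> (\<forall>q\<in>W. f q = u p q)" if p: "p \<in> U" for p
  proof -
    obtain W where W: "zopen X W" "p \<in> W" "\<forall>q\<in>W. regat q (u p)" using regat_open[OF u(1)[OF p]] by blast
    have "f q = u p q" if q: "q \<in> W \<inter> U" for q
    proof -
      from u(2)[OF p] u(2)[of q] q have "u q \<approx> u p" by (auto elim: eventually_elim2)
      then have "u q q = u p q" using q W u(1) by (intro regat_eq) auto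
      then show ?thesis using q by (simp add: f_def)
    qed
    then show ?thesis using W zopen_Int[OF W(1) U] p by (intro exI[of _ "W \<inter> U"]) auto
  qed
  have "regat p f" if "p \<in> U" for p
    using near[OF that] regat_local[OF u(1)[OF that]] by metis
  then have "f \<in> regular X U" using U by (auto simp: regular_iff f_def)
  moreover have "\<forall>\<^sub>F q in gen U. f q = m q"
  proof -
    obtain p where p: "p \<in> U" using False by blast
    then obtain W where W: "zopen X W" "p \<in> W" "\<forall>q\<in>W. f q = u p q" using near by blast
    then have "\<forall>\<^sub>F q in gen X. q \<in> W" by (intro eventually_zopen) auto
    with u(2)[OF p] have "f \<approx> m" by eventually_elim (use W in auto)
    then show ?thesis using gen_zopen[OF U False] by simp
  qed
  ultimately show ?thesis by (rule that)
qed

section \<open>Independence of the order from the uniformizer\<close>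

lemma uniformizer_shrink:
  assumes "uniformizer X p W t" "zopen X V" "p \<in> V" "V \<subseteq> W"
  shows "uniformizer X p V (restrict t V)"
  unfolding uniformizer_def
proof (intro conjI allI impI)
  have W: "zopen X W" "t \<in> regular X W" "t p = 0" using assms(1) by (auto simp: uniformizer_def)
  show "restrict t V \<in> regular X V" using regular_restrict[OF W(1) assms(2,4) W(2)] .
  fix W1 f
  assume a: "zopen X W1 \<and> p \<in> W1 \<and> W1 \<subseteq> V \<and> f \<in> regular X W1 \<and> f p = 0"
  then obtain W2 g where "zopen X W2 \<and> p \<in> W2 \<and> W2 \<subseteq> W1 \<and> g \<in> regular X W2 \<and> (\<forall>q\<in>W2. f q = t q * g q)"
    using assms unfolding uniformizer_def by (meson order_trans)
  then show "\<exists>W2 g. zopen X W2 \<and> p \<in> W2 \<and> W2 \<subseteq> W1 \<and> g \<in> regular X W2 \<and>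
    (\<forall>q\<in>W2. f q = restrict t V q * g q)"
    using a by (intro exI[of _ W2] exI[of _ g]) auto
qed (use assms in \<open>auto simp: uniformizer_def\<close>)

text \<open>Two uniformizers at \<open>p\<close> divide each other in the local ring, so the factors
  \<open>g\<close> and \<open>h\<close> are inverse units.\<close>

lemma hasord_uniformizer:
  assumes "uniformizer X p W t"
  shows "hasord p t 1"
proof -
  note t = uniformizer_props[OF assms]
  note v = unif[OF t(1)]
  obtain g where g: "regat p g" "t \<approx> (\<lambda>q. unif p q * g q)" using v(4)[OF t(2,3)] by blast
  obtain h where h: "regat p h" "unif p \<approx> (\<lambda>q. t q * h q)" using t(4)[OF v(1,2)] by blast
  from g(2) h(2) nz_nonzero[OF v(3)] have "(\<lambda>q. g q * h q) \<approx> (\<lambda>q. 1)"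
    by eventually_elim (auto simp: mult.commute)
  then have "g p * h p = 1" by (intro regat_eq[OF regat_mult[OF g(1) h(1)] regat_const[OF t(1)]])
  then have "hasord p (\<lambda>q. unif p q * g q) (1 + 0)"
    by (intro hasord_mult hasord_unif t hasord_unit g) auto
  moreover have "(\<lambda>q. unif p q * g q) \<approx> t" using g(2) by eventually_elim simp
  ultimately show ?thesis using hasord_cong by fastforce
qed

lemma has_order_iff:
  assumes U: "zopen X U" "U \<noteq> {}" and p: "p \<in> X"
  shows "has_order X p U h k \<longleftrightarrow> hasord p h k"
proof
  assume "has_order X p U h k"
  then obtain W t u where W: "uniformizer X p W t" "u \<in> regular X W" "u p \<noteq> 0"
    "\<forall>q \<in> W \<inter> U. t q \<noteq> 0 \<longrightarrow> h q = u q * t q powi k" unfolding has_order_def by blast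
  then have W': "zopen X W" "p \<in> W" by (auto simp: uniformizer_def)
  have "hasord p (\<lambda>q. u q * t q powi k) (0 + k * 1)"
    using W W' by (intro hasord_mult hasord_unit hasord_powi hasord_uniformizer) (auto simp: regular_iff)
  moreover have "(\<lambda>q. u q * t q powi k) \<approx> h"
  proof -
    have "W \<noteq> {}" using W'(2) by blast
    from eventually_zopen[OF W'(1) this] eventually_zopen[OF U] nz_nonzero[OF uniformizer_nz[OF W(1)]]
    show ?thesis by eventually_elim (use W(4) in simp)
  qed
  ultimately show "hasord p h k" using hasord_cong by fastforce
next
  assume "hasord p h k"
  then obtain u where u: "regat p u" "u p \<noteq> 0" "h \<approx> (\<lambda>q. u q * unif p q powi k)" unfolding hasord_def by blast
  obtain W where W: "uniformizer X p W (unif p)" using uniformizer_unif[OF p] by blast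
  then have W': "zopen X W" "p \<in> W" by (auto simp: uniformizer_def)
  obtain V where V: "zopen X V" "p \<in> V" "\<forall>q\<in>V. regat q u" using regat_open[OF u(1)] by blast
  \<comment> \<open>The identity for \<open>h\<close> fails at finitely many points only, and these
    are removed. The point \<open>p\<close> itself may stay, because \<open>has_order\<close> tests
    only points where the uniformizer is nonzero.\<close>
  define F where "F = {q \<in> X. h q \<noteq> u q * unif p q powi k} - {p}"
  have F: "finite F" using u(3) by (simp add: F_def eventually_gen)
  define S where "S = (W \<inter> V) - F"
  have S: "zopen X S" "p \<in> S" "S \<subseteq> W" "S \<subseteq> V"
    using W' V F zopen_diff_finite[OF zopen_Int[OF W'(1) V(1)] F] by (auto simp: S_def F_def)
  have "uniformizer X p S (restrict (unif p) S)" by (rule uniformizer_shrink[OF W S(1-3)])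
  moreover have "restrict u S \<in> regular X S" using V S by (auto simp: regular_iff regat_restrict)
  moreover have "restrict u S p \<noteq> 0" using u S by simp
  moreover have "\<forall>q\<in>S \<inter> U. restrict (unif p) S q \<noteq> 0 \<longrightarrow>
    h q = restrict u S q * restrict (unif p) S q powi k"
  proof (intro ballI impI)
    fix q assume q: "q \<in> S \<inter> U" "restrict (unif p) S q \<noteq> 0"
    then have "q \<noteq> p" using unif(2)[OF p] by auto
    moreover have "q \<in> X" using q zopen_subset[OF S(1)] by auto
    ultimately show "h q = restrict u S q * restrict (unif p) S q powi k"
      using q by (auto simp: S_def F_def)
  qed
  ultimately show "has_order X p U h k" unfolding has_order_def by blast
qed

end

section \<open>Principal divisors have degree zero\<close>

context smooth_curve
begin

text \<open>A dimension bound for a space of rational functions modulo generic equality. It is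
  stated as the dependence of any \<open>N + 1\<close> elements, so that no quotient space has to be
  formed.\<close>

definition dimle :: "(('n pt \<Rightarrow> complex) \<Rightarrow> bool) \<Rightarrow> nat \<Rightarrow> bool" where
  "dimle S N \<longleftrightarrow> (\<forall>w. (\<forall>i\<le>N. S (w i)) \<longrightarrow>
     (\<exists>c. (\<exists>i\<le>N. c i \<noteq> 0) \<and> (\<lambda>q. \<Sum>i\<le>N. c i * w i q) \<approx> (\<lambda>q. 0)))"

definition Ldiv :: "('n pt \<Rightarrow> int) \<Rightarrow> ('n pt \<Rightarrow> complex) \<Rightarrow> bool" where
  "Ldiv A f \<longleftrightarrow> (\<forall>p\<in>X. ordge p f (- A p))"

definition finsupp :: "('n pt \<Rightarrow> int) \<Rightarrow> bool" where
  "finsupp A \<longleftrightarrow> finite {p \<in> X. A p \<noteq> 0}"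

definition deg :: "('n pt \<Rightarrow> int) \<Rightarrow> int" where
  "deg A = (\<Sum>p | p \<in> X \<and> A p \<noteq> 0. A p)"

lemma deg_eq: "finite F \<Longrightarrow> F \<subseteq> X \<Longrightarrow> (\<And>p. p \<in> X \<Longrightarrow> p \<notin> F \<Longrightarrow> A p = 0) \<Longrightarrow> deg A = (\<Sum>p\<in>F. A p)"
  unfolding deg_def by (rule sum.mono_neutral_left) auto

lemma deg_cong: "(\<And>p. p \<in> X \<Longrightarrow> A p = B p) \<Longrightarrow> deg A = deg B"
  unfolding deg_def by (rule sum.cong) auto

lemma finsupp_add: "finsupp A \<Longrightarrow> finsupp B \<Longrightarrow> finsupp (\<lambda>p. A p + B p)"
  and deg_add: "finsupp A \<Longrightarrow> finsupp B \<Longrightarrow> deg (\<lambda>p. A p + B p) = deg A + deg B"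
proof -
  assume AB: "finsupp A" "finsupp B"
  define F where "F = {p \<in> X. A p \<noteq> 0} \<union> {p \<in> X. B p \<noteq> 0}"
  have F: "finite F" "F \<subseteq> X" using AB by (auto simp: F_def finsupp_def)
  show "finsupp (\<lambda>p. A p + B p)" unfolding finsupp_def
    by (rule finite_subset[OF _ F(1)]) (auto simp: F_def)
  show "deg (\<lambda>p. A p + B p) = deg A + deg B"
    using deg_eq[OF F, of A] deg_eq[OF F, of B] deg_eq[OF F, of "\<lambda>p. A p + B p"]
    by (auto simp: F_def sum.distrib)
qed

lemma finsupp_cmult: "finsupp A \<Longrightarrow> finsupp (\<lambda>p. k * A p)"
  unfolding finsupp_def by (rule rev_finite_subset) auto

lemma deg_cmult: "deg (\<lambda>p. k * A p) = k * deg A"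
  by (cases "k = 0") (auto simp: deg_def sum_distrib_left)

lemma finsupp_sum: "finite I \<Longrightarrow> (\<And>i. i \<in> I \<Longrightarrow> finsupp (A i)) \<Longrightarrow> finsupp (\<lambda>p. \<Sum>i\<in>I. A i p)"
  by (induction I rule: finite_induct) (auto intro: finsupp_add simp: finsupp_def[of "\<lambda>p. 0"])

lemma finsupp_ord: "nz f \<Longrightarrow> finsupp (\<lambda>p. ord p f)"
  unfolding finsupp_def by (rule finite_support)

lemma deg_mono:
  assumes "finsupp A" "finsupp B" "\<And>p. p \<in> X \<Longrightarrow> A p \<le> B p"
  shows "deg A \<le> deg B"
proof -
  define F where "F = {p \<in> X. A p \<noteq> 0} \<union> {p \<in> X. B p \<noteq> 0}"
  have F: "finite F" "F \<subseteq> X" using assms by (auto simp: F_def finsupp_def)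
  then show ?thesis
    using deg_eq[OF F, of A] deg_eq[OF F, of B] assms(3) by (auto simp: F_def intro!: sum_mono)
qed

lemma deg_nonneg: "(\<And>p. p \<in> X \<Longrightarrow> 0 \<le> A p) \<Longrightarrow> 0 \<le> deg A"
  unfolding deg_def by (rule sum_nonneg) auto

lemma deg_pos:
  assumes "finsupp A" "\<And>p. p \<in> X \<Longrightarrow> 0 \<le> A p" "p \<in> X" "A p > 0"
  shows "A p \<le> deg A"
  using assms unfolding deg_def finsupp_def by (intro member_le_sum) auto

lemma dimle_family:
  assumes "dimle S N" "finite I" "card I > N" "\<And>i. i \<in> I \<Longrightarrow> S (w i)"
  shows "\<exists>c. (\<exists>i\<in>I. c i \<noteq> 0) \<and> (\<lambda>q. \<Sum>i\<in>I. c i * w i q) \<approx> (\<lambda>q. 0)"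
proof -
  obtain J where J: "J \<subseteq> I" "card J = Suc N" "finite J"
    using obtain_subset_with_card_n[of "Suc N" I] assms(3) by auto
  then obtain h where h: "bij_betw h {..N} J"
    using bij_betw_iff_card[of "{..N}" J] by auto
  have "\<forall>i\<le>N. S (w (h i))" using h J assms(4) by (auto simp: bij_betw_def)
  then obtain c where c: "\<exists>i\<le>N. c i \<noteq> 0" "(\<lambda>q. \<Sum>i\<le>N. c i * w (h i) q) \<approx> (\<lambda>q. 0)"
    using assms(1)[unfolded dimle_def, THEN spec, of "\<lambda>i. w (h i)"] by blast
  define d where "d j = (if j \<in> J then c (the_inv_into {..N} h j) else 0)" for j
  have dh: "d (h i) = c i" if "i \<le> N" for i
    using that h the_inv_into_f_f[of h "{..N}" i] by (auto simp: d_def bij_betw_def)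
  have eq: "(\<Sum>i\<in>I. d i * w i q) = (\<Sum>i\<le>N. c i * w (h i) q)" for q
  proof -
    have "(\<Sum>i\<in>I. d i * w i q) = (\<Sum>j\<in>J. d j * w j q)"
      using J assms(2) by (intro sum.mono_neutral_right) (auto simp: d_def)
    also have "\<dots> = (\<Sum>i\<le>N. d (h i) * w (h i) q)"
      using sum.reindex_bij_betw[OF h, of "\<lambda>j. d j * w j q"] by simp
    also have "\<dots> = (\<Sum>i\<le>N. c i * w (h i) q)" by (intro sum.cong) (auto simp: dh)
    finally show ?thesis .
  qed
  obtain i where "i \<le> N" "c i \<noteq> 0" using c by blast
  then have "h i \<in> I" "d (h i) \<noteq> 0" using dh h J by (auto simp: bij_betw_def)
  then show ?thesis using c(2) eq by (intro exI[of _ d]) auto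
qed

text \<open>The kernel of a linear functional has codimension at most one: an element with nonzero
  value pushes all the others into the kernel. The functional \<open>l\<close> is a relation,
  because its value is only known to exist.\<close>

lemma dimle_step:
  assumes S': "dimle S' N"
    and lin: "\<And>f g c. S f \<Longrightarrow> S g \<Longrightarrow> S (\<lambda>q. f q - c * g q)"
    and ex: "\<And>f. S f \<Longrightarrow> \<exists>a. l f a"
    and diff: "\<And>f g a b c. l f a \<Longrightarrow> l g b \<Longrightarrow> l (\<lambda>q. f q - c * g q) (a - c * b)"
    and ker: "\<And>f. S f \<Longrightarrow> l f 0 \<Longrightarrow> S' f"
  shows "dimle S (Suc N)"
  unfolding dimle_def
proof (intro allI impI)
  fix w assume w: "\<forall>i\<le>Suc N. S (w i)"
  then have "\<forall>i. \<exists>a. i \<le> Suc N \<longrightarrow> l (w i) a" using ex by blast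
  then obtain a where a: "\<And>i. i \<le> Suc N \<Longrightarrow> l (w i) (a i)" by metis
  have "\<exists>c. (\<exists>i\<in>{..Suc N}. c i \<noteq> 0) \<and> (\<lambda>q. \<Sum>i\<in>{..Suc N}. c i * w i q) \<approx> (\<lambda>q. 0)"
  proof (cases "\<exists>j\<le>Suc N. a j \<noteq> 0")
    case False
    then have "S' (w i)" if "i \<in> {..Suc N}" for i using that a[of i] w ker[of "w i"] by auto
    then show ?thesis by (intro dimle_family[OF S']) auto
  next
    case True
    then obtain j where j: "j \<le> Suc N" "a j \<noteq> 0" by blast
    define I where "I = {..Suc N} - {j}"
    define v where "v i = (\<lambda>q. w i q - (a i / a j) * w j q)" for i
    have "S' (v i)" if "i \<in> I" for i
    proof (rule ker)
      show "S (v i)" unfolding v_def using that w j by (intro lin) (auto simp: I_def)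
      have "l (v i) (a i - (a i / a j) * a j)"
        unfolding v_def using that j a by (intro diff) (auto simp: I_def)
      then show "l (v i) 0" using j by simp
    qed
    moreover have "card I > N" using j by (simp add: I_def)
    ultimately obtain c where c: "\<exists>i\<in>I. c i \<noteq> 0" "(\<lambda>q. \<Sum>i\<in>I. c i * v i q) \<approx> (\<lambda>q. 0)"
      using dimle_family[OF S', of I v] by (auto simp: I_def)
    define d where "d i = (if i = j then - (\<Sum>i\<in>I. c i * (a i / a j)) else c i)" for i
    have "(\<Sum>i\<in>{..Suc N}. d i * w i q) = (\<Sum>i\<in>I. c i * v i q)" for q
    proof -
      have "(\<Sum>i\<in>{..Suc N}. d i * w i q) = d j * w j q + (\<Sum>i\<in>I. d i * w i q)"
        unfolding I_def using j by (intro sum.remove) auto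
      also have "(\<Sum>i\<in>I. d i * w i q) = (\<Sum>i\<in>I. c i * w i q)"
        by (intro sum.cong) (auto simp: d_def I_def)
      also have "d j * w j q + \<dots> = (\<Sum>i\<in>I. c i * v i q)"
        by (simp add: d_def v_def algebra_simps sum_subtractf sum_distrib_left sum_distrib_right)
      finally show ?thesis .
    qed
    moreover have "\<exists>i\<in>{..Suc N}. d i \<noteq> 0" using c(1) by (auto simp: d_def I_def)
    ultimately show ?thesis using c(2) by (intro exI[of _ d]) auto
  qed
  then show "\<exists>c. (\<exists>i\<le>Suc N. c i \<noteq> 0) \<and> (\<lambda>q. \<Sum>i\<le>Suc N. c i * w i q) \<approx> (\<lambda>q. 0)" by auto
qed

text \<open>Points are taken off \<open>A\<close> one at a time. Removing \<open>p\<close> costs at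
  most one dimension, since the coefficient of \<open>t^(- A p)\<close> at \<open>p\<close> is a
  linear functional on \<open>L(A)\<close> with kernel \<open>L(A - p)\<close>.\<close>

lemma dimle_Ldiv:
  assumes "dimle (Ldiv (\<lambda>p. 0)) N"
  shows "finsupp A \<Longrightarrow> (\<And>p. p \<in> X \<Longrightarrow> 0 \<le> A p) \<Longrightarrow> deg A = int k \<Longrightarrow> dimle (Ldiv A) (N + k)"
proof (induction k arbitrary: A)
  case 0
  have "A p = 0" if "p \<in> X" for p using deg_pos[OF 0(1,2) that] 0(2)[OF that] 0(3) by force
  then have "Ldiv A = Ldiv (\<lambda>p. 0)" by (auto simp: Ldiv_def fun_eq_iff)
  then show ?case using assms by simp
next
  case (Suc k)
  have "\<exists>p\<in>X. A p \<noteq> 0"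
  proof (rule ccontr)
    assume "\<not> ?thesis"
    then have "deg A = deg (\<lambda>p. 0)" by (intro deg_cong) auto
    then show False using Suc.prems(3) by (simp add: deg_def)
  qed
  then obtain p where p: "p \<in> X" "A p > 0" using Suc.prems(2) by force
  define D where "D = (\<lambda>q. if q = p then - 1 else 0 :: int)"
  have D: "finsupp D" "deg D = - 1"
    using deg_eq[of "{p}" D] p by (auto simp: finsupp_def D_def)
  define A' where "A' = (\<lambda>q. A q + D q)"
  have A': "finsupp A'" "deg A' = int k"
    unfolding A'_def using finsupp_add[OF Suc.prems(1) D(1)] deg_add[OF Suc.prems(1) D(1)] D Suc.prems
    by auto
  have "dimle (Ldiv A') (N + k)"
    using Suc.prems(2) p by (intro Suc.IH A') (auto simp: A'_def D_def)
  then have "dimle (Ldiv A) (Suc (N + k))"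
  proof (rule dimle_step[where l = "\<lambda>f c. ordge p (\<lambda>q. f q - c * unif p q powi (- A p)) (- A p + 1)"])
    show "Ldiv A (\<lambda>q. f q - c * g q)" if "Ldiv A f" "Ldiv A g" for f g c
      using that ordge_diff ordge_cmult by (auto simp: Ldiv_def)
    show "\<exists>a. ordge p (\<lambda>q. f q - a * unif p q powi (- A p)) (- A p + 1)" if "Ldiv A f" for f
      using that p ordge_lead[of p f "- A p"] unfolding Ldiv_def by metis
    show "ordge p (\<lambda>q. f q - c * g q - (a - c * b) * unif p q powi (- A p)) (- A p + 1)"
      if "ordge p (\<lambda>q. f q - a * unif p q powi (- A p)) (- A p + 1)"
        "ordge p (\<lambda>q. g q - b * unif p q powi (- A p)) (- A p + 1)" for f g a b c
      using ordge_diff[OF that(1) ordge_cmult[OF that(2), of c]]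
      by (simp add: algebra_simps)
    show "Ldiv A' f" if "Ldiv A f" "ordge p (\<lambda>q. f q - 0 * unif p q powi (- A p)) (- A p + 1)" for f
      using that by (auto simp: Ldiv_def A'_def D_def)
  qed
  then show ?case by simp
qed

section \<open>Weak approximation at finitely many points\<close>

lemma linear_form_avoiding:
  "finite E \<Longrightarrow> E \<subseteq> proj_space \<Longrightarrow> \<exists>m. hom_poly 1 m \<and> (\<forall>p\<in>E. m (rep p) \<noteq> 0)"
proof (induction E rule: finite_induct)
  case empty
  show ?case using hom_poly_coord by blast
next
  case (insert p E)
  then obtain m where m: "hom_poly 1 m" "\<forall>p\<in>E. m (rep p) \<noteq> 0" by blast
  show ?case
  proof (cases "m (rep p) = 0")
    case True
    obtain i where i: "rep p $ i \<noteq> 0" using insert nonvanishing_linear_form by blast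
    have "finite (insert 0 ((\<lambda>q. - m (rep q) / rep q $ i) ` E))" using insert by auto
    then obtain c where c: "c \<notin> insert 0 ((\<lambda>q. - m (rep q) / rep q $ i) ` E)"
      using ex_new_if_finite[OF infinite_UNIV_char_0] by blast
    have "m (rep q) + c * rep q $ i \<noteq> 0" if q: "q \<in> E" for q
    proof
      assume 0: "m (rep q) + c * rep q $ i = 0"
      moreover have "rep q $ i \<noteq> 0" using 0 m(2) q by auto
      ultimately have "c = - m (rep q) / rep q $ i" by (simp add: field_simps eq_neg_iff_add_eq_0 add.commute)
      then show False using c q by blast
    qed
    moreover have "hom_poly 1 (\<lambda>v. m v + c * v $ i)"
      by (intro hom_poly.add m hom_poly_smult hom_poly_coord)
    ultimately show ?thesis using True i c by (intro exI[of _ "\<lambda>v. m v + c * v $ i"]) auto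
  qed (use m in auto)
qed

text \<open>A product of quotients \<open>l / m\<close> of linear forms, one for each point of
  \<open>E\<close> other than \<open>p\<close>: the form \<open>m\<close> avoids all of
  \<open>E\<close>, and \<open>l\<close> vanishes at the given point but not at
  \<open>p\<close>.\<close>

lemma separating_function:
  assumes "finite E" "E \<subseteq> X" "p \<in> E"
  shows "\<exists>h. hasord p h 0 \<and> (\<forall>q\<in>E - {p}. ordge q h 1)"
proof -
  have EX: "E \<subseteq> proj_space" using assms(2) X_proj by blast
  obtain m where m: "hom_poly 1 m" "\<forall>p\<in>E. m (rep p) \<noteq> 0"
    using linear_form_avoiding[OF assms(1) EX] by blast
  have "\<exists>h. hasord p h 0 \<and> (\<forall>q\<in>E. ordge q h 0) \<and> (\<forall>q\<in>F. ordge q h 1)"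
    if "finite F" "F \<subseteq> E - {p}" for F
    using that
  proof (induction F rule: finite_induct)
    case empty
    then show ?case using assms by (intro exI[of _ "\<lambda>q. 1"]) (auto intro: hasord_const ordge_const)
  next
    case (insert r F)
    then obtain h where h: "hasord p h 0" "\<forall>q\<in>E. ordge q h 0" "\<forall>q\<in>F. ordge q h 1" by blast
    have "r \<in> proj_space" "p \<in> proj_space" "r \<noteq> p" using insert assms EX by auto
    then obtain l where l: "hom_poly 1 l" "l (rep r) = 0" "l (rep p) \<noteq> 0"
      using separating_linear_form by metis
    define f where "f = (\<lambda>q. l (rep q) / m (rep q))"
    have reg: "regat q f" if "q \<in> E" for q
      unfolding f_def using that m l assms by (intro regat_ratio[of 1]) auto
    have p: "hasord p f 0" using reg assms l m by (intro hasord_unit) (auto simp: f_def)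
    have r: "ordge r f 1"
    proof -
      have rE: "r \<in> E" "r \<in> X" using insert assms by auto
      obtain g where "regat r g" "f \<approx> (\<lambda>q. unif r q * g q)"
        using unif(4)[OF rE(2) reg[OF rE(1)]] l by (auto simp: f_def)
      then show ?thesis unfolding ordge_def by (intro exI[of _ g]) (auto simp: mult.commute)
    qed
    have "hasord p (\<lambda>q. f q * h q) 0" using hasord_mult[OF p h(1)] by simp
    moreover have "ordge q (\<lambda>q. f q * h q) 0" if "q \<in> E" for q
      using ordge_mult[OF regat_ordge[OF reg[OF that]]] h that by fastforce
    moreover have "ordge q (\<lambda>q. f q * h q) 1" if q: "q \<in> insert r F" for q
    proof -
      have "q \<in> E" using q insert by auto
      then show ?thesis
        using q ordge_mult[OF r, of h 0] ordge_mult[OF regat_ordge[OF reg[of q]], of h 1] h by auto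
    qed
    ultimately show ?case by (intro exI[of _ "\<lambda>q. f q * h q"]) blast
  qed
  from this[of "E - {p}"] show ?thesis using assms by auto
qed

text \<open>A power of the uniformizer at \<open>p\<close> has the right order there but may have
  poles at the other points of \<open>E\<close>. A high power of a function that is a unit at
  \<open>p\<close> and vanishes at those points repairs this.\<close>

lemma approximation:
  assumes "finite E" "E \<subseteq> X" "p \<in> E"
  shows "\<exists>u. hasord p u j \<and> (\<forall>q\<in>E - {p}. ordge q u N)"
proof -
  obtain h where h: "hasord p h 0" "\<forall>q\<in>E - {p}. ordge q h 1"
    using separating_function[OF assms] by blast
  have p: "p \<in> X" using assms by auto
  define v where "v = (\<lambda>q. unif p q powi j)"
  have v: "hasord p v j" using hasord_powi[OF hasord_unif[OF p], of j] by (simp add: v_def)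
  define M where "M = nat (\<Sum>q\<in>E. \<bar>N - ord q v\<bar>)"
  have "hasord p (\<lambda>q. v q * h q ^ M) j"
    using hasord_mult[OF v hasord_power[OF h(1), of M]] by simp
  moreover have "ordge q (\<lambda>q. v q * h q ^ M) N" if q: "q \<in> E - {p}" for q
  proof -
    have "ordge q (\<lambda>q. h q ^ k) (int k)" for k
    proof (induction k)
      case 0
      then show ?case using ordge_const assms(2) q by auto
    next
      case (Suc k)
      show ?case using ordge_mult[of q h 1 "\<lambda>q. h q ^ k" "int k"] Suc h(2) q by simp
    qed
    then have "ordge q (\<lambda>q. v q * h q ^ M) (ord q v + int M)"
      using hasord_ordge[OF hasord_ord[OF hasord_nz[OF v], of q]] assms(2) q
      by (intro ordge_mult) auto
    moreover have "N \<le> ord q v + int M"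
    proof -
      have "\<bar>N - ord q v\<bar> \<le> (\<Sum>q\<in>E. \<bar>N - ord q v\<bar>)" using q assms(1) by (intro member_le_sum) auto
      then show ?thesis by (simp add: M_def)
    qed
    ultimately show ?thesis by (rule ordge_mono)
  qed
  ultimately show ?thesis by blast
qed

end

text \<open>The assumption stands in for completeness: globally regular functions form a
  finite-dimensional space. It is derived in \<open>proper_of_sections\<close> from a line bundle
  whose space of sections is finite-dimensional and nonzero.\<close>

locale proper_curve = smooth_curve +
  assumes finite_constants: "\<exists>N. dimle (Ldiv (\<lambda>p. 0)) N"
begin

text \<open>If \<open>f\<close> has \<open>B\<close> poles, there are \<open>B\<close> rational functions that are linearly independent over
  \<open>\<complex>(f)\<close>. Multiplying them by \<open>f\<^sup>-\<^sup>i\<close> for \<open>i \<le> l\<close> gives \<open>(l + 1) B\<close> independent elements of a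
  space of dimension \<open>l Z + O(1)\<close>, where \<open>Z\<close> is the number of zeros of \<open>f\<close>.\<close>

lemma poles_le_zeros:
  assumes f: "nz f"
  shows "deg (\<lambda>p. max 0 (- ord p f)) \<le> deg (\<lambda>p. max 0 (ord p f))"
proof -
  define E where "E = {p \<in> X. ord p f < 0}"
  define e where "e p = nat (- ord p f)" for p
  define Z where "Z = (\<lambda>p. max 0 (ord p f))"
  have E: "finite E" "E \<subseteq> X" using finite_support[OF f] by (auto simp: E_def intro: rev_finite_subset)
  define N where "N = (\<Sum>p\<in>E. e p)"
  have eN: "e p \<le> N" if "p \<in> E" for p unfolding N_def using E that by (intro member_le_sum) auto
  have "\<forall>p. \<forall>j. \<exists>u. p \<in> E \<longrightarrow> hasord p u (int j) \<and> (\<forall>q\<in>E - {p}. ordge q u (int N))"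
    using approximation[OF E] by blast
  \<comment> \<open>At a pole \<open>p\<close> of order \<open>e p\<close> the functions
    \<open>u p j\<close> with \<open>j < e p\<close> realize the orders
    \<open>0, ..., e p - 1\<close>; at the other poles they vanish to order at least
    \<open>N\<close>, which is larger than any of these.\<close>
  then obtain u where u: "\<And>p j. p \<in> E \<Longrightarrow> hasord p (u p j) (int j)"
    "\<And>p j q. p \<in> E \<Longrightarrow> q \<in> E - {p} \<Longrightarrow> ordge q (u p j) (int N)" by metis
  define I where "I = Sigma E (\<lambda>p. {..<e p})"
  have I: "finite I" "card I = N" using E by (auto simp: I_def N_def)
  have B: "deg (\<lambda>p. max 0 (- ord p f)) = int N"
  proof -
    have "deg (\<lambda>p. max 0 (- ord p f)) = (\<Sum>p\<in>E. max 0 (- ord p f))"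
      using E by (intro deg_eq) (auto simp: E_def)
    also have "\<dots> = (\<Sum>p\<in>E. int (e p))" by (intro sum.cong) (auto simp: E_def e_def)
    finally show ?thesis by (simp add: N_def)
  qed
  have Z: "finsupp Z" using finite_support[OF f]
    unfolding finsupp_def by (rule rev_finite_subset) (auto simp: Z_def)
  define C where "C = (\<lambda>q. \<Sum>(p, j)\<in>I. max 0 (- ord q (u p j)))"
  have unz: "nz (u p j)" if "(p, j) \<in> I" for p j
    using hasord_nz[OF u(1)] that by (simp add: I_def)
  have C: "finsupp C"
    unfolding C_def case_prod_beta
  proof (rule finsupp_sum[OF I(1)])
    fix i assume "i \<in> I"
    then have "nz (u (fst i) (snd i))" using unz[of "fst i" "snd i"] by simp
    from finite_support[OF this] show "finsupp (\<lambda>q. max 0 (- ord q (u (fst i) (snd i))))"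
      unfolding finsupp_def by (rule rev_finite_subset) auto
  qed
  have C0: "0 \<le> C q" for q unfolding C_def by (auto intro: sum_nonneg)
  have Cu: "- C q \<le> ord q (u p j)" if "(p, j) \<in> I" for p j q
  proof -
    have "max 0 (- ord q (u p j)) \<le> C q"
      unfolding C_def using member_le_sum[OF that, of "\<lambda>(p, j). max 0 (- ord q (u p j))"] I(1) by auto
    then show ?thesis by simp
  qed
  \<comment> \<open>Passing to the inverse turns the poles of \<open>f\<close> into zeros, so that
    the powers of \<open>x\<close> are told apart by their orders at the points of \<open>E\<close>,
    while their own poles are counted by \<open>Z\<close>.\<close>
  define x where "x = (\<lambda>q. inverse (f q))"
  have x: "hasord q x (- ord q f)" if "q \<in> X" for q
    unfolding x_def using that f by (intro hasord_inverse hasord_ord)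
  define w where "w = (\<lambda>(i, p, j) q. x q ^ i * u p j q)"
  have wL: "Ldiv (\<lambda>q. int l * Z q + C q) (w k)" if k: "k \<in> {..l} \<times> I" for k l
  proof -
    obtain i p j where k: "k = (i, p, j)" "i \<le> l" "(p, j) \<in> I" using k by auto
    have "ordge q (\<lambda>q. x q ^ i * u p j q) (- (int l * Z q + C q))" if q: "q \<in> X" for q
    proof -
      have "ordge q (\<lambda>q. x q ^ i * u p j q) (int i * (- ord q f) + ord q (u p j))"
        using unz[OF k(3)] q x by (intro hasord_ordge hasord_mult hasord_power hasord_ord)
      moreover have "int i * ord q f \<le> int i * Z q" by (intro mult_left_mono) (auto simp: Z_def)
      moreover have "int i * Z q \<le> int l * Z q"
        using k(2) by (intro mult_right_mono) (auto simp: Z_def)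
      ultimately show ?thesis using Cu[OF k(3), of q] by (elim ordge_mono) auto
    qed
    then show ?thesis by (auto simp: Ldiv_def w_def k)
  qed
  have indep: "\<not> (\<lambda>q. \<Sum>k\<in>{..l} \<times> I. c k * w k q) \<approx> (\<lambda>q. 0)" if ex: "\<exists>k\<in>{..l} \<times> I. c k \<noteq> 0" for c l
  proof
    assume eq0: "(\<lambda>q. \<Sum>k\<in>{..l} \<times> I. c k * w k q) \<approx> (\<lambda>q. 0)"
    \<comment> \<open>At a pole \<open>p\<close> the function \<open>x^i * u p j\<close> has order
      \<open>i * e p + j\<close> with \<open>j < e p\<close>. The least \<open>i\<close>, and for it
      the least \<open>j\<close>, with a nonzero coefficient single out a pole at which one term has
      strictly smaller order than the sum of all the others.\<close>
    define P where "P i \<longleftrightarrow> (\<exists>p j. i \<le> l \<and> (p, j) \<in> I \<and> c (i, p, j) \<noteq> 0)" for i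
    define i0 where "i0 = (LEAST i. P i)"
    have Pex: "\<exists>i. P i" using ex by (auto simp: P_def)
    have Pi0: "P i0" unfolding i0_def by (rule LeastI_ex[OF Pex])
    have i0_min: "i0 \<le> i" if "P i" for i using that unfolding i0_def by (rule Least_le)
    define R where "R j \<longleftrightarrow> (\<exists>p. (p, j) \<in> I \<and> c (i0, p, j) \<noteq> 0)" for j
    define j0 where "j0 = (LEAST j. R j)"
    have Rex: "\<exists>j. R j" using Pi0 by (auto simp: P_def R_def)
    have Rj0: "R j0" unfolding j0_def by (rule LeastI_ex[OF Rex])
    have j0_min: "j0 \<le> j" if "R j" for j using that unfolding j0_def by (rule Least_le)
    obtain p where p: "(p, j0) \<in> I" "c (i0, p, j0) \<noteq> 0" using Rj0 by (auto simp: R_def)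
    have pE: "p \<in> E" "j0 < e p" "p \<in> X" using p E by (auto simp: I_def)
    define k0 where "k0 = (i0, p, j0)"
    have k0: "k0 \<in> {..l} \<times> I" using p Pi0 by (auto simp: k0_def P_def)
    define K where "K = {..l} \<times> I"
    have K: "finite K" using I by (simp add: K_def)
    have xp: "hasord p (\<lambda>q. x q ^ i) (int i * int (e p))" for i
      using hasord_power[OF x[OF pE(3)], of i] pE by (simp add: e_def E_def)
    have main: "hasord p (\<lambda>q. c k0 * w k0 q) (int i0 * int (e p) + int j0)"
    proof -
      have "hasord p (\<lambda>q. c k0 * (x q ^ i0 * u p j0 q)) (0 + (int i0 * int (e p) + int j0))"
        using p pE by (intro hasord_mult hasord_const xp u) (auto simp: k0_def)
      then show ?thesis by (simp add: w_def k0_def)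
    qed
    have rest: "ordge p (\<lambda>q. c k * w k q) (int i0 * int (e p) + int j0 + 1)" if k: "k \<in> K - {k0}" for k
    proof (cases "c k = 0")
      case True
      then show ?thesis using pE by (intro ordge_zero) auto
    next
      case False
      obtain i r j where kk: "k = (i, r, j)" "i \<le> l" "(r, j) \<in> I" using k by (auto simp: K_def)
      have r: "r \<in> E" using kk by (auto simp: I_def)
      have "i0 \<le> i" using False kk by (intro i0_min) (auto simp: P_def)
      have uN: "ordge p (u r j) (if r = p then int j else int N)" using u r pE hasord_ordge by auto
      have "ordge p (\<lambda>q. c k * (x q ^ i * u r j q)) (0 + (int i * int (e p) + (if r = p then int j else int N)))"
        using pE by (intro ordge_mult ordge_const hasord_ordge[OF xp] uN)
      moreover have "int i0 * int (e p) + int j0 + 1 \<le> 0 + (int i * int (e p) + (if r = p then int j else int N))"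
      proof (cases "i = i0")
        case True
        show ?thesis
        proof (cases "r = p")
          case rp: True
          have "j0 \<le> j" using False kk \<open>i = i0\<close> by (intro j0_min) (auto simp: R_def)
          moreover have "j \<noteq> j0" using k kk rp \<open>i = i0\<close> by (auto simp: k0_def)
          ultimately show ?thesis using rp \<open>i = i0\<close> by simp
        next
          case False
          then show ?thesis using eN[OF pE(1)] pE(2) \<open>i = i0\<close> by simp
        qed
      next
        case False
        then have "Suc i0 \<le> i" using \<open>i0 \<le> i\<close> by simp
        then have "int (Suc i0) * int (e p) \<le> int i * int (e p)" by (intro mult_right_mono) auto
        then show ?thesis using pE(2) by (auto simp: algebra_simps)
      qed
      ultimately have "ordge p (\<lambda>q. c k * (x q ^ i * u r j q)) (int i0 * int (e p) + int j0 + 1)"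
        by (rule ordge_mono)
      then show ?thesis by (simp add: w_def kk)
    qed
    have "ordge p (\<lambda>q. \<Sum>k\<in>K - {k0}. c k * w k q) (int i0 * int (e p) + int j0 + 1)"
      by (intro ordge_sum pE rest)
    from hasord_add[OF main this]
    have "nz (\<lambda>q. c k0 * w k0 q + (\<Sum>k\<in>K - {k0}. c k * w k q))" by (rule hasord_nz)
    moreover have "(\<lambda>q. c k0 * w k0 q + (\<Sum>k\<in>K - {k0}. c k * w k q)) = (\<lambda>q. \<Sum>k\<in>K. c k * w k q)"
      using sum.remove[OF K k0[folded K_def], of "\<lambda>k. c k * w k q" for q] by auto
    ultimately have "nz (\<lambda>q. \<Sum>k\<in>K. c k * w k q)" by (simp only:)
    then show False using eq0 by (simp add: nz_def K_def)
  qed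
  obtain M where M: "dimle (Ldiv (\<lambda>p. 0)) M" using finite_constants by blast
  have bound: "int (Suc l) * int N \<le> int M + (int l * deg Z + deg C)" for l
  proof -
    define A where "A = (\<lambda>q. int l * Z q + C q)"
    have A: "finsupp A" "deg A = int l * deg Z + deg C"
      unfolding A_def using Z C finsupp_cmult[OF Z] by (auto intro: finsupp_add simp: deg_add deg_cmult)
    have A0: "0 \<le> A q" for q using C0 by (auto simp: A_def Z_def)
    then obtain k where k: "deg A = int k" using deg_nonneg[of A] nonneg_int_cases by metis
    have d: "dimle (Ldiv A) (M + k)" by (rule dimle_Ldiv[OF M A(1) A0 k])
    have "\<not> card ({..l} \<times> I) > M + k"
    proof
      assume card: "card ({..l} \<times> I) > M + k"
      have "finite ({..l} \<times> I)" using I by simp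
      from dimle_family[OF d this card, of w, OF wL[of _ l, folded A_def]]
      obtain c where "\<exists>k\<in>{..l} \<times> I. c k \<noteq> 0" "(\<lambda>q. \<Sum>k\<in>{..l} \<times> I. c k * w k q) \<approx> (\<lambda>q. 0)" by blast
      then show False using indep by blast
    qed
    then have "Suc l * N \<le> M + k" using I by (simp add: card_cartesian_product)
    then have "int (Suc l * N) \<le> int (M + k)" by (simp only: of_nat_le_iff)
    then show ?thesis using A(2) k by (simp add: algebra_simps)
  qed
  have "int N \<le> deg Z"
  proof (rule ccontr)
    assume "\<not> int N \<le> deg Z"
    \<comment> \<open>From \<open>(l + 1) N <= M + l deg Z + deg C\<close> and
      \<open>deg Z <= N - 1\<close> follows \<open>l + N <= M + deg C\<close>, which this
      \<open>l\<close> violates because \<open>N >= 1\<close>.\<close>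
    define l where "l = nat (int M + deg C)"
    have "int l * (deg Z + 1) \<le> int l * int N" using \<open>\<not> int N \<le> deg Z\<close> by (intro mult_left_mono) auto
    then have "int l + int N \<le> int M + deg C" using bound[of l] by (simp add: algebra_simps)
    moreover have "int N \<ge> 1" using \<open>\<not> int N \<le> deg Z\<close> deg_nonneg[of Z] by (auto simp: Z_def)
    ultimately show False unfolding l_def by linarith
  qed
  then show ?thesis using B by (simp add: Z_def)
qed

text \<open>The inequality between poles and zeros, applied to \<open>f\<close> and to its inverse,
  is an equality.\<close>

theorem deg_ord:
  assumes f: "nz f"
  shows "deg (\<lambda>p. ord p f) = 0"
proof -
  have le: "deg (\<lambda>p. max 0 (- ord p f)) \<le> deg (\<lambda>p. max 0 (ord p f))" by (rule poles_le_zeros[OF f])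
  have "deg (\<lambda>p. max 0 (- ord p (\<lambda>q. inverse (f q)))) \<le> deg (\<lambda>p. max 0 (ord p (\<lambda>q. inverse (f q))))"
    by (rule poles_le_zeros[OF nz_inverse[OF f]])
  moreover have "deg (\<lambda>p. max 0 (- ord p (\<lambda>q. inverse (f q)))) = deg (\<lambda>p. max 0 (ord p f))"
    "deg (\<lambda>p. max 0 (ord p (\<lambda>q. inverse (f q)))) = deg (\<lambda>p. max 0 (- ord p f))"
    by (intro deg_cong; simp add: ord_inverse[OF f])+
  ultimately have eq: "deg (\<lambda>p. max 0 (- ord p f)) = deg (\<lambda>p. max 0 (ord p f))" using le by simp
  have fin: "finsupp (\<lambda>p. max 0 (ord p f))" "finsupp (\<lambda>p. -1 * max 0 (- ord p f))"
    using finite_support[OF f] unfolding finsupp_def by (auto elim: rev_finite_subset)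
  have "deg (\<lambda>p. ord p f) = deg (\<lambda>p. max 0 (ord p f) + -1 * max 0 (- ord p f))"
    by (intro deg_cong) (auto simp: max_def)
  also have "\<dots> = 0" using deg_add[OF fin] eq deg_cmult[of "-1"] by simp
  finally show ?thesis .
qed

text \<open>Subtracting the value at a point \<open>p\<close> leaves a function with a zero at
  \<open>p\<close> and no poles. Were it nonzero, its divisor would have positive degree.\<close>

lemma Ldiv_0_const:
  assumes "Ldiv (\<lambda>p. 0) f"
  shows "\<exists>c. f \<approx> (\<lambda>q. c)"
proof -
  obtain p where p: "p \<in> X" using X_nonempty by blast
  then have "ordge p f 0" using assms by (auto simp: Ldiv_def)
  then obtain c where c: "ordge p (\<lambda>q. f q - c) 1" by (rule ordge_value)
  have "(\<lambda>q. f q - c) \<approx> (\<lambda>q. 0)"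
  proof (rule ccontr)
    assume "\<not> ?thesis"
    then have nz: "nz (\<lambda>q. f q - c)" using ordge_rat[OF c] by (simp add: nz_def)
    have "0 \<le> ord q (\<lambda>q. f q - c)" if "q \<in> X" for q
      using ordge_diff[of q f 0 "\<lambda>q. c"] ordge_const[OF that] assms that ordge_iff[OF nz that]
      by (auto simp: Ldiv_def)
    then show False
      using deg_pos[OF finsupp_ord[OF nz] _ p] ordge_iff[OF nz p, of 1] c deg_ord[OF nz] by fastforce
  qed
  then have "f \<approx> (\<lambda>q. c)" by eventually_elim simp
  then show ?thesis by blast
qed

end

section \<open>Sheaves given by germs of tuples of rational functions\<close>

context smooth_curve
begin

lemma cring_structure_sheaf:
  assumes U: "zopen X U"
  shows "cring (structure_sheaf X U)"
proof (rule cringI)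
  have reg: "restrict f U \<in> regular X U \<longleftrightarrow> (\<forall>p\<in>U. regat p f)" for f
    using U by (auto simp: regular_iff regat_restrict)
  have regD: "f \<in> regular X U \<Longrightarrow> p \<in> U \<Longrightarrow> regat p f" for f p using U by (auto simp: regular_iff)
  have ext: "f \<in> regular X U \<Longrightarrow> restrict f U = f" for f using U by (auto simp: regular_iff extensional_restrict)
  have UX: "p \<in> U \<Longrightarrow> p \<in> X" for p using zopen_subset[OF U] by blast
  show "abelian_group (structure_sheaf X U)"
  proof (rule abelian_groupI)
    fix f assume f: "f \<in> carrier (structure_sheaf X U)"
    have "(\<lambda>p\<in>U. - 1 * f p) \<in> carrier (structure_sheaf X U)"
      using f by (auto simp: structure_sheaf_def reg intro!: regat_cmult[of _ _ "- 1", simplified] regD)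
    then show "\<exists>y\<in>carrier (structure_sheaf X U). y \<oplus>\<^bsub>structure_sheaf X U\<^esub> f = \<zero>\<^bsub>structure_sheaf X U\<^esub>"
      by (rule bexI[rotated]) (auto simp: structure_sheaf_def cong: restrict_cong)
    show "\<zero>\<^bsub>structure_sheaf X U\<^esub> \<oplus>\<^bsub>structure_sheaf X U\<^esub> f = f"
      using f by (simp add: structure_sheaf_def ext cong: restrict_cong)
  qed (auto simp: structure_sheaf_def reg regat_const regat_add regD UX algebra_simps cong: restrict_cong)
  show "comm_monoid (structure_sheaf X U)"
  proof (rule comm_monoidI)
    fix f assume f: "f \<in> carrier (structure_sheaf X U)"
    show "\<one>\<^bsub>structure_sheaf X U\<^esub> \<otimes>\<^bsub>structure_sheaf X U\<^esub> f = f"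
      using f by (simp add: structure_sheaf_def ext cong: restrict_cong)
  qed (auto simp: structure_sheaf_def reg regat_const regat_mult regD UX algebra_simps cong: restrict_cong)
qed (auto simp: structure_sheaf_def algebra_simps cong: restrict_cong)

lemma carrier_structure_sheaf [simp]: "carrier (structure_sheaf X U) = regular X U"
  by (simp add: structure_sheaf_def)

lemma regular_const: "zopen X U \<Longrightarrow> (\<lambda>p\<in>U. c) \<in> regular X U"
  using zopen_subset by (auto simp: regular_iff regat_restrict intro: regat_const)

lemma regular_add: "zopen X U \<Longrightarrow> f \<in> regular X U \<Longrightarrow> g \<in> regular X U \<Longrightarrow> (\<lambda>p\<in>U. f p + g p) \<in> regular X U"
  by (auto simp: regular_iff regat_restrict intro: regat_add)

lemma regular_mult: "zopen X U \<Longrightarrow> f \<in> regular X U \<Longrightarrow> g \<in> regular X U \<Longrightarrow> (\<lambda>p\<in>U. f p * g p) \<in> regular X U"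
  by (auto simp: regular_iff regat_restrict intro: regat_mult)

lemma regular_regat: "zopen X U \<Longrightarrow> f \<in> regular X U \<Longrightarrow> p \<in> U \<Longrightarrow> regat p f"
  by (simp add: regular_iff)

lemma eventually_gen_in: "\<forall>\<^sub>F q in gen U. q \<in> U"
  by (simp add: eventually_gen)

lemma eventually_gen_subset: "\<forall>\<^sub>F q in gen U. P q \<Longrightarrow> V \<subseteq> U \<Longrightarrow> \<forall>\<^sub>F q in gen V. P q"
  using gen_mono filter_leD by blast

lemma rat_ordge_cofinite: "rat f \<Longrightarrow> \<forall>\<^sub>F p in gen X. ordge p f 0"
proof (cases "f \<approx> (\<lambda>q. 0)")
  case True
  then show ?thesis using ordge_zero by (auto simp: eventually_gen intro: finite_subset[of _ "{}"])
next
  case False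
  assume "rat f"
  then have nz: "nz f" using False by (simp add: nz_def)
  have "{p \<in> X. \<not> ordge p f 0} \<subseteq> {p \<in> X. ord p f \<noteq> 0}" using ordge_iff[OF nz] by auto
  then show ?thesis unfolding eventually_gen using finite_support[OF nz] by (rule finite_subset)
qed

lemma rat_regular_open:
  assumes "zopen X U" "U \<noteq> {}" "\<And>j. j < (k::nat) \<Longrightarrow> rat (a j)"
  obtains V b where "zopen X V" "V \<noteq> {}" "V \<subseteq> U" "\<And>j. j < k \<Longrightarrow> b j \<in> regular X V"
    "\<And>j. j < k \<Longrightarrow> a j \<approx> b j"
proof -
  define F where "F = (\<Union>j<k. {p \<in> X. \<not> ordge p (a j) 0})"
  have F: "finite F" unfolding F_def using assms(3) rat_ordge_cofinite by (auto simp: eventually_gen)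
  define V where "V = U - F"
  have V: "zopen X V" "V \<subseteq> U" unfolding V_def using zopen_diff_finite[OF assms(1) F] by auto
  have V0: "V \<noteq> {}"
  proof
    assume "V = {}"
    then have "U \<subseteq> F" by (auto simp: V_def)
    then show False using infinite_zopen[OF assms(1,2)] F finite_subset by blast
  qed
  have "\<exists>b. b \<in> regular X V \<and> a j \<approx> b" if j: "j < k" for j
  proof -
    have "ordge p (a j) 0" if "p \<in> V" for p
      using that j zopen_subset[OF assms(1)] by (auto simp: V_def F_def)
    from regular_glue[OF V(1) this] obtain b where "b \<in> regular X V" "\<forall>\<^sub>F q in gen V. b q = a j q" by blast
    then show ?thesis using gen_zopen[OF V(1) V0] by (metis (mono_tags, lifting) eventually_mono)
  qed
  then obtain b where "\<And>j. j < k \<Longrightarrow> b j \<in> regular X V \<and> a j \<approx> b j" by metis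
  then show ?thesis using that[OF V(1) V0 V(2)] by blast
qed

end

text \<open>\<open>F\<close> is presented as a sheaf of \<open>r\<close>-tuples of rational
  functions: \<open>\<psi> U\<close> sends a section to its tuple, and \<open>C p\<close> tells
  which tuples are germs of sections at \<open>p\<close>. Sheaf axioms, sums and frames then reduce
  to generic identities between functions, whatever the type of the sections.\<close>

locale sheaf_model = smooth_curve X
  for X :: "('n::finite) pt set" +
  fixes F :: "('n, 'm) sheaf" and r :: nat
    and C :: "'n pt \<Rightarrow> (nat \<Rightarrow> 'n pt \<Rightarrow> complex) \<Rightarrow> bool"
    and \<psi> :: "'n pt set \<Rightarrow> 'm \<Rightarrow> nat \<Rightarrow> 'n pt \<Rightarrow> complex"
  assumes germ_zero: "p \<in> X \<Longrightarrow> C p (\<lambda>i q. 0)"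
    and germ_add: "p \<in> X \<Longrightarrow> C p m \<Longrightarrow> C p m' \<Longrightarrow> C p (\<lambda>i q. m i q + m' i q)"
    and germ_smult: "p \<in> X \<Longrightarrow> regat p a \<Longrightarrow> C p m \<Longrightarrow> C p (\<lambda>i q. a q * m i q)"
    and germ_cong: "p \<in> X \<Longrightarrow> C p m \<Longrightarrow> (\<And>i. i < r \<Longrightarrow> \<forall>\<^sub>F q in gen X. m i q = m' i q) \<Longrightarrow> C p m'"
    and germ_open: "p \<in> X \<Longrightarrow> C p m \<Longrightarrow> \<exists>V. zopen X V \<and> p \<in> V \<and> (\<forall>q\<in>V. C q m)"
    and zero_closed: "zopen X U \<Longrightarrow> \<zero>\<^bsub>Sec F U\<^esub> \<in> carrier (Sec F U)"
    and add_closed: "zopen X U \<Longrightarrow> s \<in> carrier (Sec F U) \<Longrightarrow> t \<in> carrier (Sec F U) \<Longrightarrow>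
      s \<oplus>\<^bsub>Sec F U\<^esub> t \<in> carrier (Sec F U)"
    and smult_closed: "zopen X U \<Longrightarrow> a \<in> regular X U \<Longrightarrow> s \<in> carrier (Sec F U) \<Longrightarrow>
      a \<odot>\<^bsub>Sec F U\<^esub> s \<in> carrier (Sec F U)"
    and res_closed: "zopen X U \<Longrightarrow> zopen X V \<Longrightarrow> V \<subseteq> U \<Longrightarrow> s \<in> carrier (Sec F U) \<Longrightarrow>
      Res F U V s \<in> carrier (Sec F V)"
    and coord_zero: "zopen X U \<Longrightarrow> i < r \<Longrightarrow> \<forall>\<^sub>F q in gen U. \<psi> U \<zero>\<^bsub>Sec F U\<^esub> i q = 0"
    and coord_add: "zopen X U \<Longrightarrow> s \<in> carrier (Sec F U) \<Longrightarrow> t \<in> carrier (Sec F U) \<Longrightarrow> i < r \<Longrightarrow>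
      \<forall>\<^sub>F q in gen U. \<psi> U (s \<oplus>\<^bsub>Sec F U\<^esub> t) i q = \<psi> U s i q + \<psi> U t i q"
    and coord_smult: "zopen X U \<Longrightarrow> a \<in> regular X U \<Longrightarrow> s \<in> carrier (Sec F U) \<Longrightarrow> i < r \<Longrightarrow>
      \<forall>\<^sub>F q in gen U. \<psi> U (a \<odot>\<^bsub>Sec F U\<^esub> s) i q = a q * \<psi> U s i q"
    and coord_res: "zopen X U \<Longrightarrow> zopen X V \<Longrightarrow> V \<subseteq> U \<Longrightarrow> s \<in> carrier (Sec F U) \<Longrightarrow> i < r \<Longrightarrow>
      \<forall>\<^sub>F q in gen V. \<psi> V (Res F U V s) i q = \<psi> U s i q"
    and coord_germ: "zopen X U \<Longrightarrow> s \<in> carrier (Sec F U) \<Longrightarrow> p \<in> U \<Longrightarrow> C p (\<psi> U s)"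
    and coord_inj: "zopen X U \<Longrightarrow> s \<in> carrier (Sec F U) \<Longrightarrow> t \<in> carrier (Sec F U) \<Longrightarrow>
      (\<And>i. i < r \<Longrightarrow> \<forall>\<^sub>F q in gen U. \<psi> U s i q = \<psi> U t i q) \<Longrightarrow> s = t"
    and coord_surj: "zopen X U \<Longrightarrow> (\<And>p. p \<in> U \<Longrightarrow> C p m) \<Longrightarrow>
      \<exists>s\<in>carrier (Sec F U). \<forall>i<r. \<forall>\<^sub>F q in gen U. \<psi> U s i q = m i q"
begin

lemma module_Sec:
  assumes U: "zopen X U"
  shows "module (structure_sheaf X U) (Sec F U)"
proof (rule moduleI)
  interpret R: cring "structure_sheaf X U" by (rule cring_structure_sheaf[OF U])
  note closed = zero_closed[OF U] add_closed[OF U] smult_closed[OF U]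
  show "cring (structure_sheaf X U)" by (rule cring_structure_sheaf[OF U])
  show "abelian_group (Sec F U)"
  proof (rule abelian_groupI)
    fix x y z assume xyz: "x \<in> carrier (Sec F U)" "y \<in> carrier (Sec F U)" "z \<in> carrier (Sec F U)"
    show "x \<oplus>\<^bsub>Sec F U\<^esub> y \<oplus>\<^bsub>Sec F U\<^esub> z = x \<oplus>\<^bsub>Sec F U\<^esub> (y \<oplus>\<^bsub>Sec F U\<^esub> z)"
    proof (rule coord_inj[OF U])
      fix i assume i: "i < r"
      show "\<forall>\<^sub>F q in gen U. \<psi> U (x \<oplus>\<^bsub>Sec F U\<^esub> y \<oplus>\<^bsub>Sec F U\<^esub> z) i q = \<psi> U (x \<oplus>\<^bsub>Sec F U\<^esub> (y \<oplus>\<^bsub>Sec F U\<^esub> z)) i q"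
        using coord_add[OF U closed(2)[OF xyz(1,2)] xyz(3) i] coord_add[OF U xyz(1,2) i]
          coord_add[OF U xyz(1) closed(2)[OF xyz(2,3)] i] coord_add[OF U xyz(2,3) i]
        by eventually_elim simp
    qed (use closed xyz in auto)
  next
    fix x y assume xyz: "x \<in> carrier (Sec F U)" "y \<in> carrier (Sec F U)"
    show "x \<oplus>\<^bsub>Sec F U\<^esub> y = y \<oplus>\<^bsub>Sec F U\<^esub> x"
    proof (rule coord_inj[OF U])
      fix i assume i: "i < r"
      show "\<forall>\<^sub>F q in gen U. \<psi> U (x \<oplus>\<^bsub>Sec F U\<^esub> y) i q = \<psi> U (y \<oplus>\<^bsub>Sec F U\<^esub> x) i q"
        using coord_add[OF U xyz i] coord_add[OF U xyz(2,1) i] by eventually_elim simp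
    qed (use closed xyz in auto)
  next
    fix x assume x: "x \<in> carrier (Sec F U)"
    show "\<zero>\<^bsub>Sec F U\<^esub> \<oplus>\<^bsub>Sec F U\<^esub> x = x"
    proof (rule coord_inj[OF U])
      fix i assume i: "i < r"
      show "\<forall>\<^sub>F q in gen U. \<psi> U (\<zero>\<^bsub>Sec F U\<^esub> \<oplus>\<^bsub>Sec F U\<^esub> x) i q = \<psi> U x i q"
        using coord_add[OF U closed(1) x i] coord_zero[OF U i] by eventually_elim simp
    qed (use closed x in auto)
    have m: "(\<lambda>p\<in>U. - 1) \<in> regular X U" by (rule regular_const[OF U])
    show "\<exists>y\<in>carrier (Sec F U). y \<oplus>\<^bsub>Sec F U\<^esub> x = \<zero>\<^bsub>Sec F U\<^esub>"
    proof (rule bexI)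
      show "((\<lambda>p\<in>U. - 1) \<odot>\<^bsub>Sec F U\<^esub> x) \<oplus>\<^bsub>Sec F U\<^esub> x = \<zero>\<^bsub>Sec F U\<^esub>"
      proof (rule coord_inj[OF U])
        fix i assume i: "i < r"
        show "\<forall>\<^sub>F q in gen U. \<psi> U (((\<lambda>p\<in>U. - 1) \<odot>\<^bsub>Sec F U\<^esub> x) \<oplus>\<^bsub>Sec F U\<^esub> x) i q = \<psi> U \<zero>\<^bsub>Sec F U\<^esub> i q"
          using coord_add[OF U closed(3)[OF m x] x i] coord_smult[OF U m x i] coord_zero[OF U i]
            eventually_gen_in by eventually_elim simp
      qed (use closed x m in auto)
    qed (use closed x m in auto)
  qed (use closed in auto)
next
  note closed = zero_closed[OF U] add_closed[OF U] smult_closed[OF U]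
  fix a b x assume "a \<in> carrier (structure_sheaf X U)" "b \<in> carrier (structure_sheaf X U)" and x: "x \<in> carrier (Sec F U)"
  then have a: "a \<in> regular X U" and b: "b \<in> regular X U" by auto
  have ab: "a \<oplus>\<^bsub>structure_sheaf X U\<^esub> b \<in> regular X U" "a \<otimes>\<^bsub>structure_sheaf X U\<^esub> b \<in> regular X U"
    using a b U by (auto simp: structure_sheaf_def intro: regular_add regular_mult)
  show "(a \<oplus>\<^bsub>structure_sheaf X U\<^esub> b) \<odot>\<^bsub>Sec F U\<^esub> x = a \<odot>\<^bsub>Sec F U\<^esub> x \<oplus>\<^bsub>Sec F U\<^esub> b \<odot>\<^bsub>Sec F U\<^esub> x"
  proof (rule coord_inj[OF U])
    fix i assume i: "i < r"
    show "\<forall>\<^sub>F q in gen U. \<psi> U ((a \<oplus>\<^bsub>structure_sheaf X U\<^esub> b) \<odot>\<^bsub>Sec F U\<^esub> x) i q =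
        \<psi> U (a \<odot>\<^bsub>Sec F U\<^esub> x \<oplus>\<^bsub>Sec F U\<^esub> b \<odot>\<^bsub>Sec F U\<^esub> x) i q"
      using coord_smult[OF U ab(1) x i] coord_smult[OF U a x i] coord_smult[OF U b x i]
        coord_add[OF U closed(3)[OF a x] closed(3)[OF b x] i] eventually_gen_in
      by eventually_elim (simp add: structure_sheaf_def algebra_simps)
  qed (use closed a b ab x in auto)
  show "(a \<otimes>\<^bsub>structure_sheaf X U\<^esub> b) \<odot>\<^bsub>Sec F U\<^esub> x = a \<odot>\<^bsub>Sec F U\<^esub> (b \<odot>\<^bsub>Sec F U\<^esub> x)"
  proof (rule coord_inj[OF U])
    fix i assume i: "i < r"
    show "\<forall>\<^sub>F q in gen U. \<psi> U ((a \<otimes>\<^bsub>structure_sheaf X U\<^esub> b) \<odot>\<^bsub>Sec F U\<^esub> x) i q =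
        \<psi> U (a \<odot>\<^bsub>Sec F U\<^esub> (b \<odot>\<^bsub>Sec F U\<^esub> x)) i q"
      using coord_smult[OF U ab(2) x i] coord_smult[OF U b x i] coord_smult[OF U a closed(3)[OF b x] i]
        eventually_gen_in
      by eventually_elim (simp add: structure_sheaf_def algebra_simps)
  qed (use closed a b ab x in auto)
next
  note closed = zero_closed[OF U] add_closed[OF U] smult_closed[OF U]
  fix a x y assume "a \<in> carrier (structure_sheaf X U)" and x: "x \<in> carrier (Sec F U)" and y: "y \<in> carrier (Sec F U)"
  then have a: "a \<in> regular X U" by simp
  show "a \<odot>\<^bsub>Sec F U\<^esub> x \<in> carrier (Sec F U)" using closed a x by blast
  show "a \<odot>\<^bsub>Sec F U\<^esub> (x \<oplus>\<^bsub>Sec F U\<^esub> y) = a \<odot>\<^bsub>Sec F U\<^esub> x \<oplus>\<^bsub>Sec F U\<^esub> a \<odot>\<^bsub>Sec F U\<^esub> y"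
  proof (rule coord_inj[OF U])
    fix i assume i: "i < r"
    show "\<forall>\<^sub>F q in gen U. \<psi> U (a \<odot>\<^bsub>Sec F U\<^esub> (x \<oplus>\<^bsub>Sec F U\<^esub> y)) i q =
        \<psi> U (a \<odot>\<^bsub>Sec F U\<^esub> x \<oplus>\<^bsub>Sec F U\<^esub> a \<odot>\<^bsub>Sec F U\<^esub> y) i q"
      using coord_smult[OF U a closed(2)[OF x y] i] coord_smult[OF U a x i] coord_smult[OF U a y i]
        coord_add[OF U closed(3)[OF a x] closed(3)[OF a y] i] coord_add[OF U x y i]
      by eventually_elim (simp add: algebra_simps)
  qed (use closed a x y in auto)
next
  note closed = zero_closed[OF U] add_closed[OF U] smult_closed[OF U]
  fix x assume x: "x \<in> carrier (Sec F U)"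
  have o: "\<one>\<^bsub>structure_sheaf X U\<^esub> \<in> regular X U"
    by (simp add: structure_sheaf_def regular_const[OF U])
  show "\<one>\<^bsub>structure_sheaf X U\<^esub> \<odot>\<^bsub>Sec F U\<^esub> x = x"
  proof (rule coord_inj[OF U])
    fix i assume i: "i < r"
    show "\<forall>\<^sub>F q in gen U. \<psi> U (\<one>\<^bsub>structure_sheaf X U\<^esub> \<odot>\<^bsub>Sec F U\<^esub> x) i q = \<psi> U x i q"
      using coord_smult[OF U o x i] eventually_gen_in by eventually_elim (simp add: structure_sheaf_def)
  qed (use closed o x in auto)
qed

lemma res_add:
  assumes "zopen X U" "zopen X V" "V \<subseteq> U" "s \<in> carrier (Sec F U)" "t \<in> carrier (Sec F U)"
  shows "Res F U V (s \<oplus>\<^bsub>Sec F U\<^esub> t) = Res F U V s \<oplus>\<^bsub>Sec F V\<^esub> Res F U V t"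
proof (rule coord_inj[OF assms(2)])
  note c = res_closed[OF assms(1-3)]
  fix i assume i: "i < r"
  show "\<forall>\<^sub>F q in gen V. \<psi> V (Res F U V (s \<oplus>\<^bsub>Sec F U\<^esub> t)) i q = \<psi> V (Res F U V s \<oplus>\<^bsub>Sec F V\<^esub> Res F U V t) i q"
    using coord_res[OF assms(1-3) add_closed[OF assms(1,4,5)] i] coord_res[OF assms(1-3) assms(4) i]
      coord_res[OF assms(1-3) assms(5) i] coord_add[OF assms(2) c[OF assms(4)] c[OF assms(5)] i]
      eventually_gen_subset[OF coord_add[OF assms(1,4,5) i] assms(3)]
    by eventually_elim simp
qed (use assms res_closed add_closed in auto)

lemma res_smult:
  assumes "zopen X U" "zopen X V" "V \<subseteq> U" "s \<in> carrier (Sec F U)" "a \<in> regular X U"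
  shows "Res F U V (a \<odot>\<^bsub>Sec F U\<^esub> s) = restrict a V \<odot>\<^bsub>Sec F V\<^esub> Res F U V s"
proof (rule coord_inj[OF assms(2)])
  note c = res_closed[OF assms(1-3)]
  have a: "restrict a V \<in> regular X V" using regular_restrict assms by blast
  fix i assume i: "i < r"
  show "\<forall>\<^sub>F q in gen V. \<psi> V (Res F U V (a \<odot>\<^bsub>Sec F U\<^esub> s)) i q = \<psi> V (restrict a V \<odot>\<^bsub>Sec F V\<^esub> Res F U V s) i q"
    using coord_res[OF assms(1-3) smult_closed[OF assms(1,5,4)] i] coord_res[OF assms(1-3) assms(4) i]
      coord_smult[OF assms(2) a c[OF assms(4)] i] eventually_gen_in
      eventually_gen_subset[OF coord_smult[OF assms(1,5,4) i] assms(3)]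
    by eventually_elim simp
next
  show "restrict a V \<odot>\<^bsub>Sec F V\<^esub> Res F U V s \<in> carrier (Sec F V)"
    using assms regular_restrict by (intro smult_closed res_closed) auto
qed (use assms res_closed smult_closed in auto)

lemma module_sheaf: "module_sheaf X F"
  unfolding module_sheaf_def
proof (intro conjI allI impI ballI)
  fix U assume U: "zopen X U"
  show "module (structure_sheaf X U) (Sec F U)" by (rule module_Sec[OF U])
  fix s assume s: "s \<in> carrier (Sec F U)"
  show "Res F U U s = s"
    by (rule coord_inj[OF U _ s]) (use res_closed[OF U U _ s] coord_res[OF U U _ s] in auto)
next
  fix U V assume "zopen X U \<and> zopen X V \<and> V \<subseteq> U"
  then have UV: "zopen X U" "zopen X V" "V \<subseteq> U" by auto
  show "Res F U V \<in> carrier (Sec F U) \<rightarrow> carrier (Sec F V)" using res_closed[OF UV] by auto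
  fix s assume s: "s \<in> carrier (Sec F U)"
  show "Res F U V (s \<oplus>\<^bsub>Sec F U\<^esub> t) = Res F U V s \<oplus>\<^bsub>Sec F V\<^esub> Res F U V t" if "t \<in> carrier (Sec F U)" for t
    by (rule res_add[OF UV s that])
  show "Res F U V (a \<odot>\<^bsub>Sec F U\<^esub> s) = restrict a V \<odot>\<^bsub>Sec F V\<^esub> Res F U V s" if "a \<in> regular X U" for a
    by (rule res_smult[OF UV s that])
next
  fix U V W s assume "zopen X U \<and> zopen X V \<and> zopen X W \<and> W \<subseteq> V \<and> V \<subseteq> U"
  then have *: "zopen X U" "zopen X V" "zopen X W" "W \<subseteq> V" "V \<subseteq> U" "W \<subseteq> U" by auto
  assume s: "s \<in> carrier (Sec F U)"
  note sV = res_closed[OF *(1,2,5) s]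
  show "Res F V W (Res F U V s) = Res F U W s"
  proof (rule coord_inj[OF *(3)])
    fix i assume i: "i < r"
    show "\<forall>\<^sub>F q in gen W. \<psi> W (Res F V W (Res F U V s)) i q = \<psi> W (Res F U W s) i q"
      using coord_res[OF *(2,3,4) sV i] coord_res[OF *(1,3,6) s i]
        eventually_gen_subset[OF coord_res[OF *(1,2,5) s i] *(4)]
      by eventually_elim simp
  qed (use res_closed[OF *(2,3,4) sV] res_closed[OF *(1,3,6) s] in auto)
next
  fix \<U> s t assume \<U>: "\<forall>V\<in>\<U>. zopen X V"
    and st: "s \<in> carrier (Sec F (\<Union>\<U>))" "t \<in> carrier (Sec F (\<Union>\<U>))"
    and eq: "\<forall>V\<in>\<U>. Res F (\<Union>\<U>) V s = Res F (\<Union>\<U>) V t"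
  have U: "zopen X (\<Union>\<U>)" using \<U> by blast
  show "s = t"
  proof (rule coord_inj[OF U st])
    fix i assume i: "i < r"
    show "\<forall>\<^sub>F q in gen (\<Union>\<U>). \<psi> (\<Union>\<U>) s i q = \<psi> (\<Union>\<U>) t i q"
    proof (cases "\<Union>\<U> = {}")
      case True
      then have "gen (\<Union>\<U>) = bot" by (simp only: gen_empty)
      then show ?thesis by simp
    next
      case False
      then obtain V where V: "V \<in> \<U>" "V \<noteq> {}" by blast
      then have VU: "zopen X V" "V \<subseteq> \<Union>\<U>" using \<U> by auto
      have "\<forall>\<^sub>F q in gen V. \<psi> (\<Union>\<U>) s i q = \<psi> (\<Union>\<U>) t i q"
        using coord_res[OF U VU st(1) i] coord_res[OF U VU st(2) i] bspec[OF eq V(1)]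
        by (auto elim: eventually_elim2)
      then show ?thesis using gen_zopen[OF U False] gen_zopen[OF VU(1) V(2)] by simp
    qed
  qed
next
  fix \<U> \<sigma> assume \<U>: "\<forall>V\<in>\<U>. zopen X V"
    and \<sigma>: "(\<forall>V\<in>\<U>. \<sigma> V \<in> carrier (Sec F V)) \<and>
      (\<forall>V\<in>\<U>. \<forall>W\<in>\<U>. Res F V (V \<inter> W) (\<sigma> V) = Res F W (V \<inter> W) (\<sigma> W))"
  then have \<sigma>1: "\<And>V. V \<in> \<U> \<Longrightarrow> \<sigma> V \<in> carrier (Sec F V)"
    and \<sigma>2: "\<And>V W. V \<in> \<U> \<Longrightarrow> W \<in> \<U> \<Longrightarrow> Res F V (V \<inter> W) (\<sigma> V) = Res F W (V \<inter> W) (\<sigma> W)" by auto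
  have U: "zopen X (\<Union>\<U>)" using \<U> by blast
  have "\<exists>m. \<forall>V\<in>\<U>. \<forall>i<r. \<forall>\<^sub>F q in gen V. \<psi> V (\<sigma> V) i q = m i q"
  proof (cases "\<Union>\<U> = {}")
    case True
    have "gen V = bot" if "V \<in> \<U>" for V
    proof -
      have "V = {}" using that True by blast
      then show ?thesis by (simp only: gen_empty)
    qed
    then show ?thesis by simp
  next
    case False
    \<comment> \<open>Any two nonempty open sets meet, so the tuple of a single nonempty member
      agrees generically with the tuples of all members of the family.\<close>
    then obtain V0 where V0: "V0 \<in> \<U>" "V0 \<noteq> {}" by blast
    have "\<forall>\<^sub>F q in gen V. \<psi> V (\<sigma> V) i q = \<psi> V0 (\<sigma> V0) i q" if V: "V \<in> \<U>" and i: "i < r" for V i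
    proof (cases "V = {}")
      case False
      have o: "zopen X V" "zopen X V0" using \<U> V V0 by auto
      have oI: "zopen X (V \<inter> V0)" "V \<inter> V0 \<noteq> {}"
        using o zopen_Int zopen_Int_nonempty False V0 by auto
      have "\<forall>\<^sub>F q in gen (V \<inter> V0). \<psi> V (\<sigma> V) i q = \<psi> V0 (\<sigma> V0) i q"
        using coord_res[OF o(1) oI(1) _ \<sigma>1[OF V] i] coord_res[OF o(2) oI(1) _ \<sigma>1[OF V0(1)] i] \<sigma>2[OF V V0(1)]
        by (auto elim: eventually_elim2)
      then show ?thesis using gen_zopen[OF oI] gen_zopen[OF o(1) False] by simp
    qed (simp add: gen_empty)
    then show ?thesis by (intro exI[of _ "\<psi> V0 (\<sigma> V0)"]) blast
  qed
  then obtain m where m: "\<And>V i. V \<in> \<U> \<Longrightarrow> i < r \<Longrightarrow> \<forall>\<^sub>F q in gen V. \<psi> V (\<sigma> V) i q = m i q" by blast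
  have "C p m" if p: "p \<in> \<Union>\<U>" for p
  proof -
    obtain V where V: "V \<in> \<U>" "p \<in> V" using p by blast
    then have VX: "zopen X V" "p \<in> X" "V \<noteq> {}" using \<U> zopen_subset by auto
    then show ?thesis
      using germ_cong[OF VX(2) coord_germ[OF VX(1) \<sigma>1[OF V(1)] V(2)], of m] m[OF V(1)] gen_zopen[OF VX(1,3)]
      by auto
  qed
  from coord_surj[OF U this] obtain s where s: "s \<in> carrier (Sec F (\<Union>\<U>))"
    "\<forall>i<r. \<forall>\<^sub>F q in gen (\<Union>\<U>). \<psi> (\<Union>\<U>) s i q = m i q" by blast
  have "Res F (\<Union>\<U>) V s = \<sigma> V" if V: "V \<in> \<U>" for V
  proof -
    have VU: "zopen X V" "V \<subseteq> \<Union>\<U>" using \<U> V by auto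
    show ?thesis
    proof (rule coord_inj[OF VU(1) res_closed[OF U VU s(1)] \<sigma>1[OF V]])
      fix i assume i: "i < r"
      show "\<forall>\<^sub>F q in gen V. \<psi> V (Res F (\<Union>\<U>) V s) i q = \<psi> V (\<sigma> V) i q"
        using coord_res[OF U VU s(1) i] m[OF V i] eventually_gen_subset[OF s(2)[rule_format, OF i] VU(2)]
        by eventually_elim simp
    qed
  qed
  then show "\<exists>s\<in>carrier (Sec F (\<Union>\<U>)). \<forall>V\<in>\<U>. Res F (\<Union>\<U>) V s = \<sigma> V" using s(1) by blast
qed

section \<open>Linear combinations of sections in coordinates\<close>

lemma finsum_coord:
  assumes U: "zopen X U" and f: "\<And>j. j < (k::nat) \<Longrightarrow> f j \<in> carrier (Sec F U)"
  shows "(\<Oplus>\<^bsub>Sec F U\<^esub>j\<in>{..<k}. f j) \<in> carrier (Sec F U)"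
    "i < r \<Longrightarrow> \<forall>\<^sub>F q in gen U. \<psi> U (\<Oplus>\<^bsub>Sec F U\<^esub>j\<in>{..<k}. f j) i q = (\<Sum>j<k. \<psi> U (f j) i q)"
proof -
  interpret M: module "structure_sheaf X U" "Sec F U" by (rule module_Sec[OF U])
  have "(\<Oplus>\<^bsub>Sec F U\<^esub>j\<in>{..<k}. f j) \<in> carrier (Sec F U) \<and>
    (i < r \<longrightarrow> (\<forall>\<^sub>F q in gen U. \<psi> U (\<Oplus>\<^bsub>Sec F U\<^esub>j\<in>{..<k}. f j) i q = (\<Sum>j<k. \<psi> U (f j) i q)))"
    using f
  proof (induction k)
    case 0
    then show ?case using coord_zero[OF U] by simp
  next
    case (Suc k)
    have fk: "f j \<in> carrier (Sec F U)" if "j \<le> k" for j using Suc.prems that by simp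
    have eq: "(\<Oplus>\<^bsub>Sec F U\<^esub>j\<in>{..<Suc k}. f j) = f k \<oplus>\<^bsub>Sec F U\<^esub> (\<Oplus>\<^bsub>Sec F U\<^esub>j\<in>{..<k}. f j)"
      unfolding lessThan_Suc by (rule M.finsum_insert) (use fk in auto)
    have IH: "(\<Oplus>\<^bsub>Sec F U\<^esub>j\<in>{..<k}. f j) \<in> carrier (Sec F U)"
      "i < r \<Longrightarrow> \<forall>\<^sub>F q in gen U. \<psi> U (\<Oplus>\<^bsub>Sec F U\<^esub>j\<in>{..<k}. f j) i q = (\<Sum>j<k. \<psi> U (f j) i q)"
      using Suc by auto
    have "\<forall>\<^sub>F q in gen U. \<psi> U (\<Oplus>\<^bsub>Sec F U\<^esub>j\<in>{..<Suc k}. f j) i q = (\<Sum>j<Suc k. \<psi> U (f j) i q)" if i: "i < r"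
      unfolding eq using coord_add[OF U fk[of k] IH(1) i] IH(2)[OF i] by (auto elim: eventually_elim2)
    then show ?case unfolding eq using add_closed[OF U fk[of k] IH(1)] by auto
  qed
  then show "(\<Oplus>\<^bsub>Sec F U\<^esub>j\<in>{..<k}. f j) \<in> carrier (Sec F U)"
    "i < r \<Longrightarrow> \<forall>\<^sub>F q in gen U. \<psi> U (\<Oplus>\<^bsub>Sec F U\<^esub>j\<in>{..<k}. f j) i q = (\<Sum>j<k. \<psi> U (f j) i q)" by auto
qed

abbreviation lin :: "nat \<Rightarrow> 'n pt set \<Rightarrow> 'n pt set \<Rightarrow> (nat \<Rightarrow> 'n pt \<Rightarrow> complex) \<Rightarrow> (nat \<Rightarrow> 'm) \<Rightarrow> 'm" where
  "lin k U V a e \<equiv> \<Oplus>\<^bsub>Sec F V\<^esub>i\<in>{..<k}. a i \<odot>\<^bsub>Sec F V\<^esub> Res F U V (e i)"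

lemma lin_coord:
  assumes UV: "zopen X U" "zopen X V" "V \<subseteq> U"
    and a: "\<And>j. j < k \<Longrightarrow> a j \<in> regular X V" and e: "\<And>j. j < k \<Longrightarrow> e j \<in> carrier (Sec F U)"
  shows "lin k U V a e \<in> carrier (Sec F V)"
    "i < r \<Longrightarrow> \<forall>\<^sub>F q in gen V. \<psi> V (lin k U V a e) i q = (\<Sum>j<k. a j q * \<psi> U (e j) i q)"
proof -
  have c: "a j \<odot>\<^bsub>Sec F V\<^esub> Res F U V (e j) \<in> carrier (Sec F V)" if "j < k" for j
    using that a e UV by (intro smult_closed res_closed) auto
  from finsum_coord(1)[OF UV(2) c, of k] show "lin k U V a e \<in> carrier (Sec F V)" by simp
  assume i: "i < r"
  have "\<forall>\<^sub>F q in gen V. \<forall>j\<in>{..<k}. \<psi> V (a j \<odot>\<^bsub>Sec F V\<^esub> Res F U V (e j)) i q = a j q * \<psi> U (e j) i q"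
  proof (rule eventually_ball_finite; intro finite_lessThan ballI)
    fix j assume "j \<in> {..<k}"
    then have j: "j < k" by simp
    show "\<forall>\<^sub>F q in gen V. \<psi> V (a j \<odot>\<^bsub>Sec F V\<^esub> Res F U V (e j)) i q = a j q * \<psi> U (e j) i q"
      using coord_smult[OF UV(2) a[OF j] res_closed[OF UV e[OF j]] i] coord_res[OF UV e[OF j] i]
      by eventually_elim simp
  qed
  moreover have "\<forall>\<^sub>F q in gen V. \<psi> V (lin k U V a e) i q =
      (\<Sum>j<k. \<psi> V (a j \<odot>\<^bsub>Sec F V\<^esub> Res F U V (e j)) i q)"
    by (rule finsum_coord(2)[OF UV(2) _ i]) (rule c)
  ultimately
  show "\<forall>\<^sub>F q in gen V. \<psi> V (lin k U V a e) i q = (\<Sum>j<k. a j q * \<psi> U (e j) i q)"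
    by eventually_elim (auto intro!: sum.cong)
qed

end

section \<open>Frames, ranks and degrees\<close>

text \<open>The determinant in the form used by \<open>det_order\<close>. Multiplicativity is proved
  by expansion up to size 2, since degrees are computed only for bundles of rank 1 and 2.\<close>

definition leibniz_det :: "nat \<Rightarrow> (nat \<Rightarrow> nat \<Rightarrow> complex) \<Rightarrow> complex" where
  "leibniz_det k a = (\<Sum>\<pi> | \<pi> permutes {..<k}. of_int (sign \<pi>) * (\<Prod>j<k. a j (\<pi> j)))"

lemma leibniz_det_0: "leibniz_det 0 a = 1"
  by (simp add: leibniz_det_def sign_id)

lemma leibniz_det_1: "leibniz_det (Suc 0) a = a 0 0"
  by (simp add: leibniz_det_def sign_id lessThan_Suc)

lemma leibniz_det_2: "leibniz_det (Suc (Suc 0)) a = a 0 0 * a 1 1 - a 0 1 * a 1 0"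
proof -
  have "{\<pi>. \<pi> permutes {..<Suc (Suc 0)}} = {id, Transposition.transpose 0 (1::nat)}"
    by (auto simp: lessThan_Suc insert_commute permutes_doubleton_iff)
  moreover have "id \<noteq> Transposition.transpose 0 (1::nat)"
    by (metis id_apply transpose_apply_first zero_neq_one)
  ultimately show ?thesis
    by (simp add: leibniz_det_def sign_id sign_swap_id lessThan_Suc algebra_simps)
qed

lemma leibniz_det_mult:
  "k \<le> 2 \<Longrightarrow> leibniz_det k (\<lambda>j l. \<Sum>i<k. a j i * b i l) = leibniz_det k a * leibniz_det k b"
  by (auto simp: le_Suc_eq numeral_2_eq_2 leibniz_det_0 leibniz_det_1 leibniz_det_2 algebra_simps)

lemma leibniz_det_id: "k \<le> 2 \<Longrightarrow> leibniz_det k (\<lambda>j l. if j = l then 1 else 0) = 1"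
  by (auto simp: le_Suc_eq numeral_2_eq_2 leibniz_det_0 leibniz_det_1 leibniz_det_2)

lemma leibniz_det_cong:
  "(\<And>j l. j < k \<Longrightarrow> l < k \<Longrightarrow> a j l = b j l) \<Longrightarrow> leibniz_det k a = leibniz_det k b"
  unfolding leibniz_det_def
proof (intro sum.cong refl arg_cong2[of _ _ _ _ "(*)"] prod.cong)
  fix \<pi> j assume *: "\<And>j l. j < k \<Longrightarrow> l < k \<Longrightarrow> a j l = b j l" "\<pi> \<in> {\<pi>. \<pi> permutes {..<k}}" "j \<in> {..<k}"
  then have "\<pi> j \<in> {..<k}" using permutes_in_image[of \<pi> "{..<k}" j] by simp
  then show "a j (\<pi> j) = b j (\<pi> j)" using * by auto
qed

lemma choice_less: "(\<And>j. j < (k::nat) \<Longrightarrow> \<exists>a. P j a) \<Longrightarrow> \<exists>A. \<forall>j<k. P j (A j)"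
  by (rule exI[of _ "\<lambda>j. SOME a. P j a"]) (auto intro: someI_ex)

lemma eventually_all2:
  "(\<And>j l. j < (k::nat) \<Longrightarrow> l < (k'::nat) \<Longrightarrow> eventually (P j l) G) \<Longrightarrow>
    eventually (\<lambda>q. \<forall>j<k. \<forall>l<k'. P j l q) G"
proof -
  assume *: "\<And>j l. j < k \<Longrightarrow> l < k' \<Longrightarrow> eventually (P j l) G"
  have "eventually (\<lambda>q. \<forall>j\<in>{..<k}. \<forall>l\<in>{..<k'}. P j l q) G"
    using * by (intro eventually_ball_finite ballI) auto
  then show ?thesis by (rule eventually_mono) auto
qed

context smooth_curve
begin

lemma regat_prod: "p \<in> X \<Longrightarrow> (\<And>i. i \<in> I \<Longrightarrow> regat p (f i)) \<Longrightarrow> regat p (\<lambda>q. \<Prod>i\<in>I. f i q)"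
  by (induction I rule: infinite_finite_induct) (auto intro: regat_mult regat_const)

lemma regat_det:
  assumes "p \<in> X" "\<And>j l. j < k \<Longrightarrow> l < k \<Longrightarrow> regat p (A j l)"
  shows "regat p (\<lambda>q. leibniz_det k (\<lambda>j l. A j l q))"
  unfolding leibniz_det_def
proof (intro regat_sum regat_cmult regat_prod assms(1))
  fix \<pi> j assume "\<pi> \<in> {\<pi>. \<pi> permutes {..<k}}" "j \<in> {..<k}"
  moreover from this have "\<pi> j \<in> {..<k}" using permutes_in_image[of \<pi> "{..<k}" j] by simp
  ultimately show "regat p (A j (\<pi> j))" using assms by auto
qed

lemma hasord_regat_nonzero:
  assumes "regat p u" "hasord p u 0"
  shows "u p \<noteq> 0"
proof
  assume 0: "u p = 0"
  obtain v where v: "regat p v" "v p \<noteq> 0" "u \<approx> v" using assms(2) by (auto simp: hasord_def)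
  then show False using regat_eq[OF assms(1) v(1,3)] 0 by simp
qed

end

section \<open>Change of frame\<close>

context sheaf_model
begin

definition expresses :: "nat \<Rightarrow> (nat \<Rightarrow> nat \<Rightarrow> 'n pt \<Rightarrow> complex) \<Rightarrow> nat \<Rightarrow> (nat \<Rightarrow> nat \<Rightarrow> 'n pt \<Rightarrow> complex) \<Rightarrow>
    (nat \<Rightarrow> nat \<Rightarrow> 'n pt \<Rightarrow> complex) \<Rightarrow> bool" where
  "expresses k E k' E' A \<longleftrightarrow> (\<forall>j<k. \<forall>i<r. E j i \<approx> (\<lambda>q. \<Sum>l<k'. A j l q * E' l i q))"

definition indep :: "nat \<Rightarrow> (nat \<Rightarrow> nat \<Rightarrow> 'n pt \<Rightarrow> complex) \<Rightarrow> bool" where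
  "indep k E \<longleftrightarrow> (\<forall>a. (\<forall>j<k. rat (a j)) \<and> (\<forall>i<r. (\<lambda>q. \<Sum>j<k. a j q * E j i q) \<approx> (\<lambda>q. 0)) \<longrightarrow>
     (\<forall>j<k. a j \<approx> (\<lambda>q. 0)))"

lemma expresses_trans:
  assumes "expresses k E k' E' A" "expresses k' E' k'' E'' B"
  shows "expresses k E k'' E'' (\<lambda>j l q. \<Sum>m<k'. A j m q * B m l q)"
  unfolding expresses_def
proof (intro allI impI)
  fix j i assume j: "j < k" and i: "i < r"
  have "\<forall>\<^sub>F q in gen X. \<forall>m\<in>{..<k'}. E' m i q = (\<Sum>l<k''. B m l q * E'' l i q)"
    using assms(2) i by (intro eventually_ball_finite) (auto simp: expresses_def)
  moreover have "E j i \<approx> (\<lambda>q. \<Sum>m<k'. A j m q * E' m i q)" using assms(1) i j by (simp add: expresses_def)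
  ultimately show "E j i \<approx> (\<lambda>q. \<Sum>l<k''. (\<Sum>m<k'. A j m q * B m l q) * E'' l i q)"
  proof eventually_elim
    case (elim q)
    have "E j i q = (\<Sum>m<k'. A j m q * (\<Sum>l<k''. B m l q * E'' l i q))" using elim by simp
    also have "\<dots> = (\<Sum>m<k'. \<Sum>l<k''. A j m q * B m l q * E'' l i q)"
      by (simp add: sum_distrib_left mult.assoc)
    also have "\<dots> = (\<Sum>l<k''. \<Sum>m<k'. A j m q * B m l q * E'' l i q)" by (rule sum.swap)
    finally show ?case by (simp add: sum_distrib_right)
  qed
qed

lemma expresses_unique:
  assumes "indep k' E'" "expresses k E k' E' A" "expresses k E k' E' B"
    "\<And>l. l < k' \<Longrightarrow> rat (A j l)" "\<And>l. l < k' \<Longrightarrow> rat (B j l)" "j < k" "l < k'"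
  shows "A j l \<approx> B j l"
proof -
  have "(\<lambda>q. \<Sum>l<k'. (A j l q - B j l q) * E' l i q) \<approx> (\<lambda>q. 0)" if i: "i < r" for i
    using assms(2)[unfolded expresses_def, rule_format, OF assms(6) i]
      assms(3)[unfolded expresses_def, rule_format, OF assms(6) i]
    by eventually_elim (simp add: algebra_simps sum_subtractf)
  moreover have "\<forall>l<k'. rat (\<lambda>q. A j l q - B j l q)" using assms(4,5) rat_diff by blast
  ultimately have "(\<lambda>q. A j l q - B j l q) \<approx> (\<lambda>q. 0)"
    using assms(1)[unfolded indep_def, THEN spec, of "\<lambda>l q. A j l q - B j l q"] assms(7) by simp
  then show ?thesis by eventually_elim simp
qed

lemma expresses_refl: "expresses k E k E (\<lambda>j l q. if j = l then 1 else 0)"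
proof -
  have "(\<Sum>l<k. (if j = l then 1 else 0) * E l i q) = E j i q" if "j < k" for i j q
  proof -
    have "(\<Sum>l<k. (if j = l then 1 else 0) * E l i q) = (\<Sum>l<k. if j = l then E l i q else 0)"
      by (intro sum.cong) auto
    then show ?thesis using that by simp
  qed
  then show ?thesis by (simp add: expresses_def)
qed

lemma frame_coords:
  assumes "frame X F k U e" "zopen X V" "V \<subseteq> U" "s \<in> carrier (Sec F V)"
  obtains a where "\<forall>j<k. a j \<in> regular X V" "s = lin k U V a e"
proof -
  have "bij_betw (\<lambda>a. lin k U V a e) ({..<k} \<rightarrow>\<^sub>E regular X V) (carrier (Sec F V))"
    using assms by (simp add: frame_def)
  then obtain a where "a \<in> {..<k} \<rightarrow>\<^sub>E regular X V" "s = lin k U V a e"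
    using assms(4) unfolding bij_betw_def by blast
  then show ?thesis using that by auto
qed

lemma frameD:
  assumes "frame X F k U e"
  shows "zopen X U" "\<forall>j<k. e j \<in> carrier (Sec F U)"
  using assms by (auto simp: frame_def)

lemma lin_coord':
  assumes "zopen X U" "zopen X V" "V \<subseteq> U" "\<forall>j<k. a j \<in> regular X V" "\<forall>j<k. e j \<in> carrier (Sec F U)"
  shows "lin k U V a e \<in> carrier (Sec F V)"
    "i < r \<Longrightarrow> \<forall>\<^sub>F q in gen V. \<psi> V (lin k U V a e) i q = (\<Sum>j<k. a j q * \<psi> U (e j) i q)"
  using assms by (auto intro!: lin_coord)

lemma frame_span:
  assumes fr: "frame X F k U e" and p: "p \<in> U" and m: "C p m"
  shows "\<exists>a. (\<forall>j<k. regat p (a j)) \<and> (\<forall>i<r. m i \<approx> (\<lambda>q. \<Sum>j<k. a j q * \<psi> U (e j) i q))"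
proof -
  note U = frameD[OF fr]
  have pX: "p \<in> X" using p zopen_subset[OF U(1)] by auto
  obtain V0 where V0: "zopen X V0" "p \<in> V0" "\<forall>q\<in>V0. C q m" using germ_open[OF pX m] by blast
  define V where "V = V0 \<inter> U"
  have V: "zopen X V" "p \<in> V" "V \<subseteq> U" "V \<noteq> {}" using V0 U p zopen_Int by (auto simp: V_def)
  have "C q m" if "q \<in> V" for q using V0 that by (auto simp: V_def)
  from coord_surj[OF V(1) this] obtain s where s: "s \<in> carrier (Sec F V)"
    "\<And>i. i < r \<Longrightarrow> \<forall>\<^sub>F q in gen V. \<psi> V s i q = m i q" by blast
  obtain a where a: "\<forall>j<k. a j \<in> regular X V" "s = lin k U V a e"
    using frame_coords[OF fr V(1,3) s(1)] by blast
  have "m i \<approx> (\<lambda>q. \<Sum>j<k. a j q * \<psi> U (e j) i q)" if i: "i < r" for i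
  proof -
    have "\<forall>\<^sub>F q in gen V. \<psi> V (lin k U V a e) i q = (\<Sum>j<k. a j q * \<psi> U (e j) i q)"
      by (rule lin_coord'(2)[OF U(1) V(1,3) a(1) U(2) i])
    then have "\<forall>\<^sub>F q in gen V. \<psi> V s i q = (\<Sum>j<k. a j q * \<psi> U (e j) i q)" by (simp only: a(2))
    with s(2)[OF i] have "\<forall>\<^sub>F q in gen V. m i q = (\<Sum>j<k. a j q * \<psi> U (e j) i q)" by eventually_elim simp
    then show ?thesis using gen_zopen[OF V(1,4)] by simp
  qed
  moreover have "regat p (a j)" if "j < k" for j using regular_regat[OF V(1) a(1)[rule_format, OF that] V(2)] .
  ultimately show ?thesis by blast
qed

text \<open>A relation with rational coefficients has regular coefficients on a smaller nonempty
  open set, and there coordinates with respect to the frame are unique.\<close>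

lemma frame_indep:
  assumes fr: "frame X F k U e" and U0: "U \<noteq> {}"
  shows "indep k (\<lambda>j. \<psi> U (e j))"
  unfolding indep_def
proof (intro allI impI)
  note U = frameD[OF fr]
  fix a j assume a: "(\<forall>j<k. rat (a j)) \<and> (\<forall>i<r. (\<lambda>q. \<Sum>j<k. a j q * \<psi> U (e j) i q) \<approx> (\<lambda>q. 0))"
    and j: "j < k"
  obtain V b where V: "zopen X V" "V \<noteq> {}" "V \<subseteq> U" and b: "\<And>j. j < k \<Longrightarrow> b j \<in> regular X V"
    "\<And>j. j < k \<Longrightarrow> a j \<approx> b j"
    using rat_regular_open[OF U(1) U0, of k a] a by blast
  define b' where "b' = restrict b {..<k}"
  define z where "z = (\<lambda>j\<in>{..<k}. \<lambda>p\<in>V. 0 :: complex)"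
  have z: "(\<lambda>p\<in>V. 0) \<in> regular X V" by (rule regular_const[OF V(1)])
  have mem: "b' \<in> {..<k} \<rightarrow>\<^sub>E regular X V" "z \<in> {..<k} \<rightarrow>\<^sub>E regular X V"
    using b(1) z by (auto simp: b'_def z_def)
  have c: "\<forall>j<k. b' j \<in> regular X V" "\<forall>j<k. z j \<in> regular X V" using mem by auto
  have "lin k U V b' e = lin k U V z e"
  proof (rule coord_inj[OF V(1)])
    show "lin k U V b' e \<in> carrier (Sec F V)" "lin k U V z e \<in> carrier (Sec F V)"
      by (intro lin_coord'(1)[OF U(1) V(1,3)] c U(2))+
    fix i assume i: "i < r"
    have "\<forall>\<^sub>F q in gen X. \<forall>j\<in>{..<k}. a j q = b j q" using b(2) by (intro eventually_ball_finite) auto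
    then have bz: "(\<lambda>q. \<Sum>j<k. b' j q * \<psi> U (e j) i q) \<approx> (\<lambda>q. 0)"
      using a[THEN conjunct2, rule_format, OF i] by eventually_elim (simp add: b'_def)
    show "\<forall>\<^sub>F q in gen V. \<psi> V (lin k U V b' e) i q = \<psi> V (lin k U V z e) i q"
      using lin_coord'(2)[OF U(1) V(1,3) c(1) U(2) i] lin_coord'(2)[OF U(1) V(1,3) c(2) U(2) i]
        bz[folded gen_zopen[OF V(1,2)]] eventually_gen_in
      by eventually_elim (simp add: z_def)
  qed
  moreover have "inj_on (\<lambda>a. lin k U V a e) ({..<k} \<rightarrow>\<^sub>E regular X V)"
    using fr V by (simp add: frame_def bij_betw_def)
  ultimately have "b' = z" using mem by (auto dest: inj_onD)
  then have "b j = (\<lambda>p\<in>V. 0)" using j by (metis b'_def z_def lessThan_iff restrict_apply')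
  then show "a j \<approx> (\<lambda>q. 0)"
    using b(2)[OF j] eventually_zopen[OF V(1,2)] by (auto elim: eventually_elim2)
qed

text \<open>Spanning is asked for at each point separately. The local coefficients are rational and,
  by independence, generically the same for all points of \<open>V\<close>; being regular at every
  point, they glue to regular functions on \<open>V\<close>.\<close>

lemma frameI:
  assumes U: "zopen X U" and e: "\<forall>j<k. e j \<in> carrier (Sec F U)"
    and span: "\<And>p m. p \<in> U \<Longrightarrow> C p m \<Longrightarrow>
      \<exists>a. (\<forall>j<k. regat p (a j)) \<and> (\<forall>i<r. m i \<approx> (\<lambda>q. \<Sum>j<k. a j q * \<psi> U (e j) i q))"
    and indep: "U \<noteq> {} \<Longrightarrow> indep k (\<lambda>j. \<psi> U (e j))"
  shows "frame X F k U e"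
  unfolding frame_def
proof (intro conjI allI impI)
  fix V assume "zopen X V \<and> V \<subseteq> U"
  then have V: "zopen X V" "V \<subseteq> U" by auto
  show "bij_betw (\<lambda>a. lin k U V a e) ({..<k} \<rightarrow>\<^sub>E regular X V) (carrier (Sec F V))"
    unfolding bij_betw_def
  proof (intro conjI equalityI subsetI inj_onI)
    fix a b assume ab: "a \<in> {..<k} \<rightarrow>\<^sub>E regular X V" "b \<in> {..<k} \<rightarrow>\<^sub>E regular X V"
      and eq: "lin k U V a e = lin k U V b e"
    have c: "\<forall>j<k. a j \<in> regular X V" "\<forall>j<k. b j \<in> regular X V" using ab by auto
    show "a = b"
    proof (rule PiE_ext[OF ab])
      fix j assume "j \<in> {..<k}"
      then have j: "j < k" by simp
      show "a j = b j"
      proof (rule regular_eqI[OF V(1) c(1)[rule_format, OF j] c(2)[rule_format, OF j]], cases "V = {}")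
        case False
        then obtain p where p: "p \<in> V" by blast
        then have ne: "U \<noteq> {}" using V(2) by blast
        have rr: "rat (\<lambda>q. a j q - b j q)" if "j < k" for j
          using regat_rat regular_regat[OF V(1) _ p] c that by (intro rat_diff) blast+
        have "(\<lambda>q. \<Sum>j<k. (a j q - b j q) * \<psi> U (e j) i q) \<approx> (\<lambda>q. 0)" if i: "i < r" for i
        proof -
          have "\<forall>\<^sub>F q in gen V. (\<Sum>j<k. (a j q - b j q) * \<psi> U (e j) i q) = 0"
            using lin_coord'(2)[OF U V c(1) e i] lin_coord'(2)[OF U V c(2) e i] unfolding eq
            by eventually_elim (simp add: algebra_simps sum_subtractf)
          then show ?thesis using gen_zopen[OF V(1) False] by simp
        qed
        then have "(\<lambda>q. a j q - b j q) \<approx> (\<lambda>q. 0)"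
          using indep[OF ne, unfolded indep_def, THEN spec, of "\<lambda>j q. a j q - b j q"] rr j by blast
        then have "a j \<approx> b j" by eventually_elim simp
        then show "\<forall>\<^sub>F q in gen V. a j q = b j q" using gen_zopen[OF V(1) False] by simp
      qed (simp add: gen_empty)
    qed
  next
    fix s assume "s \<in> (\<lambda>a. lin k U V a e) ` ({..<k} \<rightarrow>\<^sub>E regular X V)"
    then obtain a where a: "a \<in> {..<k} \<rightarrow>\<^sub>E regular X V" "s = lin k U V a e" by blast
    then have "\<forall>j<k. a j \<in> regular X V" by auto
    then show "s \<in> carrier (Sec F V)" unfolding a(2) by (intro lin_coord'(1)[OF U V] e)
  next
    fix s assume s: "s \<in> carrier (Sec F V)"
    have "\<exists>a. (\<forall>j<k. regat p (a j)) \<and> (\<forall>i<r. \<psi> V s i \<approx> (\<lambda>q. \<Sum>j<k. a j q * \<psi> U (e j) i q))"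
      if "p \<in> V" for p
      using span[OF _ coord_germ[OF V(1) s that]] that V(2) by blast
    then have "\<forall>p\<in>V. \<exists>a. (\<forall>j<k. regat p (a j)) \<and> (\<forall>i<r. \<psi> V s i \<approx> (\<lambda>q. \<Sum>j<k. a j q * \<psi> U (e j) i q))"
      by blast
    from bchoice[OF this] obtain a where
      "\<forall>p\<in>V. (\<forall>j<k. regat p (a p j)) \<and> (\<forall>i<r. \<psi> V s i \<approx> (\<lambda>q. \<Sum>j<k. a p j q * \<psi> U (e j) i q))" ..
    then have a: "\<And>p j. p \<in> V \<Longrightarrow> j < k \<Longrightarrow> regat p (a p j)"
      "\<And>p i. p \<in> V \<Longrightarrow> i < r \<Longrightarrow> \<psi> V s i \<approx> (\<lambda>q. \<Sum>j<k. a p j q * \<psi> U (e j) i q)" by auto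
    define b where "b = a (SOME p. p \<in> V)"
    have ab: "a p j \<approx> b j" if p: "p \<in> V" and j: "j < k" for p j
    proof -
      define p0 where "p0 = (SOME p. p \<in> V)"
      have p0: "p0 \<in> V" unfolding p0_def using p by (rule someI)
      have "expresses 1 (\<lambda>_. \<psi> V s) k (\<lambda>j. \<psi> U (e j)) (\<lambda>_. a p)"
        "expresses 1 (\<lambda>_. \<psi> V s) k (\<lambda>j. \<psi> U (e j)) (\<lambda>_. a p0)"
        using a(2)[OF p] a(2)[OF p0] by (auto simp: expresses_def)
      moreover have "U \<noteq> {}" using p V(2) by blast
      ultimately have "rat (a p j) \<Longrightarrow> rat (a p0 j) \<Longrightarrow> (\<And>l. l < k \<Longrightarrow> rat (a p l)) \<Longrightarrow>
          (\<And>l. l < k \<Longrightarrow> rat (a p0 l)) \<Longrightarrow> a p j \<approx> a p0 j"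
        using expresses_unique[OF indep, of 1 "\<lambda>_. \<psi> V s" "\<lambda>_. a p" "\<lambda>_. a p0" 0 j] j by simp
      then show ?thesis
        using regat_rat[OF a(1)[OF p]] regat_rat[OF a(1)[OF p0]] j by (simp add: b_def p0_def)
    qed
    have "\<exists>f. f \<in> regular X V \<and> (\<forall>\<^sub>F q in gen V. f q = b j q)" if j: "j < k" for j
    proof -
      have "ordge p (b j) 0" if p: "p \<in> V" for p
        using ordge_cong[OF regat_ordge[OF a(1)[OF p j]] ab[OF p j]] .
      from regular_glue[OF V(1) this] show ?thesis by blast
    qed
    from choice_less[OF this] obtain f where
      "\<forall>j<k. f j \<in> regular X V \<and> (\<forall>\<^sub>F q in gen V. f j q = b j q)" ..
    then have f: "\<And>j. j < k \<Longrightarrow> f j \<in> regular X V"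
      "\<And>j. j < k \<Longrightarrow> \<forall>\<^sub>F q in gen V. f j q = b j q" by simp_all
    define f' where "f' = restrict f {..<k}"
    have f': "f' \<in> {..<k} \<rightarrow>\<^sub>E regular X V" "\<forall>j<k. f' j \<in> regular X V"
      using f(1) by (auto simp: f'_def)
    have "s = lin k U V f' e"
    proof (rule coord_inj[OF V(1) s lin_coord'(1)[OF U V f'(2) e]])
      fix i assume i: "i < r"
      have fb: "\<forall>\<^sub>F q in gen V. \<forall>j\<in>{..<k}. f' j q = b j q"
        using f(2) by (intro eventually_ball_finite) (auto simp: f'_def)
      have sb: "\<forall>\<^sub>F q in gen V. \<psi> V s i q = (\<Sum>j<k. b j q * \<psi> U (e j) i q)"
      proof (cases "V = {}")
        case False
        then have "(SOME p. p \<in> V) \<in> V" using some_in_eq by blast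
        from a(2)[OF this i] show ?thesis using gen_zopen[OF V(1) False] by (simp add: b_def)
      qed (simp add: gen_empty)
      show "\<forall>\<^sub>F q in gen V. \<psi> V s i q = \<psi> V (lin k U V f' e) i q"
        using lin_coord'(2)[OF U V f'(2) e i] fb sb by eventually_elim simp
    qed
    then show "s \<in> (\<lambda>a. lin k U V a e) ` ({..<k} \<rightarrow>\<^sub>E regular X V)" using f'(1) by blast
  qed
qed (use U e in auto)

lemma frame_expresses:
  assumes "frame X F k U e" "frame X F k' U' e'" "p \<in> U" "p \<in> U'"
  obtains A where "\<forall>j<k. \<forall>l<k'. regat p (A j l)"
    "expresses k (\<lambda>j. \<psi> U (e j)) k' (\<lambda>j. \<psi> U' (e' j)) A"
proof -
  have "\<exists>a. (\<forall>l<k'. regat p (a l)) \<and> (\<forall>i<r. \<psi> U (e j) i \<approx> (\<lambda>q. \<Sum>l<k'. a l q * \<psi> U' (e' l) i q))"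
    if "j < k" for j
    using frame_span[OF assms(2,4) coord_germ[OF frameD(1)[OF assms(1)] frameD(2)[OF assms(1), rule_format, OF that] assms(3)]] .
  from choice_less[OF this] obtain A where A: "\<forall>j<k. (\<forall>l<k'. regat p (A j l)) \<and>
    (\<forall>i<r. \<psi> U (e j) i \<approx> (\<lambda>q. \<Sum>l<k'. A j l q * \<psi> U' (e' l) i q))" ..
  show ?thesis by (rule that[of A]) (use A in \<open>simp_all add: expresses_def\<close>)
qed

lemma frame_inverse:
  assumes "frame X F k U e" "frame X F k' U' e'" "U \<noteq> {}"
    "\<forall>j<k. \<forall>l<k'. rat (A j l)" "expresses k (\<lambda>j. \<psi> U (e j)) k' (\<lambda>j. \<psi> U' (e' j)) A"
    "\<forall>j<k'. \<forall>l<k. rat (B j l)" "expresses k' (\<lambda>j. \<psi> U' (e' j)) k (\<lambda>j. \<psi> U (e j)) B"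
  shows "\<forall>\<^sub>F q in gen X. \<forall>j<k. \<forall>l<k. (\<Sum>m<k'. A j m q * B m l q) = (if j = l then 1 else 0)"
proof (rule eventually_all2)
  fix j l assume jl: "j < k" "l < k"
  show "\<forall>\<^sub>F q in gen X. (\<Sum>m<k'. A j m q * B m l q) = (if j = l then 1 else 0)"
    by (rule expresses_unique[OF frame_indep[OF assms(1,3)] expresses_trans[OF assms(5,7)] expresses_refl _ _ jl])
      (use assms(4,6) jl in \<open>auto intro!: rat_sum rat_mult rat_const\<close>)
qed

lemma regat_rat_matrix: "\<forall>j<k. \<forall>l<k'. regat p (A j l) \<Longrightarrow> \<forall>j<(k::nat). \<forall>l<(k'::nat). rat (A j l)"
  using regat_rat by blast

text \<open>The matrices \<open>A\<close> and \<open>B\<close> of the two changes of frame satisfy \<open>A B = 1\<close> and \<open>B A = 1\<close>, and the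
  traces of the two products agree.\<close>

lemma frame_rank_unique:
  assumes fr: "frame X F k U e" "frame X F k' U' e'" and ne: "U \<noteq> {}" "U' \<noteq> {}"
  shows "k = k'"
proof -
  obtain p where p: "p \<in> U" "p \<in> U'"
    using zopen_Int_nonempty[OF frameD(1)[OF fr(1)] frameD(1)[OF fr(2)] ne] by blast
  obtain A where A: "\<forall>j<k. \<forall>l<k'. regat p (A j l)"
    "expresses k (\<lambda>j. \<psi> U (e j)) k' (\<lambda>j. \<psi> U' (e' j)) A" using frame_expresses[OF fr p] by blast
  obtain B where B: "\<forall>j<k'. \<forall>l<k. regat p (B j l)"
    "expresses k' (\<lambda>j. \<psi> U' (e' j)) k (\<lambda>j. \<psi> U (e j)) B" using frame_expresses[OF fr(2,1) p(2,1)] by blast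
  have "\<forall>\<^sub>F q in gen X. \<forall>j<k. \<forall>l<k. (\<Sum>m<k'. A j m q * B m l q) = (if j = l then 1 else 0)"
    using frame_inverse[OF fr ne(1) regat_rat_matrix[OF A(1)] A(2) regat_rat_matrix[OF B(1)] B(2)] .
  moreover have "\<forall>\<^sub>F q in gen X. \<forall>j<k'. \<forall>l<k'. (\<Sum>m<k. B j m q * A m l q) = (if j = l then 1 else 0)"
    using frame_inverse[OF fr(2,1) ne(2) regat_rat_matrix[OF B(1)] B(2) regat_rat_matrix[OF A(1)] A(2)] .
  ultimately have "\<forall>\<^sub>F q in gen X. (of_nat k :: complex) = of_nat k'"
  proof eventually_elim
    case (elim q)
    have "(of_nat k :: complex) = (\<Sum>j<k. \<Sum>m<k'. A j m q * B m j q)" using elim(1) by simp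
    also have "\<dots> = (\<Sum>m<k'. \<Sum>j<k. B m j q * A j m q)"
      by (subst sum.swap) (simp add: mult.commute)
    also have "\<dots> = of_nat k'" using elim(2) by simp
    finally show ?case .
  qed
  then have "(of_nat k :: complex) = of_nat k'"
    using gen_nontrivial by (simp add: eventually_const_iff)
  then show ?thesis by simp
qed

text \<open>The changes of frame in the two directions are regular at \<open>p\<close> and inverse
  to each other, so the product of their determinants is 1 and neither vanishes at
  \<open>p\<close>.\<close>

lemma frame_det_unit:
  assumes fr: "frame X F k U e" "frame X F k U' e'" and p: "p \<in> U" "p \<in> U'" and k: "k \<le> 2"
    and A: "\<forall>j<k. \<forall>l<k. rat (A j l)" "expresses k (\<lambda>j. \<psi> U (e j)) k (\<lambda>j. \<psi> U' (e' j)) A"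
  shows "hasord p (\<lambda>q. leibniz_det k (\<lambda>j l. A j l q)) 0"
proof -
  have pX: "p \<in> X" using p zopen_subset[OF frameD(1)[OF fr(1)]] by auto
  have ne: "U \<noteq> {}" "U' \<noteq> {}" using p by auto
  obtain A' where A': "\<forall>j<k. \<forall>l<k. regat p (A' j l)"
    "expresses k (\<lambda>j. \<psi> U (e j)) k (\<lambda>j. \<psi> U' (e' j)) A'" using frame_expresses[OF fr p] by blast
  obtain B where B: "\<forall>j<k. \<forall>l<k. regat p (B j l)"
    "expresses k (\<lambda>j. \<psi> U' (e' j)) k (\<lambda>j. \<psi> U (e j)) B" using frame_expresses[OF fr(2,1) p(2,1)] by blast
  have "(\<lambda>q. leibniz_det k (\<lambda>j l. A' j l q) * leibniz_det k (\<lambda>j l. B j l q)) \<approx> (\<lambda>q. 1)"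
    using frame_inverse[OF fr ne(1) regat_rat_matrix[OF A'(1)] A'(2) regat_rat_matrix[OF B(1)] B(2)]
  proof eventually_elim
    case (elim q)
    have "leibniz_det k (\<lambda>j l. A' j l q) * leibniz_det k (\<lambda>j l. B j l q) =
      leibniz_det k (\<lambda>j l. \<Sum>m<k. A' j m q * B m l q)" by (rule leibniz_det_mult[OF k, symmetric])
    also have "\<dots> = leibniz_det k (\<lambda>j l. if j = l then 1 else 0)" by (rule leibniz_det_cong) (use elim in auto)
    finally show ?case using leibniz_det_id[OF k] by simp
  qed
  then have "leibniz_det k (\<lambda>j l. A' j l p) * leibniz_det k (\<lambda>j l. B j l p) = 1"
    by (intro regat_eq[OF regat_mult[OF regat_det regat_det] regat_const])
      (use pX A'(1) B(1) in auto)
  then have "hasord p (\<lambda>q. leibniz_det k (\<lambda>j l. A' j l q)) 0"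
    by (intro hasord_unit regat_det) (use pX A'(1) in auto)
  moreover have "(\<lambda>q. leibniz_det k (\<lambda>j l. A' j l q)) \<approx> (\<lambda>q. leibniz_det k (\<lambda>j l. A j l q))"
  proof -
    have "\<forall>\<^sub>F q in gen X. \<forall>j<k. \<forall>l<k. A' j l q = A j l q"
    proof (rule eventually_all2)
      fix j l assume jl: "j < k" "l < k"
      show "A' j l \<approx> A j l"
        by (rule expresses_unique[OF frame_indep[OF fr(2) ne(2)] A'(2) A(2) _ _ jl])
          (use regat_rat_matrix[OF A'(1)] A(1) jl in auto)
    qed
    then show ?thesis by eventually_elim (auto intro: leibniz_det_cong)
  qed
  ultimately show ?thesis by (rule hasord_cong)
qed

lemma bundle_rank_eq:
  assumes "vector_bundle X F k"
  shows "bundle_rank X F = k"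
  unfolding bundle_rank_def
proof (rule the_equality)
  show "vector_bundle X F k" by (rule assms)
  fix k' assume k': "vector_bundle X F k'"
  obtain p where "p \<in> X" using X_nonempty by blast
  then obtain U e U' e' where "p \<in> U" "frame X F k' U e" "p \<in> U'" "frame X F k U' e'"
    using assms k' unfolding vector_bundle_def by meson
  then show "k' = k" using frame_rank_unique[of k' U e k U' e'] by auto
qed

text \<open>\<open>det_order\<close> speaks of regular coefficients over an intersection of domains.
  Here and in \<open>det_orderI\<close> these are exchanged for matrices of rational functions,
  which can be composed without regard to domains.\<close>

lemma det_orderE:
  assumes "det_order X F k U e p d" "frame X F k U e" "U \<noteq> {}" "p \<in> X"
  obtains U' e' A where "p \<in> U'" "frame X F k U' e'" "\<forall>j<k. \<forall>l<k. rat (A j l)"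
    "expresses k (\<lambda>j. \<psi> U (e j)) k (\<lambda>j. \<psi> U' (e' j)) A" "hasord p (\<lambda>q. leibniz_det k (\<lambda>j l. A j l q)) d"
proof -
  obtain U' e' a where *: "p \<in> U'" "frame X F k U' e'"
     "\<forall>j<k. \<forall>i<k. a j i \<in> regular X (U \<inter> U')"
     "\<forall>j<k. Res F U (U \<inter> U') (e j) = lin k U' (U \<inter> U') (a j) e'"
     "has_order X p (U \<inter> U') (\<lambda>q. leibniz_det k (\<lambda>j l. a j l q)) d"
    using assms(1) unfolding det_order_def leibniz_det_def by blast
  note U = frameD[OF assms(2)] and U' = frameD[OF *(2)]
  have V: "zopen X (U \<inter> U')" "U \<inter> U' \<noteq> {}"
    using zopen_Int[OF U(1) U'(1)] zopen_Int_nonempty[OF U(1) U'(1) assms(3)] *(1) by auto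
  show ?thesis
  proof (rule that[OF *(1,2)])
    obtain q where "q \<in> U \<inter> U'" using V by blast
    then show "\<forall>j<k. \<forall>l<k. rat (a j l)"
      using *(3) regular_regat[OF V(1)] regat_rat by blast
    show "hasord p (\<lambda>q. leibniz_det k (\<lambda>j l. a j l q)) d"
      using *(5) has_order_iff[OF V assms(4)] by blast
    show "expresses k (\<lambda>j. \<psi> U (e j)) k (\<lambda>j. \<psi> U' (e' j)) a"
      unfolding expresses_def
    proof (intro allI impI)
      fix j i assume j: "j < k" and i: "i < r"
      have "\<forall>\<^sub>F q in gen (U \<inter> U'). \<psi> (U \<inter> U') (lin k U' (U \<inter> U') (a j) e') i q = (\<Sum>l<k. a j l q * \<psi> U' (e' l) i q)"
        using *(3) j by (intro lin_coord'(2)[OF U'(1) V(1) _ _ U'(2) i]) auto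
      then have "\<forall>\<^sub>F q in gen (U \<inter> U'). \<psi> (U \<inter> U') (Res F U (U \<inter> U') (e j)) i q = (\<Sum>l<k. a j l q * \<psi> U' (e' l) i q)"
        using *(4) j by simp
      then have "\<forall>\<^sub>F q in gen (U \<inter> U'). \<psi> U (e j) i q = (\<Sum>l<k. a j l q * \<psi> U' (e' l) i q)"
        using coord_res[OF U(1) V(1) _ U(2)[rule_format, OF j] i] by (auto elim: eventually_elim2)
      then show "\<psi> U (e j) i \<approx> (\<lambda>q. \<Sum>l<k. a j l q * \<psi> U' (e' l) i q)" using gen_zopen[OF V] by simp
    qed
  qed
qed

lemma det_orderI:
  assumes fr: "frame X F k U e" "U \<noteq> {}" and p: "p \<in> U'" and fr': "frame X F k U' e'"
    and A: "\<forall>j<k. \<forall>l<k. rat (A j l)"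
    "expresses k (\<lambda>j. \<psi> U (e j)) k (\<lambda>j. \<psi> U' (e' j)) A" "hasord p (\<lambda>q. leibniz_det k (\<lambda>j l. A j l q)) d"
  shows "det_order X F k U e p d"
proof -
  note U = frameD[OF fr(1)] and U' = frameD[OF fr']
  have pX: "p \<in> X" using p zopen_subset[OF U'(1)] by auto
  have V: "zopen X (U \<inter> U')" "U \<inter> U' \<noteq> {}"
    using zopen_Int[OF U(1) U'(1)] zopen_Int_nonempty[OF U(1) U'(1) fr(2)] p by auto
  have "\<exists>a. (\<forall>l<k. a l \<in> regular X (U \<inter> U')) \<and> Res F U (U \<inter> U') (e j) = lin k U' (U \<inter> U') a e'" if "j < k" for j
    by (rule frame_coords[OF fr' V(1) Int_lower2 res_closed[OF U(1) V(1) Int_lower1 U(2)[rule_format, OF that]]]) blast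
  from choice_less[OF this] obtain a where
    "\<forall>j<k. (\<forall>l<k. a j l \<in> regular X (U \<inter> U')) \<and> Res F U (U \<inter> U') (e j) = lin k U' (U \<inter> U') (a j) e'" ..
  then have a: "\<And>j l. j < k \<Longrightarrow> l < k \<Longrightarrow> a j l \<in> regular X (U \<inter> U')"
    "\<And>j. j < k \<Longrightarrow> Res F U (U \<inter> U') (e j) = lin k U' (U \<inter> U') (a j) e'" by simp_all
  have ex: "expresses k (\<lambda>j. \<psi> U (e j)) k (\<lambda>j. \<psi> U' (e' j)) a"
    unfolding expresses_def
  proof (intro allI impI)
    fix j i assume j: "j < k" and i: "i < r"
    have "\<forall>\<^sub>F q in gen (U \<inter> U'). \<psi> (U \<inter> U') (lin k U' (U \<inter> U') (a j) e') i q = (\<Sum>l<k. a j l q * \<psi> U' (e' l) i q)"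
      using a(1) j by (intro lin_coord'(2)[OF U'(1) V(1) _ _ U'(2) i]) auto
    then have "\<forall>\<^sub>F q in gen (U \<inter> U'). \<psi> (U \<inter> U') (Res F U (U \<inter> U') (e j)) i q = (\<Sum>l<k. a j l q * \<psi> U' (e' l) i q)"
      using a(2) j by simp
    then have "\<forall>\<^sub>F q in gen (U \<inter> U'). \<psi> U (e j) i q = (\<Sum>l<k. a j l q * \<psi> U' (e' l) i q)"
      using coord_res[OF U(1) V(1) _ U(2)[rule_format, OF j] i] by (auto elim: eventually_elim2)
    then show "\<psi> U (e j) i \<approx> (\<lambda>q. \<Sum>l<k. a j l q * \<psi> U' (e' l) i q)" using gen_zopen[OF V] by simp
  qed
  obtain q where q: "q \<in> U \<inter> U'" using V by blast
  have "\<forall>\<^sub>F q in gen X. \<forall>j<k. \<forall>l<k. A j l q = a j l q"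
  proof (rule eventually_all2)
    fix j l assume jl: "j < k" "l < k"
    show "A j l \<approx> a j l"
      by (rule expresses_unique[OF frame_indep[OF fr'] A(2) ex _ _ jl])
        (use A(1) regat_rat[OF regular_regat[OF V(1) a(1) q]] jl p in auto)
  qed
  then have "(\<lambda>q. leibniz_det k (\<lambda>j l. A j l q)) \<approx> (\<lambda>q. leibniz_det k (\<lambda>j l. a j l q))"
    by eventually_elim (auto intro: leibniz_det_cong)
  then have "has_order X p (U \<inter> U') (\<lambda>q. leibniz_det k (\<lambda>j l. a j l q)) d"
    by (rule iffD2[OF has_order_iff[OF V pX] hasord_cong[OF A(3)]])
  then have h: "has_order X p (U \<inter> U') (\<lambda>q. \<Sum>\<pi> | \<pi> permutes {..<k}. of_int (sign \<pi>) * (\<Prod>j<k. a j (\<pi> j) q)) d"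
    by (simp only: leibniz_det_def)
  show ?thesis
    unfolding det_order_def
  proof (rule exI[of _ U'], rule exI[of _ e'], rule exI[of _ a], intro conjI allI impI)
    show "a j i \<in> regular X (U \<inter> U')" if "j < k" "i < k" for j i by (rule a(1)[OF that])
    show "Res F U (U \<inter> U') (e j) = lin k U' (U \<inter> U') (a j) e'" if "j < k" for j by (rule a(2)[OF that])
  qed (fact p fr' h)+
qed

end

section \<open>The degree of a bundle is well defined\<close>

locale proper_sheaf_model = proper_curve X + sheaf_model X F r C \<psi>
  for X :: "('n::finite) pt set" and F :: "('n, 'm) sheaf" and r C \<psi>
begin

text \<open>The degree is a definite description, so every other frame has to give
  \<open>deg D\<close> as well. Two frames differ generically by a matrix with determinant
  \<open>f\<close>, their divisors differ by the divisor of \<open>f\<close>, and this has degree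
  zero by \<open>deg_ord\<close>.\<close>

lemma bundle_degreeI:
  assumes fr: "frame X F k U e" "U \<noteq> {}" and k: "k \<le> 2" and D: "finsupp D"
    and loc: "\<And>p. p \<in> X \<Longrightarrow> \<exists>U' e' A. p \<in> U' \<and> frame X F k U' e' \<and> (\<forall>j<k. \<forall>l<k. rat (A j l)) \<and>
      expresses k (\<lambda>j. \<psi> U (e j)) k (\<lambda>j. \<psi> U' (e' j)) A \<and> hasord p (\<lambda>q. leibniz_det k (\<lambda>j l. A j l q)) (D p)"
  shows "bundle_degree X F = deg D"
  unfolding bundle_degree_def
proof (rule the_equality)
  have "det_order X F k U e p (D p)" if "p \<in> X" for p
    using loc[OF that] det_orderI[OF fr] by blast
  then show "\<exists>k U e ord. U \<noteq> {} \<and> frame X F k U e \<and> (\<forall>p\<in>X. det_order X F k U e p (ord p)) \<and>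
    deg D = (\<Sum>p | p \<in> X \<and> ord p \<noteq> 0. ord p)"
    using fr by (intro exI[of _ k] exI[of _ U] exI[of _ e] exI[of _ D]) (auto simp: deg_def)
next
  fix d assume "\<exists>k U e ord. U \<noteq> {} \<and> frame X F k U e \<and> (\<forall>p\<in>X. det_order X F k U e p (ord p)) \<and>
    d = (\<Sum>p | p \<in> X \<and> ord p \<noteq> 0. ord p)"
  then obtain k2 U2 e2 D2 where 2: "U2 \<noteq> {}" "frame X F k2 U2 e2"
    "\<forall>p\<in>X. det_order X F k2 U2 e2 p (D2 p)" and d: "d = deg D2" unfolding deg_def by blast
  have "k2 = k" using frame_rank_unique[OF 2(2) fr(1) 2(1) fr(2)] .
  then have 2: "U2 \<noteq> {}" "frame X F k U2 e2" "\<And>p. p \<in> X \<Longrightarrow> det_order X F k U2 e2 p (D2 p)"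
    using 2 by auto
  obtain q0 where q0: "q0 \<in> U2" "q0 \<in> U"
    using zopen_Int_nonempty[OF frameD(1)[OF 2(2)] frameD(1)[OF fr(1)] 2(1) fr(2)] by blast
  obtain A0 where A0: "\<forall>j<k. \<forall>l<k. regat q0 (A0 j l)"
    "expresses k (\<lambda>j. \<psi> U2 (e2 j)) k (\<lambda>j. \<psi> U (e j)) A0" using frame_expresses[OF 2(2) fr(1) q0] by blast
  have A0r: "\<forall>j<k. \<forall>l<k. rat (A0 j l)" by (rule regat_rat_matrix[OF A0(1)])
  define f where "f = (\<lambda>q. leibniz_det k (\<lambda>j l. A0 j l q))"
  have f: "nz f" unfolding f_def
    using hasord_nz[OF frame_det_unit[OF 2(2) fr(1) q0 k A0r A0(2)]] .
  have "D2 p = ord p f + D p" if p: "p \<in> X" for p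
  proof -
    obtain U' e' A where A: "p \<in> U'" "frame X F k U' e'" "\<forall>j<k. \<forall>l<k. rat (A j l)"
      "expresses k (\<lambda>j. \<psi> U (e j)) k (\<lambda>j. \<psi> U' (e' j)) A" "hasord p (\<lambda>q. leibniz_det k (\<lambda>j l. A j l q)) (D p)"
      using loc[OF p] by blast
    obtain U2' e2' A2 where A2: "p \<in> U2'" "frame X F k U2' e2'" "\<forall>j<k. \<forall>l<k. rat (A2 j l)"
      "expresses k (\<lambda>j. \<psi> U2 (e2 j)) k (\<lambda>j. \<psi> U2' (e2' j)) A2"
      "hasord p (\<lambda>q. leibniz_det k (\<lambda>j l. A2 j l q)) (D2 p)"
      using det_orderE[OF 2(3)[OF p] 2(2,1) p] by metis
    obtain G where G: "\<forall>j<k. \<forall>l<k. regat p (G j l)"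
      "expresses k (\<lambda>j. \<psi> U' (e' j)) k (\<lambda>j. \<psi> U2' (e2' j)) G" using frame_expresses[OF A(2) A2(2) A(1) A2(1)] by blast
    have Gr: "\<forall>j<k. \<forall>l<k. rat (G j l)" by (rule regat_rat_matrix[OF G(1)])
    have Gu: "hasord p (\<lambda>q. leibniz_det k (\<lambda>j l. G j l q)) 0"
      by (rule frame_det_unit[OF A(2) A2(2) A(1) A2(1) k Gr G(2)])
    \<comment> \<open>The frame \<open>e2\<close> is expressed through the local frame
      \<open>e2'\<close> by way of \<open>e\<close> and \<open>e'\<close>. Determinants multiply,
      and that of \<open>G\<close> is a unit at \<open>p\<close>, so \<open>D2 p\<close> is the sum
      of \<open>ord p f\<close> and \<open>D p\<close>.\<close>
    define P where "P = (\<lambda>j l q. \<Sum>m<k. (\<Sum>i<k. A0 j i q * A i m q) * G m l q)"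
    have P: "expresses k (\<lambda>j. \<psi> U2 (e2 j)) k (\<lambda>j. \<psi> U2' (e2' j)) P"
      unfolding P_def by (rule expresses_trans[OF expresses_trans[OF A0(2) A(4)] G(2)])
    have Pr: "rat (P j l)" if "j < k" "l < k" for j l
      unfolding P_def using that A0r A(3) Gr by (intro rat_sum rat_mult) auto
    have "\<forall>\<^sub>F q in gen X. \<forall>j<k. \<forall>l<k. P j l q = A2 j l q"
    proof (rule eventually_all2)
      fix j l assume jl: "j < k" "l < k"
      show "P j l \<approx> A2 j l"
        by (rule expresses_unique[OF frame_indep[OF A2(2)] P A2(4) _ _ jl]) (use Pr A2(1,3) jl in auto)
    qed
    then have eq: "(\<lambda>q. (f q * leibniz_det k (\<lambda>j l. A j l q)) * leibniz_det k (\<lambda>j l. G j l q)) \<approx>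
      (\<lambda>q. leibniz_det k (\<lambda>j l. A2 j l q))"
    proof eventually_elim
      case (elim q)
      have "leibniz_det k (\<lambda>j l. A2 j l q) = leibniz_det k (\<lambda>j l. P j l q)"
        by (rule leibniz_det_cong) (use elim in auto)
      also have "\<dots> = leibniz_det k (\<lambda>j m. \<Sum>i<k. A0 j i q * A i m q) * leibniz_det k (\<lambda>j l. G j l q)"
        unfolding P_def by (rule leibniz_det_mult[OF k])
      also have "leibniz_det k (\<lambda>j m. \<Sum>i<k. A0 j i q * A i m q) = f q * leibniz_det k (\<lambda>j l. A j l q)"
        unfolding f_def by (rule leibniz_det_mult[OF k])
      finally show ?case by simp
    qed
    have "hasord p (\<lambda>q. (f q * leibniz_det k (\<lambda>j l. A j l q)) * leibniz_det k (\<lambda>j l. G j l q)) (ord p f + D p + 0)"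
      by (intro hasord_mult hasord_ord f p A(5) Gu)
    from hasord_unique[OF hasord_cong[OF this eq] A2(5)] show ?thesis by simp
  qed
  then have "d = deg (\<lambda>p. ord p f + D p)" unfolding d by (rule deg_cong)
  also have "\<dots> = deg D" using deg_add[OF finsupp_ord[OF f] D] deg_ord[OF f] by simp
  finally show "d = deg D" .
qed

end

section \<open>Line bundles and divisors\<close>

context smooth_curve
begin

text \<open>The germs of the sheaf O(D), with poles of order at most \<open>D p\<close>. Only entry
  0 is constrained, because the tuples in question have length 1.\<close>

definition line_germ :: "('n pt \<Rightarrow> int) \<Rightarrow> 'n pt \<Rightarrow> (nat \<Rightarrow> 'n pt \<Rightarrow> complex) \<Rightarrow> bool" where
  "line_germ D p m \<longleftrightarrow> ordge p (m 0) (- D p)"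

lemma open_of_cofinite:
  assumes "\<forall>\<^sub>F q in gen X. P q" "p \<in> X" "P p"
  shows "\<exists>V. zopen X V \<and> p \<in> V \<and> (\<forall>q\<in>V. P q)"
proof -
  have "finite {q \<in> X. \<not> P q}" using assms(1) by (simp add: eventually_gen)
  then have "zopen X (X - {q \<in> X. \<not> P q})" by (rule zopen_diff_finite[OF zopen_X])
  then show ?thesis using assms(2,3) by (intro exI[of _ "X - {q \<in> X. \<not> P q}"]) auto
qed

lemma line_germ:
  shows "p \<in> X \<Longrightarrow> line_germ D p (\<lambda>i q. 0)"
    "p \<in> X \<Longrightarrow> line_germ D p m \<Longrightarrow> line_germ D p m' \<Longrightarrow> line_germ D p (\<lambda>i q. m i q + m' i q)"
    "p \<in> X \<Longrightarrow> regat p a \<Longrightarrow> line_germ D p m \<Longrightarrow> line_germ D p (\<lambda>i q. a q * m i q)"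
    "p \<in> X \<Longrightarrow> line_germ D p m \<Longrightarrow> (\<And>i. i < (1::nat) \<Longrightarrow> m i \<approx> m' i) \<Longrightarrow> line_germ D p m'"
    "finsupp D \<Longrightarrow> p \<in> X \<Longrightarrow> line_germ D p m \<Longrightarrow> \<exists>V. zopen X V \<and> p \<in> V \<and> (\<forall>q\<in>V. line_germ D q m)"
proof -
  show "p \<in> X \<Longrightarrow> line_germ D p (\<lambda>i q. 0)" using ordge_zero by (simp add: line_germ_def)
  show "p \<in> X \<Longrightarrow> line_germ D p m \<Longrightarrow> line_germ D p m' \<Longrightarrow> line_germ D p (\<lambda>i q. m i q + m' i q)"
    using ordge_add by (simp add: line_germ_def)
  show "p \<in> X \<Longrightarrow> regat p a \<Longrightarrow> line_germ D p m \<Longrightarrow> line_germ D p (\<lambda>i q. a q * m i q)"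
    using ordge_mult[OF regat_ordge[of p a], of "m 0" "- D p"] by (simp add: line_germ_def)
  show "p \<in> X \<Longrightarrow> line_germ D p m \<Longrightarrow> (\<And>i. i < (1::nat) \<Longrightarrow> m i \<approx> m' i) \<Longrightarrow> line_germ D p m'"
    using ordge_cong[of p "m 0" "- D p" "m' 0"] by (simp add: line_germ_def)
  assume D: "finsupp D" and p: "p \<in> X" and m: "line_germ D p m"
  have "rat (m 0)" using m ordge_rat by (simp add: line_germ_def)
  then have "\<forall>\<^sub>F q in gen X. ordge q (m 0) 0" by (rule rat_ordge_cofinite)
  moreover have "\<forall>\<^sub>F q in gen X. D q = 0" using D by (simp add: finsupp_def eventually_gen)
  ultimately have "\<forall>\<^sub>F q in gen X. line_germ D q m" by eventually_elim (simp add: line_germ_def)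
  then show "\<exists>V. zopen X V \<and> p \<in> V \<and> (\<forall>q\<in>V. line_germ D q m)" using p m by (rule open_of_cofinite)
qed

end

locale line_model = sheaf_model X F 1 "smooth_curve.line_germ X D" \<psi>
  for X :: "('n::finite) pt set" and F :: "('n, 'm) sheaf" and D \<psi> +
  assumes finsupp_D: "finsupp D"
begin

lemma line_coord_germ: "zopen X U \<Longrightarrow> s \<in> carrier (Sec F U) \<Longrightarrow> p \<in> U \<Longrightarrow> ordge p (\<psi> U s 0) (- D p)"
  using coord_germ by (simp add: line_germ_def)

lemma line_coord_surj:
  assumes "zopen X U" "\<And>p. p \<in> U \<Longrightarrow> ordge p f (- D p)"
  obtains s where "s \<in> carrier (Sec F U)" "\<forall>\<^sub>F q in gen U. \<psi> U s 0 q = f q"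
  using coord_surj[OF assms(1), of "\<lambda>i. f"] assms(2) by (auto simp: line_germ_def)

lemma generatorI:
  assumes U: "zopen X U" and e: "e \<in> carrier (Sec F U)"
    and ord: "\<And>p. p \<in> U \<Longrightarrow> hasord p (\<psi> U e 0) (- D p)"
  shows "generator X F U e"
proof (rule frameI[OF U])
  show "\<forall>j<1. e \<in> carrier (Sec F U)" using e by simp
  fix p m assume p: "p \<in> U" and "line_germ D p m"
  then have m: "ordge p (m 0) (- D p)" by (simp add: line_germ_def)
  have "ordge p (\<lambda>q. m 0 q * inverse (\<psi> U e 0 q)) (- D p + - (- D p))"
    by (intro ordge_mult m hasord_ordge hasord_inverse ord p)
  then have "ordge p (\<lambda>q. m 0 q * inverse (\<psi> U e 0 q)) 0" by simp
  then obtain u where u: "regat p u" "(\<lambda>q. m 0 q * inverse (\<psi> U e 0 q)) \<approx> u" by (auto simp: ordge_0_iff)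
  from u(2) nz_nonzero[OF hasord_nz[OF ord[OF p]]] have "m 0 \<approx> (\<lambda>q. u q * \<psi> U e 0 q)"
    by eventually_elim (auto simp: field_simps)
  then show "\<exists>a. (\<forall>j<1::nat. regat p (a j)) \<and> (\<forall>i<1. m i \<approx> (\<lambda>q. \<Sum>j<1. a j q * \<psi> U e i q))"
    using u(1) by (intro exI[of _ "\<lambda>j. u"]) simp
next
  assume "U \<noteq> {}"
  then obtain p where p: "p \<in> U" by blast
  show "indep 1 (\<lambda>j. \<psi> U e)"
    unfolding indep_def
  proof (intro allI impI)
    fix a :: "nat \<Rightarrow> 'n pt \<Rightarrow> complex" and j :: nat
    assume a: "(\<forall>j<1. rat (a j)) \<and> (\<forall>i<1. (\<lambda>q. \<Sum>j<1. a j q * \<psi> U e i q) \<approx> (\<lambda>q. 0))" and "j < 1"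
    then have "(\<lambda>q. a j q * \<psi> U e 0 q) \<approx> (\<lambda>q. 0)" by simp
    then show "a j \<approx> (\<lambda>q. 0)"
      using nz_nonzero[OF hasord_nz[OF ord[OF p]]] by eventually_elim simp
  qed
qed

lemma generatorD:
  assumes "generator X F U e"
  shows "zopen X U" "e \<in> carrier (Sec F U)"
  using frameD[OF assms] by auto

text \<open>The function \<open>t^(- D p)\<close> is a germ of O(D) at \<open>p\<close>, hence a
  regular multiple of the generator; so the order of the generator cannot exceed
  \<open>- D p\<close>.\<close>

lemma generator_ord:
  assumes gen: "generator X F U e" and p: "p \<in> U"
  shows "hasord p (\<psi> U e 0) (- D p)"
proof -
  note U = generatorD[OF gen]
  have pX: "p \<in> X" using zopen_subset[OF U(1)] p by auto
  have t: "hasord p (\<lambda>q. unif p q powi (- D p)) (- D p)" using hasord_powi[OF hasord_unif[OF pX], of "- D p"] by simp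
  have "line_germ D p (\<lambda>i q. unif p q powi (- D p))" using hasord_ordge[OF t] by (simp add: line_germ_def)
  from frame_span[OF gen p this] obtain a where a: "regat p (a (0::nat))"
    "(\<lambda>q. unif p q powi (- D p)) \<approx> (\<lambda>q. a 0 q * \<psi> U e 0 q)" by auto
  have "\<not> ordge p (\<psi> U e 0) (- D p + 1)"
  proof
    assume "ordge p (\<psi> U e 0) (- D p + 1)"
    from ordge_mult[OF regat_ordge[OF a(1)] this] have "ordge p (\<lambda>q. a 0 q * \<psi> U e 0 q) (- D p + 1)" by simp
    moreover have "(\<lambda>q. a 0 q * \<psi> U e 0 q) \<approx> (\<lambda>q. unif p q powi (- D p))"
      using a(2) by eventually_elim simp
    ultimately have "ordge p (\<lambda>q. unif p q powi (- D p)) (- D p + 1)" by (rule ordge_cong)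
    then show False using hasord_ordge_iff[OF t] by simp
  qed
  then show ?thesis using ordge_exact[OF line_coord_germ[OF U p]] by blast
qed

lemma generator_restrict:
  assumes gen: "generator X F U e" and V: "zopen X V" "V \<subseteq> U"
  shows "generator X F V (Res F U V e)"
proof (rule generatorI[OF V(1)])
  note U = generatorD[OF gen]
  show "Res F U V e \<in> carrier (Sec F V)" by (rule res_closed[OF U(1) V U(2)])
  fix p assume p: "p \<in> V"
  have "\<forall>\<^sub>F q in gen V. \<psi> V (Res F U V e) 0 q = \<psi> U e 0 q" using coord_res[OF U(1) V U(2)] by simp
  moreover have "gen V = gen X" using gen_zopen[OF V(1)] p by blast
  ultimately have "\<psi> U e 0 \<approx> \<psi> V (Res F U V e) 0" by (auto elim: eventually_mono)
  then show "hasord p (\<psi> V (Res F U V e) 0) (- D p)"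
    using hasord_cong[OF generator_ord[OF gen]] p V(2) by blast
qed

lemma generator_unit:
  assumes gen: "generator X F U e" and u: "u \<in> regular X U" "\<And>q. q \<in> U \<Longrightarrow> u q \<noteq> 0"
  shows "generator X F U (u \<odot>\<^bsub>Sec F U\<^esub> e)"
proof (rule generatorI)
  note U = generatorD[OF gen]
  show "zopen X U" "u \<odot>\<^bsub>Sec F U\<^esub> e \<in> carrier (Sec F U)" using U u smult_closed by auto
  fix p assume p: "p \<in> U"
  have "hasord p (\<lambda>q. u q * \<psi> U e 0 q) (0 + - D p)"
    by (intro hasord_mult hasord_unit generator_ord gen p u regular_regat[OF U(1) u(1)])
  moreover have "(\<lambda>q. u q * \<psi> U e 0 q) \<approx> \<psi> U (u \<odot>\<^bsub>Sec F U\<^esub> e) 0"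
  proof -
    have "gen U = gen X" using gen_zopen[OF U(1)] p by blast
    moreover have "\<forall>\<^sub>F q in gen U. \<psi> U (u \<odot>\<^bsub>Sec F U\<^esub> e) 0 q = u q * \<psi> U e 0 q"
      using coord_smult[OF U(1) u(1) U(2)] by simp
    ultimately show ?thesis by (auto elim: eventually_mono)
  qed
  ultimately show "hasord p (\<psi> U (u \<odot>\<^bsub>Sec F U\<^esub> e) 0) (- D p)" by (metis add_0 hasord_cong)
qed

lemma generator_of_function:
  assumes U: "zopen X U" and f: "\<And>p. p \<in> U \<Longrightarrow> hasord p f (- D p)"
  obtains e where "generator X F U e" "\<forall>\<^sub>F q in gen U. \<psi> U e 0 q = f q"
proof -
  have "ordge p f (- D p)" if "p \<in> U" for p using hasord_ordge f that by blast
  from line_coord_surj[OF U this] obtain e where e: "e \<in> carrier (Sec F U)" "\<forall>\<^sub>F q in gen U. \<psi> U e 0 q = f q" .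
  have "generator X F U e"
  proof (rule generatorI[OF U e(1)])
    fix p assume p: "p \<in> U"
    then have "gen U = gen X" using gen_zopen[OF U] by blast
    then have "f \<approx> \<psi> U e 0" using e(2) by (auto elim: eventually_mono)
    then show "hasord p (\<psi> U e 0) (- D p)" using hasord_cong f p by blast
  qed
  then show ?thesis using that e(2) by blast
qed

lemma local_generator:
  assumes p: "p \<in> X"
  obtains U e where "p \<in> U" "generator X F U e"
proof -
  define f where "f = (\<lambda>q. unif p q powi (- D p))"
  have f: "hasord p f (- D p)" using hasord_powi[OF hasord_unif[OF p], of "- D p"] by (simp add: f_def)
  note nz = hasord_nz[OF f]
  \<comment> \<open>Away from \<open>p\<close>, the function \<open>t^(- D p)\<close> generates O(D)
    wherever its order and \<open>D\<close> both vanish; the finitely many other points are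
    removed.\<close>
  define B where "B = ({q \<in> X. ord q f \<noteq> 0} \<union> {q \<in> X. D q \<noteq> 0}) - {p}"
  have B: "finite B" using finite_support[OF nz] finsupp_D by (auto simp: B_def finsupp_def)
  have U: "zopen X (X - B)" by (rule zopen_diff_finite[OF zopen_X B])
  have "hasord q f (- D q)" if q: "q \<in> X - B" for q
  proof (cases "q = p")
    case False
    then show ?thesis using hasord_ord[OF nz, of q] q by (auto simp: B_def)
  qed (use f in simp)
  from generator_of_function[OF U this] obtain e where "generator X F (X - B) e" by blast
  moreover have "p \<in> X - B" using p by (simp add: B_def)
  ultimately show ?thesis using that by blast
qed

lemma generator_inside:
  assumes "zopen X U" "p \<in> U"
  obtains W e where "p \<in> W" "W \<subseteq> U" "generator X F W e"
proof -
  have "p \<in> X" using assms zopen_subset by blast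
  then obtain W e where W: "p \<in> W" "generator X F W e" using local_generator by blast
  then have "zopen X (W \<inter> U)" using generatorD assms(1) zopen_Int by blast
  from generator_restrict[OF W(2) this] show ?thesis using that[of "W \<inter> U"] W(1) assms(2) by blast
qed

text \<open>The constant 1 generates O(D) off the support of \<open>D\<close>. As a rational section
  of O(D) it has divisor \<open>D\<close>, and this is how the degree is computed.\<close>

lemma generic_generator:
  obtains U e where "U \<noteq> {}" "generator X F U e" "\<psi> U e 0 \<approx> (\<lambda>q. 1)"
proof -
  define U where "U = X - {q \<in> X. D q \<noteq> 0}"
  have fin: "finite {q \<in> X. D q \<noteq> 0}" using finsupp_D by (simp add: finsupp_def)
  have U: "zopen X U" unfolding U_def by (rule zopen_diff_finite[OF zopen_X fin])
  have ne: "U \<noteq> {}"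
  proof
    assume "U = {}"
    then have "X \<subseteq> {q \<in> X. D q \<noteq> 0}" by (auto simp: U_def)
    then show False using infinite_X fin finite_subset by blast
  qed
  have "hasord p (\<lambda>q. 1) (- D p)" if "p \<in> U" for p using that hasord_const by (simp add: U_def)
  from generator_of_function[OF U this] obtain e where "generator X F U e" "\<forall>\<^sub>F q in gen U. \<psi> U e 0 q = 1" .
  then show ?thesis using that[OF ne] gen_zopen[OF U ne] by simp
qed

lemma vector_bundle_1: "vector_bundle X F 1"
  unfolding vector_bundle_def
proof (intro conjI ballI)
  show "module_sheaf X F" by (rule module_sheaf)
  fix p assume "p \<in> X"
  then obtain U e where "p \<in> U" "generator X F U e" by (rule local_generator)
  then show "\<exists>U e. p \<in> U \<and> frame X F 1 U e" by blast
qed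

end

locale proper_line_model = proper_curve X + line_model X F D \<psi>
  for X :: "('n::finite) pt set" and F :: "('n, 'm) sheaf" and D \<psi>
begin

sublocale proper_sheaf_model X F 1 "line_germ D" \<psi> ..

lemma bundle_degree_line: "bundle_degree X F = deg D"
proof -
  obtain U e where e: "U \<noteq> {}" "generator X F U e" "\<psi> U e 0 \<approx> (\<lambda>q. 1)" by (rule generic_generator)
  show ?thesis
  proof (rule bundle_degreeI[OF e(2,1) _ finsupp_D])
    fix p assume p: "p \<in> X"
    obtain U' e' where e': "p \<in> U'" "generator X F U' e'" using local_generator[OF p] by blast
    \<comment> \<open>The rational section 1 is \<open>1 / e'\<close> times the local generator
      \<open>e'\<close>, and \<open>e'\<close> has order \<open>- D p\<close>.\<close>
    define A where "A = (\<lambda>(j::nat) (l::nat) q. inverse (\<psi> U' e' 0 q))"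
    have o: "hasord p (\<psi> U' e' 0) (- D p)" by (rule generator_ord[OF e'(2,1)])
    have "\<psi> U e 0 \<approx> (\<lambda>q. inverse (\<psi> U' e' 0 q) * \<psi> U' e' 0 q)"
      using e(3) nz_nonzero[OF hasord_nz[OF o]] by eventually_elim simp
    then have "expresses 1 (\<lambda>j. \<psi> U e) 1 (\<lambda>j. \<psi> U' e') A" by (unfold expresses_def A_def) simp
    moreover have "hasord p (\<lambda>q. leibniz_det 1 (\<lambda>j l. A j l q)) (D p)"
      using hasord_inverse[OF o] by (simp add: A_def leibniz_det_1)
    moreover have "\<forall>j<1. \<forall>l<1. rat (A j l)"
      using rat_inverse hasord_nz[OF o] by (simp add: A_def nz_def)
    ultimately show "\<exists>U' e' A. p \<in> U' \<and> frame X F 1 U' e' \<and> (\<forall>j<1. \<forall>l<1. rat (A j l)) \<and>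
        expresses 1 (\<lambda>j. \<psi> U e) 1 (\<lambda>j. \<psi> U' (e' j)) A \<and> hasord p (\<lambda>q. leibniz_det 1 (\<lambda>j l. A j l q)) (D p)"
      using e' by (intro exI[of _ U'] exI[of _ "\<lambda>i. e'"] exI[of _ A]) simp
  qed simp
qed

end

section \<open>Every line bundle is the sheaf of a divisor\<close>

context smooth_curve
begin

lemma line_modelI:
  fixes F :: "('n, 'm) sheaf" and \<phi> :: "'n pt set \<Rightarrow> 'm \<Rightarrow> 'n pt \<Rightarrow> complex"
  assumes "finsupp D"
    and "\<And>U. zopen X U \<Longrightarrow> \<zero>\<^bsub>Sec F U\<^esub> \<in> carrier (Sec F U)"
    and "\<And>U s t. zopen X U \<Longrightarrow> s \<in> carrier (Sec F U) \<Longrightarrow> t \<in> carrier (Sec F U) \<Longrightarrow>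
      s \<oplus>\<^bsub>Sec F U\<^esub> t \<in> carrier (Sec F U)"
    and "\<And>U a s. zopen X U \<Longrightarrow> a \<in> regular X U \<Longrightarrow> s \<in> carrier (Sec F U) \<Longrightarrow>
      a \<odot>\<^bsub>Sec F U\<^esub> s \<in> carrier (Sec F U)"
    and "\<And>U V s. zopen X U \<Longrightarrow> zopen X V \<Longrightarrow> V \<subseteq> U \<Longrightarrow> s \<in> carrier (Sec F U) \<Longrightarrow>
      Res F U V s \<in> carrier (Sec F V)"
    and "\<And>U. zopen X U \<Longrightarrow> \<forall>\<^sub>F q in gen U. \<phi> U \<zero>\<^bsub>Sec F U\<^esub> q = 0"
    and "\<And>U s t. zopen X U \<Longrightarrow> s \<in> carrier (Sec F U) \<Longrightarrow> t \<in> carrier (Sec F U) \<Longrightarrow>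
      \<forall>\<^sub>F q in gen U. \<phi> U (s \<oplus>\<^bsub>Sec F U\<^esub> t) q = \<phi> U s q + \<phi> U t q"
    and "\<And>U a s. zopen X U \<Longrightarrow> a \<in> regular X U \<Longrightarrow> s \<in> carrier (Sec F U) \<Longrightarrow>
      \<forall>\<^sub>F q in gen U. \<phi> U (a \<odot>\<^bsub>Sec F U\<^esub> s) q = a q * \<phi> U s q"
    and "\<And>U V s. zopen X U \<Longrightarrow> zopen X V \<Longrightarrow> V \<subseteq> U \<Longrightarrow> s \<in> carrier (Sec F U) \<Longrightarrow>
      \<forall>\<^sub>F q in gen V. \<phi> V (Res F U V s) q = \<phi> U s q"
    and "\<And>U s p. zopen X U \<Longrightarrow> s \<in> carrier (Sec F U) \<Longrightarrow> p \<in> U \<Longrightarrow> ordge p (\<phi> U s) (- D p)"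
    and inj: "\<And>U s t. zopen X U \<Longrightarrow> s \<in> carrier (Sec F U) \<Longrightarrow> t \<in> carrier (Sec F U) \<Longrightarrow>
      \<forall>\<^sub>F q in gen U. \<phi> U s q = \<phi> U t q \<Longrightarrow> s = t"
    and surj: "\<And>U f. zopen X U \<Longrightarrow> (\<And>p. p \<in> U \<Longrightarrow> ordge p f (- D p)) \<Longrightarrow>
      \<exists>s\<in>carrier (Sec F U). \<forall>\<^sub>F q in gen U. \<phi> U s q = f q"
  shows "line_model X F D (\<lambda>U s i. \<phi> U s)"
proof unfold_locales
  show "s = t" if "zopen X U" "s \<in> carrier (Sec F U)" "t \<in> carrier (Sec F U)"
    "\<And>i. i < (1::nat) \<Longrightarrow> \<forall>\<^sub>F q in gen U. \<phi> U s q = \<phi> U t q" for U s t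
    using inj[OF that(1-3)] that(4)[of 0] by simp
  show "\<exists>s\<in>carrier (Sec F U). \<forall>i<1::nat. \<forall>\<^sub>F q in gen U. \<phi> U s q = m i q"
    if "zopen X U" "\<And>p. p \<in> U \<Longrightarrow> line_germ D p m" for U m
    using surj[OF that(1), of "m 0"] that(2) by (simp add: line_germ_def)
  show "line_germ D p (\<lambda>i. \<phi> U s)" if "zopen X U" "s \<in> carrier (Sec F U)" "p \<in> U" for U s p
    using assms(10)[OF that] by (simp add: line_germ_def)
qed (fact line_germ(1-4) line_germ(5)[OF assms(1)] assms | simp add: assms)+

lemma module_sheafD:
  fixes F :: "('n, 'm) sheaf"
  assumes "module_sheaf X F"
  shows "zopen X U \<Longrightarrow> module (structure_sheaf X U) (Sec F U)"
    "zopen X U \<Longrightarrow> zopen X V \<Longrightarrow> V \<subseteq> U \<Longrightarrow> s \<in> carrier (Sec F U) \<Longrightarrow> Res F U V s \<in> carrier (Sec F V)"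
    "zopen X U \<Longrightarrow> zopen X V \<Longrightarrow> V \<subseteq> U \<Longrightarrow> s \<in> carrier (Sec F U) \<Longrightarrow> t \<in> carrier (Sec F U) \<Longrightarrow>
      Res F U V (s \<oplus>\<^bsub>Sec F U\<^esub> t) = Res F U V s \<oplus>\<^bsub>Sec F V\<^esub> Res F U V t"
    "zopen X U \<Longrightarrow> zopen X V \<Longrightarrow> V \<subseteq> U \<Longrightarrow> s \<in> carrier (Sec F U) \<Longrightarrow> a \<in> regular X U \<Longrightarrow>
      Res F U V (a \<odot>\<^bsub>Sec F U\<^esub> s) = restrict a V \<odot>\<^bsub>Sec F V\<^esub> Res F U V s"
    "zopen X U \<Longrightarrow> s \<in> carrier (Sec F U) \<Longrightarrow> Res F U U s = s"
    "zopen X U \<Longrightarrow> zopen X V \<Longrightarrow> zopen X W \<Longrightarrow> W \<subseteq> V \<Longrightarrow> V \<subseteq> U \<Longrightarrow> s \<in> carrier (Sec F U) \<Longrightarrow>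
      Res F V W (Res F U V s) = Res F U W s"
    "\<forall>V\<in>\<U>. zopen X V \<Longrightarrow> s \<in> carrier (Sec F (\<Union>\<U>)) \<Longrightarrow> t \<in> carrier (Sec F (\<Union>\<U>)) \<Longrightarrow>
      \<forall>V\<in>\<U>. Res F (\<Union>\<U>) V s = Res F (\<Union>\<U>) V t \<Longrightarrow> s = t"
    "\<forall>V\<in>\<U>. zopen X V \<Longrightarrow> \<forall>V\<in>\<U>. \<sigma> V \<in> carrier (Sec F V) \<Longrightarrow>
      \<forall>V\<in>\<U>. \<forall>W\<in>\<U>. Res F V (V \<inter> W) (\<sigma> V) = Res F W (V \<inter> W) (\<sigma> W) \<Longrightarrow>
      \<exists>s\<in>carrier (Sec F (\<Union>\<U>)). \<forall>V\<in>\<U>. Res F (\<Union>\<U>) V s = \<sigma> V"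
proof -
  note m = assms[unfolded module_sheaf_def]
  note m1 = m[THEN conjunct1] and m2 = m[THEN conjunct2, THEN conjunct1]
    and m3 = m[THEN conjunct2, THEN conjunct2, THEN conjunct1]
    and m4 = m[THEN conjunct2, THEN conjunct2, THEN conjunct2, THEN conjunct1]
    and m5 = m[THEN conjunct2, THEN conjunct2, THEN conjunct2, THEN conjunct2]
  show "zopen X U \<Longrightarrow> module (structure_sheaf X U) (Sec F U)" using m1 by simp
  show "zopen X U \<Longrightarrow> zopen X V \<Longrightarrow> V \<subseteq> U \<Longrightarrow> s \<in> carrier (Sec F U) \<Longrightarrow> Res F U V s \<in> carrier (Sec F V)"
    using m2[THEN spec, THEN spec, of U V] by blast
  show "zopen X U \<Longrightarrow> zopen X V \<Longrightarrow> V \<subseteq> U \<Longrightarrow> s \<in> carrier (Sec F U) \<Longrightarrow> t \<in> carrier (Sec F U) \<Longrightarrow>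
      Res F U V (s \<oplus>\<^bsub>Sec F U\<^esub> t) = Res F U V s \<oplus>\<^bsub>Sec F V\<^esub> Res F U V t"
    using m2[THEN spec, THEN spec, of U V] by simp
  show "zopen X U \<Longrightarrow> zopen X V \<Longrightarrow> V \<subseteq> U \<Longrightarrow> s \<in> carrier (Sec F U) \<Longrightarrow> a \<in> regular X U \<Longrightarrow>
      Res F U V (a \<odot>\<^bsub>Sec F U\<^esub> s) = restrict a V \<odot>\<^bsub>Sec F V\<^esub> Res F U V s"
    using m2[THEN spec, THEN spec, of U V] by simp
  show "zopen X U \<Longrightarrow> s \<in> carrier (Sec F U) \<Longrightarrow> Res F U U s = s" using m3 by simp
  show "zopen X U \<Longrightarrow> zopen X V \<Longrightarrow> zopen X W \<Longrightarrow> W \<subseteq> V \<Longrightarrow> V \<subseteq> U \<Longrightarrow> s \<in> carrier (Sec F U) \<Longrightarrow>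
      Res F V W (Res F U V s) = Res F U W s"
    using m4[THEN spec, THEN spec, THEN spec, of U V W] by simp
  show "\<forall>V\<in>\<U>. zopen X V \<Longrightarrow> s \<in> carrier (Sec F (\<Union>\<U>)) \<Longrightarrow> t \<in> carrier (Sec F (\<Union>\<U>)) \<Longrightarrow>
      \<forall>V\<in>\<U>. Res F (\<Union>\<U>) V s = Res F (\<Union>\<U>) V t \<Longrightarrow> s = t"
    using m5[THEN spec, of \<U>] by blast
  show "\<forall>V\<in>\<U>. zopen X V \<Longrightarrow> \<forall>V\<in>\<U>. \<sigma> V \<in> carrier (Sec F V) \<Longrightarrow>
      \<forall>V\<in>\<U>. \<forall>W\<in>\<U>. Res F V (V \<inter> W) (\<sigma> V) = Res F W (V \<inter> W) (\<sigma> W) \<Longrightarrow>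
      \<exists>s\<in>carrier (Sec F (\<Union>\<U>)). \<forall>V\<in>\<U>. Res F (\<Union>\<U>) V s = \<sigma> V"
    using m5[THEN spec, of \<U>, THEN mp, THEN conjunct2, THEN spec, of \<sigma>] by simp
qed

lemma frame_1_coord:
  fixes F :: "('n, 'm) sheaf"
  assumes F: "module_sheaf X F" and fr: "frame X F 1 U e" and V: "zopen X V" "V \<subseteq> U"
  shows "s \<in> carrier (Sec F V) \<Longrightarrow> \<exists>a\<in>regular X V. s = a \<odot>\<^bsub>Sec F V\<^esub> Res F U V (e 0)"
    "a \<in> regular X V \<Longrightarrow> b \<in> regular X V \<Longrightarrow>
      a \<odot>\<^bsub>Sec F V\<^esub> Res F U V (e 0) = b \<odot>\<^bsub>Sec F V\<^esub> Res F U V (e 0) \<Longrightarrow> a = b"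
    "e 0 \<in> carrier (Sec F U)" "zopen X U"
proof -
  interpret M: module "structure_sheaf X V" "Sec F V" by (rule module_sheafD(1)[OF F V(1)])
  show U: "zopen X U" and e: "e 0 \<in> carrier (Sec F U)" using fr by (auto simp: frame_def)
  have eV: "Res F U V (e 0) \<in> carrier (Sec F V)" by (rule module_sheafD(2)[OF F U V e])
  have bij: "bij_betw (\<lambda>a. \<Oplus>\<^bsub>Sec F V\<^esub>i\<in>{..<1}. a i \<odot>\<^bsub>Sec F V\<^esub> Res F U V (e i)) ({..<1} \<rightarrow>\<^sub>E regular X V) (carrier (Sec F V))"
    using fr V unfolding frame_def by blast
  have sum: "(\<Oplus>\<^bsub>Sec F V\<^esub>i\<in>{..<1::nat}. a i \<odot>\<^bsub>Sec F V\<^esub> Res F U V (e i)) = a 0 \<odot>\<^bsub>Sec F V\<^esub> Res F U V (e 0)"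
    if "a 0 \<in> regular X V" for a
  proof -
    have "a 0 \<odot>\<^bsub>Sec F V\<^esub> Res F U V (e 0) \<in> carrier (Sec F V)" using that eV by simp
    then show ?thesis by (simp add: lessThan_Suc)
  qed
  show "\<exists>a\<in>regular X V. s = a \<odot>\<^bsub>Sec F V\<^esub> Res F U V (e 0)" if s: "s \<in> carrier (Sec F V)"
  proof -
    obtain a where a: "a \<in> {..<1} \<rightarrow>\<^sub>E regular X V" "s = (\<Oplus>\<^bsub>Sec F V\<^esub>i\<in>{..<1}. a i \<odot>\<^bsub>Sec F V\<^esub> Res F U V (e i))"
      using bij s unfolding bij_betw_def by blast
    then have "a 0 \<in> regular X V" by auto
    with sum[of a, OF this] a(2) show ?thesis by auto
  qed
  show "a = b" if ab: "a \<in> regular X V" "b \<in> regular X V"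
    "a \<odot>\<^bsub>Sec F V\<^esub> Res F U V (e 0) = b \<odot>\<^bsub>Sec F V\<^esub> Res F U V (e 0)"
  proof -
    define a' b' where "a' = (\<lambda>i\<in>{..<1::nat}. a)" and "b' = (\<lambda>i\<in>{..<1::nat}. b)"
    have m: "a' \<in> {..<1} \<rightarrow>\<^sub>E regular X V" "b' \<in> {..<1} \<rightarrow>\<^sub>E regular X V" using ab by (auto simp: a'_def b'_def)
    have v: "a' 0 = a" "b' 0 = b" by (auto simp: a'_def b'_def)
    have "(\<Oplus>\<^bsub>Sec F V\<^esub>i\<in>{..<1}. a' i \<odot>\<^bsub>Sec F V\<^esub> Res F U V (e i)) =
      (\<Oplus>\<^bsub>Sec F V\<^esub>i\<in>{..<1}. b' i \<odot>\<^bsub>Sec F V\<^esub> Res F U V (e i))"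
      using sum[of a'] sum[of b'] ab v by simp
    then have "a' = b'" using bij m unfolding bij_betw_def by (auto dest: inj_onD)
    then show ?thesis using v by metis
  qed
qed

text \<open>A generator \<open>e0\<close> over one nonempty open set makes every section a rational
  function, its quotient by \<open>e0\<close>. If \<open>e0 = a p * e p\<close> with a local
  generator \<open>e p\<close>, the quotients that come from sections near \<open>p\<close> are the
  \<open>f\<close> with \<open>f * a p\<close> regular; so \<open>D\<close> is the divisor of
  \<open>e0\<close>.\<close>

lemma line_bundle_model:
  fixes H :: "('n, 'm) sheaf"
  assumes vb: "vector_bundle X H 1"
  shows "\<exists>D \<psi>. line_model X H D \<psi>"
proof -
  have ms: "module_sheaf X H" using vb by (simp add: vector_bundle_def)
  note R = module_sheafD[OF ms]
  have "\<forall>p. \<exists>U e. p \<in> X \<longrightarrow> p \<in> U \<and> frame X H 1 U e" using vb unfolding vector_bundle_def by blast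
  then obtain N e where N: "\<And>p. p \<in> X \<Longrightarrow> p \<in> N p" "\<And>p. p \<in> X \<Longrightarrow> frame X H 1 (N p) (e p)" by metis
  obtain p0 where p0: "p0 \<in> X" using X_nonempty by blast
  define U0 where "U0 = N p0"
  define e0 where "e0 = e p0"
  have fr0: "frame X H 1 U0 e0" and U0ne: "U0 \<noteq> {}" using N[OF p0] by (auto simp: U0_def e0_def)
  have Nz: "zopen X (N p)" "e p 0 \<in> carrier (Sec H (N p))" if "p \<in> X" for p
    using frame_1_coord(3,4)[OF ms N(2)[OF that] zopen_X] frame_1_coord(3,4)[OF ms N(2)[OF that], of "{}"] by auto
  have U0: "zopen X U0" "e0 0 \<in> carrier (Sec H U0)" using Nz[OF p0] by (auto simp: U0_def e0_def)
  note c0 = frame_1_coord(1,2)[OF ms fr0]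
  define \<phi> where "\<phi> U s = (SOME a. a \<in> regular X (U \<inter> U0) \<and>
    Res H U (U \<inter> U0) s = a \<odot>\<^bsub>Sec H (U \<inter> U0)\<^esub> Res H U0 (U \<inter> U0) (e0 0))" for U s
  have UU0: "zopen X (U \<inter> U0)" if "zopen X U" for U using zopen_Int[OF that U0(1)] .
  have e0c: "Res H U0 (U \<inter> U0) (e0 0) \<in> carrier (Sec H (U \<inter> U0))" if "zopen X U" for U
    using R(2)[OF U0(1) UU0[OF that] _ U0(2)] by simp
  have \<phi>: "\<phi> U s \<in> regular X (U \<inter> U0)"
    "Res H U (U \<inter> U0) s = \<phi> U s \<odot>\<^bsub>Sec H (U \<inter> U0)\<^esub> Res H U0 (U \<inter> U0) (e0 0)"
    if "zopen X U" "s \<in> carrier (Sec H U)" for U s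
  proof -
    have "\<exists>a. a \<in> regular X (U \<inter> U0) \<and>
      Res H U (U \<inter> U0) s = a \<odot>\<^bsub>Sec H (U \<inter> U0)\<^esub> Res H U0 (U \<inter> U0) (e0 0)"
      using c0(1)[OF UU0[OF that(1)] _ R(2)[OF that(1) UU0[OF that(1)] _ that(2)]] by auto
    from someI_ex[OF this] show "\<phi> U s \<in> regular X (U \<inter> U0)"
      "Res H U (U \<inter> U0) s = \<phi> U s \<odot>\<^bsub>Sec H (U \<inter> U0)\<^esub> Res H U0 (U \<inter> U0) (e0 0)" by (simp_all add: \<phi>_def)
  qed
  have \<phi>_eq: "\<phi> U s = a" if "zopen X U" "s \<in> carrier (Sec H U)" "a \<in> regular X (U \<inter> U0)"
    "Res H U (U \<inter> U0) s = a \<odot>\<^bsub>Sec H (U \<inter> U0)\<^esub> Res H U0 (U \<inter> U0) (e0 0)" for U s a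
    using c0(2)[OF UU0[OF that(1)] _ \<phi>(1)[OF that(1,2)] that(3)] \<phi>(2)[OF that(1,2)] that(4) by simp
  have gU0: "\<forall>\<^sub>F q in gen U. P q" if "zopen X U" "\<forall>q\<in>U \<inter> U0. P q" for U P
  proof -
    have "{q \<in> U. \<not> P q} \<subseteq> X - U0" using that zopen_subset[OF that(1)] by auto
    then show ?thesis unfolding eventually_gen using zopen_cofinite[OF U0(1) U0ne] finite_subset by blast
  qed
  have \<phi>_add: "\<forall>\<^sub>F q in gen U. \<phi> U (s \<oplus>\<^bsub>Sec H U\<^esub> t) q = \<phi> U s q + \<phi> U t q"
    if U: "zopen X U" and s: "s \<in> carrier (Sec H U)" and t: "t \<in> carrier (Sec H U)" for U s t
  proof -
    interpret M: module "structure_sheaf X (U \<inter> U0)" "Sec H (U \<inter> U0)" by (rule R(1)[OF UU0[OF U]])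
    interpret MU: module "structure_sheaf X U" "Sec H U" by (rule R(1)[OF U])
    define a where "a = (\<lambda>q\<in>U \<inter> U0. \<phi> U s q + \<phi> U t q)"
    have "a = \<phi> U s \<oplus>\<^bsub>structure_sheaf X (U \<inter> U0)\<^esub> \<phi> U t" by (simp add: a_def structure_sheaf_def)
    then have "a \<odot>\<^bsub>Sec H (U \<inter> U0)\<^esub> Res H U0 (U \<inter> U0) (e0 0) = Res H U (U \<inter> U0) s \<oplus>\<^bsub>Sec H (U \<inter> U0)\<^esub> Res H U (U \<inter> U0) t"
      using M.smult_l_distr[of "\<phi> U s" "\<phi> U t" "Res H U0 (U \<inter> U0) (e0 0)"] \<phi>[OF U s] \<phi>[OF U t] e0c[OF U] by simp
    also have "\<dots> = Res H U (U \<inter> U0) (s \<oplus>\<^bsub>Sec H U\<^esub> t)" using R(3)[OF U UU0[OF U] _ s t] by simp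
    finally have "\<phi> U (s \<oplus>\<^bsub>Sec H U\<^esub> t) = a"
      using \<phi>(1)[OF U s] \<phi>(1)[OF U t] s t
      by (intro \<phi>_eq[OF U]) (auto simp: a_def intro: regular_add[OF UU0[OF U]])
    then show ?thesis by (intro gU0[OF U]) (simp add: a_def)
  qed
  have \<phi>_smult: "\<forall>\<^sub>F q in gen U. \<phi> U (b \<odot>\<^bsub>Sec H U\<^esub> s) q = b q * \<phi> U s q"
    if U: "zopen X U" and b: "b \<in> regular X U" and s: "s \<in> carrier (Sec H U)" for U s b
  proof -
    interpret M: module "structure_sheaf X (U \<inter> U0)" "Sec H (U \<inter> U0)" by (rule R(1)[OF UU0[OF U]])
    interpret MU: module "structure_sheaf X U" "Sec H U" by (rule R(1)[OF U])
    define a where "a = (\<lambda>q\<in>U \<inter> U0. restrict b (U \<inter> U0) q * \<phi> U s q)"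
    have br: "restrict b (U \<inter> U0) \<in> regular X (U \<inter> U0)" using regular_restrict[OF U UU0[OF U] _ b] by simp
    have "a = restrict b (U \<inter> U0) \<otimes>\<^bsub>structure_sheaf X (U \<inter> U0)\<^esub> \<phi> U s"
      by (simp add: a_def structure_sheaf_def)
    then have "a \<odot>\<^bsub>Sec H (U \<inter> U0)\<^esub> Res H U0 (U \<inter> U0) (e0 0) =
        restrict b (U \<inter> U0) \<odot>\<^bsub>Sec H (U \<inter> U0)\<^esub> Res H U (U \<inter> U0) s"
      using M.smult_assoc1[of "restrict b (U \<inter> U0)" "\<phi> U s" "Res H U0 (U \<inter> U0) (e0 0)"] \<phi>[OF U s] e0c[OF U] br by simp
    also have "\<dots> = Res H U (U \<inter> U0) (b \<odot>\<^bsub>Sec H U\<^esub> s)" using R(4)[OF U UU0[OF U] _ s b] by simp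
    finally have "\<phi> U (b \<odot>\<^bsub>Sec H U\<^esub> s) = a"
      using s b regular_mult[OF UU0[OF U] br \<phi>(1)[OF U s]]
      by (intro \<phi>_eq[OF U]) (simp_all only: a_def[symmetric] MU.smult_closed carrier_structure_sheaf)
    then show ?thesis by (intro gU0[OF U]) (simp add: a_def)
  qed
  have \<phi>_res: "\<forall>\<^sub>F q in gen V. \<phi> V (Res H U V s) q = \<phi> U s q"
    if U: "zopen X U" and V: "zopen X V" "V \<subseteq> U" and s: "s \<in> carrier (Sec H U)" for U V s
  proof -
    have VU: "V \<inter> U0 \<subseteq> U \<inter> U0" using V by auto
    have "Res H V (V \<inter> U0) (Res H U V s) = Res H (U \<inter> U0) (V \<inter> U0) (Res H U (U \<inter> U0) s)"
      using R(6)[OF U V(1) UU0[OF V(1)] _ V(2) s] R(6)[OF U UU0[OF U] UU0[OF V(1)] VU _ s] by simp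
    also have "\<dots> = restrict (\<phi> U s) (V \<inter> U0) \<odot>\<^bsub>Sec H (V \<inter> U0)\<^esub> Res H (U \<inter> U0) (V \<inter> U0) (Res H U0 (U \<inter> U0) (e0 0))"
      unfolding \<phi>(2)[OF U s] by (rule R(4)[OF UU0[OF U] UU0[OF V(1)] VU e0c[OF U] \<phi>(1)[OF U s]])
    also have "Res H (U \<inter> U0) (V \<inter> U0) (Res H U0 (U \<inter> U0) (e0 0)) = Res H U0 (V \<inter> U0) (e0 0)"
      by (rule R(6)[OF U0(1) UU0[OF U] UU0[OF V(1)] VU _ U0(2)]) simp
    finally have "\<phi> V (Res H U V s) = restrict (\<phi> U s) (V \<inter> U0)"
      by (rule \<phi>_eq[OF V(1) R(2)[OF U V s] regular_restrict[OF UU0[OF U] UU0[OF V(1)] VU \<phi>(1)[OF U s]]])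
    then show ?thesis by (intro gU0[OF V(1)]) simp
  qed
  \<comment> \<open>The transition function is invertible on the overlap, because \<open>e p\<close>
    is in turn a multiple of \<open>e0\<close> there.\<close>
  have "\<exists>a. a \<in> regular X (U0 \<inter> N p) \<and> (\<forall>q\<in>U0 \<inter> N p. a q \<noteq> 0) \<and>
    Res H U0 (U0 \<inter> N p) (e0 0) = a \<odot>\<^bsub>Sec H (U0 \<inter> N p)\<^esub> Res H (N p) (U0 \<inter> N p) (e p 0)" if p: "p \<in> X" for p
  proof -
    define W where "W = U0 \<inter> N p"
    have W: "zopen X W" "W \<subseteq> U0" "W \<subseteq> N p" using zopen_Int U0 Nz[OF p] by (auto simp: W_def)
    interpret M: module "structure_sheaf X W" "Sec H W" by (rule R(1)[OF W(1)])
    note cp = frame_1_coord(1,2)[OF ms N(2)[OF p] W(1,3)]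
    have c: "Res H U0 W (e0 0) \<in> carrier (Sec H W)" "Res H (N p) W (e p 0) \<in> carrier (Sec H W)"
      using R(2)[OF U0(1) W(1,2) U0(2)] R(2)[OF Nz(1)[OF p] W(1,3) Nz(2)[OF p]] by auto
    obtain a where a: "a \<in> regular X W" "Res H U0 W (e0 0) = a \<odot>\<^bsub>Sec H W\<^esub> Res H (N p) W (e p 0)"
      using cp(1)[OF c(1)] by blast
    obtain b where b: "b \<in> regular X W" "Res H (N p) W (e p 0) = b \<odot>\<^bsub>Sec H W\<^esub> Res H U0 W (e0 0)"
      using c0(1)[OF W(1,2) c(2)] by blast
    have "(a \<otimes>\<^bsub>structure_sheaf X W\<^esub> b) \<odot>\<^bsub>Sec H W\<^esub> Res H U0 W (e0 0) = \<one>\<^bsub>structure_sheaf X W\<^esub> \<odot>\<^bsub>Sec H W\<^esub> Res H U0 W (e0 0)"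
    proof -
      have "(a \<otimes>\<^bsub>structure_sheaf X W\<^esub> b) \<odot>\<^bsub>Sec H W\<^esub> Res H U0 W (e0 0) = a \<odot>\<^bsub>Sec H W\<^esub> (b \<odot>\<^bsub>Sec H W\<^esub> Res H U0 W (e0 0))"
        using a(1) b(1) c(1) by (intro M.smult_assoc1) simp_all
      also have "b \<odot>\<^bsub>Sec H W\<^esub> Res H U0 W (e0 0) = Res H (N p) W (e p 0)" by (rule b(2)[symmetric])
      also have "a \<odot>\<^bsub>Sec H W\<^esub> Res H (N p) W (e p 0) = Res H U0 W (e0 0)" by (rule a(2)[symmetric])
      also have "\<dots> = \<one>\<^bsub>structure_sheaf X W\<^esub> \<odot>\<^bsub>Sec H W\<^esub> Res H U0 W (e0 0)" by (rule M.smult_one[OF c(1), symmetric])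
      finally show ?thesis .
    qed
    moreover have "a \<otimes>\<^bsub>structure_sheaf X W\<^esub> b \<in> regular X W" "\<one>\<^bsub>structure_sheaf X W\<^esub> \<in> regular X W"
      using M.m_closed[of a b] M.one_closed a(1) b(1) by simp_all
    ultimately have ab: "a \<otimes>\<^bsub>structure_sheaf X W\<^esub> b = \<one>\<^bsub>structure_sheaf X W\<^esub>"
      using c0(2)[OF W(1,2)] by blast
    have "a q * b q = 1" if "q \<in> W" for q
      using fun_cong[OF ab, of q] that by (simp add: structure_sheaf_def)
    then have "\<forall>q\<in>W. a q \<noteq> 0" by (metis mult_zero_left zero_neq_one)
    then show ?thesis unfolding W_def[symmetric] using a by blast
  qed
  then have "\<forall>p. \<exists>a. p \<in> X \<longrightarrow> a \<in> regular X (U0 \<inter> N p) \<and> (\<forall>q\<in>U0 \<inter> N p. a q \<noteq> 0) \<and>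
    Res H U0 (U0 \<inter> N p) (e0 0) = a \<odot>\<^bsub>Sec H (U0 \<inter> N p)\<^esub> Res H (N p) (U0 \<inter> N p) (e p 0)" by blast
  then obtain a where a: "\<And>p. p \<in> X \<Longrightarrow> a p \<in> regular X (U0 \<inter> N p)"
    "\<And>p q. p \<in> X \<Longrightarrow> q \<in> U0 \<inter> N p \<Longrightarrow> a p q \<noteq> 0"
    "\<And>p. p \<in> X \<Longrightarrow> Res H U0 (U0 \<inter> N p) (e0 0) = a p \<odot>\<^bsub>Sec H (U0 \<inter> N p)\<^esub> Res H (N p) (U0 \<inter> N p) (e p 0)"
    by metis
  have U0N: "zopen X (U0 \<inter> N p)" "U0 \<inter> N p \<noteq> {}" if "p \<in> X" for p
    using zopen_Int[OF U0(1) Nz(1)[OF that]] zopen_Int_nonempty[OF U0(1) Nz(1)[OF that] U0ne] N(1)[OF that] by auto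
  have anz: "nz (a p)" if p: "p \<in> X" for p
  proof -
    obtain q where q: "q \<in> U0 \<inter> N p" using U0N[OF p] by blast
    have "\<forall>\<^sub>F q in gen X. a p q \<noteq> 0"
      using eventually_zopen[OF U0N[OF p]] by (rule eventually_mono) (use a(2)[OF p] in blast)
    then show ?thesis using regat_rat[OF regular_regat[OF U0N(1)[OF p] a(1)[OF p] q]] by (simp add: nz_iff)
  qed
  define D where "D p = ord p (a p)" for p
  have aD: "hasord p (a p) (D p)" if "p \<in> X" for p unfolding D_def by (rule hasord_ord[OF anz[OF that] that])
  have D: "finsupp D"
  proof -
    have "D p = 0" if p: "p \<in> X" "p \<in> U0" for p
      unfolding D_def using p N(1)[OF p(1)] a(2)[OF p(1), of p] regular_regat[OF U0N(1)[OF p(1)] a(1)[OF p(1)], of p]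
      by (intro ord_eq hasord_unit) auto
    then have "{p \<in> X. D p \<noteq> 0} \<subseteq> X - U0" by blast
    then show ?thesis unfolding finsupp_def using zopen_cofinite[OF U0(1) U0ne] finite_subset by blast
  qed
  \<comment> \<open>Near \<open>p\<close> a section is \<open>g * e p\<close>, and over a common
    open set also \<open>\<phi> U s * e0 = \<phi> U s * a p * e p\<close>. Hence
    \<open>\<phi> U s * a p\<close> agrees generically with a function regular at \<open>p\<close>,
    which bounds the pole of \<open>\<phi> U s\<close>.\<close>
  have K: "\<exists>g. g \<in> regular X (U \<inter> N p) \<and> Res H U (U \<inter> N p) s = g \<odot>\<^bsub>Sec H (U \<inter> N p)\<^esub> Res H (N p) (U \<inter> N p) (e p 0) \<and>
    (\<lambda>q. \<phi> U s q * a p q) \<approx> g" if U: "zopen X U" and s: "s \<in> carrier (Sec H U)" and p: "p \<in> U" for U s p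
  proof -
    have pX: "p \<in> X" using p zopen_subset[OF U] by blast
    have UN: "zopen X (U \<inter> N p)" "U \<inter> N p \<subseteq> U" "U \<inter> N p \<subseteq> N p" using zopen_Int[OF U Nz(1)[OF pX]] by auto
    note cp = frame_1_coord(1,2)[OF ms N(2)[OF pX]]
    obtain g where g: "g \<in> regular X (U \<inter> N p)"
      "Res H U (U \<inter> N p) s = g \<odot>\<^bsub>Sec H (U \<inter> N p)\<^esub> Res H (N p) (U \<inter> N p) (e p 0)"
      using cp(1)[OF UN(1,3) R(2)[OF U UN(1,2) s]] by blast
    define W where "W = U \<inter> N p \<inter> U0"
    have W: "zopen X W" "W \<subseteq> U" "W \<subseteq> N p" "W \<subseteq> U0" "W \<subseteq> U \<inter> U0" "W \<subseteq> U \<inter> N p" "W \<subseteq> U0 \<inter> N p"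
      using zopen_Int[OF UN(1) U0(1)] by (auto simp: W_def)
    have Wne: "W \<noteq> {}" unfolding W_def
      using zopen_Int_nonempty[OF UN(1) U0(1)] U0ne p N(1)[OF pX] by blast
    interpret M: module "structure_sheaf X W" "Sec H W" by (rule R(1)[OF W(1)])
    define f where "f = Res H (N p) W (e p 0)"
    have f: "f \<in> carrier (Sec H W)" unfolding f_def by (rule R(2)[OF Nz(1)[OF pX] W(1,3) Nz(2)[OF pX]])
    have e0W: "Res H U0 W (e0 0) = restrict (a p) W \<odot>\<^bsub>Sec H W\<^esub> f"
    proof -
      have "Res H U0 W (e0 0) = Res H (U0 \<inter> N p) W (Res H U0 (U0 \<inter> N p) (e0 0))"
        using R(6)[OF U0(1) U0N(1)[OF pX] W(1,7) _ U0(2)] by simp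
      also have "\<dots> = restrict (a p) W \<odot>\<^bsub>Sec H W\<^esub> Res H (U0 \<inter> N p) W (Res H (N p) (U0 \<inter> N p) (e p 0))"
        unfolding a(3)[OF pX]
        by (rule R(4)[OF U0N(1)[OF pX] W(1,7) R(2)[OF Nz(1)[OF pX] U0N(1)[OF pX] _ Nz(2)[OF pX]] a(1)[OF pX]]) simp
      also have "Res H (U0 \<inter> N p) W (Res H (N p) (U0 \<inter> N p) (e p 0)) = f"
        unfolding f_def using R(6)[OF Nz(1)[OF pX] U0N(1)[OF pX] W(1,7) _ Nz(2)[OF pX]] by simp
      finally show ?thesis .
    qed
    have s1: "Res H U W s = restrict g W \<odot>\<^bsub>Sec H W\<^esub> f"
    proof -
      have "Res H U W s = Res H (U \<inter> N p) W (Res H U (U \<inter> N p) s)"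
        using R(6)[OF U UN(1) W(1,6) UN(2) s] by simp
      also have "\<dots> = restrict g W \<odot>\<^bsub>Sec H W\<^esub> Res H (U \<inter> N p) W (Res H (N p) (U \<inter> N p) (e p 0))"
        unfolding g(2) by (rule R(4)[OF UN(1) W(1,6) R(2)[OF Nz(1)[OF pX] UN(1,3) Nz(2)[OF pX]] g(1)])
      also have "Res H (U \<inter> N p) W (Res H (N p) (U \<inter> N p) (e p 0)) = f"
        unfolding f_def by (rule R(6)[OF Nz(1)[OF pX] UN(1) W(1,6) UN(3) Nz(2)[OF pX]])
      finally show ?thesis .
    qed
    have \<phi>W: "restrict (\<phi> U s) W \<in> regular X W" by (rule regular_restrict[OF UU0[OF U] W(1,5) \<phi>(1)[OF U s]])
    have aW: "restrict (a p) W \<in> regular X W" by (rule regular_restrict[OF U0N(1)[OF pX] W(1,7) a(1)[OF pX]])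
    have gW: "restrict g W \<in> regular X W" by (rule regular_restrict[OF UN(1) W(1,6) g(1)])
    have "Res H U W s = (restrict (\<phi> U s) W \<otimes>\<^bsub>structure_sheaf X W\<^esub> restrict (a p) W) \<odot>\<^bsub>Sec H W\<^esub> f"
    proof -
      have "Res H U W s = Res H (U \<inter> U0) W (Res H U (U \<inter> U0) s)"
        using R(6)[OF U UU0[OF U] W(1,5) _ s] by simp
      also have "\<dots> = restrict (\<phi> U s) W \<odot>\<^bsub>Sec H W\<^esub> Res H (U \<inter> U0) W (Res H U0 (U \<inter> U0) (e0 0))"
        unfolding \<phi>(2)[OF U s] by (rule R(4)[OF UU0[OF U] W(1,5) e0c[OF U] \<phi>(1)[OF U s]])
      also have "Res H (U \<inter> U0) W (Res H U0 (U \<inter> U0) (e0 0)) = restrict (a p) W \<odot>\<^bsub>Sec H W\<^esub> f"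
        unfolding e0W[symmetric] using R(6)[OF U0(1) UU0[OF U] W(1,5) _ U0(2)] by simp
      also have "restrict (\<phi> U s) W \<odot>\<^bsub>Sec H W\<^esub> (restrict (a p) W \<odot>\<^bsub>Sec H W\<^esub> f) =
        (restrict (\<phi> U s) W \<otimes>\<^bsub>structure_sheaf X W\<^esub> restrict (a p) W) \<odot>\<^bsub>Sec H W\<^esub> f"
        by (rule M.smult_assoc1[symmetric]) (simp_all only: carrier_structure_sheaf \<phi>W aW f)
      finally show ?thesis .
    qed
    then have eqW: "restrict (\<phi> U s) W \<otimes>\<^bsub>structure_sheaf X W\<^esub> restrict (a p) W = restrict g W"
      using cp(2)[OF W(1,3), of "restrict (\<phi> U s) W \<otimes>\<^bsub>structure_sheaf X W\<^esub> restrict (a p) W" "restrict g W"]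
        s1 M.m_closed[of "restrict (\<phi> U s) W" "restrict (a p) W"] \<phi>W aW gW by (simp add: f_def)
    have "\<phi> U s q * a p q = g q" if "q \<in> W" for q
      using fun_cong[OF eqW, of q] that by (simp add: structure_sheaf_def)
    then have "(\<lambda>q. \<phi> U s q * a p q) \<approx> g"
      using eventually_zopen[OF W(1) Wne] by (auto elim: eventually_mono)
    then show ?thesis using g by blast
  qed
  have inj: "s = t" if U: "zopen X U" and st: "s \<in> carrier (Sec H U)" "t \<in> carrier (Sec H U)"
    and eq: "\<forall>\<^sub>F q in gen U. \<phi> U s q = \<phi> U t q" for U s t
  proof -
    define \<U> where "\<U> = (\<lambda>p. U \<inter> N p) ` U"
    have pX: "p \<in> X" if "p \<in> U" for p using that zopen_subset[OF U] by blast
    have cover: "\<Union>\<U> = U" using N(1) pX by (auto simp: \<U>_def)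
    have opn: "\<forall>V\<in>\<U>. zopen X V" using zopen_Int[OF U Nz(1)] pX by (auto simp: \<U>_def)
    have "Res H U (U \<inter> N p) s = Res H U (U \<inter> N p) t" if p: "p \<in> U" for p
    proof -
      obtain g where g: "g \<in> regular X (U \<inter> N p)" "(\<lambda>q. \<phi> U s q * a p q) \<approx> g"
        "Res H U (U \<inter> N p) s = g \<odot>\<^bsub>Sec H (U \<inter> N p)\<^esub> Res H (N p) (U \<inter> N p) (e p 0)" using K[OF U st(1) p] by blast
      obtain h where h: "h \<in> regular X (U \<inter> N p)" "(\<lambda>q. \<phi> U t q * a p q) \<approx> h"
        "Res H U (U \<inter> N p) t = h \<odot>\<^bsub>Sec H (U \<inter> N p)\<^esub> Res H (N p) (U \<inter> N p) (e p 0)" using K[OF U st(2) p] by blast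
      have "gen U = gen X" using gen_zopen[OF U] p by blast
      then have "\<phi> U s \<approx> \<phi> U t" using eq by simp
      from this g(2) h(2) have gh: "g \<approx> h" by eventually_elim simp
      have o: "zopen X (U \<inter> N p)" "U \<inter> N p \<noteq> {}" using zopen_Int[OF U Nz(1)[OF pX[OF p]]] p N(1)[OF pX[OF p]] by auto
      have "g = h" by (rule regular_eqI[OF o(1) g(1) h(1)]) (simp add: gen_zopen[OF o] gh)
      then show ?thesis using g(3) h(3) by simp
    qed
    then have "\<forall>V\<in>\<U>. Res H (\<Union>\<U>) V s = Res H (\<Union>\<U>) V t" unfolding cover by (auto simp: \<U>_def)
    from R(7)[OF opn _ _ this] st show ?thesis by (simp add: cover)
  qed
  have germ: "ordge p (\<phi> U s) (- D p)" if U: "zopen X U" and s: "s \<in> carrier (Sec H U)" and p: "p \<in> U" for U s p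
  proof -
    have pX: "p \<in> X" using p zopen_subset[OF U] by blast
    obtain g where g: "g \<in> regular X (U \<inter> N p)" "(\<lambda>q. \<phi> U s q * a p q) \<approx> g" using K[OF U s p] by blast
    have "regat p g" using regular_regat[OF zopen_Int[OF U Nz(1)[OF pX]] g(1)] p N(1)[OF pX] by blast
    then have "ordge p (\<lambda>q. \<phi> U s q * a p q) 0"
      using g(2) by (intro ordge_cong[OF regat_ordge]) (auto elim: eventually_mono)
    then have "ordge p (\<lambda>q. \<phi> U s q * a p q) (- D p + D p)" by simp
    then show ?thesis using ordge_mult_iff[OF aD[OF pX]] by blast
  qed
  have surj: "\<exists>s\<in>carrier (Sec H U). \<forall>\<^sub>F q in gen U. \<phi> U s q = m q"
    if U: "zopen X U" and m: "\<And>p. p \<in> U \<Longrightarrow> ordge p m (- D p)" for U m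
  proof -
    \<comment> \<open>The cover consists of all open subsets that carry a section with coordinate
      \<open>m\<close>. By injectivity any choice of such sections is compatible on overlaps, so
      they glue.\<close>
    define \<U> where "\<U> = {V. zopen X V \<and> V \<subseteq> U \<and> (\<exists>s\<in>carrier (Sec H V). \<forall>\<^sub>F q in gen V. \<phi> V s q = m q)}"
    define \<sigma> where "\<sigma> V = (SOME s. s \<in> carrier (Sec H V) \<and> (\<forall>\<^sub>F q in gen V. \<phi> V s q = m q))" for V
    have \<sigma>: "\<sigma> V \<in> carrier (Sec H V)" "\<forall>\<^sub>F q in gen V. \<phi> V (\<sigma> V) q = m q" if "V \<in> \<U>" for V
    proof -
      have "\<exists>s. s \<in> carrier (Sec H V) \<and> (\<forall>\<^sub>F q in gen V. \<phi> V s q = m q)" using that by (auto simp: \<U>_def)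
      from someI_ex[OF this] show "\<sigma> V \<in> carrier (Sec H V)" "\<forall>\<^sub>F q in gen V. \<phi> V (\<sigma> V) q = m q"
        by (simp_all add: \<sigma>_def)
    qed
    have local: "\<exists>V\<in>\<U>. p \<in> V" if p: "p \<in> U" for p
    proof -
      have pX: "p \<in> X" using p zopen_subset[OF U] by blast
      have "ordge p (\<lambda>q. m q * a p q) (- D p + D p)" using ordge_mult_iff[OF aD[OF pX]] m[OF p] by blast
      then obtain g where g: "regat p g" "(\<lambda>q. m q * a p q) \<approx> g" by (auto simp: ordge_0_iff)
      obtain W0 where W0: "zopen X W0" "p \<in> W0" "\<forall>q\<in>W0. regat q g" using regat_open[OF g(1)] by blast
      define V where "V = W0 \<inter> (U \<inter> N p)"
      have V: "zopen X V" "p \<in> V" "V \<subseteq> U" "V \<subseteq> N p" "V \<noteq> {}"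
        using zopen_Int[OF W0(1) zopen_Int[OF U Nz(1)[OF pX]]] W0 p N(1)[OF pX] by (auto simp: V_def)
      interpret M: module "structure_sheaf X V" "Sec H V" by (rule R(1)[OF V(1)])
      have gV: "restrict g V \<in> regular X V" using W0 V by (auto simp: regular_iff regat_restrict V_def)
      define s where "s = restrict g V \<odot>\<^bsub>Sec H V\<^esub> Res H (N p) V (e p 0)"
      have s: "s \<in> carrier (Sec H V)"
        unfolding s_def using gV R(2)[OF Nz(1)[OF pX] V(1,4) Nz(2)[OF pX]] by simp
      obtain h where h: "h \<in> regular X (V \<inter> N p)" "(\<lambda>q. \<phi> V s q * a p q) \<approx> h"
        "Res H V (V \<inter> N p) s = h \<odot>\<^bsub>Sec H (V \<inter> N p)\<^esub> Res H (N p) (V \<inter> N p) (e p 0)" using K[OF V(1) s V(2)] by blast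
      have VN: "V \<inter> N p = V" using V(4) by auto
      have "s = h \<odot>\<^bsub>Sec H V\<^esub> Res H (N p) V (e p 0)" using h(3) R(5)[OF V(1) s] by (simp add: VN)
      then have "restrict g V = h"
        using frame_1_coord(2)[OF ms N(2)[OF pX] V(1,4) gV, of h] h(1) by (simp add: VN s_def)
      then have "\<forall>\<^sub>F q in gen X. h q = g q" using eventually_zopen[OF V(1,5)] by (auto elim: eventually_mono)
      with g(2) h(2) nz_nonzero[OF anz[OF pX]] have "\<phi> V s \<approx> m"
        by eventually_elim (metis mult_cancel_right)
      then have "V \<in> \<U>" using V s gen_zopen[OF V(1,5)] by (auto simp: \<U>_def)
      then show ?thesis using V(2) by blast
    qed
    have cover: "\<Union>\<U> = U" using local by (auto simp: \<U>_def)
    have opn: "\<forall>V\<in>\<U>. zopen X V" by (auto simp: \<U>_def)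
    have "Res H V (V \<inter> W) (\<sigma> V) = Res H W (V \<inter> W) (\<sigma> W)" if V: "V \<in> \<U>" and W: "W \<in> \<U>" for V W
    proof -
      have o: "zopen X V" "zopen X W" "zopen X (V \<inter> W)" using opn V W zopen_Int by auto
      show ?thesis
      proof (rule inj[OF o(3) R(2)[OF o(1,3) _ \<sigma>(1)[OF V]] R(2)[OF o(2,3) _ \<sigma>(1)[OF W]]])
        show "\<forall>\<^sub>F q in gen (V \<inter> W). \<phi> (V \<inter> W) (Res H V (V \<inter> W) (\<sigma> V)) q = \<phi> (V \<inter> W) (Res H W (V \<inter> W) (\<sigma> W)) q"
          using \<phi>_res[OF o(1,3) _ \<sigma>(1)[OF V], simplified] \<phi>_res[OF o(2,3) _ \<sigma>(1)[OF W], simplified]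
            eventually_gen_subset[OF \<sigma>(2)[OF V], of "V \<inter> W", simplified] eventually_gen_subset[OF \<sigma>(2)[OF W], of "V \<inter> W", simplified]
          by eventually_elim simp
      qed auto
    qed
    with R(8)[OF opn, of \<sigma>] \<sigma>(1) obtain s where s: "s \<in> carrier (Sec H U)" "\<forall>V\<in>\<U>. Res H U V s = \<sigma> V"
      unfolding cover by blast
    have "\<forall>\<^sub>F q in gen U. \<phi> U s q = m q"
    proof (cases "U = {}")
      case False
      then obtain p where "p \<in> U" by blast
      then obtain V where V: "V \<in> \<U>" "p \<in> V" using local by blast
      then have VU: "zopen X V" "V \<subseteq> U" "V \<noteq> {}" by (auto simp: \<U>_def)
      have "\<forall>\<^sub>F q in gen V. \<phi> U s q = m q"
        using \<phi>_res[OF U VU(1,2) s(1)] \<sigma>(2)[OF V(1)] s(2)[rule_format, OF V(1)] by (auto elim: eventually_elim2)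
      then show ?thesis using gen_zopen[OF VU(1,3)] gen_zopen[OF U False] by simp
    qed (simp add: gen_empty)
    then show ?thesis using s(1) by blast
  qed
  have zero: "\<zero>\<^bsub>Sec H U\<^esub> \<in> carrier (Sec H U)" "\<forall>\<^sub>F q in gen U. \<phi> U \<zero>\<^bsub>Sec H U\<^esub> q = 0" if U: "zopen X U" for U
  proof -
    interpret M: module "structure_sheaf X U" "Sec H U" by (rule R(1)[OF U])
    show "\<zero>\<^bsub>Sec H U\<^esub> \<in> carrier (Sec H U)" by simp
    show "\<forall>\<^sub>F q in gen U. \<phi> U \<zero>\<^bsub>Sec H U\<^esub> q = 0"
      using \<phi>_add[OF U M.M.zero_closed M.M.zero_closed] by (auto elim: eventually_mono)
  qed
  have "line_model X H D (\<lambda>U s i. \<phi> U s)"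
  proof (rule line_modelI[OF D])
    fix U s t assume U: "zopen X U" and st: "s \<in> carrier (Sec H U)" "t \<in> carrier (Sec H U)"
    interpret M: module "structure_sheaf X U" "Sec H U" by (rule R(1)[OF U])
    show "s \<oplus>\<^bsub>Sec H U\<^esub> t \<in> carrier (Sec H U)" using st by simp
  next
    fix U b s assume U: "zopen X U" and bs: "b \<in> regular X U" "s \<in> carrier (Sec H U)"
    interpret M: module "structure_sheaf X U" "Sec H U" by (rule R(1)[OF U])
    show "b \<odot>\<^bsub>Sec H U\<^esub> s \<in> carrier (Sec H U)" using bs by simp
  qed (fact zero R(2) \<phi>_add \<phi>_smult \<phi>_res germ inj surj)+
  then show ?thesis by blast
qed

end

section \<open>Tensor powers, subsheaves and images\<close>

context line_model
begin

definition chosen_generator :: "'n pt set \<Rightarrow> 'n pt set \<times> 'm" where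
  "chosen_generator U = (SOME We. fst We \<noteq> {} \<and> fst We \<subseteq> U \<and> generator X F (fst We) (snd We))"

text \<open>The coordinate \<open>s W e\<close> refers to \<open>e^k\<close>, so multiplying it by
  \<open>\<psi> W e 0\<close> to the power \<open>k\<close> gives a rational function that does not
  depend on \<open>W\<close> and \<open>e\<close>. The chosen \<open>W\<close> is nonempty, hence
  determines the function generically.\<close>

definition tensor_coord :: "int \<Rightarrow> 'n pt set \<Rightarrow> ('n pt set \<Rightarrow> 'm \<Rightarrow> 'n pt \<Rightarrow> complex) \<Rightarrow> 'n pt \<Rightarrow> complex" where
  "tensor_coord k U s = (let (W, e) = chosen_generator U in (\<lambda>q. s W e q * \<psi> W e 0 q powi k))"

lemma chosen_generator:
  assumes "zopen X U" "U \<noteq> {}"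
  obtains W e where "chosen_generator U = (W, e)" "W \<noteq> {}" "W \<subseteq> U" "generator X F W e"
proof -
  obtain p where "p \<in> U" using assms by blast
  then obtain W e where "p \<in> W" "W \<subseteq> U" "generator X F W e" using generator_inside assms(1) by blast
  then have "\<exists>We. fst We \<noteq> {} \<and> fst We \<subseteq> U \<and> generator X F (fst We) (snd We)"
    by (intro exI[of _ "(W, e)"]) auto
  from someI_ex[OF this] show ?thesis
    using that[of "fst (chosen_generator U)" "snd (chosen_generator U)"] by (simp add: chosen_generator_def)
qed

lemma generator_nz: "generator X F W e \<Longrightarrow> W \<noteq> {} \<Longrightarrow> nz (\<psi> W e 0)"
  using generator_ord hasord_nz by blast

lemma coordinatewise_idem: "coordinatewise X F U (coordinatewise X F U t) = coordinatewise X F U t"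
  by (auto simp: coordinatewise_def fun_eq_iff)

lemma coordinatewise_apply:
  "W \<subseteq> U \<Longrightarrow> generator X F W e \<Longrightarrow> coordinatewise X F U t W e = restrict (t W e) W"
  by (simp add: coordinatewise_def)

lemma tensor_power_carrier:
  "s \<in> carrier (Sec (tensor_power X F k) U) \<longleftrightarrow> s = coordinatewise X F U s \<and>
     (\<forall>W e. W \<subseteq> U \<and> generator X F W e \<longrightarrow> s W e \<in> regular X W \<and>
        (\<forall>V. zopen X V \<and> V \<subseteq> W \<longrightarrow> s V (Res F W V e) = restrict (s W e) V) \<and>
        (\<forall>u\<in>regular X W. (\<forall>q\<in>W. u q \<noteq> 0) \<longrightarrow>
           s W (u \<odot>\<^bsub>Sec F W\<^esub> e) = (\<lambda>q\<in>W. u q powi (- k) * s W e q)))"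
  by (simp add: tensor_power_def)

lemma tensor_power_regular:
  "s \<in> carrier (Sec (tensor_power X F k) U) \<Longrightarrow> W \<subseteq> U \<Longrightarrow> generator X F W e \<Longrightarrow> s W e \<in> regular X W"
  unfolding tensor_power_carrier by blast

lemma tensor_coord_unique:
  assumes U: "zopen X U"
    and m: "\<And>W e. W \<subseteq> U \<Longrightarrow> generator X F W e \<Longrightarrow> \<forall>\<^sub>F q in gen W. s W e q = m q * \<psi> W e 0 q powi (- k)"
  shows "\<forall>\<^sub>F q in gen U. tensor_coord k U s q = m q"
proof (cases "U = {}")
  case False
  obtain W e where W: "chosen_generator U = (W, e)" "W \<noteq> {}" "W \<subseteq> U" "generator X F W e"
    using chosen_generator[OF U False] .
  have "\<forall>\<^sub>F q in gen X. s W e q = m q * \<psi> W e 0 q powi (- k)"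
    using m[OF W(3,4)] gen_zopen[OF generatorD(1)[OF W(4)] W(2)] by simp
  then have "tensor_coord k U s \<approx> m"
    using nz_nonzero[OF generator_nz[OF W(4,2)]]
    by eventually_elim (simp add: tensor_coord_def W power_int_minus)
  then show ?thesis using gen_zopen[OF U False] by simp
qed (simp add: gen_empty)

lemma tensor_power_intro:
  assumes U: "zopen X U"
    and reg: "\<And>W e. W \<subseteq> U \<Longrightarrow> generator X F W e \<Longrightarrow> restrict (t W e) W \<in> regular X W"
    and m: "\<And>W e. W \<subseteq> U \<Longrightarrow> generator X F W e \<Longrightarrow> \<forall>\<^sub>F q in gen W. t W e q = m q * \<psi> W e 0 q powi (- k)"
  shows "coordinatewise X F U t \<in> carrier (Sec (tensor_power X F k) U)"
    "\<forall>\<^sub>F q in gen U. tensor_coord k U (coordinatewise X F U t) q = m q"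
proof -
  define s where "s = coordinatewise X F U t"
  have s: "s W e = restrict (t W e) W" if "W \<subseteq> U" "generator X F W e" for W e
    using that by (simp add: s_def coordinatewise_apply)
  have sm: "\<forall>\<^sub>F q in gen W. s W e q = m q * \<psi> W e 0 q powi (- k)"
    if "W \<subseteq> U" "generator X F W e" for W e
    using m[OF that] eventually_gen_in by eventually_elim (simp add: s[OF that])
  have sr: "s W e \<in> regular X W" if "W \<subseteq> U" "generator X F W e" for W e
    using reg[OF that] by (simp add: s[OF that])
  show "\<forall>\<^sub>F q in gen U. tensor_coord k U (coordinatewise X F U t) q = m q"
    unfolding s_def[symmetric] by (rule tensor_coord_unique[OF U sm])
  have "s V (Res F W V e) = restrict (s W e) V"
    if W: "W \<subseteq> U" "generator X F W e" and V: "zopen X V" "V \<subseteq> W" for W e V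
  proof (rule regular_eqI[OF V(1)])
    have gV: "generator X F V (Res F W V e)" by (rule generator_restrict[OF W(2) V])
    have VU: "V \<subseteq> U" using V W by blast
    show "s V (Res F W V e) \<in> regular X V" by (rule sr[OF VU gV])
    show "restrict (s W e) V \<in> regular X V"
      by (rule regular_restrict[OF generatorD(1)[OF W(2)] V sr[OF W]])
    have "\<forall>\<^sub>F q in gen V. \<psi> V (Res F W V e) 0 q = \<psi> W e 0 q"
      using coord_res[OF generatorD(1)[OF W(2)] V generatorD(2)[OF W(2)]] by simp
    then show "\<forall>\<^sub>F q in gen V. s V (Res F W V e) q = restrict (s W e) V q"
      using sm[OF VU gV] eventually_gen_subset[OF sm[OF W] V(2)] eventually_gen_in
      by eventually_elim simp
  qed
  moreover have "s W (u \<odot>\<^bsub>Sec F W\<^esub> e) = (\<lambda>q\<in>W. u q powi (- k) * s W e q)"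
    if W: "W \<subseteq> U" "generator X F W e" and u: "u \<in> regular X W" "\<forall>q\<in>W. u q \<noteq> 0" for W e u
  proof (rule regular_eqI[OF generatorD(1)[OF W(2)]])
    note Wo = generatorD[OF W(2)]
    have gu: "generator X F W (u \<odot>\<^bsub>Sec F W\<^esub> e)" using generator_unit[OF W(2) u(1)] u(2) by blast
    show "s W (u \<odot>\<^bsub>Sec F W\<^esub> e) \<in> regular X W" by (rule sr[OF W(1) gu])
    show "(\<lambda>q\<in>W. u q powi (- k) * s W e q) \<in> regular X W"
      using sr[OF W] u Wo(1)
      by (auto simp: regular_iff regat_restrict intro!: regat_mult regat_powi)
    have "\<forall>\<^sub>F q in gen W. \<psi> W (u \<odot>\<^bsub>Sec F W\<^esub> e) 0 q = u q * \<psi> W e 0 q"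
      using coord_smult[OF Wo(1) u(1) Wo(2)] by simp
    then show "\<forall>\<^sub>F q in gen W. s W (u \<odot>\<^bsub>Sec F W\<^esub> e) q = (\<lambda>q\<in>W. u q powi (- k) * s W e q) q"
      using sm[OF W(1) gu] sm[OF W] eventually_gen_in
      by eventually_elim (simp add: power_int_mult_distrib algebra_simps)
  qed
  ultimately show "coordinatewise X F U t \<in> carrier (Sec (tensor_power X F k) U)"
    unfolding s_def[symmetric] tensor_power_carrier
    using sr coordinatewise_idem[of U t] by (auto simp: s_def)
qed

text \<open>On the overlap two generators differ by a unit \<open>u\<close>. The transformation rule
  of the tensor power multiplies the coordinate by \<open>u\<close> to the power \<open>- k\<close>,
  and the power of the generator's own coordinate compensates this.\<close>

lemma tensor_coord:
  assumes U: "zopen X U" and s: "s \<in> carrier (Sec (tensor_power X F k) U)"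
    and W: "W \<subseteq> U" "generator X F W e"
  shows "\<forall>\<^sub>F q in gen W. s W e q = tensor_coord k U s q * \<psi> W e 0 q powi (- k)"
proof (cases "W = {}")
  case False
  note Wo = generatorD[OF W(2)]
  have Une: "U \<noteq> {}" using False W by blast
  obtain W' e' where W': "chosen_generator U = (W', e')" "W' \<noteq> {}" "W' \<subseteq> U" "generator X F W' e'"
    using chosen_generator[OF U Une] .
  note Wo' = generatorD[OF W'(4)]
  note sD = s[unfolded tensor_power_carrier, THEN conjunct2, rule_format]
  define V where "V = W \<inter> W'"
  have V: "zopen X V" "V \<subseteq> W" "V \<subseteq> W'" "V \<subseteq> U" "V \<noteq> {}"
    using zopen_Int[OF Wo(1) Wo'(1)] zopen_Int_nonempty[OF Wo(1) Wo'(1) False W'(2)] W by (auto simp: V_def)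
  define f f' where "f = Res F W V e" and "f' = Res F W' V e'"
  have f: "generator X F V f" "generator X F V f'"
    unfolding f_def f'_def by (rule generator_restrict[OF W(2) V(1,2)], rule generator_restrict[OF W'(4) V(1,3)])
  obtain u where u: "u \<in> regular X V" "f = u \<odot>\<^bsub>Sec F V\<^esub> f'"
  proof -
    obtain a where "a \<in> regular X V" "f = a \<odot>\<^bsub>Sec F V\<^esub> Res F V V f'"
      using frame_1_coord(1)[OF module_sheaf f(2) V(1) order_refl generatorD(2)[OF f(1)]] by blast
    then show ?thesis using that module_sheafD(5)[OF module_sheaf V(1) generatorD(2)[OF f(2)]] by simp
  qed
  have \<psi>u: "\<psi> V f 0 \<approx> (\<lambda>q. u q * \<psi> V f' 0 q)"
    using coord_smult[OF V(1) u(1) generatorD(2)[OF f(2)]] gen_zopen[OF V(1,5)] u(2) by simp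
  have u0: "u q \<noteq> 0" if q: "q \<in> V" for q
  proof (rule hasord_regat_nonzero)
    show "regat q u" by (rule regular_regat[OF V(1) u(1) q])
    have "hasord q (\<lambda>q. \<psi> V f 0 q * inverse (\<psi> V f' 0 q)) (- D q + - (- D q))"
      by (intro hasord_mult hasord_inverse generator_ord f q)
    moreover have "(\<lambda>q. \<psi> V f 0 q * inverse (\<psi> V f' 0 q)) \<approx> u"
      using \<psi>u nz_nonzero[OF generator_nz[OF f(2) V(5)]] by eventually_elim simp
    ultimately show "hasord q u 0" using hasord_cong by fastforce
  qed
  have "s V (u \<odot>\<^bsub>Sec F V\<^esub> f') = (\<lambda>q\<in>V. u q powi (- k) * s V f' q)"
    using sD[of V f'] V(4) f(2) u(1) u0 by blast
  then have 1: "s V f = (\<lambda>q\<in>V. u q powi (- k) * s V f' q)" by (simp only: u(2))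
  have 2: "s V f = restrict (s W e) V" unfolding f_def using sD[of W e] W V by blast
  have 3: "s V f' = restrict (s W' e') V" unfolding f'_def using sD[of W' e'] W' V by blast
  have rel: "s W e q = u q powi (- k) * s W' e' q" if "q \<in> V" for q
    using fun_cong[OF 1, of q] that by (simp add: 2 3)
  have e1: "\<psi> V f 0 \<approx> \<psi> W e 0" and e2: "\<psi> V f' 0 \<approx> \<psi> W' e' 0"
    unfolding f_def f'_def
    using coord_res[OF Wo(1) V(1,2) Wo(2)] coord_res[OF Wo'(1) V(1,3) Wo'(2)] gen_zopen[OF V(1,5)] by simp_all
  have "\<forall>\<^sub>F q in gen X. s W e q = tensor_coord k U s q * \<psi> W e 0 q powi (- k)"
    using eventually_zopen[OF V(1,5)] \<psi>u e1 e2 nz_nonzero[OF generator_nz[OF W'(4,2)]]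
  proof eventually_elim
    case (elim q)
    have "\<psi> W e 0 q = u q * \<psi> W' e' 0 q" using elim by simp
    then show ?case using elim rel[of q]
      by (simp add: tensor_coord_def W' power_int_minus power_int_mult_distrib)
  qed
  then show ?thesis using gen_zopen[OF Wo(1) False] by simp
qed (simp add: gen_empty)

text \<open>If \<open>F\<close> is O(D), its \<open>k\<close>-th power is O(kD): coordinates with
  respect to \<open>e^k\<close> are regular functions, and \<open>e\<close> has order
  \<open>- D p\<close> at \<open>p\<close>.\<close>

lemma tensor_power_line_model: "line_model X (tensor_power X F k) (\<lambda>p. k * D p) (\<lambda>U s i. tensor_coord k U s)"
proof (rule line_modelI)
  show "finsupp (\<lambda>p. k * D p)" by (rule finsupp_cmult[OF finsupp_D])
next
  fix U assume U: "zopen X U"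
  have z: "\<zero>\<^bsub>Sec (tensor_power X F k) U\<^esub> = coordinatewise X F U (\<lambda>W e q. 0)" by (simp add: tensor_power_def)
  have r: "restrict (\<lambda>q. 0) W \<in> regular X W" if "W \<subseteq> U" "generator X F W e" for W e
    by (rule regular_const[OF generatorD(1)[OF that(2)]])
  note i = tensor_power_intro[OF U, of "\<lambda>W e q. 0" "\<lambda>q. 0" k, OF this]
  show "\<zero>\<^bsub>Sec (tensor_power X F k) U\<^esub> \<in> carrier (Sec (tensor_power X F k) U)"
    "\<forall>\<^sub>F q in gen U. tensor_coord k U \<zero>\<^bsub>Sec (tensor_power X F k) U\<^esub> q = 0"
    unfolding z using i by auto
next
  fix U s t assume U: "zopen X U" and s: "s \<in> carrier (Sec (tensor_power X F k) U)"
    and t: "t \<in> carrier (Sec (tensor_power X F k) U)"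
  have a: "s \<oplus>\<^bsub>Sec (tensor_power X F k) U\<^esub> t = coordinatewise X F U (\<lambda>W e q. s W e q + t W e q)"
    by (simp add: tensor_power_def)
  have r: "restrict (\<lambda>q. s W e q + t W e q) W \<in> regular X W" if "W \<subseteq> U" "generator X F W e" for W e
    by (rule regular_add[OF generatorD(1)[OF that(2)] tensor_power_regular[OF s that] tensor_power_regular[OF t that]])
  have m: "\<forall>\<^sub>F q in gen W. s W e q + t W e q = (tensor_coord k U s q + tensor_coord k U t q) * \<psi> W e 0 q powi (- k)"
    if "W \<subseteq> U" "generator X F W e" for W e
    using tensor_coord[OF U s that] tensor_coord[OF U t that] by eventually_elim (simp add: algebra_simps)
  show "s \<oplus>\<^bsub>Sec (tensor_power X F k) U\<^esub> t \<in> carrier (Sec (tensor_power X F k) U)"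
    "\<forall>\<^sub>F q in gen U. tensor_coord k U (s \<oplus>\<^bsub>Sec (tensor_power X F k) U\<^esub> t) q = tensor_coord k U s q + tensor_coord k U t q"
    unfolding a
    by (rule tensor_power_intro[OF U], (rule r; assumption), (rule m; assumption))+
next
  fix U a s assume U: "zopen X U" and b: "a \<in> regular X U" and s: "s \<in> carrier (Sec (tensor_power X F k) U)"
  have a: "a \<odot>\<^bsub>Sec (tensor_power X F k) U\<^esub> s = coordinatewise X F U (\<lambda>W e q. a q * s W e q)"
    by (simp add: tensor_power_def)
  have r: "restrict (\<lambda>q. a q * s W e q) W \<in> regular X W" if "W \<subseteq> U" "generator X F W e" for W e
  proof -
    have "s W e \<in> regular X W" by (rule tensor_power_regular[OF s that])
    moreover have "zopen X W" using generatorD that by blast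
    ultimately show ?thesis using b U that(1) by (auto simp: regular_iff regat_restrict intro!: regat_mult)
  qed
  have m: "\<forall>\<^sub>F q in gen W. a q * s W e q = (a q * tensor_coord k U s q) * \<psi> W e 0 q powi (- k)"
    if "W \<subseteq> U" "generator X F W e" for W e
    using tensor_coord[OF U s that] by eventually_elim simp
  show "a \<odot>\<^bsub>Sec (tensor_power X F k) U\<^esub> s \<in> carrier (Sec (tensor_power X F k) U)"
    "\<forall>\<^sub>F q in gen U. tensor_coord k U (a \<odot>\<^bsub>Sec (tensor_power X F k) U\<^esub> s) q = a q * tensor_coord k U s q"
    unfolding a
    by (rule tensor_power_intro[OF U], (rule r; assumption), (rule m; assumption))+
next
  fix U V s assume U: "zopen X U" and V: "zopen X V" "V \<subseteq> U" and s: "s \<in> carrier (Sec (tensor_power X F k) U)"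
  have res: "Res (tensor_power X F k) U V s = coordinatewise X F V s" by (simp add: tensor_power_def)
  have r: "restrict (s W e) W \<in> regular X W" if "W \<subseteq> V" "generator X F W e" for W e
  proof -
    have "s W e \<in> regular X W" using tensor_power_regular[OF s _ that(2)] that(1) V(2) by blast
    moreover have "zopen X W" using generatorD that by blast
    ultimately show ?thesis by (simp add: regular_iff regat_restrict)
  qed
  have m: "\<forall>\<^sub>F q in gen W. s W e q = tensor_coord k U s q * \<psi> W e 0 q powi (- k)"
    if "W \<subseteq> V" "generator X F W e" for W e
    using tensor_coord[OF U s _ that(2)] that(1) V(2) by blast
  show "Res (tensor_power X F k) U V s \<in> carrier (Sec (tensor_power X F k) V)"
    "\<forall>\<^sub>F q in gen V. tensor_coord k V (Res (tensor_power X F k) U V s) q = tensor_coord k U s q"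
    unfolding res
    by (rule tensor_power_intro[OF V(1)], (rule r; assumption), (rule m; assumption))+
next
  fix U s p assume U: "zopen X U" and s: "s \<in> carrier (Sec (tensor_power X F k) U)" and p: "p \<in> U"
  obtain W e where W: "p \<in> W" "W \<subseteq> U" "generator X F W e" using generator_inside[OF U p] .
  have "s W e \<in> regular X W" by (rule tensor_power_regular[OF s W(2,3)])
  then have "regat p (s W e)" using regular_regat generatorD W by blast
  then have "ordge p (\<lambda>q. s W e q * \<psi> W e 0 q powi k) (0 + k * (- D p))"
    by (intro ordge_mult regat_ordge hasord_ordge hasord_powi generator_ord W)
  moreover have "(\<lambda>q. s W e q * \<psi> W e 0 q powi k) \<approx> tensor_coord k U s"
  proof -
    have Wne: "W \<noteq> {}" using W by blast
    have "\<forall>\<^sub>F q in gen X. s W e q = tensor_coord k U s q * \<psi> W e 0 q powi (- k)"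
      using tensor_coord[OF U s W(2,3)] gen_zopen[OF generatorD(1)[OF W(3)] Wne] by simp
    then show ?thesis using nz_nonzero[OF generator_nz[OF W(3) Wne]]
      by eventually_elim (simp add: power_int_minus)
  qed
  ultimately show "ordge p (tensor_coord k U s) (- (k * D p))" using ordge_cong by fastforce
next
  fix U s t assume U: "zopen X U" and s: "s \<in> carrier (Sec (tensor_power X F k) U)"
    and t: "t \<in> carrier (Sec (tensor_power X F k) U)"
    and eq: "\<forall>\<^sub>F q in gen U. tensor_coord k U s q = tensor_coord k U t q"
  have "s W e = t W e" if W: "W \<subseteq> U" "generator X F W e" for W e
  proof (rule regular_eqI[OF generatorD(1)[OF W(2)]])
    show "s W e \<in> regular X W" "t W e \<in> regular X W"
      by (rule tensor_power_regular[OF s W], rule tensor_power_regular[OF t W])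
    show "\<forall>\<^sub>F q in gen W. s W e q = t W e q"
      using tensor_coord[OF U s W] tensor_coord[OF U t W] eventually_gen_subset[OF eq W(1)]
      by eventually_elim simp
  qed
  then have "coordinatewise X F U s = coordinatewise X F U t" by (auto simp: coordinatewise_def fun_eq_iff)
  moreover have "s = coordinatewise X F U s" "t = coordinatewise X F U t"
    using s t unfolding tensor_power_carrier by blast+
  ultimately show "s = t" by simp
next
  fix U f assume U: "zopen X U" and f: "\<And>p. p \<in> U \<Longrightarrow> ordge p f (- (k * D p))"
  \<comment> \<open>A function \<open>f\<close> with poles bounded by \<open>k D\<close> has the
    coordinate \<open>f * e^(-k)\<close>, which has no poles; for each generator the regular
    function generically equal to it is chosen.\<close>
  define t where "t W e = (SOME g. g \<in> regular X W \<and> (\<forall>\<^sub>F q in gen W. g q = f q * \<psi> W e 0 q powi (- k)))" for W e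
  have t: "t W e \<in> regular X W \<and> (\<forall>\<^sub>F q in gen W. t W e q = f q * \<psi> W e 0 q powi (- k))"
    if W: "W \<subseteq> U" "generator X F W e" for W e
  proof -
    have "ordge p (\<lambda>q. f q * \<psi> W e 0 q powi (- k)) 0" if p: "p \<in> W" for p
    proof -
      have "ordge p (\<lambda>q. f q * \<psi> W e 0 q powi (- k)) (- (k * D p) + - k * (- D p))"
        using p W by (intro ordge_mult f hasord_ordge hasord_powi generator_ord) auto
      then show ?thesis by simp
    qed
    from regular_glue[OF generatorD(1)[OF W(2)] this] obtain g where
      "g \<in> regular X W" "\<forall>\<^sub>F q in gen W. g q = f q * \<psi> W e 0 q powi (- k)" .
    then show ?thesis unfolding t_def by (intro someI[where P = "\<lambda>g. g \<in> regular X W \<and> _ g"]) auto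
  qed
  have r: "restrict (t W e) W \<in> regular X W" if "W \<subseteq> U" "generator X F W e" for W e
    using t[OF that] generatorD(1)[OF that(2)] by (simp add: regular_iff regat_restrict)
  have m: "\<forall>\<^sub>F q in gen W. t W e q = f q * \<psi> W e 0 q powi (- k)" if "W \<subseteq> U" "generator X F W e" for W e
    using t[OF that] by blast
  show "\<exists>s\<in>carrier (Sec (tensor_power X F k) U). \<forall>\<^sub>F q in gen U. tensor_coord k U s q = f q"
  proof (rule bexI[of _ "coordinatewise X F U t"])
    show "\<forall>\<^sub>F q in gen U. tensor_coord k U (coordinatewise X F U t) q = f q"
      by (rule tensor_power_intro[OF U], (rule r; assumption), (rule m; assumption))
    show "coordinatewise X F U t \<in> carrier (Sec (tensor_power X F k) U)"
      by (rule tensor_power_intro[OF U], (rule r; assumption), (rule m; assumption))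
  qed
qed

end

section \<open>Subsheaves given by germ conditions, and images of injections\<close>

context sheaf_model
begin

text \<open>The image and the kernel of the evaluation map are both of this kind: they consist of
  the sections whose tuples satisfy a stronger condition on germs.\<close>

lemma sub_sheaf_model:
  assumes germ: "\<And>p. p \<in> X \<Longrightarrow> C' p (\<lambda>i q. 0)"
      "\<And>p m m'. p \<in> X \<Longrightarrow> C' p m \<Longrightarrow> C' p m' \<Longrightarrow> C' p (\<lambda>i q. m i q + m' i q)"
      "\<And>p a m. p \<in> X \<Longrightarrow> regat p a \<Longrightarrow> C' p m \<Longrightarrow> C' p (\<lambda>i q. a q * m i q)"
      "\<And>p m m'. p \<in> X \<Longrightarrow> C' p m \<Longrightarrow> (\<And>i. i < r \<Longrightarrow> m i \<approx> m' i) \<Longrightarrow> C' p m'"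
      "\<And>p m. p \<in> X \<Longrightarrow> C' p m \<Longrightarrow> \<exists>V. zopen X V \<and> p \<in> V \<and> (\<forall>q\<in>V. C' q m)"
    and sub: "\<And>p m. p \<in> X \<Longrightarrow> C' p m \<Longrightarrow> C p m"
    and S: "\<And>U. zopen X U \<Longrightarrow> S U = {s \<in> carrier (Sec F U). \<forall>p\<in>U. C' p (\<psi> U s)}"
  shows "sheaf_model X (sub_sheaf F S) r C' \<psi>"
proof -
  have c: "carrier (Sec (sub_sheaf F S) U) = S U" "\<zero>\<^bsub>Sec (sub_sheaf F S) U\<^esub> = \<zero>\<^bsub>Sec F U\<^esub>"
    "s \<oplus>\<^bsub>Sec (sub_sheaf F S) U\<^esub> t = s \<oplus>\<^bsub>Sec F U\<^esub> t" "a \<odot>\<^bsub>Sec (sub_sheaf F S) U\<^esub> s = a \<odot>\<^bsub>Sec F U\<^esub> s"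
    "Res (sub_sheaf F S) = Res F" for U s t a by (simp_all add: sub_sheaf_def)
  have ev: "m \<approx> m'" if "zopen X U" "p \<in> U" "\<forall>\<^sub>F q in gen U. m q = m' q" for U p and m m' :: "'n pt \<Rightarrow> complex"
  proof -
    have "gen U = gen X" using gen_zopen[OF that(1)] that(2) by blast
    then show ?thesis using that(3) by simp
  qed
  have ev_sym: "\<forall>\<^sub>F q in G. m q = m' q \<Longrightarrow> \<forall>\<^sub>F q in G. m' q = m q" for G and m m' :: "'n pt \<Rightarrow> complex"
    by (erule eventually_mono) simp
  have UX: "p \<in> X" if "zopen X U" "p \<in> U" for U p using zopen_subset that by blast
  show ?thesis
  proof unfold_locales
    fix U assume U: "zopen X U"
    show "\<zero>\<^bsub>Sec (sub_sheaf F S) U\<^esub> \<in> carrier (Sec (sub_sheaf F S) U)"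
      unfolding c S[OF U]
    proof (intro CollectI conjI ballI)
      fix p assume p: "p \<in> U"
      show "C' p (\<psi> U \<zero>\<^bsub>Sec F U\<^esub>)"
        by (rule germ(4)[OF UX[OF U p] germ(1)[OF UX[OF U p]]], rule ev[OF U p])
          (rule ev_sym, rule coord_zero[OF U], assumption)
    qed (rule zero_closed[OF U])
    show "\<forall>\<^sub>F q in gen U. \<psi> U \<zero>\<^bsub>Sec (sub_sheaf F S) U\<^esub> i q = 0" if "i < r" for i
      unfolding c by (rule coord_zero[OF U that])
    fix s assume "s \<in> carrier (Sec (sub_sheaf F S) U)"
    then have s: "s \<in> carrier (Sec F U)" "\<And>p. p \<in> U \<Longrightarrow> C' p (\<psi> U s)" using S[OF U] by (auto simp: c)
    show "C' p (\<psi> U s)" if "p \<in> U" for p using s(2)[OF that] .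
    show "a \<odot>\<^bsub>Sec (sub_sheaf F S) U\<^esub> s \<in> carrier (Sec (sub_sheaf F S) U)" if a: "a \<in> regular X U" for a
      unfolding c S[OF U]
    proof (intro CollectI conjI ballI)
      fix p assume p: "p \<in> U"
      show "C' p (\<psi> U (a \<odot>\<^bsub>Sec F U\<^esub> s))"
        by (rule germ(4)[OF UX[OF U p] germ(3)[OF UX[OF U p] regular_regat[OF U a p] s(2)[OF p]]], rule ev[OF U p])
          (rule ev_sym, rule coord_smult[OF U a s(1)], assumption)
    qed (rule smult_closed[OF U a s(1)])
    show "\<forall>\<^sub>F q in gen U. \<psi> U (a \<odot>\<^bsub>Sec (sub_sheaf F S) U\<^esub> s) i q = a q * \<psi> U s i q"
      if "a \<in> regular X U" "i < r" for a i unfolding c by (rule coord_smult[OF U that(1) s(1) that(2)])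
    show "Res (sub_sheaf F S) U V s \<in> carrier (Sec (sub_sheaf F S) V)"
      if V: "zopen X V" "V \<subseteq> U" for V
      unfolding c S[OF V(1)]
    proof (intro CollectI conjI ballI)
      fix p assume p: "p \<in> V"
      then have pU: "p \<in> U" using V by blast
      show "C' p (\<psi> V (Res F U V s))"
        by (rule germ(4)[OF UX[OF U pU] s(2)[OF pU]], rule ev[OF V(1) p])
          (rule ev_sym, rule coord_res[OF U V s(1)], assumption)
    qed (rule res_closed[OF U V s(1)])
    show "\<forall>\<^sub>F q in gen V. \<psi> V (Res (sub_sheaf F S) U V s) i q = \<psi> U s i q"
      if "zopen X V" "V \<subseteq> U" "i < r" for V i unfolding c by (rule coord_res[OF U that(1,2) s(1) that(3)])
    fix t assume "t \<in> carrier (Sec (sub_sheaf F S) U)"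
    then have t: "t \<in> carrier (Sec F U)" "\<And>p. p \<in> U \<Longrightarrow> C' p (\<psi> U t)" using S[OF U] by (auto simp: c)
    show "s \<oplus>\<^bsub>Sec (sub_sheaf F S) U\<^esub> t \<in> carrier (Sec (sub_sheaf F S) U)"
      unfolding c S[OF U]
    proof (intro CollectI conjI ballI)
      fix p assume p: "p \<in> U"
      show "C' p (\<psi> U (s \<oplus>\<^bsub>Sec F U\<^esub> t))"
        by (rule germ(4)[OF UX[OF U p] germ(2)[OF UX[OF U p] s(2)[OF p] t(2)[OF p]]], rule ev[OF U p])
          (rule ev_sym, rule coord_add[OF U s(1) t(1)], assumption)
    qed (rule add_closed[OF U s(1) t(1)])
    show "\<forall>\<^sub>F q in gen U. \<psi> U (s \<oplus>\<^bsub>Sec (sub_sheaf F S) U\<^esub> t) i q = \<psi> U s i q + \<psi> U t i q"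
      if "i < r" for i unfolding c by (rule coord_add[OF U s(1) t(1) that])
    show "s = t" if "\<And>i. i < r \<Longrightarrow> \<forall>\<^sub>F q in gen U. \<psi> U s i q = \<psi> U t i q"
      by (rule coord_inj[OF U s(1) t(1) that])
  next
    fix U m assume U: "zopen X U" and m: "\<And>p. p \<in> U \<Longrightarrow> C' p m"
    have "C p m" if "p \<in> U" for p using sub m UX[OF U] that by blast
    from coord_surj[OF U this] obtain s where s: "s \<in> carrier (Sec F U)"
      "\<And>i. i < r \<Longrightarrow> \<forall>\<^sub>F q in gen U. \<psi> U s i q = m i q" by blast
    have "C' p (\<psi> U s)" if p: "p \<in> U" for p
      by (rule germ(4)[OF UX[OF U p] m[OF p]], rule ev[OF U p]) (rule ev_sym, rule s(2), assumption)
    then have "s \<in> S U" using s(1) S[OF U] by blast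
    then show "\<exists>s\<in>carrier (Sec (sub_sheaf F S) U). \<forall>i<r. \<forall>\<^sub>F q in gen U. \<psi> U s i q = m i q"
      unfolding c using s(2) by blast
  qed (fact germ)+
qed

text \<open>\<open>semistable\<close> quantifies over subsheaves, so an injection into a bundle has
  to be replaced by its image. The image keeps the tuples and the germ condition of the source, read
  through the inverse of \<open>\<phi>\<close>.\<close>

lemma image_model:
  fixes M :: "('n, 'k) sheaf"
  assumes inj: "sheaf_injection X F M \<phi>" and M: "module_sheaf X M"
  shows "sheaf_model X (sub_sheaf M (\<lambda>U. \<phi> U ` carrier (Sec F U))) r C
    (\<lambda>U h. \<psi> U (inv_into (carrier (Sec F U)) (\<phi> U) h))"
proof -
  let ?G = "sub_sheaf M (\<lambda>U. \<phi> U ` carrier (Sec F U))"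
  have c: "carrier (Sec ?G U) = \<phi> U ` carrier (Sec F U)" "\<zero>\<^bsub>Sec ?G U\<^esub> = \<zero>\<^bsub>Sec M U\<^esub>"
    "s \<oplus>\<^bsub>Sec ?G U\<^esub> t = s \<oplus>\<^bsub>Sec M U\<^esub> t" "a \<odot>\<^bsub>Sec ?G U\<^esub> s = a \<odot>\<^bsub>Sec M U\<^esub> s"
    "Res ?G = Res M" for U s t a by (simp_all add: sub_sheaf_def)
  have mor: "sheaf_morphism X F M \<phi>" using inj by (simp add: sheaf_injection_def)
  have \<phi>: "\<phi> U s \<in> carrier (Sec M U)" "\<phi> U (s \<oplus>\<^bsub>Sec F U\<^esub> t) = \<phi> U s \<oplus>\<^bsub>Sec M U\<^esub> \<phi> U t"
    "a \<in> regular X U \<Longrightarrow> \<phi> U (a \<odot>\<^bsub>Sec F U\<^esub> s) = a \<odot>\<^bsub>Sec M U\<^esub> \<phi> U s"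
    if "zopen X U" "s \<in> carrier (Sec F U)" "t \<in> carrier (Sec F U)" for U s t a
    using mor[unfolded sheaf_morphism_def, THEN conjunct1, THEN spec, of U] that by auto
  have \<phi>r: "\<phi> V (Res F U V s) = Res M U V (\<phi> U s)"
    if "zopen X U" "zopen X V" "V \<subseteq> U" "s \<in> carrier (Sec F U)" for U V s
    using mor[unfolded sheaf_morphism_def, THEN conjunct2, THEN spec, THEN spec, of U V] that by auto
  have io: "inj_on (\<phi> U) (carrier (Sec F U))" if "zopen X U" for U using inj that by (simp add: sheaf_injection_def)
  have iv: "inv_into (carrier (Sec F U)) (\<phi> U) (\<phi> U s) = s" if "zopen X U" "s \<in> carrier (Sec F U)" for U s
    using io that by simp
  have zero: "\<phi> U \<zero>\<^bsub>Sec F U\<^esub> = \<zero>\<^bsub>Sec M U\<^esub>" if U: "zopen X U" for U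
  proof -
    interpret N: module "structure_sheaf X U" "Sec M U" by (rule module_sheafD(1)[OF M U])
    interpret N': module "structure_sheaf X U" "Sec F U" by (rule module_Sec[OF U])
    have z: "\<zero>\<^bsub>structure_sheaf X U\<^esub> \<in> regular X U" using N.R.zero_closed by simp
    have "\<phi> U \<zero>\<^bsub>Sec F U\<^esub> = \<phi> U (\<zero>\<^bsub>structure_sheaf X U\<^esub> \<odot>\<^bsub>Sec F U\<^esub> \<zero>\<^bsub>Sec F U\<^esub>)" by simp
    also have "\<dots> = \<zero>\<^bsub>structure_sheaf X U\<^esub> \<odot>\<^bsub>Sec M U\<^esub> \<phi> U \<zero>\<^bsub>Sec F U\<^esub>"
      by (rule \<phi>(3)[OF U zero_closed[OF U] zero_closed[OF U] z])
    also have "\<dots> = \<zero>\<^bsub>Sec M U\<^esub>" using \<phi>(1)[OF U zero_closed[OF U] zero_closed[OF U]] by simp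
    finally show ?thesis .
  qed
  show ?thesis
  proof unfold_locales
    fix U assume U: "zopen X U"
    note z = zero_closed[OF U]
    show "\<zero>\<^bsub>Sec ?G U\<^esub> \<in> carrier (Sec ?G U)" unfolding c using zero[OF U] z by (metis imageI)
    show "\<forall>\<^sub>F q in gen U. \<psi> U (inv_into (carrier (Sec F U)) (\<phi> U) \<zero>\<^bsub>Sec ?G U\<^esub>) i q = 0" if "i < r" for i
      unfolding c zero[OF U, symmetric] iv[OF U z] by (rule coord_zero[OF U that])
    fix h assume "h \<in> carrier (Sec ?G U)"
    then obtain s where s: "s \<in> carrier (Sec F U)" "h = \<phi> U s" by (auto simp: c)
    show "C p (\<psi> U (inv_into (carrier (Sec F U)) (\<phi> U) h))" if "p \<in> U" for p
      unfolding s(2) iv[OF U s(1)] by (rule coord_germ[OF U s(1) that])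
    show "a \<odot>\<^bsub>Sec ?G U\<^esub> h \<in> carrier (Sec ?G U)"
      and "i < r \<Longrightarrow> \<forall>\<^sub>F q in gen U. \<psi> U (inv_into (carrier (Sec F U)) (\<phi> U) (a \<odot>\<^bsub>Sec ?G U\<^esub> h)) i q =
        a q * \<psi> U (inv_into (carrier (Sec F U)) (\<phi> U) h) i q" if a: "a \<in> regular X U" for a i
    proof -
      have eq: "a \<odot>\<^bsub>Sec ?G U\<^esub> h = \<phi> U (a \<odot>\<^bsub>Sec F U\<^esub> s)" unfolding c s(2) by (rule \<phi>(3)[OF U s(1) s(1) a, symmetric])
      note cl = smult_closed[OF U a s(1)]
      show "a \<odot>\<^bsub>Sec ?G U\<^esub> h \<in> carrier (Sec ?G U)" unfolding c(1) eq using cl by blast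
      show "\<forall>\<^sub>F q in gen U. \<psi> U (inv_into (carrier (Sec F U)) (\<phi> U) (a \<odot>\<^bsub>Sec ?G U\<^esub> h)) i q =
        a q * \<psi> U (inv_into (carrier (Sec F U)) (\<phi> U) h) i q" if "i < r"
        unfolding eq iv[OF U cl] unfolding s(2) iv[OF U s(1)] by (rule coord_smult[OF U a s(1) that])
    qed
    show "Res ?G U V h \<in> carrier (Sec ?G V)"
      and "i < r \<Longrightarrow> \<forall>\<^sub>F q in gen V. \<psi> V (inv_into (carrier (Sec F V)) (\<phi> V) (Res ?G U V h)) i q =
        \<psi> U (inv_into (carrier (Sec F U)) (\<phi> U) h) i q" if V: "zopen X V" "V \<subseteq> U" for V i
    proof -
      have eq: "Res ?G U V h = \<phi> V (Res F U V s)" unfolding c s(2) by (rule \<phi>r[OF U V s(1), symmetric])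
      note cl = res_closed[OF U V s(1)]
      show "Res ?G U V h \<in> carrier (Sec ?G V)" unfolding c(1) eq using cl by blast
      show "\<forall>\<^sub>F q in gen V. \<psi> V (inv_into (carrier (Sec F V)) (\<phi> V) (Res ?G U V h)) i q =
        \<psi> U (inv_into (carrier (Sec F U)) (\<phi> U) h) i q" if "i < r"
        unfolding eq iv[OF V(1) cl] unfolding s(2) iv[OF U s(1)] by (rule coord_res[OF U V s(1) that])
    qed
    fix h' assume "h' \<in> carrier (Sec ?G U)"
    then obtain t where t: "t \<in> carrier (Sec F U)" "h' = \<phi> U t" by (auto simp: c)
    have eq: "h \<oplus>\<^bsub>Sec ?G U\<^esub> h' = \<phi> U (s \<oplus>\<^bsub>Sec F U\<^esub> t)" unfolding c s(2) t(2) by (rule \<phi>(2)[OF U s(1) t(1), symmetric])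
    note cl = add_closed[OF U s(1) t(1)]
    show "h \<oplus>\<^bsub>Sec ?G U\<^esub> h' \<in> carrier (Sec ?G U)" unfolding c(1) eq using cl by blast
    show "\<forall>\<^sub>F q in gen U. \<psi> U (inv_into (carrier (Sec F U)) (\<phi> U) (h \<oplus>\<^bsub>Sec ?G U\<^esub> h')) i q =
        \<psi> U (inv_into (carrier (Sec F U)) (\<phi> U) h) i q + \<psi> U (inv_into (carrier (Sec F U)) (\<phi> U) h') i q"
      if "i < r" for i
      unfolding eq iv[OF U cl] unfolding s(2) t(2) iv[OF U s(1)] iv[OF U t(1)] by (rule coord_add[OF U s(1) t(1) that])
    show "h = h'" if e: "\<And>i. i < r \<Longrightarrow> \<forall>\<^sub>F q in gen U. \<psi> U (inv_into (carrier (Sec F U)) (\<phi> U) h) i q =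
      \<psi> U (inv_into (carrier (Sec F U)) (\<phi> U) h') i q"
      using coord_inj[OF U s(1) t(1)] e unfolding s(2) t(2) iv[OF U s(1)] iv[OF U t(1)] by blast
  next
    fix U m assume U: "zopen X U" and m: "\<And>p. p \<in> U \<Longrightarrow> C p m"
    obtain s where s: "s \<in> carrier (Sec F U)" "\<forall>i<r. \<forall>\<^sub>F q in gen U. \<psi> U s i q = m i q"
      using coord_surj[OF U m] by blast
    show "\<exists>s\<in>carrier (Sec ?G U). \<forall>i<r. \<forall>\<^sub>F q in gen U. \<psi> U (inv_into (carrier (Sec F U)) (\<phi> U) s) i q = m i q"
      unfolding c by (rule bexI[of _ "\<phi> U s"]) (use s in \<open>simp_all add: iv[OF U s(1)]\<close>)
  qed (fact germ_zero germ_add germ_smult germ_cong germ_open)+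
qed

end

section \<open>Coherent systems on a line bundle\<close>

context line_model
begin

lemma scal_coord:
  assumes "s \<in> carrier (Sec F X)"
  shows "scal X F c s \<in> carrier (Sec F X)" "\<psi> X (scal X F c s) 0 \<approx> (\<lambda>q. c * \<psi> X s 0 q)"
proof -
  have c: "(\<lambda>p\<in>X. c) \<in> regular X X" by (rule regular_const[OF zopen_X])
  show "scal X F c s \<in> carrier (Sec F X)" unfolding scal_def by (rule smult_closed[OF zopen_X c assms])
  have "\<psi> X (scal X F c s) 0 \<approx> (\<lambda>q. (\<lambda>p\<in>X. c) q * \<psi> X s 0 q)"
    unfolding scal_def using coord_smult[OF zopen_X c assms, of 0] by simp
  then show "\<psi> X (scal X F c s) 0 \<approx> (\<lambda>q. c * \<psi> X s 0 q)"
    using eventually_in_X by eventually_elim simp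
qed

lemma line_coord_inj:
  "s \<in> carrier (Sec F X) \<Longrightarrow> t \<in> carrier (Sec F X) \<Longrightarrow> \<psi> X s 0 \<approx> \<psi> X t 0 \<Longrightarrow> s = t"
  using coord_inj[OF zopen_X] by (metis less_one)

lemma finsum_scal_coord:
  assumes v: "\<forall>i<(k::nat). v i \<in> carrier (Sec F X)"
  shows "(\<Oplus>\<^bsub>Sec F X\<^esub>i\<in>{..<k}. scal X F (c i) (v i)) \<in> carrier (Sec F X)"
    "\<psi> X (\<Oplus>\<^bsub>Sec F X\<^esub>i\<in>{..<k}. scal X F (c i) (v i)) 0 \<approx> (\<lambda>q. \<Sum>i<k. c i * \<psi> X (v i) 0 q)"
proof -
  have s: "scal X F (c i) (v i) \<in> carrier (Sec F X)" if "i < k" for i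
    using scal_coord(1) v that by blast
  show "(\<Oplus>\<^bsub>Sec F X\<^esub>i\<in>{..<k}. scal X F (c i) (v i)) \<in> carrier (Sec F X)"
    by (rule finsum_coord(1)[OF zopen_X, of k "\<lambda>i. scal X F (c i) (v i)", OF s])
  have "\<psi> X (\<Oplus>\<^bsub>Sec F X\<^esub>i\<in>{..<k}. scal X F (c i) (v i)) 0 \<approx> (\<lambda>q. \<Sum>i<k. \<psi> X (scal X F (c i) (v i)) 0 q)"
    by (rule finsum_coord(2)[OF zopen_X, of k "\<lambda>i. scal X F (c i) (v i)" 0, OF s]) simp_all
  moreover have "\<forall>\<^sub>F q in gen X. \<forall>i\<in>{..<k}. \<psi> X (scal X F (c i) (v i)) 0 q = c i * \<psi> X (v i) 0 q"
  proof (intro eventually_ball_finite ballI)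
    fix i assume "i \<in> {..<k}"
    then have "v i \<in> carrier (Sec F X)" using v by auto
    then show "\<forall>\<^sub>F q in gen X. \<psi> X (scal X F (c i) (v i)) 0 q = c i * \<psi> X (v i) 0 q" by (rule scal_coord(2))
  qed simp
  ultimately show "\<psi> X (\<Oplus>\<^bsub>Sec F X\<^esub>i\<in>{..<k}. scal X F (c i) (v i)) 0 \<approx> (\<lambda>q. \<Sum>i<k. c i * \<psi> X (v i) 0 q)"
    by eventually_elim simp
qed

end

locale section_space = line_model X F D \<psi>
  for X :: "('n::finite) pt set" and F :: "('n, 'm) sheaf" and D \<psi> +
  fixes V :: "'m set" and b :: "nat \<Rightarrow> 'm" and m :: nat
  assumes subspace: "section_subspace X F V"
    and basis: "\<And>i. i < m \<Longrightarrow> b i \<in> V"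
    and bij: "bij_betw (\<lambda>c. \<Oplus>\<^bsub>Sec F X\<^esub>i\<in>{..<m}. scal X F (c i) (b i)) ({..<m} \<rightarrow>\<^sub>E UNIV) V"
begin

definition comb :: "(nat \<Rightarrow> complex) \<Rightarrow> 'm" where
  "comb c = (\<Oplus>\<^bsub>Sec F X\<^esub>i\<in>{..<m}. scal X F (c i) (b i))"

definition coords :: "'m \<Rightarrow> nat \<Rightarrow> complex" where
  "coords v = inv_into ({..<m} \<rightarrow>\<^sub>E UNIV) comb v"

definition \<beta> :: "nat \<Rightarrow> 'n pt \<Rightarrow> complex" where
  "\<beta> i = \<psi> X (b i) 0"

lemma V_carrier: "v \<in> V \<Longrightarrow> v \<in> carrier (Sec F X)"
  using subspace by (auto simp: section_subspace_def)

lemma comb_coord: "comb c \<in> carrier (Sec F X)" "\<psi> X (comb c) 0 \<approx> (\<lambda>q. \<Sum>i<m. c i * \<beta> i q)"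
  unfolding comb_def \<beta>_def using finsum_scal_coord[of m b c] basis V_carrier by auto

lemma comb_eqI: "(\<lambda>q. \<Sum>i<m. c i * \<beta> i q) \<approx> (\<lambda>q. \<Sum>i<m. d i * \<beta> i q) \<Longrightarrow> comb c = comb d"
proof (rule line_coord_inj[OF comb_coord(1) comb_coord(1)])
  assume "(\<lambda>q. \<Sum>i<m. c i * \<beta> i q) \<approx> (\<lambda>q. \<Sum>i<m. d i * \<beta> i q)"
  with comb_coord(2)[of c] comb_coord(2)[of d] show "\<psi> X (comb c) 0 \<approx> \<psi> X (comb d) 0"
    by eventually_elim simp
qed

lemma comb_cong: "(\<And>i. i < m \<Longrightarrow> c i = d i) \<Longrightarrow> comb c = comb d"
  by (rule comb_eqI) simp

lemma bij_comb: "bij_betw comb ({..<m} \<rightarrow>\<^sub>E UNIV) V"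
  using bij unfolding comb_def[abs_def] .

lemma comb_V: "comb c \<in> V"
proof -
  have "restrict c {..<m} \<in> {..<m} \<rightarrow>\<^sub>E UNIV" by auto
  then have "comb (restrict c {..<m}) \<in> V" using bij_comb by (auto simp: bij_betw_def)
  moreover have "comb (restrict c {..<m}) = comb c" by (rule comb_cong) simp
  ultimately show ?thesis by simp
qed

lemma coords_comb: "i < m \<Longrightarrow> coords (comb c) i = c i"
proof -
  assume i: "i < m"
  have "comb (restrict c {..<m}) = comb c" by (rule comb_cong) simp
  moreover have "coords (comb (restrict c {..<m})) = restrict c {..<m}"
    unfolding coords_def by (rule inv_into_f_f) (use bij_comb in \<open>auto simp: bij_betw_def\<close>)
  ultimately show ?thesis using i by simp
qed

lemma comb_coords: "v \<in> V \<Longrightarrow> comb (coords v) = v"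
proof -
  assume "v \<in> V"
  then have "v \<in> comb ` ({..<m} \<rightarrow>\<^sub>E UNIV)" using bij_comb by (simp add: bij_betw_def)
  then show ?thesis unfolding coords_def by (rule f_inv_into_f)
qed

lemma V_coord: "v \<in> V \<Longrightarrow> \<psi> X v 0 \<approx> (\<lambda>q. \<Sum>i<m. coords v i * \<beta> i q)"
  using comb_coord(2)[of "coords v"] comb_coords by simp

lemma \<beta>_indep:
  assumes "(\<lambda>q. \<Sum>i<m. c i * \<beta> i q) \<approx> (\<lambda>q. 0)" "i < m"
  shows "c i = 0"
proof -
  have "comb c = comb (\<lambda>i. 0)" by (rule comb_eqI) (use assms(1) in simp)
  then show ?thesis using coords_comb[OF assms(2), of c] coords_comb[OF assms(2), of "\<lambda>i. 0"] by simp
qed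

lemma \<beta>_ordge: "i < m \<Longrightarrow> p \<in> X \<Longrightarrow> ordge p (\<beta> i) (- D p)"
  unfolding \<beta>_def using line_coord_germ[OF zopen_X] V_carrier basis by blast

lemma comb_zero: "comb (\<lambda>i. 0) = \<zero>\<^bsub>Sec F X\<^esub>"
proof (rule line_coord_inj[OF comb_coord(1) zero_closed[OF zopen_X]])
  have "\<psi> X \<zero>\<^bsub>Sec F X\<^esub> 0 \<approx> (\<lambda>q. 0)" using coord_zero[OF zopen_X] by simp
  with comb_coord(2)[of "\<lambda>i. 0"] show "\<psi> X (comb (\<lambda>i. 0)) 0 \<approx> \<psi> X \<zero>\<^bsub>Sec F X\<^esub> 0"
    by eventually_elim simp
qed

lemma comb_add: "comb c \<oplus>\<^bsub>Sec F X\<^esub> comb d = comb (\<lambda>i. c i + d i)"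
proof (rule line_coord_inj[OF add_closed[OF zopen_X comb_coord(1) comb_coord(1)] comb_coord(1)])
  have "\<psi> X (comb c \<oplus>\<^bsub>Sec F X\<^esub> comb d) 0 \<approx> (\<lambda>q. \<psi> X (comb c) 0 q + \<psi> X (comb d) 0 q)"
    using coord_add[OF zopen_X comb_coord(1) comb_coord(1)] by simp
  with comb_coord(2)[of c] comb_coord(2)[of d] comb_coord(2)[of "\<lambda>i. c i + d i"]
  show "\<psi> X (comb c \<oplus>\<^bsub>Sec F X\<^esub> comb d) 0 \<approx> \<psi> X (comb (\<lambda>i. c i + d i)) 0"
    by eventually_elim (simp add: algebra_simps sum.distrib)
qed

lemma comb_scal: "scal X F a (comb c) = comb (\<lambda>i. a * c i)"
proof (rule line_coord_inj[OF scal_coord(1)[OF comb_coord(1)] comb_coord(1)])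
  from scal_coord(2)[OF comb_coord(1), of a c] comb_coord(2)[of c] comb_coord(2)[of "\<lambda>i. a * c i"]
  show "\<psi> X (scal X F a (comb c)) 0 \<approx> \<psi> X (comb (\<lambda>i. a * c i)) 0"
    by eventually_elim (simp add: sum_distrib_left mult.assoc)
qed

lemma tensor_rep_comb:
  assumes rep: "tensor_rep X F V U k f v h" and p: "p \<in> U"
  shows "h p = comb (\<lambda>l. \<Sum>i<k. f i p * coords (v i) l)"
proof -
  have v: "\<forall>i<k. v i \<in> V" using rep by (simp add: tensor_rep_def)
  then have vX: "\<forall>i<k. v i \<in> carrier (Sec F X)" using V_carrier by blast
  have "h p = (\<Oplus>\<^bsub>Sec F X\<^esub>i\<in>{..<k}. scal X F (f i p) (v i))" using rep p by (simp add: tensor_rep_def)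
  also have "\<dots> = comb (\<lambda>l. \<Sum>i<k. f i p * coords (v i) l)"
  proof (rule line_coord_inj[OF finsum_scal_coord(1)[OF vX] comb_coord(1)])
    have "\<forall>\<^sub>F q in gen X. \<forall>i\<in>{..<k}. \<psi> X (v i) 0 q = (\<Sum>l<m. coords (v i) l * \<beta> l q)"
      using v V_coord by (intro eventually_ball_finite) auto
    with finsum_scal_coord(2)[OF vX, of "\<lambda>i. f i p"] comb_coord(2)[of "\<lambda>l. \<Sum>i<k. f i p * coords (v i) l"]
    show "\<psi> X (\<Oplus>\<^bsub>Sec F X\<^esub>i\<in>{..<k}. scal X F (f i p) (v i)) 0 \<approx>
        \<psi> X (comb (\<lambda>l. \<Sum>i<k. f i p * coords (v i) l)) 0"
    proof eventually_elim
      case (elim q)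
      have "(\<Sum>i<k. f i p * \<psi> X (v i) 0 q) = (\<Sum>i<k. \<Sum>l<m. f i p * coords (v i) l * \<beta> l q)"
        using elim(3) by (intro sum.cong refl) (simp add: sum_distrib_left mult.assoc)
      also have "\<dots> = (\<Sum>l<m. \<Sum>i<k. f i p * coords (v i) l * \<beta> l q)" by (rule sum.swap)
      also have "\<dots> = (\<Sum>l<m. (\<Sum>i<k. f i p * coords (v i) l) * \<beta> l q)" by (simp add: sum_distrib_right)
      finally show ?case using elim(1,2) by simp
    qed
  qed
  finally show ?thesis .
qed

text \<open>A tensor with arbitrary factors is rewritten in the basis \<open>b\<close>, which leaves
  one regular coefficient for each basis element and identifies the sheaf with
  \<open>m\<close>-tuples of regular functions.\<close>

lemma trivial_carrier:
  assumes U: "zopen X U"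
  shows "h \<in> carrier (Sec (trivial_bundle X F V) U) \<longleftrightarrow>
    (\<exists>f. (\<forall>i<m. f i \<in> regular X U) \<and> h = (\<lambda>p\<in>U. comb (\<lambda>i. f i p)))"
proof
  assume "h \<in> carrier (Sec (trivial_bundle X F V) U)"
  then obtain k f v where rep: "tensor_rep X F V U k f v h" by (auto simp: trivial_bundle_def)
  define g where "g l = (\<lambda>p\<in>U. \<Sum>i<k. f i p * coords (v i) l)" for l
  have greg: "g l \<in> regular X U" for l
  proof -
    have "regat p (\<lambda>p. \<Sum>i<k. f i p * coords (v i) l)" if p: "p \<in> U" for p
    proof (rule regat_sum)
      show pX: "p \<in> X" using p zopen_subset[OF U] by blast
      fix i assume "i \<in> {..<k}"
      then have "regat p (f i)" using rep regular_regat[OF U _ p] by (simp add: tensor_rep_def)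
      then show "regat p (\<lambda>p. f i p * coords (v i) l)" by (rule regat_mult[OF _ regat_const[OF pX]])
    qed
    then show ?thesis using U by (simp add: g_def regular_iff regat_restrict)
  qed
  have heq: "h = (\<lambda>p\<in>U. comb (\<lambda>i. g i p))"
  proof (rule extensionalityI[of _ U])
    show "h \<in> extensional U" using rep by (simp add: tensor_rep_def)
    fix p assume p: "p \<in> U"
    then show "h p = (\<lambda>p\<in>U. comb (\<lambda>i. g i p)) p" using tensor_rep_comb[OF rep p] by (simp add: g_def)
  qed simp
  show "\<exists>f. (\<forall>i<m. f i \<in> regular X U) \<and> h = (\<lambda>p\<in>U. comb (\<lambda>i. f i p))"
    by (intro exI[of _ g] conjI allI impI greg heq)
next
  assume "\<exists>f. (\<forall>i<m. f i \<in> regular X U) \<and> h = (\<lambda>p\<in>U. comb (\<lambda>i. f i p))"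
  then obtain f where f: "\<forall>i<m. f i \<in> regular X U" "h = (\<lambda>p\<in>U. comb (\<lambda>i. f i p))" by blast
  have "tensor_rep X F V U m f b h" using f basis by (simp add: tensor_rep_def comb_def)
  then show "h \<in> carrier (Sec (trivial_bundle X F V) U)" by (auto simp: trivial_bundle_def)
qed

definition trivial_coord :: "'n pt set \<Rightarrow> ('n pt \<Rightarrow> 'm) \<Rightarrow> nat \<Rightarrow> 'n pt \<Rightarrow> complex" where
  "trivial_coord U h i = (\<lambda>p\<in>U. coords (h p) i)"

lemma trivial_coord_comb: "i < m \<Longrightarrow> q \<in> U \<Longrightarrow> trivial_coord U (\<lambda>p\<in>U. comb (c p)) i q = c q i"
  by (simp add: trivial_coord_def coords_comb)

lemma trivial_coord:
  assumes U: "zopen X U" and h: "h \<in> carrier (Sec (trivial_bundle X F V) U)"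
  shows "i < m \<Longrightarrow> trivial_coord U h i \<in> regular X U" "h = (\<lambda>p\<in>U. comb (\<lambda>i. trivial_coord U h i p))"
proof -
  obtain f where f: "\<forall>i<m. f i \<in> regular X U" "h = (\<lambda>p\<in>U. comb (\<lambda>i. f i p))"
    using h trivial_carrier[OF U] by blast
  have eq: "trivial_coord U h i = f i" if i: "i < m" for i
  proof (rule extensionalityI[of _ U])
    show "f i \<in> extensional U" using f i U by (simp add: regular_iff)
  qed (simp_all add: trivial_coord_def f(2) coords_comb[OF i])
  then show "i < m \<Longrightarrow> trivial_coord U h i \<in> regular X U" using f by simp
  have "comb (\<lambda>i. trivial_coord U h i p) = comb (\<lambda>i. f i p)" for p by (rule comb_cong) (simp add: eq)
  then show "h = (\<lambda>p\<in>U. comb (\<lambda>i. trivial_coord U h i p))" using f(2) by simp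
qed

lemma trivial_sheaf_model:
  "sheaf_model X (trivial_bundle X F V) m (\<lambda>p g. \<forall>i<m. ordge p (g i) 0) trivial_coord"
proof unfold_locales
  fix p m' a assume "p \<in> X"
  show "\<forall>i<m. ordge p (\<lambda>q. 0) 0" using ordge_const \<open>p \<in> X\<close> by blast
  show "\<forall>i<m. ordge p (\<lambda>q. a q * m' i q) 0" if "regat p a" "\<forall>i<m. ordge p (m' i) 0"
    using ordge_mult[OF regat_ordge[OF that(1)]] that(2) by fastforce
next
  fix p and m1 m2 :: "nat \<Rightarrow> 'n pt \<Rightarrow> complex" assume p: "p \<in> X" and 1: "\<forall>i<m. ordge p (m1 i) 0"
  show "\<forall>i<m. ordge p (\<lambda>q. m1 i q + m2 i q) 0" if "\<forall>i<m. ordge p (m2 i) 0"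
    using 1 that ordge_add by blast
  show "\<forall>i<m. ordge p (m2 i) 0" if "\<And>i. i < m \<Longrightarrow> m1 i \<approx> m2 i"
    using 1 that ordge_cong by blast
  have "\<forall>\<^sub>F q in gen X. \<forall>i\<in>{..<m}. ordge q (m1 i) 0"
    using 1 rat_ordge_cofinite ordge_rat by (intro eventually_ball_finite) auto
  then have "\<forall>\<^sub>F q in gen X. \<forall>i<m. ordge q (m1 i) 0" by (rule eventually_mono) simp
  then show "\<exists>V. zopen X V \<and> p \<in> V \<and> (\<forall>q\<in>V. \<forall>i<m. ordge q (m1 i) 0)"
    using p 1 by (rule open_of_cofinite)
next
  fix U assume U: "zopen X U"
  let ?T = "trivial_bundle X F V"
  have z: "\<zero>\<^bsub>Sec ?T U\<^esub> = (\<lambda>p\<in>U. comb (\<lambda>i. 0))" by (simp add: trivial_bundle_def comb_zero)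
  show "\<zero>\<^bsub>Sec ?T U\<^esub> \<in> carrier (Sec ?T U)"
    unfolding trivial_carrier[OF U] z
    by (intro exI[of _ "\<lambda>i. \<lambda>p\<in>U. 0"]) (auto simp: regular_const[OF U] cong: restrict_cong)
  show "\<forall>\<^sub>F q in gen U. trivial_coord U \<zero>\<^bsub>Sec ?T U\<^esub> i q = 0" if "i < m" for i
    using eventually_gen_in by eventually_elim (simp add: z trivial_coord_def coords_comb[OF that])
  fix s assume s: "s \<in> carrier (Sec ?T U)"
  have sp: "s p = comb (\<lambda>i. trivial_coord U s i p)" if "p \<in> U" for p
    using fun_cong[OF trivial_coord(2)[OF U s], of p] that by simp
  show "\<forall>i<m. ordge p (trivial_coord U s i) 0" if "p \<in> U" for p
    using regat_ordge[OF regular_regat[OF U trivial_coord(1)[OF U s] that]] by blast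
  show "a \<odot>\<^bsub>Sec ?T U\<^esub> s \<in> carrier (Sec ?T U)"
    and "i < m \<Longrightarrow> \<forall>\<^sub>F q in gen U. trivial_coord U (a \<odot>\<^bsub>Sec ?T U\<^esub> s) i q = a q * trivial_coord U s i q"
    if a: "a \<in> regular X U" for a i
  proof -
    have eq: "a \<odot>\<^bsub>Sec ?T U\<^esub> s = (\<lambda>p\<in>U. comb (\<lambda>i. a p * trivial_coord U s i p))"
      by (simp add: trivial_bundle_def sp comb_scal cong: restrict_cong)
    show "a \<odot>\<^bsub>Sec ?T U\<^esub> s \<in> carrier (Sec ?T U)"
      unfolding trivial_carrier[OF U] eq
      by (intro exI[of _ "\<lambda>i. \<lambda>p\<in>U. a p * trivial_coord U s i p"])
        (auto intro: regular_mult[OF U a trivial_coord(1)[OF U s]] cong: restrict_cong)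
    show "\<forall>\<^sub>F q in gen U. trivial_coord U (a \<odot>\<^bsub>Sec ?T U\<^esub> s) i q = a q * trivial_coord U s i q" if "i < m"
      using eventually_gen_in
      by eventually_elim (simp add: eq trivial_coord_comb[OF that])
  qed
  show "Res ?T U W s \<in> carrier (Sec ?T W)"
    and "i < m \<Longrightarrow> \<forall>\<^sub>F q in gen W. trivial_coord W (Res ?T U W s) i q = trivial_coord U s i q"
    if W: "zopen X W" "W \<subseteq> U" for W i
  proof -
    have eq: "Res ?T U W s = (\<lambda>p\<in>W. comb (\<lambda>i. restrict (trivial_coord U s i) W p))"
    proof -
      have "Res ?T U W s = restrict s W" by (simp add: trivial_bundle_def)
      also have "\<dots> = (\<lambda>p\<in>W. comb (\<lambda>i. restrict (trivial_coord U s i) W p))"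
        using W(2) by (intro restrict_ext) (use sp in auto)
      finally show ?thesis .
    qed
    show "Res ?T U W s \<in> carrier (Sec ?T W)"
      unfolding trivial_carrier[OF W(1)] eq
      by (intro exI[of _ "\<lambda>i. restrict (trivial_coord U s i) W"])
        (auto intro: regular_restrict[OF U W trivial_coord(1)[OF U s]])
    show "\<forall>\<^sub>F q in gen W. trivial_coord W (Res ?T U W s) i q = trivial_coord U s i q" if "i < m"
      using eventually_gen_in
      by eventually_elim (simp add: eq trivial_coord_comb[OF that])
  qed
  fix t assume t: "t \<in> carrier (Sec ?T U)"
  have tp: "t p = comb (\<lambda>i. trivial_coord U t i p)" if "p \<in> U" for p
    using fun_cong[OF trivial_coord(2)[OF U t], of p] that by simp
  have eq: "s \<oplus>\<^bsub>Sec ?T U\<^esub> t = (\<lambda>p\<in>U. comb (\<lambda>i. trivial_coord U s i p + trivial_coord U t i p))"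
    by (simp add: trivial_bundle_def sp tp comb_add cong: restrict_cong)
  show "s \<oplus>\<^bsub>Sec ?T U\<^esub> t \<in> carrier (Sec ?T U)"
    unfolding trivial_carrier[OF U] eq
    by (intro exI[of _ "\<lambda>i. \<lambda>p\<in>U. trivial_coord U s i p + trivial_coord U t i p"])
      (auto intro: regular_add[OF U trivial_coord(1)[OF U s] trivial_coord(1)[OF U t]] cong: restrict_cong)
  show "\<forall>\<^sub>F q in gen U. trivial_coord U (s \<oplus>\<^bsub>Sec ?T U\<^esub> t) i q = trivial_coord U s i q + trivial_coord U t i q"
    if "i < m" for i
    using eventually_gen_in
    by eventually_elim (simp add: eq trivial_coord_comb[OF that])
  show "s = t" if e: "\<And>i. i < m \<Longrightarrow> \<forall>\<^sub>F q in gen U. trivial_coord U s i q = trivial_coord U t i q"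
  proof -
    have ee: "trivial_coord U s i = trivial_coord U t i" if "i < m" for i
      by (rule regular_eqI[OF U trivial_coord(1)[OF U s that] trivial_coord(1)[OF U t that] e[OF that]])
    have "comb (\<lambda>i. trivial_coord U s i p) = comb (\<lambda>i. trivial_coord U t i p)" for p
      by (rule comb_cong) (simp add: ee)
    then show ?thesis using trivial_coord(2)[OF U s] trivial_coord(2)[OF U t] by simp
  qed
next
  fix U g assume U: "zopen X U" and g: "\<And>p. p \<in> U \<Longrightarrow> \<forall>i<m. ordge p (g i) 0"
  have "\<exists>f. f \<in> regular X U \<and> (\<forall>\<^sub>F q in gen U. f q = g i q)" if i: "i < m" for i
  proof -
    have "ordge p (g i) 0" if "p \<in> U" for p using g[OF that] i by blast
    from regular_glue[OF U this] show ?thesis by blast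
  qed
  from choice_less[OF this] obtain f where f: "\<forall>i<m. f i \<in> regular X U \<and> (\<forall>\<^sub>F q in gen U. f i q = g i q)" ..
  define h where "h = (\<lambda>p\<in>U. comb (\<lambda>i. f i p))"
  have h: "h \<in> carrier (Sec (trivial_bundle X F V) U)" unfolding trivial_carrier[OF U] h_def using f by blast
  have "\<forall>\<^sub>F q in gen U. trivial_coord U h i q = g i q" if i: "i < m" for i
    using f[rule_format, OF i, THEN conjunct2] eventually_gen_in
    by eventually_elim (simp add: trivial_coord_def h_def coords_comb[OF i])
  then show "\<exists>s\<in>carrier (Sec (trivial_bundle X F V) U). \<forall>i<m. \<forall>\<^sub>F q in gen U. trivial_coord U s i q = g i q"
    using h by blast
qed

text \<open>The value is a definite description over all tensors that represent \<open>h\<close>.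
  Its coordinate is the sum of the products of the entries of \<open>h\<close> with the
  \<open>\<beta> l\<close>; this depends on \<open>h\<close> alone, so the description is
  unique.\<close>

lemma evaluation:
  assumes U: "zopen X U" and h: "h \<in> carrier (Sec (trivial_bundle X F V) U)"
  shows "evaluation X F V U h \<in> carrier (Sec F U)"
    "\<forall>\<^sub>F q in gen U. \<psi> U (evaluation X F V U h) 0 q = (\<Sum>l<m. trivial_coord U h l q * \<beta> l q)"
proof -
  have UX: "U \<subseteq> X" by (rule zopen_subset[OF U])
  have val: "lin k X U f v \<in> carrier (Sec F U)"
    "\<forall>\<^sub>F q in gen U. \<psi> U (lin k X U f v) 0 q = (\<Sum>l<m. trivial_coord U h l q * \<beta> l q)"
    if rep: "tensor_rep X F V U k f v h" for k f v
  proof -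
    have f: "\<forall>i<k. f i \<in> regular X U" and v: "\<forall>i<k. v i \<in> V" using rep by (auto simp: tensor_rep_def)
    have vX: "\<forall>i<k. v i \<in> carrier (Sec F X)" using v V_carrier by blast
    show "lin k X U f v \<in> carrier (Sec F U)" by (rule lin_coord'(1)[OF zopen_X U UX f vX])
    have "\<forall>\<^sub>F q in gen U. \<psi> U (lin k X U f v) 0 q = (\<Sum>i<k. f i q * \<psi> X (v i) 0 q)"
      by (rule lin_coord'(2)[OF zopen_X U UX f vX]) simp
    moreover have "\<forall>\<^sub>F q in gen X. \<forall>i\<in>{..<k}. \<psi> X (v i) 0 q = (\<Sum>l<m. coords (v i) l * \<beta> l q)"
      using v V_coord by (intro eventually_ball_finite) auto
    then have "\<forall>\<^sub>F q in gen U. \<forall>i\<in>{..<k}. \<psi> X (v i) 0 q = (\<Sum>l<m. coords (v i) l * \<beta> l q)"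
      by (rule eventually_gen_subset[OF _ UX])
    ultimately show "\<forall>\<^sub>F q in gen U. \<psi> U (lin k X U f v) 0 q = (\<Sum>l<m. trivial_coord U h l q * \<beta> l q)"
      using eventually_gen_in
    proof eventually_elim
      case (elim q)
      have tc: "trivial_coord U h l q = (\<Sum>i<k. f i q * coords (v i) l)" if "l < m" for l
        using elim(3) by (simp add: trivial_coord_def tensor_rep_comb[OF rep elim(3)] coords_comb[OF that])
      have "(\<Sum>i<k. f i q * \<psi> X (v i) 0 q) = (\<Sum>i<k. \<Sum>l<m. f i q * coords (v i) l * \<beta> l q)"
        using elim(2) by (intro sum.cong refl) (simp add: sum_distrib_left mult.assoc)
      also have "\<dots> = (\<Sum>l<m. \<Sum>i<k. f i q * coords (v i) l * \<beta> l q)" by (rule sum.swap)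
      also have "\<dots> = (\<Sum>l<m. trivial_coord U h l q * \<beta> l q)"
        by (intro sum.cong refl) (simp add: tc sum_distrib_right)
      finally show ?case using elim(1) by simp
    qed
  qed
  obtain k0 f0 v0 where rep0: "tensor_rep X F V U k0 f0 v0 h" using h by (auto simp: trivial_bundle_def)
  have "evaluation X F V U h = lin k0 X U f0 v0"
    unfolding evaluation_def
  proof (rule the_equality)
    show "\<exists>k f v. tensor_rep X F V U k f v h \<and> lin k0 X U f0 v0 = lin k X U f v" using rep0 by blast
    fix s assume "\<exists>k f v. tensor_rep X F V U k f v h \<and> s = lin k X U f v"
    then obtain k f v where rep: "tensor_rep X F V U k f v h" "s = lin k X U f v" by blast
    show "s = lin k0 X U f0 v0"
    proof (rule coord_inj[OF U])
      show "s \<in> carrier (Sec F U)" "lin k0 X U f0 v0 \<in> carrier (Sec F U)"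
        using val(1)[OF rep(1)] val(1)[OF rep0] rep(2) by simp_all
      show "\<forall>\<^sub>F q in gen U. \<psi> U s i q = \<psi> U (lin k0 X U f0 v0) i q" if "i < 1" for i
      proof -
        have "\<forall>\<^sub>F q in gen U. \<psi> U (lin k X U f v) 0 q = \<psi> U (lin k0 X U f0 v0) 0 q"
          using val(2)[OF rep(1)] val(2)[OF rep0] by eventually_elim simp
        then show ?thesis using that rep(2) by simp
      qed
    qed
  qed
  then show "evaluation X F V U h \<in> carrier (Sec F U)"
    "\<forall>\<^sub>F q in gen U. \<psi> U (evaluation X F V U h) 0 q = (\<Sum>l<m. trivial_coord U h l q * \<beta> l q)"
    using val[OF rep0] by simp_all
qed

definition generated_germ :: "'n pt \<Rightarrow> ('n pt \<Rightarrow> complex) \<Rightarrow> bool" where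
  "generated_germ p g \<longleftrightarrow> (\<exists>a. (\<forall>l<m. regat p (a l)) \<and> g \<approx> (\<lambda>q. \<Sum>l<m. a l q * \<beta> l q))"

lemma evaluation_image_carrier:
  assumes U: "zopen X U"
  shows "carrier (Sec (evaluation_image X F V) U) = {s \<in> carrier (Sec F U). \<forall>p\<in>U. generated_germ p (\<psi> U s 0)}"
proof -
  let ?T = "trivial_bundle X F V"
  have "(\<exists>W. zopen X W \<and> p \<in> W \<and> W \<subseteq> U \<and> Res F U W s \<in> evaluation X F V W ` carrier (Sec ?T W)) \<longleftrightarrow>
      generated_germ p (\<psi> U s 0)" (is "?L \<longleftrightarrow> _") if s: "s \<in> carrier (Sec F U)" and p: "p \<in> U" for s p
  proof
    assume ?L
    then obtain W h where W: "zopen X W" "p \<in> W" "W \<subseteq> U" and h: "h \<in> carrier (Sec ?T W)"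
      "Res F U W s = evaluation X F V W h" by blast
    have gW: "gen W = gen X" using gen_zopen[OF W(1)] W(2) by blast
    have "\<forall>\<^sub>F q in gen W. \<psi> W (Res F U W s) 0 q = \<psi> U s 0 q" using coord_res[OF U W(1,3) s] by simp
    with evaluation(2)[OF W(1) h(1)] have "\<forall>\<^sub>F q in gen W. \<psi> U s 0 q = (\<Sum>l<m. trivial_coord W h l q * \<beta> l q)"
      unfolding h(2) by eventually_elim simp
    moreover have "\<forall>l<m. regat p (trivial_coord W h l)"
      using regular_regat[OF W(1) trivial_coord(1)[OF W(1) h(1)] W(2)] by blast
    ultimately show "generated_germ p (\<psi> U s 0)" unfolding generated_germ_def gW by blast
  next
    assume "generated_germ p (\<psi> U s 0)"
    then obtain a where a: "\<forall>l<m. regat p (a l)" "\<psi> U s 0 \<approx> (\<lambda>q. \<Sum>l<m. a l q * \<beta> l q)"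
      unfolding generated_germ_def by blast
    have pX: "p \<in> X" using p zopen_subset[OF U] by blast
    have "\<forall>l<m. ordge p (a l) 0" using a(1) regat_ordge by blast
    from sheaf_model.germ_open[OF trivial_sheaf_model pX this] obtain W0 where
      W0: "zopen X W0" "p \<in> W0" "\<forall>q\<in>W0. \<forall>l<m. ordge q (a l) 0" by blast
    define W where "W = W0 \<inter> U"
    have W: "zopen X W" "p \<in> W" "W \<subseteq> U" using W0 U p zopen_Int by (auto simp: W_def)
    have gW: "gen W = gen X" using gen_zopen[OF W(1)] W(2) by blast
    have "\<forall>l<m. ordge q (a l) 0" if "q \<in> W" for q using W0(3) that by (auto simp: W_def)
    from sheaf_model.coord_surj[OF trivial_sheaf_model W(1) this] obtain h where h: "h \<in> carrier (Sec ?T W)"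
      "\<forall>l<m. \<forall>\<^sub>F q in gen W. trivial_coord W h l q = a l q" by blast
    have ev: "\<forall>\<^sub>F q in gen W. \<forall>l\<in>{..<m}. trivial_coord W h l q = a l q"
      using h(2) by (intro eventually_ball_finite) auto
    have "Res F U W s = evaluation X F V W h"
    proof (rule coord_inj[OF W(1) res_closed[OF U W(1,3) s] evaluation(1)[OF W(1) h(1)]])
      fix i :: nat assume "i < 1"
      have "\<forall>\<^sub>F q in gen W. \<psi> W (Res F U W s) 0 q = \<psi> W (evaluation X F V W h) 0 q"
        using coord_res[OF U W(1,3) s, of 0, simplified] a(2)[folded gW] evaluation(2)[OF W(1) h(1)] ev
        by eventually_elim simp
      then show "\<forall>\<^sub>F q in gen W. \<psi> W (Res F U W s) i q = \<psi> W (evaluation X F V W h) i q"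
        using \<open>i < 1\<close> by simp
    qed
    then show ?L using W h(1) by blast
  qed
  then show ?thesis by (auto simp: evaluation_image_def sub_sheaf_def)
qed

text \<open>Linear stability asks for the degree of this subsheaf. Once the germs generated by the
  sections are found to be those of O(E), the subsheaf is O(E) and its degree is
  \<open>deg E\<close>.\<close>

lemma evaluation_image_line_model:
  assumes E: "finsupp E" and gen: "\<And>p g. p \<in> X \<Longrightarrow> generated_germ p g \<longleftrightarrow> ordge p g (- E p)"
  shows "line_model X (evaluation_image X F V) E \<psi>"
proof -
  have eq: "evaluation_image X F V = sub_sheaf F (\<lambda>U. carrier (Sec (evaluation_image X F V) U))"
    by (simp add: evaluation_image_def sub_sheaf_def)
  have "sheaf_model X (sub_sheaf F (\<lambda>U. carrier (Sec (evaluation_image X F V) U))) 1 (line_germ E) \<psi>"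
  proof (rule sub_sheaf_model)
    fix p g assume p: "p \<in> X" and "line_germ E p g"
    then have "generated_germ p (g 0)" using gen by (simp add: line_germ_def)
    then obtain a where a: "\<forall>l<m. regat p (a l)" "g 0 \<approx> (\<lambda>q. \<Sum>l<m. a l q * \<beta> l q)"
      unfolding generated_germ_def by blast
    have "ordge p (\<lambda>q. \<Sum>l<m. a l q * \<beta> l q) (- D p)"
    proof (rule ordge_sum[OF p])
      fix l assume "l \<in> {..<m}"
      then show "ordge p (\<lambda>q. a l q * \<beta> l q) (- D p)"
        using ordge_mult[OF regat_ordge \<beta>_ordge[OF _ p], of "a l" l] a(1) by simp
    qed
    then have "ordge p (g 0) (- D p)" by (rule ordge_cong) (use a(2) in \<open>auto elim: eventually_mono\<close>)
    then show "line_germ D p g" by (simp add: line_germ_def)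
  next
    fix U assume U: "zopen X U"
    show "carrier (Sec (evaluation_image X F V) U) = {s \<in> carrier (Sec F U). \<forall>p\<in>U. line_germ E p (\<psi> U s)}"
    proof -
      have "generated_germ p g \<longleftrightarrow> ordge p g (- E p)" if "p \<in> U" for p g
        using gen zopen_subset[OF U] that by blast
      then show ?thesis by (simp add: evaluation_image_carrier[OF U] line_germ_def)
    qed
  qed (fact line_germ(1-4) line_germ(5)[OF E])+
  then have "sheaf_model X (evaluation_image X F V) 1 (line_germ E) \<psi>" using eq by simp
  then show ?thesis by (intro line_model.intro line_model_axioms.intro E)
qed

lemma generatedI:
  assumes "\<And>p g. p \<in> X \<Longrightarrow> ordge p g (- D p) \<Longrightarrow> generated_germ p g"
  shows "generated X F V"
  unfolding generated_def
proof (intro allI impI)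
  fix U assume U: "zopen X U"
  have "generated_germ p (\<psi> U s 0)" if "s \<in> carrier (Sec F U)" "p \<in> U" for s p
    using assms line_coord_germ[OF U that] zopen_subset[OF U] that(2) by blast
  then show "carrier (Sec (evaluation_image X F V) U) = carrier (Sec F U)"
    using evaluation_image_carrier[OF U] by blast
qed

section \<open>The kernel of evaluation as a sheaf of syzygies\<close>

definition syzygy_germ :: "'n pt \<Rightarrow> (nat \<Rightarrow> 'n pt \<Rightarrow> complex) \<Rightarrow> bool" where
  "syzygy_germ p g \<longleftrightarrow> (\<forall>i<m. ordge p (g i) 0) \<and> (\<lambda>q. \<Sum>l<m. g l q * \<beta> l q) \<approx> (\<lambda>q. 0)"

text \<open>The equation that cuts the kernel out of the \<open>m\<close>-tuples is a generic
  identity, the same at every point; only regularity has to be followed from germ to germ.\<close>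

lemma dual_span_model: "sheaf_model X (dual_span X F V) m syzygy_germ trivial_coord"
proof -
  interpret T: sheaf_model X "trivial_bundle X F V" m "\<lambda>p g. \<forall>i<m. ordge p (g i) 0" trivial_coord
    by (rule trivial_sheaf_model)
  show ?thesis
    unfolding dual_span_def
  proof (rule T.sub_sheaf_model)
    fix p assume p: "p \<in> X"
    show "syzygy_germ p (\<lambda>i q. 0)" using T.germ_zero[OF p] by (simp add: syzygy_germ_def)
    fix g assume g: "syzygy_germ p g"
    then have g1: "\<forall>i<m. ordge p (g i) 0" and g2: "(\<lambda>q. \<Sum>l<m. g l q * \<beta> l q) \<approx> (\<lambda>q. 0)"
      by (auto simp: syzygy_germ_def)
    show "\<forall>i<m. ordge p (g i) 0" by (rule g1)
    show "\<exists>V. zopen X V \<and> p \<in> V \<and> (\<forall>q\<in>V. syzygy_germ q g)"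
      using T.germ_open[OF p g1] g2 unfolding syzygy_germ_def by blast
    show "syzygy_germ p (\<lambda>i q. a q * g i q)" if a: "regat p a" for a
      unfolding syzygy_germ_def
    proof (rule conjI[OF T.germ_smult[OF p a g1]])
      show "(\<lambda>q. \<Sum>l<m. a q * g l q * \<beta> l q) \<approx> (\<lambda>q. 0)"
        using g2 by eventually_elim (simp add: mult.assoc sum_distrib_left[symmetric])
    qed
    fix g' :: "nat \<Rightarrow> 'n pt \<Rightarrow> complex"
    show "syzygy_germ p (\<lambda>i q. g i q + g' i q)" if "syzygy_germ p g'"
    proof -
      have g'1: "\<forall>i<m. ordge p (g' i) 0" and g'2: "(\<lambda>q. \<Sum>l<m. g' l q * \<beta> l q) \<approx> (\<lambda>q. 0)"
        using that by (auto simp: syzygy_germ_def)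
      have "(\<lambda>q. \<Sum>l<m. (g l q + g' l q) * \<beta> l q) \<approx> (\<lambda>q. 0)"
        using g2 g'2 by eventually_elim (simp add: algebra_simps sum.distrib)
      then show ?thesis unfolding syzygy_germ_def using T.germ_add[OF p g1 g'1] by blast
    qed
    show "syzygy_germ p g'" if e: "\<And>i. i < m \<Longrightarrow> g i \<approx> g' i"
    proof -
      have "\<forall>\<^sub>F q in gen X. \<forall>i\<in>{..<m}. g i q = g' i q" using e by (intro eventually_ball_finite) auto
      with g2 have "(\<lambda>q. \<Sum>l<m. g' l q * \<beta> l q) \<approx> (\<lambda>q. 0)" by eventually_elim simp
      moreover have "\<forall>i<m. ordge p (g' i) 0" by (rule T.germ_cong[OF p g1]) (rule e)
      ultimately show ?thesis unfolding syzygy_germ_def by blast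
    qed
  next
    fix U assume U: "zopen X U"
    have "evaluation X F V U h = \<zero>\<^bsub>Sec F U\<^esub> \<longleftrightarrow> (\<forall>p\<in>U. syzygy_germ p (trivial_coord U h))"
      if h: "h \<in> carrier (Sec (trivial_bundle X F V) U)" for h
    proof
      assume "evaluation X F V U h = \<zero>\<^bsub>Sec F U\<^esub>"
      then have "\<forall>\<^sub>F q in gen U. (\<Sum>l<m. trivial_coord U h l q * \<beta> l q) = 0"
        using evaluation(2)[OF U h] coord_zero[OF U, of 0] by (auto elim: eventually_elim2)
      then have ev: "\<forall>\<^sub>F q in gen U. (\<Sum>l<m. trivial_coord U h l q * \<beta> l q) = 0" .
      show "\<forall>p\<in>U. syzygy_germ p (trivial_coord U h)"
      proof
        fix p assume p: "p \<in> U"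
        then have "gen U = gen X" using gen_zopen[OF U] by blast
        then show "syzygy_germ p (trivial_coord U h)"
          using T.coord_germ[OF U h p] ev by (simp add: syzygy_germ_def)
      qed
    next
      assume a: "\<forall>p\<in>U. syzygy_germ p (trivial_coord U h)"
      have "\<forall>\<^sub>F q in gen U. (\<Sum>l<m. trivial_coord U h l q * \<beta> l q) = 0"
      proof (cases "U = {}")
        case False
        then show ?thesis using a gen_zopen[OF U False] by (auto simp: syzygy_germ_def)
      qed (simp add: gen_empty)
      then have "\<forall>\<^sub>F q in gen U. \<psi> U (evaluation X F V U h) 0 q = \<psi> U \<zero>\<^bsub>Sec F U\<^esub> 0 q"
        using evaluation(2)[OF U h] coord_zero[OF U, of 0, simplified] by eventually_elim simp
      then show "evaluation X F V U h = \<zero>\<^bsub>Sec F U\<^esub>"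
        by (intro coord_inj[OF U evaluation(1)[OF U h] zero_closed[OF U]]) simp
    qed
    then show "{h \<in> carrier (Sec (trivial_bundle X F V) U). evaluation X F V U h = \<zero>\<^bsub>Sec F U\<^esub>} =
      {s \<in> carrier (Sec (trivial_bundle X F V) U). \<forall>p\<in>U. syzygy_germ p (trivial_coord U s)}" by blast
  qed
qed

end

section \<open>Finite-dimensional spaces of rational functions\<close>

context smooth_curve
begin

definition cspan :: "nat \<Rightarrow> (nat \<Rightarrow> 'n pt \<Rightarrow> complex) \<Rightarrow> ('n pt \<Rightarrow> complex) \<Rightarrow> bool" where
  "cspan k w f \<longleftrightarrow> (\<exists>c. f \<approx> (\<lambda>q. \<Sum>l<k. c l * w l q))"

text \<open>Induction on the number of generators, with the last coefficient of some representation
  as the functional of \<open>dimle_step\<close>. As that functional is a relation, the generators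
  may well be dependent.\<close>

lemma dimle_cspan: "dimle (cspan k w) k"
proof (induction k)
  case 0
  show ?case
    unfolding dimle_def
  proof (intro allI impI)
    fix v :: "nat \<Rightarrow> 'n pt \<Rightarrow> complex" assume "\<forall>i\<le>0. cspan 0 w (v i)"
    from this[rule_format, of 0] have "cspan 0 w (v 0)" by simp
    then have "v 0 \<approx> (\<lambda>q. 0)" by (simp add: cspan_def)
    then show "\<exists>c. (\<exists>i\<le>0. c i \<noteq> 0) \<and> (\<lambda>q. \<Sum>i\<le>0. c i * v i q) \<approx> (\<lambda>q. 0)"
      by (intro exI[of _ "\<lambda>i. 1"]) simp
  qed
next
  case (Suc k)
  show ?case
  proof (rule dimle_step[OF Suc, where l = "\<lambda>f a. \<exists>c. f \<approx> (\<lambda>q. (\<Sum>l<k. c l * w l q) + a * w k q)"])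
    fix f g c assume "cspan (Suc k) w f" "cspan (Suc k) w g"
    then obtain a b where ab: "f \<approx> (\<lambda>q. \<Sum>l<Suc k. a l * w l q)" "g \<approx> (\<lambda>q. \<Sum>l<Suc k. b l * w l q)"
      unfolding cspan_def by blast
    then have "(\<lambda>q. f q - c * g q) \<approx> (\<lambda>q. \<Sum>l<Suc k. (a l - c * b l) * w l q)"
      by eventually_elim (simp add: algebra_simps sum_subtractf sum_distrib_left)
    then show "cspan (Suc k) w (\<lambda>q. f q - c * g q)" unfolding cspan_def
      by (intro exI[of _ "\<lambda>l. a l - c * b l"])
  next
    fix f assume "cspan (Suc k) w f"
    then obtain a where "f \<approx> (\<lambda>q. \<Sum>l<Suc k. a l * w l q)" unfolding cspan_def by blast
    then have "f \<approx> (\<lambda>q. (\<Sum>l<k. a l * w l q) + a k * w k q)" by simp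
    then show "\<exists>a c. f \<approx> (\<lambda>q. (\<Sum>l<k. c l * w l q) + a * w k q)" by blast
  next
    fix f g a b c
    assume "\<exists>c. f \<approx> (\<lambda>q. (\<Sum>l<k. c l * w l q) + a * w k q)" "\<exists>c. g \<approx> (\<lambda>q. (\<Sum>l<k. c l * w l q) + b * w k q)"
    then obtain u v where uv: "f \<approx> (\<lambda>q. (\<Sum>l<k. u l * w l q) + a * w k q)"
      "g \<approx> (\<lambda>q. (\<Sum>l<k. v l * w l q) + b * w k q)" by blast
    then have "(\<lambda>q. f q - c * g q) \<approx> (\<lambda>q. (\<Sum>l<k. (u l - c * v l) * w l q) + (a - c * b) * w k q)"
      by eventually_elim (simp add: algebra_simps sum_subtractf sum_distrib_left)
    then show "\<exists>d. (\<lambda>q. f q - c * g q) \<approx> (\<lambda>q. (\<Sum>l<k. d l * w l q) + (a - c * b) * w k q)"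
      by (intro exI[of _ "\<lambda>l. u l - c * v l"])
  next
    fix f assume "\<exists>c. f \<approx> (\<lambda>q. (\<Sum>l<k. c l * w l q) + 0 * w k q)"
    then show "cspan k w f" unfolding cspan_def by simp
  qed
qed

end

context line_model
begin

lemma section_spaceI:
  assumes b: "\<And>i. i < m \<Longrightarrow> b i \<in> carrier (Sec F X)"
    and indep: "\<And>c i. (\<lambda>q. \<Sum>i<m. c i * \<psi> X (b i) 0 q) \<approx> (\<lambda>q. 0) \<Longrightarrow> i < m \<Longrightarrow> c i = 0"
  shows "section_space X F D \<psi> {s \<in> carrier (Sec F X). cspan m (\<lambda>i. \<psi> X (b i) 0) (\<psi> X s 0)} b m"
proof
  define V where "V = {s \<in> carrier (Sec F X). cspan m (\<lambda>i. \<psi> X (b i) 0) (\<psi> X s 0)}"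
  let ?w = "\<lambda>i. \<psi> X (b i) 0"
  have bX: "\<forall>i<m. b i \<in> carrier (Sec F X)" using b by blast
  show "section_subspace X F {s \<in> carrier (Sec F X). cspan m (\<lambda>i. \<psi> X (b i) 0) (\<psi> X s 0)}"
    unfolding section_subspace_def
  proof (intro conjI ballI allI subsetI)
    have "\<psi> X \<zero>\<^bsub>Sec F X\<^esub> 0 \<approx> (\<lambda>q. \<Sum>l<m. 0 * ?w l q)" using coord_zero[OF zopen_X, of 0] by simp
    then have "cspan m ?w (\<psi> X \<zero>\<^bsub>Sec F X\<^esub> 0)" unfolding cspan_def by (intro exI[of _ "\<lambda>l. 0"])
    then show "\<zero>\<^bsub>Sec F X\<^esub> \<in> {s \<in> carrier (Sec F X). cspan m ?w (\<psi> X s 0)}" using zero_closed[OF zopen_X] by blast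
    fix s assume "s \<in> {s \<in> carrier (Sec F X). cspan m ?w (\<psi> X s 0)}"
    then obtain c where s: "s \<in> carrier (Sec F X)" "\<psi> X s 0 \<approx> (\<lambda>q. \<Sum>l<m. c l * ?w l q)"
      unfolding cspan_def by blast
    show "s \<in> carrier (Sec F X)" by (rule s(1))
    show "scal X F a s \<in> {s \<in> carrier (Sec F X). cspan m ?w (\<psi> X s 0)}" for a
    proof -
      from scal_coord(2)[OF s(1), of a] s(2) have "\<psi> X (scal X F a s) 0 \<approx> (\<lambda>q. \<Sum>l<m. (a * c l) * ?w l q)"
        by eventually_elim (simp add: sum_distrib_left mult.assoc)
      then have "cspan m ?w (\<psi> X (scal X F a s) 0)" unfolding cspan_def by (intro exI[of _ "\<lambda>l. a * c l"])
      then show ?thesis using scal_coord(1)[OF s(1)] by blast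
    qed
    fix t assume "t \<in> {s \<in> carrier (Sec F X). cspan m ?w (\<psi> X s 0)}"
    then obtain d where t: "t \<in> carrier (Sec F X)" "\<psi> X t 0 \<approx> (\<lambda>q. \<Sum>l<m. d l * ?w l q)"
      unfolding cspan_def by blast
    from coord_add[OF zopen_X s(1) t(1), of 0, simplified] s(2) t(2)
    have "\<psi> X (s \<oplus>\<^bsub>Sec F X\<^esub> t) 0 \<approx> (\<lambda>q. \<Sum>l<m. (c l + d l) * ?w l q)"
      by eventually_elim (simp add: algebra_simps sum.distrib)
    then have "cspan m ?w (\<psi> X (s \<oplus>\<^bsub>Sec F X\<^esub> t) 0)" unfolding cspan_def by (intro exI[of _ "\<lambda>l. c l + d l"])
    then show "s \<oplus>\<^bsub>Sec F X\<^esub> t \<in> {s \<in> carrier (Sec F X). cspan m ?w (\<psi> X s 0)}"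
      using add_closed[OF zopen_X s(1) t(1)] by blast
  qed
  show "b i \<in> {s \<in> carrier (Sec F X). cspan m (\<lambda>i. \<psi> X (b i) 0) (\<psi> X s 0)}" if i: "i < m" for i
  proof -
    have "(\<Sum>l<m. (if l = i then 1 else 0) * ?w l q) = ?w i q" for q
    proof -
      have "(\<Sum>l<m. (if l = i then 1 else 0) * ?w l q) = (\<Sum>l<m. if l = i then ?w l q else 0)"
        by (intro sum.cong) auto
      then show ?thesis using i by simp
    qed
    then have "?w i \<approx> (\<lambda>q. \<Sum>l<m. (if l = i then 1 else 0) * ?w l q)" by simp
    then have "cspan m ?w (?w i)" unfolding cspan_def by (intro exI[of _ "\<lambda>l. if l = i then 1 else 0"])
    then show ?thesis using b[OF i] by blast
  qed
  define cm where "cm = (\<lambda>c. \<Oplus>\<^bsub>Sec F X\<^esub>i\<in>{..<m}. scal X F (c i) (b i))"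
  have cm: "cm c \<in> carrier (Sec F X)" "\<psi> X (cm c) 0 \<approx> (\<lambda>q. \<Sum>i<m. c i * ?w i q)" for c
    unfolding cm_def using finsum_scal_coord[OF bX, of c] by auto
  show "bij_betw (\<lambda>c. \<Oplus>\<^bsub>Sec F X\<^esub>i\<in>{..<m}. scal X F (c i) (b i)) ({..<m} \<rightarrow>\<^sub>E UNIV)
      {s \<in> carrier (Sec F X). cspan m (\<lambda>i. \<psi> X (b i) 0) (\<psi> X s 0)}"
    unfolding cm_def[symmetric] bij_betw_def
  proof (intro conjI equalityI subsetI inj_onI)
    fix c d :: "nat \<Rightarrow> complex" assume cd: "c \<in> {..<m} \<rightarrow>\<^sub>E UNIV" "d \<in> {..<m} \<rightarrow>\<^sub>E UNIV" and eq: "cm c = cm d"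
    have "(\<lambda>q. \<Sum>i<m. (c i - d i) * ?w i q) \<approx> (\<lambda>q. 0)"
      using cm(2)[of c] cm(2)[of d] unfolding eq by eventually_elim (simp add: algebra_simps sum_subtractf)
    then have "c i - d i = 0" if "i < m" for i using indep[of "\<lambda>i. c i - d i" i] that by blast
    then show "c = d" by (intro PiE_ext[OF cd]) simp
  next
    fix s assume "s \<in> cm ` ({..<m} \<rightarrow>\<^sub>E UNIV)"
    then obtain c where "s = cm c" by blast
    then show "s \<in> {s \<in> carrier (Sec F X). cspan m ?w (\<psi> X s 0)}" using cm[of c] unfolding cspan_def by blast
  next
    fix s assume "s \<in> {s \<in> carrier (Sec F X). cspan m ?w (\<psi> X s 0)}"
    then obtain c where s: "s \<in> carrier (Sec F X)" "\<psi> X s 0 \<approx> (\<lambda>q. \<Sum>l<m. c l * ?w l q)"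
      unfolding cspan_def by blast
    have "s = cm (restrict c {..<m})"
    proof (rule line_coord_inj[OF s(1) cm(1)])
      show "\<psi> X s 0 \<approx> \<psi> X (cm (restrict c {..<m})) 0"
        using s(2) cm(2)[of "restrict c {..<m}"] by eventually_elim simp
    qed
    then show "s \<in> cm ` ({..<m} \<rightarrow>\<^sub>E UNIV)" by (intro image_eqI[of _ _ "restrict c {..<m}"]) auto
  qed
qed

lemma section_space_of_dim:
  assumes "section_dim X F V m"
  obtains b where "section_space X F D \<psi> V b m"
proof -
  obtain b where b: "section_subspace X F V" "\<forall>i<m. b i \<in> V"
    "bij_betw (\<lambda>c. \<Oplus>\<^bsub>Sec F X\<^esub>i\<in>{..<m}. scal X F (c i) (b i)) ({..<m} \<rightarrow>\<^sub>E UNIV) V"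
    using assms unfolding section_dim_def by blast
  have "section_space X F D \<psi> V b m" by unfold_locales (use b in auto)
  then show ?thesis by (rule that)
qed

end

context section_space
begin

lemma section_dim: "section_dim X F V m"
  unfolding section_dim_def using subspace basis bij by blast

lemma V_iff: "s \<in> V \<longleftrightarrow> s \<in> carrier (Sec F X) \<and> cspan m \<beta> (\<psi> X s 0)"
proof
  show "s \<in> V \<Longrightarrow> s \<in> carrier (Sec F X) \<and> cspan m \<beta> (\<psi> X s 0)"
    using V_carrier V_coord unfolding cspan_def by blast
  assume s: "s \<in> carrier (Sec F X) \<and> cspan m \<beta> (\<psi> X s 0)"
  then obtain c where c: "\<psi> X s 0 \<approx> (\<lambda>q. \<Sum>i<m. c i * \<beta> i q)" unfolding cspan_def by blast
  have "s = comb c"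
  proof (rule line_coord_inj[OF _ comb_coord(1)])
    show "\<psi> X s 0 \<approx> \<psi> X (comb c) 0" using c comb_coord(2)[of c] by eventually_elim simp
  qed (use s in blast)
  then show "s \<in> V" using comb_V by simp
qed

lemma \<beta>_nz: "i < m \<Longrightarrow> nz (\<beta> i)"
proof -
  assume i: "i < m"
  obtain p where p: "p \<in> X" using X_nonempty by blast
  have "\<not> \<beta> i \<approx> (\<lambda>q. 0)"
  proof
    assume 0: "\<beta> i \<approx> (\<lambda>q. 0)"
    have "(\<Sum>l<m. (if l = i then 1 else 0) * \<beta> l q) = \<beta> i q" for q
    proof -
      have "(\<Sum>l<m. (if l = i then 1 else 0) * \<beta> l q) = (\<Sum>l<m. if l = i then \<beta> l q else 0)"
        by (intro sum.cong) auto
      then show ?thesis using i by simp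
    qed
    then have "(\<lambda>q. \<Sum>l<m. (if l = i then 1 else 0) * \<beta> l q) \<approx> (\<lambda>q. 0)" using 0 by simp
    from \<beta>_indep[OF this i] show False by simp
  qed
  then show ?thesis using ordge_rat[OF \<beta>_ordge[OF i p]] by (simp add: nz_def)
qed

text \<open>\<open>linearly_stable\<close> mentions \<open>V\<close> and \<open>W\<close> only
  through \<open>section_dim\<close>. This lemma makes the dimension of \<open>V\<close> unique and,
  for a three-dimensional \<open>V\<close>, leaves only the subspaces of dimension 2 to be
  examined.\<close>

lemma subspace_dim_le:
  assumes "section_space X F D \<psi> W b' w" "W \<subseteq> V"
  shows "w \<le> m" "w = m \<Longrightarrow> W = V"
proof -
  interpret W: section_space X F D \<psi> W b' w by (rule assms(1))
  have span: "cspan m \<beta> (\<psi> X s 0)" if "s \<in> V" for s using that V_iff by blast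
  have \<omega>: "cspan m \<beta> (W.\<beta> i)" if "i < w" for i
    unfolding W.\<beta>_def using span W.basis[OF that] assms(2) by blast
  show "w \<le> m"
  proof (rule ccontr)
    assume "\<not> w \<le> m"
    then have "\<exists>c. (\<exists>i\<in>{..<w}. c i \<noteq> 0) \<and> (\<lambda>q. \<Sum>i\<in>{..<w}. c i * W.\<beta> i q) \<approx> (\<lambda>q. 0)"
      using \<omega> by (intro dimle_family[OF dimle_cspan]) auto
    then show False using W.\<beta>_indep by blast
  qed
  show "W = V" if wm: "w = m"
  proof (rule antisym[OF assms(2)], rule subsetI)
    fix v assume v: "v \<in> V"
    define g where "g i = (if i < w then W.\<beta> i else \<psi> X v 0)" for i
    have "\<exists>c. (\<exists>i\<in>{..w}. c i \<noteq> 0) \<and> (\<lambda>q. \<Sum>i\<in>{..w}. c i * g i q) \<approx> (\<lambda>q. 0)"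
      using \<omega> span[OF v] wm by (intro dimle_family[OF dimle_cspan[of m \<beta>]]) (auto simp: g_def)
    then obtain c where c: "\<exists>i\<in>{..w}. c i \<noteq> 0" "(\<lambda>q. \<Sum>i\<in>{..w}. c i * g i q) \<approx> (\<lambda>q. 0)" by blast
    have eq: "(\<lambda>q. (\<Sum>i<w. c i * W.\<beta> i q) + c w * \<psi> X v 0 q) \<approx> (\<lambda>q. 0)"
      using c(2) by eventually_elim (simp add: lessThan_Suc_atMost[symmetric] g_def)
    have cw: "c w \<noteq> 0"
    proof
      assume cw: "c w = 0"
      then have "c i = 0" if "i < w" for i using W.\<beta>_indep[of c i] eq that by simp
      then show False using c(1) cw by (auto simp: le_less)
    qed
    have "\<psi> X v 0 \<approx> (\<lambda>q. \<Sum>i<w. (- c i / c w) * W.\<beta> i q)"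
      using eq
    proof eventually_elim
      case (elim q)
      have "c w * \<psi> X v 0 q = - (\<Sum>i<w. c i * W.\<beta> i q)" using elim by (simp add: add_eq_0_iff2 add.commute)
      then have "\<psi> X v 0 q = - (\<Sum>i<w. c i * W.\<beta> i q) / c w" using cw by (simp add: field_simps)
      then show ?case by (simp add: sum_divide_distrib sum_negf)
    qed
    then have "cspan w W.\<beta> (\<psi> X v 0)" unfolding cspan_def by (rule exI[of _ "\<lambda>i. - c i / c w"])
    then show "v \<in> W" using W.V_iff V_carrier[OF v] by blast
  qed
qed

end

section \<open>A base point free pencil of degree two\<close>

context line_model
begin

text \<open>Dividing all coordinates by \<open>f\<close> replaces \<open>D\<close> by the linearly
  equivalent divisor \<open>D + div f\<close>. If \<open>f\<close> is the coordinate of a global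
  section, that section becomes the function 1 and the new divisor is effective.\<close>

lemma renormalize:
  assumes f: "nz f"
  shows "line_model X F (\<lambda>p. D p + ord p f) (\<lambda>U s i q. \<psi> U s 0 q * inverse (f q))"
proof -
  have UX: "\<forall>\<^sub>F q in gen U. f q \<noteq> 0" if "zopen X U" for U
    using eventually_gen_subset[OF nz_nonzero[OF f] zopen_subset[OF that]] .
  show ?thesis
  proof (rule line_modelI[of "\<lambda>p. D p + ord p f" F "\<lambda>U s q. \<psi> U s 0 q * inverse (f q)"])
    show "finsupp (\<lambda>p. D p + ord p f)" by (rule finsupp_add[OF finsupp_D finsupp_ord[OF f]])
  next
    fix U assume U: "zopen X U"
    show "\<forall>\<^sub>F q in gen U. \<psi> U \<zero>\<^bsub>Sec F U\<^esub> 0 q * inverse (f q) = 0"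
      using coord_zero[OF U, of 0, simplified] by eventually_elim simp
  next
    fix U s t assume U: "zopen X U" and st: "s \<in> carrier (Sec F U)" "t \<in> carrier (Sec F U)"
    show "\<forall>\<^sub>F q in gen U. \<psi> U (s \<oplus>\<^bsub>Sec F U\<^esub> t) 0 q * inverse (f q) = \<psi> U s 0 q * inverse (f q) + \<psi> U t 0 q * inverse (f q)"
      using coord_add[OF U st, of 0, simplified] by eventually_elim (simp add: algebra_simps)
  next
    fix U a s assume U: "zopen X U" and a: "a \<in> regular X U" and s: "s \<in> carrier (Sec F U)"
    show "\<forall>\<^sub>F q in gen U. \<psi> U (a \<odot>\<^bsub>Sec F U\<^esub> s) 0 q * inverse (f q) = a q * (\<psi> U s 0 q * inverse (f q))"
      using coord_smult[OF U a s, of 0, simplified] by eventually_elim simp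
  next
    fix U V s assume U: "zopen X U" and V: "zopen X V" "V \<subseteq> U" and s: "s \<in> carrier (Sec F U)"
    show "\<forall>\<^sub>F q in gen V. \<psi> V (Res F U V s) 0 q * inverse (f q) = \<psi> U s 0 q * inverse (f q)"
      using coord_res[OF U V s, of 0, simplified] by eventually_elim simp
  next
    fix U s p assume U: "zopen X U" and s: "s \<in> carrier (Sec F U)" and p: "p \<in> U"
    then have "p \<in> X" using zopen_subset by blast
    then have "ordge p (\<lambda>q. \<psi> U s 0 q * inverse (f q)) (- D p + - ord p f)"
      by (intro ordge_mult line_coord_germ[OF U s p] hasord_ordge hasord_inverse hasord_ord f)
    then show "ordge p (\<lambda>q. \<psi> U s 0 q * inverse (f q)) (- (D p + ord p f))" by simp
  next
    fix U s t assume U: "zopen X U" and st: "s \<in> carrier (Sec F U)" "t \<in> carrier (Sec F U)"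
      and eq: "\<forall>\<^sub>F q in gen U. \<psi> U s 0 q * inverse (f q) = \<psi> U t 0 q * inverse (f q)"
    have "\<forall>\<^sub>F q in gen U. \<psi> U s 0 q = \<psi> U t 0 q" using eq UX[OF U] by eventually_elim simp
    then show "s = t" by (intro coord_inj[OF U st]) simp
  next
    fix U g assume U: "zopen X U" and g: "\<And>p. p \<in> U \<Longrightarrow> ordge p g (- (D p + ord p f))"
    have "ordge p (\<lambda>q. g q * f q) (- D p)" if p: "p \<in> U" for p
    proof -
      have "p \<in> X" using zopen_subset[OF U] p by blast
      then have "ordge p (\<lambda>q. g q * f q) (- (D p + ord p f) + ord p f)"
        by (intro ordge_mult g p hasord_ordge hasord_ord f)
      then show ?thesis by simp
    qed
    from line_coord_surj[OF U this] obtain s where s: "s \<in> carrier (Sec F U)"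
      "\<forall>\<^sub>F q in gen U. \<psi> U s 0 q = g q * f q" .
    have "\<forall>\<^sub>F q in gen U. \<psi> U s 0 q * inverse (f q) = g q"
      using s(2) UX[OF U] by eventually_elim simp
    then show "\<exists>s\<in>carrier (Sec F U). \<forall>\<^sub>F q in gen U. \<psi> U s 0 q * inverse (f q) = g q" using s(1) by blast
  qed (fact zero_closed add_closed smult_closed res_closed)+
qed

text \<open>Multiplication by a nonzero section embeds the global regular functions into \<open>H\<^sup>0(F)\<close>.\<close>

lemma proper_of_sections:
  assumes "section_dim X F (carrier (Sec F X)) m" "0 < m"
  shows "proper_curve X"
proof (unfold_locales, rule exI[of _ m])
  obtain b where "section_space X F D \<psi> (carrier (Sec F X)) b m" using section_space_of_dim[OF assms(1)] .
  then interpret S: section_space X F D \<psi> "carrier (Sec F X)" b m .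
  show "dimle (Ldiv (\<lambda>p. 0)) m"
    unfolding dimle_def
  proof (intro allI impI)
    fix w assume w: "\<forall>i\<le>m. Ldiv (\<lambda>p. 0) (w i)"
    have "cspan m S.\<beta> (\<lambda>q. w i q * S.\<beta> 0 q)" if i: "i \<le> m" for i
    proof -
      have "ordge p (\<lambda>q. w i q * S.\<beta> 0 q) (- D p)" if p: "p \<in> X" for p
      proof -
        have "ordge p (w i) 0" using w i p by (auto simp: Ldiv_def)
        then have "ordge p (\<lambda>q. w i q * S.\<beta> 0 q) (0 + - D p)"
          using S.\<beta>_ordge[OF assms(2) p] by (intro ordge_mult)
        then show ?thesis by simp
      qed
      from line_coord_surj[OF zopen_X this] obtain s where s: "s \<in> carrier (Sec F X)"
        "\<psi> X s 0 \<approx> (\<lambda>q. w i q * S.\<beta> 0 q)" .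
      from S.V_coord[OF s(1)] s(2) have "(\<lambda>q. w i q * S.\<beta> 0 q) \<approx> (\<lambda>q. \<Sum>i<m. S.coords s i * S.\<beta> i q)"
        by eventually_elim simp
      then show ?thesis unfolding cspan_def by blast
    qed
    then have "\<exists>c. (\<exists>i\<le>m. c i \<noteq> 0) \<and> (\<lambda>q. \<Sum>i\<le>m. c i * (w i q * S.\<beta> 0 q)) \<approx> (\<lambda>q. 0)"
      using dimle_cspan[of m S.\<beta>, unfolded dimle_def, THEN spec, of "\<lambda>i q. w i q * S.\<beta> 0 q"] by blast
    then obtain c where c: "\<exists>i\<le>m. c i \<noteq> 0" "(\<lambda>q. \<Sum>i\<le>m. c i * (w i q * S.\<beta> 0 q)) \<approx> (\<lambda>q. 0)" by blast
    from c(2) nz_nonzero[OF S.\<beta>_nz[OF assms(2)]] have "(\<lambda>q. \<Sum>i\<le>m. c i * w i q) \<approx> (\<lambda>q. 0)"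
      by eventually_elim (simp add: mult.assoc[symmetric] sum_distrib_right[symmetric])
    then show "\<exists>c. (\<exists>i\<le>m. c i \<noteq> 0) \<and> (\<lambda>q. \<Sum>i\<le>m. c i * w i q) \<approx> (\<lambda>q. 0)" using c(1) by blast
  qed
qed

end

text \<open>The sections of H divided by one of them: \<open>D\<close> is the divisor of that
  section, and \<open>x\<close> is the quotient of a second section by it, the affine coordinate of
  the map to the projective line.\<close>

locale degree_two_pencil = proper_curve X for X :: "('n::finite) pt set" +
  fixes D :: "'n pt \<Rightarrow> int" and x :: "'n pt \<Rightarrow> complex"
  assumes D_fin: "finsupp D" and D_nonneg: "\<And>p. p \<in> X \<Longrightarrow> 0 \<le> D p" and D_deg: "deg D = 2"
    and x_Ldiv: "Ldiv D x"
    and Ldiv_span: "\<And>f. Ldiv D f \<Longrightarrow> \<exists>a b. f \<approx> (\<lambda>q. a + b * x q)"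
    and x_indep: "\<And>a b. (\<lambda>q. a + b * x q) \<approx> (\<lambda>q. 0) \<Longrightarrow> a = 0 \<and> b = 0"
begin

lemma x_not_const: "\<not> x \<approx> (\<lambda>q. c)"
proof
  assume "x \<approx> (\<lambda>q. c)"
  then have "(\<lambda>q. - c + 1 * x q) \<approx> (\<lambda>q. 0)" by eventually_elim simp
  then show False using x_indep by fastforce
qed

lemma deg_point:
  assumes "p \<in> X"
  shows "finsupp (\<lambda>q. if q = p then k else 0)" "deg (\<lambda>q. if q = p then k else 0) = k"
proof -
  have "{q \<in> X. (if q = p then k else 0) \<noteq> 0} \<subseteq> {p}" by auto
  then show "finsupp (\<lambda>q. if q = p then k else 0)" unfolding finsupp_def using finite_subset by blast
  show "deg (\<lambda>q. if q = p then k else 0) = k"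
    using deg_eq[of "{p}" "\<lambda>q. if q = p then k else 0"] assms by simp
qed

text \<open>If \<open>p\<close> were a base point, \<open>x\<close> would have a single simple pole \<open>q\<close>, and then \<open>x\<^sup>2\<close> or the inverse
  of \<open>x - x(p)\<close>, according to whether \<open>p = q\<close>, would be a third independent element of \<open>L(D)\<close>.\<close>

lemma x_pole:
  assumes p: "p \<in> X" and Dp: "D p > 0"
  shows "hasord p x (- D p)"
proof (rule ccontr)
  assume no: "\<not> hasord p x (- D p)"
  have xrat: "rat x" using x_Ldiv p ordge_rat by (auto simp: Ldiv_def)
  have xp: "ordge p x (- D p + 1)" using ordge_exact[of p x "- D p"] x_Ldiv p no by (auto simp: Ldiv_def)
  \<comment> \<open>Removing the base point leaves an effective divisor of degree 1, that is, a
    single point \<open>q\<close>, which is then the only possible pole of \<open>x\<close>.\<close>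
  define D1 where "D1 = (\<lambda>q. D q + (if q = p then - 1 else 0))"
  have D1: "finsupp D1" "deg D1 = 1"
    unfolding D1_def using finsupp_add[OF D_fin deg_point(1)[OF p]] deg_add[OF D_fin deg_point(1)[OF p]]
      deg_point(2)[OF p] D_deg by auto
  have D1_nonneg: "0 \<le> D1 q" if "q \<in> X" for q using D_nonneg[OF that] Dp by (auto simp: D1_def)
  have xD1: "ordge q x (- D1 q)" if "q \<in> X" for q
    using x_Ldiv that xp by (auto simp: Ldiv_def D1_def)
  have "\<exists>q\<in>X. D1 q \<noteq> 0"
  proof (rule ccontr)
    assume "\<not> ?thesis"
    then have "deg D1 = deg (\<lambda>q. 0)" by (intro deg_cong) auto
    then show False using D1 by (simp add: deg_def)
  qed
  then obtain q where q: "q \<in> X" "D1 q > 0" using D1_nonneg by force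
  define D2 where "D2 = (\<lambda>r. D1 r + (if r = q then - 1 else 0))"
  have D2: "finsupp D2" "deg D2 = 0"
    unfolding D2_def using finsupp_add[OF D1(1) deg_point(1)[OF q(1)]] deg_add[OF D1(1) deg_point(1)[OF q(1)]]
      deg_point(2)[OF q(1)] D1 by auto
  have D2_nonneg: "0 \<le> D2 r" if "r \<in> X" for r using D1_nonneg[OF that] q by (auto simp: D2_def)
  have D2_0: "D2 r = 0" if "r \<in> X" for r
    using deg_pos[OF D2(1) D2_nonneg that] D2_nonneg[OF that] D2(2) by force
  have D1q: "D1 r = (if r = q then 1 else 0)" if "r \<in> X" for r
    using D2_0[OF that] by (simp add: D2_def split: if_splits)
  have xr: "ordge r x 0" if "r \<in> X" "r \<noteq> q" for r using xD1[OF that(1)] D1q[OF that(1)] that by simp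
  have xq: "hasord q x (- 1)"
  proof (rule ccontr)
    assume "\<not> hasord q x (- 1)"
    then have "ordge q x 0" using ordge_exact[of q x "- 1"] xD1[OF q(1)] D1q[OF q(1)] by auto
    then have "Ldiv (\<lambda>p. 0) x" using xr by (auto simp: Ldiv_def)
    then show False using Ldiv_0_const x_not_const by blast
  qed
  show False
  proof (cases "p = q")
    case True
    have D: "D r = (if r = q then 2 else 0)" if "r \<in> X" for r
      using D1q[OF that] True by (auto simp: D1_def split: if_splits)
    have xx: "hasord q (\<lambda>r. x r * x r) (- 1 + - 1)" by (intro hasord_mult xq)
    have "ordge r (\<lambda>r. x r * x r) (- D r)" if r: "r \<in> X" for r
    proof (cases "r = q")
      case True
      then show ?thesis using hasord_ordge[OF xx] D[OF r] by simp
    next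
      case False
      then show ?thesis using ordge_mult[OF xr[OF r False] xr[OF r False]] D[OF r] by simp
    qed
    then have "Ldiv D (\<lambda>r. x r * x r)" by (simp add: Ldiv_def)
    from Ldiv_span[OF this] obtain a b where ab: "(\<lambda>r. x r * x r) \<approx> (\<lambda>r. a + b * x r)" by blast
    have "ordge q (\<lambda>r. a + b * x r) (- 1)"
      using ordge_mono[OF ordge_const[OF q(1), of a], of "- 1"] ordge_cmult[OF hasord_ordge[OF xq], of b]
      by (intro ordge_add) auto
    moreover have "hasord q (\<lambda>r. a + b * x r) (- 1 + - 1)" by (rule hasord_cong[OF xx ab])
    ultimately show False using hasord_ordge_iff by fastforce
  next
    case False
    have D: "D r = (if r = q then 1 else 0) + (if r = p then 1 else 0)" if "r \<in> X" for r
      using D1q[OF that] False by (auto simp: D1_def split: if_splits)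
    obtain c where c: "ordge p (\<lambda>r. x r - c) 1" using ordge_value[OF xr[OF p False]] .
    define f where "f = (\<lambda>r. x r - c)"
    have fnz: "nz f"
    proof -
      have "\<not> f \<approx> (\<lambda>q. 0)"
      proof
        assume "f \<approx> (\<lambda>q. 0)"
        then have "x \<approx> (\<lambda>q. c)" by eventually_elim (simp add: f_def)
        then show False using x_not_const by blast
      qed
      then show ?thesis using ordge_rat[OF c] by (simp add: nz_def f_def)
    qed
    have fq: "ord q f = - 1"
    proof (rule ord_eq)
      have "ordge q (\<lambda>r. - c) (- 1 + 1)" using ordge_const[OF q(1)] by simp
      from hasord_add[OF xq this] show "hasord q f (- 1)" by (simp add: f_def)
    qed
    have fr: "0 \<le> ord r f" if r: "r \<in> X" "r \<noteq> q" for r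
      using ordge_diff[OF xr[OF r] ordge_const[OF r(1)]] ordge_iff[OF fnz r(1), of 0] by (simp add: f_def)
    have fp: "1 \<le> ord p f" using c ordge_iff[OF fnz p, of 1] by (simp add: f_def)
    \<comment> \<open>This is the divisor of \<open>f\<close> plus \<open>q\<close> minus
      \<open>p\<close>. It is effective of degree zero, hence zero, so \<open>f\<close> has a simple
      zero at \<open>p\<close> and a simple pole at \<open>q\<close>, and its inverse has a pole at
      \<open>p\<close> alone.\<close>
    define E where "E = (\<lambda>r. (ord r f + (if r = q then 1 else 0)) + (if r = p then - 1 else 0))"
    have E: "finsupp E" "deg E = 0"
      unfolding E_def
      using finsupp_add[OF finsupp_add[OF finsupp_ord[OF fnz] deg_point(1)[OF q(1), of 1]] deg_point(1)[OF p, of "- 1"]]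
        deg_add[OF finsupp_add[OF finsupp_ord[OF fnz] deg_point(1)[OF q(1), of 1]] deg_point(1)[OF p, of "- 1"]]
        deg_add[OF finsupp_ord[OF fnz] deg_point(1)[OF q(1), of 1]] deg_point(2)[OF q(1), of 1]
        deg_point(2)[OF p, of "- 1"] deg_ord[OF fnz] by auto
    have E_nonneg: "0 \<le> E r" if "r \<in> X" for r using fr[OF that] fq fp False by (auto simp: E_def)
    have E0: "E r = 0" if "r \<in> X" for r
      using deg_pos[OF E(1) E_nonneg that] E_nonneg[OF that] E(2) by force
    have ordf: "ord r f = (if r = p then 1 else 0) - (if r = q then 1 else 0)" if "r \<in> X" for r
      using E0[OF that] unfolding E_def by (cases "r = p"; cases "r = q"; simp)
    define y where "y = (\<lambda>r. inverse (f r))"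
    have y: "hasord r y (- ord r f)" if "r \<in> X" for r
      unfolding y_def by (rule hasord_inverse[OF hasord_ord[OF fnz that]])
    have "ordge r y (- D r)" if "r \<in> X" for r
      using hasord_ordge_iff[OF y[OF that], of "- D r"] ordf[OF that] D[OF that] by auto
    then have "Ldiv D y" by (simp add: Ldiv_def)
    from Ldiv_span[OF this] obtain a b where ab: "y \<approx> (\<lambda>r. a + b * x r)" by blast
    have "ordge p (\<lambda>r. a + b * x r) 0"
      by (intro ordge_add ordge_const p ordge_cmult xr[OF p False])
    moreover have "hasord p (\<lambda>r. a + b * x r) (- 1)"
      using hasord_cong[OF y[OF p] ab] ordf[OF p] False by simp
    ultimately show False using hasord_ordge_iff by fastforce
  qed
qed

lemma x_regular: "p \<in> X \<Longrightarrow> D p = 0 \<Longrightarrow> ordge p x 0"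
  using x_Ldiv by (auto simp: Ldiv_def)

lemma pole_exists: obtains p where "p \<in> X" "D p > 0"
proof -
  have "\<exists>q\<in>X. D q \<noteq> 0"
  proof (rule ccontr)
    assume "\<not> ?thesis"
    then have "deg D = deg (\<lambda>q. 0)" by (intro deg_cong) auto
    then show False using D_deg by (simp add: deg_def)
  qed
  then show ?thesis using that D_nonneg by force
qed

definition ev :: "complex poly \<Rightarrow> 'n pt \<Rightarrow> complex" where
  "ev P = (\<lambda>q. poly P (x q))"

lemma ev_pole:
  assumes p: "p \<in> X" "D p > 0"
  shows "P \<noteq> 0 \<Longrightarrow> hasord p (ev P) (- (D p * int (degree P)))"
proof (induction P rule: pCons_induct)
  case (pCons a P)
  show ?case
  proof (cases "P = 0")
    case True
    then show ?thesis using pCons hasord_const[OF p(1), of a] by (simp add: ev_def)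
  next
    case False
    have "hasord p (\<lambda>q. x q * ev P q) (- D p + - (D p * int (degree P)))"
      using False pCons by (intro hasord_mult x_pole p) simp
    then have h: "hasord p (\<lambda>q. x q * ev P q) (- (D p * int (degree (pCons a P))))"
      using False by (simp add: algebra_simps)
    have "D p * int (degree (pCons a P)) \<ge> D p * 1" using p(2) False by (intro mult_left_mono) auto
    then have "- (D p * int (degree (pCons a P))) + 1 \<le> 0" using p(2) by linarith
    from hasord_add[OF h ordge_mono[OF ordge_const[OF p(1)] this, of a]] show ?thesis
      by (simp add: ev_def add.commute)
  qed
qed simp

lemma ev_regular: "p \<in> X \<Longrightarrow> D p = 0 \<Longrightarrow> ordge p (ev P) 0"
proof (induction P rule: pCons_induct)
  case 0
  then show ?case by (simp add: ev_def ordge_const)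
next
  case (pCons a P)
  then have "ordge p (\<lambda>q. a + x q * ev P q) 0"
    using ordge_mult[OF x_regular[OF pCons(3,4)], of "ev P" 0] by (intro ordge_add ordge_const) auto
  then show ?case by (simp add: ev_def)
qed

lemma ev_nz: "P \<noteq> 0 \<Longrightarrow> nz (ev P)"
  using pole_exists ev_pole hasord_nz by metis

lemma ev_0_iff: "ev P \<approx> (\<lambda>q. 0) \<longleftrightarrow> P = 0"
  using ev_nz[of P] by (auto simp: nz_def ev_def)

lemma ev_ordge:
  assumes "p \<in> X" "degree P \<le> d"
  shows "ordge p (ev P) (- (int d * D p))"
proof (cases "P = 0")
  case True
  then show ?thesis using ordge_zero[OF assms(1)] by (simp add: ev_def)
next
  case False
  show ?thesis
  proof (cases "D p = 0")
    case True
    then show ?thesis using ev_regular[OF assms(1)] by simp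
  next
    case Dp: False
    then have "D p > 0" using D_nonneg[OF assms(1)] by simp
    have "D p * int (degree P) \<le> D p * int d"
      using assms(2) D_nonneg[OF assms(1)] by (intro mult_left_mono) auto
    then have "- (int d * D p) \<le> - (D p * int (degree P))" by (simp add: mult.commute)
    then show ?thesis using ordge_mono[OF hasord_ordge[OF ev_pole[OF assms(1) \<open>D p > 0\<close> False]]] by blast
  qed
qed

text \<open>The divisor \<open>G\<close> is \<open>(d - degree P) D - div P(x)\<close>. It equals
  \<open>d D\<close> at the poles of \<open>x\<close> and minus the order of \<open>P(x)\<close>
  elsewhere, so it is bounded by \<open>E\<close>; its degree is \<open>2 (d - degree P)\<close>, as
  principal divisors have degree zero. In the application \<open>d\<close> is the degree of a member
  of a pencil, and \<open>P\<close> a combination of the two generators with polynomial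
  coefficients.\<close>

lemma degree_bound:
  assumes E: "finsupp E" and P: "P \<noteq> 0"
    and pole: "\<And>p. p \<in> X \<Longrightarrow> D p > 0 \<Longrightarrow> d * D p \<le> E p"
    and reg: "\<And>p. p \<in> X \<Longrightarrow> D p = 0 \<Longrightarrow> - ord p (ev P) \<le> E p"
  shows "2 * d - 2 * int (degree P) \<le> deg E"
proof -
  define G where "G = (\<lambda>p. (d - int (degree P)) * D p + -1 * ord p (ev P))"
  have fin: "finsupp (\<lambda>p. (d - int (degree P)) * D p)" "finsupp (\<lambda>p. -1 * ord p (ev P))"
    by (rule finsupp_cmult[OF D_fin], rule finsupp_cmult[OF finsupp_ord[OF ev_nz[OF P]]])
  have "deg G = (d - int (degree P)) * 2"
    unfolding G_def using deg_add[OF fin] deg_cmult[of "d - int (degree P)" D] deg_cmult[of "-1" "\<lambda>p. ord p (ev P)"]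
      deg_ord[OF ev_nz[OF P]] D_deg by simp
  moreover have "deg G \<le> deg E"
  proof (rule deg_mono[OF _ E])
    show "finsupp G" unfolding G_def by (rule finsupp_add[OF fin])
    fix p assume p: "p \<in> X"
    show "G p \<le> E p"
    proof (cases "D p = 0")
      case True
      then show ?thesis using reg[OF p] by (simp add: G_def)
    next
      case False
      then have Dp: "D p > 0" using D_nonneg[OF p] by simp
      have "ord p (ev P) = - (D p * int (degree P))" by (rule ord_eq[OF ev_pole[OF p Dp P]])
      then show ?thesis using pole[OF p Dp] by (simp add: G_def algebra_simps)
    qed
  qed
  ultimately show ?thesis by simp
qed

end

text \<open>The divisor of the first of two basis sections becomes the divisor of the pencil, and
  the quotient of the second by the first becomes \<open>x\<close>. The finiteness of the constants
  has to come first, since only with it can the degree of H be read as \<open>deg D\<close>.\<close>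

lemma (in smooth_curve) hyperelliptic_pencil:
  fixes H :: "('n, 'm) sheaf"
  assumes "hyperelliptic_bundle X H"
  shows "\<exists>D \<psi> x. degree_two_pencil X D x \<and> line_model X H D \<psi>"
proof -
  have vb: "vector_bundle X H 1" and dg: "bundle_degree X H = 2" and h: "section_dim X H (carrier (Sec H X)) 2"
    using assms by (auto simp: hyperelliptic_bundle_def)
  obtain D \<psi> where lm: "line_model X H D \<psi>" using line_bundle_model[OF vb] by blast
  interpret L: line_model X H D \<psi> by (rule lm)
  have pc: "proper_curve X" by (rule L.proper_of_sections[OF h]) simp
  interpret P: proper_curve X by (rule pc)
  interpret PL: proper_line_model X H D \<psi> by unfold_locales
  have degD: "deg D = 2" using PL.bundle_degree_line dg by simp
  obtain b where "section_space X H D \<psi> (carrier (Sec H X)) b 2" using L.section_space_of_dim[OF h] .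
  then interpret S: section_space X H D \<psi> "carrier (Sec H X)" b 2 .
  define f where "f = S.\<beta> 0"
  have f: "nz f" unfolding f_def by (rule S.\<beta>_nz) simp
  define x where "x = (\<lambda>q. S.\<beta> 1 q * inverse (f q))"
  define D' where "D' = (\<lambda>p. D p + ord p f)"
  have lm': "line_model X H D' (\<lambda>U s i q. \<psi> U s 0 q * inverse (f q))"
    unfolding D'_def by (rule L.renormalize[OF f])
  have "degree_two_pencil X D' x"
  proof unfold_locales
    show D'fin: "finsupp D'" unfolding D'_def by (rule finsupp_add[OF L.finsupp_D finsupp_ord[OF f]])
    show "deg D' = 2" unfolding D'_def
      using deg_add[OF L.finsupp_D finsupp_ord[OF f]] degD P.deg_ord[OF f] by simp
    show "0 \<le> D' p" if p: "p \<in> X" for p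
      using ordge_iff[OF f p] S.\<beta>_ordge[of 0 p] p unfolding D'_def f_def by force
    show "Ldiv D' x"
      unfolding Ldiv_def
    proof
      fix p assume p: "p \<in> X"
      have "ordge p x (- D p + - ord p f)"
        unfolding x_def using p by (intro ordge_mult S.\<beta>_ordge hasord_ordge hasord_inverse hasord_ord f) auto
      then show "ordge p x (- D' p)" by (simp add: D'_def)
    qed
    show "\<exists>a b. g \<approx> (\<lambda>q. a + b * x q)" if g: "Ldiv D' g" for g
    proof -
      have "ordge p (\<lambda>q. g q * f q) (- D p)" if p: "p \<in> X" for p
      proof -
        have "ordge p g (- D' p)" using g p by (simp add: Ldiv_def)
        from ordge_mult[OF this hasord_ordge[OF hasord_ord[OF f p]]]
        have "ordge p (\<lambda>q. g q * f q) (- D' p + ord p f)" .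
        then show ?thesis by (simp add: D'_def)
      qed
      from L.line_coord_surj[OF zopen_X this] obtain s where s: "s \<in> carrier (Sec H X)"
        "\<psi> X s 0 \<approx> (\<lambda>q. g q * f q)" .
      from S.V_coord[OF s(1)] s(2) nz_nonzero[OF f]
      have "g \<approx> (\<lambda>q. S.coords s 0 + S.coords s 1 * x q)"
        by eventually_elim (auto simp: numeral_2_eq_2 x_def f_def field_simps)
      then show ?thesis by blast
    qed
    show "a = 0 \<and> b = 0" if "(\<lambda>q. a + b * x q) \<approx> (\<lambda>q. 0)" for a b
    proof -
      define c where "c i = (if i = 0 then a else b)" for i :: nat
      from that nz_nonzero[OF f] have "(\<lambda>q. \<Sum>i<2. c i * S.\<beta> i q) \<approx> (\<lambda>q. 0)"
      proof eventually_elim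
        case (elim q)
        have "a * f q + b * S.\<beta> 1 q = (a + b * x q) * f q" using elim(2) by (simp add: x_def field_simps)
        then show ?case using elim(1) by (simp add: numeral_2_eq_2 c_def f_def)
      qed
      from S.\<beta>_indep[OF this, of 0] S.\<beta>_indep[OF this, of 1] show ?thesis by (simp add: c_def)
    qed
  qed
  then show ?thesis using lm' by blast
qed

section \<open>Three polynomials and their syzygies\<close>

definition span_poly :: "nat \<Rightarrow> nat \<Rightarrow> complex poly" where
  "span_poly N i = (if i = 0 then 1 else if i = 1 then monom 1 N + monom 1 (N + 1) else monom 1 (2 * N + 1))"

text \<open>The quotient of \<open>X\<^sup>N\<^sup>+\<^sup>1 + (-1)\<^sup>N\<close> by \<open>X + 1\<close>.\<close>

primrec alt_poly :: "nat \<Rightarrow> complex poly" where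
  "alt_poly 0 = 1"
| "alt_poly (Suc k) = pCons ((- 1) ^ Suc k) (alt_poly k)"

lemma alt_poly_mult: "alt_poly k * [:1, 1:] = monom 1 (Suc k) + [:(- 1) ^ k:]"
proof (induction k)
  case (Suc k)
  have "alt_poly (Suc k) * [:1, 1:] = [:(- 1) ^ Suc k, (- 1) ^ Suc k:] + pCons 0 (alt_poly k * [:1, 1:])"
    by (simp add: mult_pCons_left)
  also have "\<dots> = monom 1 (Suc (Suc k)) + [:(- 1) ^ Suc k:]"
    unfolding Suc by (simp add: monom_Suc)
  finally show ?case .
qed (simp add: monom_Suc)

lemma degree_alt_poly: "degree (alt_poly k) = k" and lead_alt_poly: "coeff (alt_poly k) k = 1"
proof -
  have "degree (alt_poly k) = k \<and> coeff (alt_poly k) k = 1 \<and> alt_poly k \<noteq> 0"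
    by (induction k) auto
  then show "degree (alt_poly k) = k" "coeff (alt_poly k) k = 1" by auto
qed

lemma subleading_alt_poly: "coeff (alt_poly (Suc k)) k = - 1"
  by (induction k) auto

text \<open>Division by the middle polynomial with a quotient of degree \<open>N\<close> and a
  remainder that is a multiple of \<open>X^N\<close>. It serves both as the syzygy that embeds the
  tensor power and as the means to lower degrees in \<open>low_combination\<close>.\<close>

lemma span_poly_2: "span_poly N 2 = alt_poly N * span_poly N 1 - monom ((- 1) ^ N) N"
proof -
  have "alt_poly N * span_poly N 1 = monom 1 N * (alt_poly N * [:1, 1:])"
    by (simp add: span_poly_def monom_Suc algebra_simps smult_monom)
  also have "\<dots> = monom 1 (2 * N + 1) + monom ((- 1) ^ N) N"
    unfolding alt_poly_mult by (simp add: algebra_simps mult_monom smult_monom mult_2 mult_2_right)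
  finally show ?thesis by (simp add: span_poly_def)
qed

lemma degree_span_poly: "degree (span_poly N i) \<le> 2 * N + 1"
  by (auto simp: span_poly_def degree_monom_eq intro!: degree_add_le order_trans[OF degree_monom_le])

section \<open>Pencils in the span of the three polynomials\<close>

definition span_comb :: "nat \<Rightarrow> (nat \<Rightarrow> complex) \<Rightarrow> complex poly" where
  "span_comb N c = (\<Sum>l<3. smult (c l) (span_poly N l))"

lemma span_comb_eq: "span_comb N c = [:c 0:] + smult (c 1) (span_poly N 1) + smult (c 2) (span_poly N 2)"
  by (simp add: span_comb_def numeral_3_eq_3 lessThan_Suc span_poly_def numeral_2_eq_2)

lemma coeff_span_comb: "N \<ge> 1 \<Longrightarrow> coeff (span_comb N c) (2 * N + 1) = c 2"
  "N \<ge> 1 \<Longrightarrow> coeff (span_comb N c) (N + 1) = c 1" "N \<ge> 1 \<Longrightarrow> coeff (span_comb N c) 0 = c 0"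
  by (cases N; auto simp: span_comb_eq span_poly_def)+

lemma degree_span_comb: "N \<ge> 1 \<Longrightarrow> c 2 \<noteq> 0 \<Longrightarrow> degree (span_comb N c) = 2 * N + 1"
proof (rule antisym)
  show "degree (span_comb N c) \<le> 2 * N + 1"
    unfolding span_comb_def by (intro degree_sum_le order_trans[OF degree_smult_le] degree_span_poly) auto
  show "N \<ge> 1 \<Longrightarrow> c 2 \<noteq> 0 \<Longrightarrow> 2 * N + 1 \<le> degree (span_comb N c)"
    using coeff_span_comb(1)[of N c] by (intro le_degree) simp
qed

text \<open>The syzygy of the three polynomials eliminates the two highest powers, whatever the coefficients.\<close>

lemma low_combination:
  assumes N: "N \<ge> 2" and ind: "\<And>a b. smult a (span_comb N c) + smult b (span_comb N c') = 0 \<Longrightarrow> a = 0 \<and> b = 0"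
    and c': "c' 2 \<noteq> 0"
  shows "\<exists>u v. u * span_comb N c + v * span_comb N c' \<noteq> 0 \<and> degree (u * span_comb N c + v * span_comb N c') \<le> N"
proof -
  \<comment> \<open>Eliminating \<open>X^(2N+1)\<close> leaves a combination of 1 and the middle
    polynomial. If the coefficient \<open>\<beta>\<close> of the latter is zero, \<open>A\<close> is
    already a nonzero constant.\<close>
  define A where "A = smult (c' 2) (span_comb N c) + smult (- c 2) (span_comb N c')"
  define \<alpha> where "\<alpha> = c' 2 * c 0 - c 2 * c' 0"
  define \<beta> where "\<beta> = c' 2 * c 1 - c 2 * c' 1"
  have A: "A = [:\<alpha>:] + smult \<beta> (span_poly N 1)"
    by (simp add: A_def span_comb_eq \<alpha>_def \<beta>_def smult_add_right smult_diff_left algebra_simps)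
  have A0: "A \<noteq> 0" using ind[of "c' 2" "- c 2"] c' by (auto simp: A_def)
  show ?thesis
  proof (cases "\<beta> = 0")
    case True
    then have "degree A \<le> N" "A \<noteq> 0" using A A0 by auto
    then show ?thesis
      by (intro exI[of _ "[:c' 2:]"] exI[of _ "[:- c 2:]"]) (simp add: A_def)
  next
    case False
    \<comment> \<open>As \<open>\<beta>\<close> times the middle polynomial is
      \<open>A - [:\<alpha>:]\<close>, the division in \<open>span_poly_2\<close> makes
      \<open>\<beta>^2\<close> times the second generator, modulo multiples of \<open>A\<close>, a
      combination of 1, \<open>alt_poly N\<close> and \<open>X^N\<close>. This gives the degree
      bound.\<close>
    define P where "P = smult (\<beta> * \<beta>) (span_comb N c') - (smult (c' 1 * \<beta>) A + smult (\<beta> * c' 2) (alt_poly N * A))"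
    have P: "P = [:\<beta> * (\<beta> * c' 0 - c' 1 * \<alpha>):] - smult (c' 2 * \<alpha> * \<beta>) (alt_poly N)
        - monom (c' 2 * \<beta> * \<beta> * (- 1) ^ N) N"
      unfolding P_def A span_comb_eq span_poly_2
      by (simp add: algebra_simps smult_add_right smult_diff_right smult_monom smult_diff_left smult_add_left)
    have deg: "degree P \<le> N"
      unfolding P by (intro degree_diff_le order_trans[OF degree_smult_le] degree_monom_le)
        (auto simp: degree_alt_poly)
    \<comment> \<open>The coefficient of \<open>X^(N-1)\<close> comes from \<open>alt_poly N\<close>
      alone, since \<open>N >= 2\<close> separates it from the constant term; if it vanishes, then
      \<open>\<alpha> = 0\<close>. In that case the coefficient of \<open>X^N\<close> is
      nonzero.\<close>
    have "P \<noteq> 0"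
    proof
      assume P0: "P = 0"
      obtain k where k: "N = Suc (Suc k)" using N by (metis Suc_le_D numeral_2_eq_2 Suc_le_mono)
      have "coeff P (Suc k) = c' 2 * \<alpha> * \<beta>"
        unfolding P k using subleading_alt_poly[of "Suc k"] by (simp del: alt_poly.simps)
      then have \<alpha>0: "\<alpha> = 0" using P0 c' False by simp
      have "coeff P N = - (c' 2 * \<beta> * \<beta> * (- 1) ^ N)"
        unfolding P \<alpha>0 using N by (simp add: coeff_pCons split: nat.split)
      then show False using P0 c' False by simp
    qed
    moreover have "P = (- smult (c' 2) ([:c' 1 * \<beta>:] + smult (\<beta> * c' 2) (alt_poly N))) * span_comb N c
        + ([:\<beta> * \<beta>:] + smult (c 2) ([:c' 1 * \<beta>:] + smult (\<beta> * c' 2) (alt_poly N))) * span_comb N c'"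
      unfolding P_def A_def by (simp add: algebra_simps smult_add_right smult_diff_right)
    ultimately show ?thesis using deg by metis
  qed
qed

text \<open>The gap \<open>N + 1\<close> between the degrees becomes \<open>2 N + 2\<close> on the
  curve, just above the bound \<open>2 N + 1\<close> of linear stability. If \<open>X^(2N+1)\<close>
  occurs in the pencil, degree \<open>2 N + 1\<close> stands against at most \<open>N\<close>;
  otherwise the pencil is spanned by 1 and the middle polynomial, of degrees 0 and
  \<open>N + 1\<close>.\<close>

lemma pencil_combination:
  assumes N: "N \<ge> 2" and ind: "\<And>a b. smult a (span_comb N c) + smult b (span_comb N c') = 0 \<Longrightarrow> a = 0 \<and> b = 0"
  obtains a b u v where "smult a (span_comb N c) + smult b (span_comb N c') \<noteq> 0"
    "u * span_comb N c + v * span_comb N c' \<noteq> 0"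
    "degree (u * span_comb N c + v * span_comb N c') + N + 1
      \<le> degree (smult a (span_comb N c) + smult b (span_comb N c'))"
proof -
  let ?Q = "span_comb N c" and ?Q' = "span_comb N c'"
  have nz: "smult a ?Q + smult b ?Q' \<noteq> 0" if "a \<noteq> 0 \<or> b \<noteq> 0" for a b using ind that by blast
  consider "c' 2 \<noteq> 0" | "c 2 \<noteq> 0" | "c 2 = 0" "c' 2 = 0" by blast
  then show ?thesis
  proof cases
    case 1
    then obtain u v where "u * ?Q + v * ?Q' \<noteq> 0" "degree (u * ?Q + v * ?Q') \<le> N"
      using low_combination[OF N ind] by blast
    then show ?thesis using that[of 0 1 u v] nz[of 0 1] degree_span_comb[of N c'] 1 N by simp
  next
    case 2
    have "a = 0 \<and> b = 0" if "smult a ?Q' + smult b ?Q = 0" for a b using ind[of b a] that by (simp add: add.commute)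
    from low_combination[of N c' c, OF N this 2] obtain v u where "v * ?Q' + u * ?Q \<noteq> 0" "degree (v * ?Q' + u * ?Q) \<le> N"
      by blast
    then show ?thesis using that[of 1 0 u v] nz[of 1 0] degree_span_comb[of N c] 2 N by (simp add: add.commute)
  next
    case 3
    \<comment> \<open>The determinant of Cramer's rule by which 1 and the middle polynomial are
      recovered from the two generators of the pencil.\<close>
    define \<Delta> where "\<Delta> = c 0 * c' 1 - c' 0 * c 1"
    have e1: "smult (c' 1) ?Q + smult (- c 1) ?Q' = [:\<Delta>:]"
      by (simp add: span_comb_eq 3 \<Delta>_def smult_add_right algebra_simps)
    have e2: "smult (- c' 0) ?Q + smult (c 0) ?Q' = smult \<Delta> (span_poly N 1)"
      by (simp add: span_comb_eq 3 \<Delta>_def smult_add_right algebra_simps smult_diff_left)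
    have \<Delta>: "\<Delta> \<noteq> 0"
    proof
      assume "\<Delta> = 0"
      then have "c' 1 = 0" "c 1 = 0" "c' 0 = 0" "c 0 = 0" using ind[of "c' 1" "- c 1"] ind[of "- c' 0" "c 0"] e1 e2 by auto
      then have "?Q = 0" by (simp add: span_comb_eq 3)
      then show False using ind[of 1 0] by simp
    qed
    have e3: "[:c' 1:] * ?Q + [:- c 1:] * ?Q' = [:\<Delta>:]" using e1 by simp
    have deg: "degree (span_poly N 1) = N + 1"
      unfolding span_poly_def using degree_add_eq_right[of "monom 1 N" "monom (1::complex) (N + 1)"]
      by (simp add: degree_monom_eq)
    then have "span_poly N 1 \<noteq> 0" by auto
    then show ?thesis
      using that[of "- c' 0" "c 0" "[:c' 1:]" "[:- c 1:]", unfolded e2 e3] \<Delta> deg by simp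
  qed
qed

section \<open>Frames and injections given by functions\<close>

text \<open>A version of \<open>frameI\<close> in which the frame is given by tuples of functions
  and regularity by orders, so that frames can be written down as explicit expressions in
  \<open>x\<close>.\<close>

lemma (in sheaf_model) frame_of_functions:
  assumes U: "zopen X U" and E: "\<And>p j. p \<in> U \<Longrightarrow> j < k \<Longrightarrow> C p (E j)"
    and span: "\<And>p m. p \<in> U \<Longrightarrow> C p m \<Longrightarrow>
      \<exists>a. (\<forall>j<k. ordge p (a j) 0) \<and> (\<forall>i<r. m i \<approx> (\<lambda>q. \<Sum>j<k. a j q * E j i q))"
    and indep: "indep k E"
  obtains e where "frame X F k U e" "\<forall>j<k. \<forall>i<r. \<forall>\<^sub>F q in gen U. \<psi> U (e j) i q = E j i q"
proof -
  have "\<exists>s. s \<in> carrier (Sec F U) \<and> (\<forall>i<r. \<forall>\<^sub>F q in gen U. \<psi> U s i q = E j i q)" if "j < k" for j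
    using coord_surj[OF U, of "E j"] E that by blast
  then obtain e where e: "\<And>j. j < k \<Longrightarrow> e j \<in> carrier (Sec F U) \<and> (\<forall>i<r. \<forall>\<^sub>F q in gen U. \<psi> U (e j) i q = E j i q)"
    by metis
  have eX: "\<psi> U (e j) i \<approx> E j i" if "U \<noteq> {}" "j < k" "i < r" for i j
    using e[OF that(2)] that gen_zopen[OF U that(1)] by simp
  have "frame X F k U e"
  proof (rule frameI[OF U])
    show "\<forall>j<k. e j \<in> carrier (Sec F U)" using e by blast
    fix p m assume p: "p \<in> U" and m: "C p m"
    then have ne: "U \<noteq> {}" by blast
    obtain a where a: "\<forall>j<k. ordge p (a j) 0" "\<forall>i<r. m i \<approx> (\<lambda>q. \<Sum>j<k. a j q * E j i q)" using span[OF p m] by blast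
    have "\<forall>j<k. \<exists>b. regat p b \<and> a j \<approx> b" using a(1) by (simp add: ordge_0_iff)
    then obtain b where b: "\<And>j. j < k \<Longrightarrow> regat p (b j)" "\<And>j. j < k \<Longrightarrow> a j \<approx> b j" by metis
    have "m i \<approx> (\<lambda>q. \<Sum>j<k. b j q * \<psi> U (e j) i q)" if i: "i < r" for i
    proof -
      have "\<forall>\<^sub>F q in gen X. \<forall>j\<in>{..<k}. a j q = b j q" using b by (intro eventually_ball_finite) auto
      moreover have "\<forall>\<^sub>F q in gen X. \<forall>j\<in>{..<k}. \<psi> U (e j) i q = E j i q"
        using eX[OF ne _ i] by (intro eventually_ball_finite) auto
      moreover have "m i \<approx> (\<lambda>q. \<Sum>j<k. a j q * E j i q)" using a(2) i by blast
      ultimately show ?thesis by eventually_elim simp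
    qed
    then show "\<exists>a. (\<forall>j<k. regat p (a j)) \<and> (\<forall>i<r. m i \<approx> (\<lambda>q. \<Sum>j<k. a j q * \<psi> U (e j) i q))" using b by blast
  next
    assume ne: "U \<noteq> {}"
    show "indep k (\<lambda>j. \<psi> U (e j))"
      unfolding indep_def
    proof (rule allI, rule impI, elim conjE)
      fix a assume a: "\<forall>j<k. rat (a j)" and z: "\<forall>i<r. (\<lambda>q. \<Sum>j<k. a j q * \<psi> U (e j) i q) \<approx> (\<lambda>q. 0)"
      have "(\<lambda>q. \<Sum>j<k. a j q * E j i q) \<approx> (\<lambda>q. 0)" if i: "i < r" for i
      proof -
        have "\<forall>\<^sub>F q in gen X. \<forall>j\<in>{..<k}. \<psi> U (e j) i q = E j i q"
          using eX[OF ne _ i] by (intro eventually_ball_finite) auto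
        moreover have "(\<lambda>q. \<Sum>j<k. a j q * \<psi> U (e j) i q) \<approx> (\<lambda>q. 0)" using z i by blast
        ultimately show ?thesis by eventually_elim simp
      qed
      then show "\<forall>j<k. a j \<approx> (\<lambda>q. 0)" using indep[unfolded indep_def, rule_format, of a] a by blast
    qed
  qed
  then show ?thesis using that e by blast
qed

text \<open>The coordinate of a section is multiplied by a fixed tuple of functions. One entry of
  the tuple is generically nonzero and can be cancelled, whence injectivity.\<close>

lemma (in line_model) multiplication_injection:
  fixes G :: "('n, 'k) sheaf"
  assumes "sheaf_model X G r C \<kappa>"
    and C: "\<And>p f. p \<in> X \<Longrightarrow> ordge p f (- D p) \<Longrightarrow> C p (\<lambda>i q. f q * c i q)"
    and nz: "i0 < r" "nz (c i0)"
  shows "\<exists>\<phi>. sheaf_injection X F G \<phi>"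
proof -
  interpret G: sheaf_model X G r C \<kappa> by (rule assms(1))
  define \<phi> where "\<phi> U s = (SOME h. h \<in> carrier (Sec G U) \<and>
    (\<forall>i<r. \<forall>\<^sub>F q in gen U. \<kappa> U h i q = \<psi> U s 0 q * c i q))" for U s
  have \<phi>: "\<phi> U s \<in> carrier (Sec G U)" "\<forall>i<r. \<forall>\<^sub>F q in gen U. \<kappa> U (\<phi> U s) i q = \<psi> U s 0 q * c i q"
    if U: "zopen X U" and s: "s \<in> carrier (Sec F U)" for U s
  proof -
    have "C p (\<lambda>i q. \<psi> U s 0 q * c i q)" if "p \<in> U" for p
      using that zopen_subset[OF U] by (intro C line_coord_germ[OF U s]) auto
    from G.coord_surj[OF U this]
    have "\<exists>h. h \<in> carrier (Sec G U) \<and> (\<forall>i<r. \<forall>\<^sub>F q in gen U. \<kappa> U h i q = \<psi> U s 0 q * c i q)" by blast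
    from someI_ex[OF this]
    show "\<phi> U s \<in> carrier (Sec G U)" "\<forall>i<r. \<forall>\<^sub>F q in gen U. \<kappa> U (\<phi> U s) i q = \<psi> U s 0 q * c i q"
      unfolding \<phi>_def by blast+
  qed
  have "sheaf_injection X F G \<phi>"
    unfolding sheaf_injection_def sheaf_morphism_def
  proof (intro conjI allI impI ballI)
    fix U assume U: "zopen X U"
    show "\<phi> U \<in> carrier (Sec F U) \<rightarrow> carrier (Sec G U)" using \<phi>(1)[OF U] by blast
    show "inj_on (\<phi> U) (carrier (Sec F U))"
    proof (rule inj_onI)
      fix s t assume s: "s \<in> carrier (Sec F U)" and t: "t \<in> carrier (Sec F U)" and eq: "\<phi> U s = \<phi> U t"
      have "\<forall>\<^sub>F q in gen U. c i0 q \<noteq> 0" using eventually_gen_subset[OF nz_nonzero[OF nz(2)] zopen_subset[OF U]] .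
      moreover have "\<forall>\<^sub>F q in gen U. \<kappa> U (\<phi> U s) i0 q = \<psi> U s 0 q * c i0 q" using \<phi>(2)[OF U s] nz(1) by blast
      moreover have "\<forall>\<^sub>F q in gen U. \<kappa> U (\<phi> U t) i0 q = \<psi> U t 0 q * c i0 q" using \<phi>(2)[OF U t] nz(1) by blast
      ultimately have "\<forall>\<^sub>F q in gen U. \<psi> U s 0 q = \<psi> U t 0 q" by eventually_elim (simp add: eq)
      then show "s = t" by (intro coord_inj[OF U s t]) simp
    qed
    fix s assume s: "s \<in> carrier (Sec F U)"
    show "\<phi> U (s \<oplus>\<^bsub>Sec F U\<^esub> t) = \<phi> U s \<oplus>\<^bsub>Sec G U\<^esub> \<phi> U t" if t: "t \<in> carrier (Sec F U)" for t
    proof (rule G.coord_inj[OF U])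
      fix i assume i: "i < r"
      show "\<forall>\<^sub>F q in gen U. \<kappa> U (\<phi> U (s \<oplus>\<^bsub>Sec F U\<^esub> t)) i q = \<kappa> U (\<phi> U s \<oplus>\<^bsub>Sec G U\<^esub> \<phi> U t) i q"
        using \<phi>(2)[OF U add_closed[OF U s t], rule_format, OF i] \<phi>(2)[OF U s, rule_format, OF i]
          \<phi>(2)[OF U t, rule_format, OF i] G.coord_add[OF U \<phi>(1)[OF U s] \<phi>(1)[OF U t] i]
          coord_add[OF U s t zero_less_one]
        by eventually_elim (simp add: algebra_simps)
    qed (use \<phi>(1) add_closed G.add_closed U s t in auto)
    show "\<phi> U (a \<odot>\<^bsub>Sec F U\<^esub> s) = a \<odot>\<^bsub>Sec G U\<^esub> \<phi> U s" if a: "a \<in> regular X U" for a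
    proof (rule G.coord_inj[OF U])
      fix i assume i: "i < r"
      show "\<forall>\<^sub>F q in gen U. \<kappa> U (\<phi> U (a \<odot>\<^bsub>Sec F U\<^esub> s)) i q = \<kappa> U (a \<odot>\<^bsub>Sec G U\<^esub> \<phi> U s) i q"
        using \<phi>(2)[OF U smult_closed[OF U a s], rule_format, OF i] \<phi>(2)[OF U s, rule_format, OF i]
          G.coord_smult[OF U a \<phi>(1)[OF U s] i] coord_smult[OF U a s zero_less_one]
        by eventually_elim simp
    qed (use \<phi>(1) smult_closed G.smult_closed U s a in auto)
  next
    fix U V s assume "zopen X U \<and> zopen X V \<and> V \<subseteq> U" and s: "s \<in> carrier (Sec F U)"
    then have U: "zopen X U" and V: "zopen X V" "V \<subseteq> U" by auto
    show "\<phi> V (Res F U V s) = Res G U V (\<phi> U s)"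
    proof (rule G.coord_inj[OF V(1)])
      fix i assume i: "i < r"
      show "\<forall>\<^sub>F q in gen V. \<kappa> V (\<phi> V (Res F U V s)) i q = \<kappa> V (Res G U V (\<phi> U s)) i q"
        using \<phi>(2)[OF V(1) res_closed[OF U V s], rule_format, OF i]
          eventually_gen_subset[OF \<phi>(2)[OF U s, rule_format, OF i] V(2)]
          G.coord_res[OF U V \<phi>(1)[OF U s] i] coord_res[OF U V s zero_less_one]
        by eventually_elim simp
    qed (use \<phi>(1) res_closed G.res_closed U V s in auto)
  qed
  then show ?thesis by blast
qed

lemma (in section_space) generated_germI:
  assumes k: "k < m" and g: "ordge p (\<lambda>q. g q * inverse (\<beta> k q)) 0"
  shows "generated_germ p g"
proof -
  obtain u where u: "regat p u" "(\<lambda>q. g q * inverse (\<beta> k q)) \<approx> u" using g unfolding ordge_0_iff by blast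
  define a where "a l = (if l = k then u else (\<lambda>q. 0))" for l
  have p: "p \<in> X" by (rule regat_in_X[OF u(1)])
  have s: "(\<Sum>l<m. a l q * \<beta> l q) = u q * \<beta> k q" for q
  proof -
    have "(\<Sum>l<m. a l q * \<beta> l q) = (\<Sum>l<m. if l = k then u q * \<beta> k q else 0)" by (rule sum.cong) (auto simp: a_def)
    then show ?thesis using k by simp
  qed
  have "g \<approx> (\<lambda>q. \<Sum>l<m. a l q * \<beta> l q)"
    unfolding s using u(2) nz_nonzero[OF \<beta>_nz[OF k]] by eventually_elim (auto simp: field_simps)
  moreover have "\<forall>l<m. regat p (a l)" using u(1) regat_const[OF p] by (auto simp: a_def)
  ultimately show ?thesis unfolding generated_germ_def by blast
qed

section \<open>The coherent system\<close>

locale pencil_system =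
  degree_two_pencil X D x + section_space X L "\<lambda>p. (2 * int N + 1) * D p" \<psi> V b 3
  for X :: "('n::finite) pt set" and D x and N :: nat and L :: "('n, 'm) sheaf" and \<psi> V b +
  assumes N: "2 \<le> N" and \<beta>_ev: "i < 3 \<Longrightarrow> \<beta> i \<approx> ev (span_poly N i)"
begin

sublocale proper_line_model X L "\<lambda>p. (2 * int N + 1) * D p" \<psi> ..

lemma coherent_system: "coherent_system X L V 1 (4 * int N + 2) 3"
  unfolding coherent_system_def
  using vector_bundle_1 section_dim bundle_degree_line deg_cmult[of "2 * int N + 1" D] D_deg by simp

lemma \<beta>_eqs: "\<beta> 0 \<approx> (\<lambda>q. 1)" "\<beta> 1 \<approx> (\<lambda>q. x q ^ N + x q ^ (N + 1))" "\<beta> 2 \<approx> (\<lambda>q. x q ^ (2 * N + 1))"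
  using \<beta>_ev[of 0] \<beta>_ev[of 1] \<beta>_ev[of 2] by (simp_all add: ev_def span_poly_def poly_monom)

lemma \<beta>_2_pole: "p \<in> X \<Longrightarrow> D p > 0 \<Longrightarrow> hasord p (\<beta> 2) (- ((2 * int N + 1) * D p))"
proof -
  assume p: "p \<in> X" "D p > 0"
  have "hasord p (ev (span_poly N 2)) (- (D p * int (degree (span_poly N 2))))"
    by (rule ev_pole[OF p]) (simp add: span_poly_def)
  then have "hasord p (ev (span_poly N 2)) (- ((2 * int N + 1) * D p))"
    by (simp add: span_poly_def degree_monom_eq algebra_simps)
  then show ?thesis by (rule hasord_cong) (use \<beta>_ev[of 2] in \<open>auto elim: eventually_mono\<close>)
qed

text \<open>At the points outside the support of \<open>D\<close> the section 1 generates; at the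
  poles of \<open>x\<close> it is the section \<open>x^(2N+1)\<close>, which attains the full pole
  order \<open>(2 N + 1) D p\<close>.\<close>

lemma generated: "generated X L V"
proof (rule generatedI)
  fix p g assume p: "p \<in> X" and g: "ordge p g (- ((2 * int N + 1) * D p))"
  show "generated_germ p g"
  proof (cases "D p = 0")
    case True
    then have "ordge p (\<lambda>q. g q * inverse (\<beta> 0 q)) 0"
      using g \<beta>_eqs(1) by (auto elim!: ordge_cong eventually_mono)
    then show ?thesis by (intro generated_germI[of 0]) auto
  next
    case False
    then have "D p > 0" using D_nonneg[OF p] by simp
    from ordge_mult[OF g hasord_ordge[OF hasord_inverse[OF \<beta>_2_pole[OF p this]]]]
    show ?thesis by (intro generated_germI[of 2]) auto
  qed
qed

lemma span_comb_ev: "ev (span_comb N c) \<approx> (\<lambda>q. \<Sum>l<3. c l * \<beta> l q)"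
proof -
  have "\<forall>\<^sub>F q in gen X. \<forall>l\<in>{..<3}. \<beta> l q = ev (span_poly N l) q"
    using \<beta>_ev by (intro eventually_ball_finite) auto
  then show ?thesis by eventually_elim (simp add: ev_def span_comb_def poly_sum)
qed

text \<open>The image of \<open>W\<close> tensor O is O(E), where \<open>- E p\<close> is the least
  order of the two generators at \<open>p\<close>. At the poles of \<open>x\<close> every member of
  the pencil bounds \<open>E\<close> from below by its degree; elsewhere every combination with
  polynomial coefficients bounds it by minus its order. The gap of \<open>pencil_combination\<close>
  then enters through \<open>degree_bound\<close>.\<close>

lemma two_dim_degree:
  assumes W: "section_space X L (\<lambda>p. (2 * int N + 1) * D p) \<psi> W b' 2" "W \<subseteq> V"
  shows "2 * int N + 2 \<le> bundle_degree X (evaluation_image X L W)"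
proof -
  interpret W: section_space X L "\<lambda>p. (2 * int N + 1) * D p" \<psi> W b' 2 by (rule W(1))
  have "\<exists>c. W.\<beta> i \<approx> (\<lambda>q. \<Sum>l<3. c l * \<beta> l q)" if "i < 2" for i
    using W.basis[OF that] W(2) V_iff unfolding W.\<beta>_def cspan_def by blast
  from this[of 0] this[of 1] obtain c c' where c: "W.\<beta> 0 \<approx> (\<lambda>q. \<Sum>l<3. c l * \<beta> l q)"
    "W.\<beta> 1 \<approx> (\<lambda>q. \<Sum>l<3. c' l * \<beta> l q)" by auto
  define Q where "Q = span_comb N c"
  define Q' where "Q' = span_comb N c'"
  have Q: "W.\<beta> 0 \<approx> ev Q" "W.\<beta> 1 \<approx> ev Q'"
    unfolding Q_def Q'_def using c span_comb_ev[of c] span_comb_ev[of c'] by (eventually_elim, simp)+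
  have "a0 = 0 \<and> a1 = 0" if z: "smult a0 Q + smult a1 Q' = 0" for a0 a1
  proof -
    have z': "a0 * poly Q t + a1 * poly Q' t = 0" for t using arg_cong[OF z, of "\<lambda>P. poly P t"] by simp
    have "(\<lambda>q. \<Sum>i<2. (if i = 0 then a0 else a1) * W.\<beta> i q) \<approx> (\<lambda>q. 0)"
      using Q by eventually_elim (simp add: numeral_2_eq_2 lessThan_Suc ev_def z' add.commute)
    from W.\<beta>_indep[OF this, of 0] W.\<beta>_indep[OF this, of 1] show ?thesis by simp
  qed
  from pencil_combination[OF N, of c c', folded Q_def Q'_def, OF this] obtain a0 a1 u v where
    comb: "smult a0 Q + smult a1 Q' \<noteq> 0" "u * Q + v * Q' \<noteq> 0"
    and degs: "degree (u * Q + v * Q') + N + 1 \<le> degree (smult a0 Q + smult a1 Q')" by blast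
  define E where "E p = - min (ord p (W.\<beta> 0)) (ord p (W.\<beta> 1))" for p
  have nz: "nz (W.\<beta> 0)" "nz (W.\<beta> 1)" using W.\<beta>_nz by auto
  have E: "finsupp E"
    unfolding finsupp_def
  proof (rule finite_subset)
    show "{p \<in> X. E p \<noteq> 0} \<subseteq> {p \<in> X. ord p (W.\<beta> 0) \<noteq> 0} \<union> {p \<in> X. ord p (W.\<beta> 1) \<noteq> 0}"
      by (auto simp: E_def min_def split: if_splits)
  qed (use finite_support nz in auto)
  have \<beta>E: "ordge p (W.\<beta> 0) (- E p)" "ordge p (W.\<beta> 1) (- E p)" if "p \<in> X" for p
    using ordge_iff[OF _ that] nz by (auto simp: E_def)
  have gen: "W.generated_germ p g \<longleftrightarrow> ordge p g (- E p)" if p: "p \<in> X" for p g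
  proof
    assume "W.generated_germ p g"
    then obtain a where a: "\<forall>l<2. regat p (a l)" "g \<approx> (\<lambda>q. \<Sum>l<2. a l q * W.\<beta> l q)"
      unfolding W.generated_germ_def by blast
    have "ordge p (\<lambda>q. a 0 q * W.\<beta> 0 q + a 1 q * W.\<beta> 1 q) (- E p)"
      using ordge_add[OF ordge_mult[OF regat_ordge \<beta>E(1)[OF p]] ordge_mult[OF regat_ordge \<beta>E(2)[OF p]]] a(1) by simp
    then show "ordge p g (- E p)"
      by (rule ordge_cong) (use a(2) in \<open>eventually_elim, simp add: numeral_2_eq_2 lessThan_Suc add.commute\<close>)
  next
    assume g: "ordge p g (- E p)"
    have "\<exists>k<2. ord p (W.\<beta> k) = - E p" by (auto simp: E_def min_def intro: exI[of _ "0::nat"] exI[of _ "1::nat"])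
    then obtain k where k: "k < 2" "ord p (W.\<beta> k) = - E p" by blast
    have "hasord p (W.\<beta> k) (- E p)" using hasord_ord[OF W.\<beta>_nz[OF k(1)] p] k(2) by simp
    from ordge_mult[OF g hasord_ordge[OF hasord_inverse[OF this]]]
    show "W.generated_germ p g" by (intro W.generated_germI[OF k(1)]) simp
  qed
  interpret I: line_model X "evaluation_image X L W" E \<psi> by (rule W.evaluation_image_line_model[OF E gen])
  interpret I: proper_line_model X "evaluation_image X L W" E \<psi> ..
  have "2 * int (degree (smult a0 Q + smult a1 Q')) - 2 * int (degree (u * Q + v * Q')) \<le> deg E"
  proof (rule degree_bound[OF E comb(2)])
    fix p assume p: "p \<in> X"
    {
      assume Dp: "D p > 0"
      have "ordge p (\<lambda>q. a0 * W.\<beta> 0 q + a1 * W.\<beta> 1 q) (- E p)"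
        by (intro ordge_add ordge_cmult \<beta>E p)
      moreover have "(\<lambda>q. a0 * W.\<beta> 0 q + a1 * W.\<beta> 1 q) \<approx> ev (smult a0 Q + smult a1 Q')"
        using Q by eventually_elim (simp add: ev_def)
      ultimately have "ordge p (ev (smult a0 Q + smult a1 Q')) (- E p)" by (rule ordge_cong)
      then show "int (degree (smult a0 Q + smult a1 Q')) * D p \<le> E p"
        using hasord_ordge_iff[OF ev_pole[OF p Dp comb(1)]] by (simp add: mult.commute)
    next
      assume Dp: "D p = 0"
      have "ordge p (\<lambda>q. ev u q * W.\<beta> 0 q + ev v q * W.\<beta> 1 q) (0 + - E p)"
        by (intro ordge_add ordge_mult ev_regular \<beta>E p Dp)
      moreover have "(\<lambda>q. ev u q * W.\<beta> 0 q + ev v q * W.\<beta> 1 q) \<approx> ev (u * Q + v * Q')"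
        using Q by eventually_elim (simp add: ev_def)
      ultimately have "ordge p (ev (u * Q + v * Q')) (0 + - E p)" by (rule ordge_cong)
      then show "- ord p (ev (u * Q + v * Q')) \<le> E p"
        using ordge_iff[OF ev_nz[OF comb(2)] p] by simp
    }
  qed
  then show ?thesis using degs I.bundle_degree_line by linarith
qed

lemma linearly_stable: "linearly_stable X L V"
  unfolding linearly_stable_def
proof (intro allI impI, elim conjE)
  fix m' W w assume V': "section_dim X L V m'" and W: "section_dim X L W w" "W \<subset> V" "2 \<le> w"
  obtain b1 where b1: "section_space X L (\<lambda>p. (2 * int N + 1) * D p) \<psi> V b1 m'" using section_space_of_dim[OF V'] .
  interpret V': section_space X L "\<lambda>p. (2 * int N + 1) * D p" \<psi> V b1 m' by (rule b1)
  have m': "m' = 3"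
    using subspace_dim_le(1)[OF b1 subset_refl] V'.subspace_dim_le(1)[OF section_space_axioms subset_refl] by simp
  obtain b2 where b2: "section_space X L (\<lambda>p. (2 * int N + 1) * D p) \<psi> W b2 w" using section_space_of_dim[OF W(1)] .
  have "w \<le> 3" "w \<noteq> 3" using subspace_dim_le[OF b2] W(2) by auto
  then have w: "w = 2" using W(3) by simp
  \<comment> \<open>With \<open>w - 1 = 1\<close> and \<open>m' - 1 = 2\<close> the degree of the
    image must exceed \<open>2 N + 1\<close>, and it is at least \<open>2 N + 2\<close>.\<close>
  have "bundle_degree X L = 4 * int N + 2" using coherent_system by (simp add: coherent_system_def)
  then show "real_of_int (bundle_degree X (evaluation_image X L W)) / (real w - 1)
      > real_of_int (bundle_degree X L) / (real m' - 1)"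
    using two_dim_degree[OF b2[unfolded w]] W(2) unfolding m' w by auto
qed

section \<open>The dual span bundle\<close>

sublocale M: proper_sheaf_model X "dual_span X L V" 3 syzygy_germ trivial_coord
  by (intro proper_sheaf_model.intro dual_span_model proper_curve_axioms)

lemma syzygy_iff: "syzygy_germ p g \<longleftrightarrow> ordge p (g 0) 0 \<and> ordge p (g 1) 0 \<and> ordge p (g 2) 0 \<and>
  (\<lambda>q. g 0 q + g 1 q * (x q ^ N + x q ^ (N + 1)) + g 2 q * x q ^ (2 * N + 1)) \<approx> (\<lambda>q. 0)"
proof -
  have "(\<lambda>q. \<Sum>l<3. g l q * \<beta> l q) \<approx> (\<lambda>q. g 0 q + g 1 q * (x q ^ N + x q ^ (N + 1)) + g 2 q * x q ^ (2 * N + 1))"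
    using \<beta>_eqs
    by eventually_elim (simp add: numeral_3_eq_3 lessThan_Suc numeral_2_eq_2 algebra_simps)
  then have eq: "(\<lambda>q. \<Sum>l<3. g l q * \<beta> l q) \<approx> (\<lambda>q. 0) \<longleftrightarrow>
      (\<lambda>q. g 0 q + g 1 q * (x q ^ N + x q ^ (N + 1)) + g 2 q * x q ^ (2 * N + 1)) \<approx> (\<lambda>q. 0)"
    by (rule eventually_subst[OF eventually_mono]) simp
  have all3: "(\<forall>i<3. P i) \<longleftrightarrow> P 0 \<and> P 1 \<and> P 2" for P :: "nat \<Rightarrow> bool"
    by (auto simp: numeral_3_eq_3 less_Suc_eq numeral_2_eq_2)
  show ?thesis unfolding syzygy_germ_def all3 by (simp only: eq conj_assoc)
qed

text \<open>A syzygy is solved for the coefficient of a section that generates. Where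
  \<open>x\<close> is regular this section is 1, so that entries 1 and 2 are free and determine
  entry 0.\<close>

definition affine_frame :: "nat \<Rightarrow> nat \<Rightarrow> 'n pt \<Rightarrow> complex" where
  "affine_frame j i q = (if i = 0 then - (if j = 0 then x q ^ N + x q ^ (N + 1) else x q ^ (2 * N + 1))
     else if i = Suc j then 1 else 0)"

text \<open>Where \<open>1 / x\<close> is regular the section \<open>x^(2N+1)\<close> generates
  instead: entries 0 and 1 are free, and entry 2 follows from the quotients of the other two
  sections by \<open>x^(2N+1)\<close>.\<close>

definition pole_frame :: "nat \<Rightarrow> nat \<Rightarrow> 'n pt \<Rightarrow> complex" where
  "pole_frame j i q = (if i = 2 then - (if j = 0 then inverse (x q) ^ (2 * N + 1)
     else inverse (x q) ^ N + inverse (x q) ^ (N + 1)) else if i = j then 1 else 0)"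

lemma x_nz: "nz x"
  using ev_nz[of "[:0, 1:]"] by (simp add: ev_def)

lemma ordge_power0: "ordge p f 0 \<Longrightarrow> ordge p (\<lambda>q. f q ^ k) 0"
proof (induction k)
  case (Suc k)
  then show ?case using ordge_mult[of p f 0 "\<lambda>q. f q ^ k" 0] by simp
qed (simp add: ordge_const ordge_in_X)

lemma indep_affine: "M.indep 2 affine_frame"
  unfolding M.indep_def
proof (intro allI impI, elim conjE)
  fix a j assume z: "\<forall>i<3. (\<lambda>q. \<Sum>j<2. a j q * affine_frame j i q) \<approx> (\<lambda>q. 0)" and "j < (2::nat)"
  then have "(\<lambda>q. \<Sum>j'<2. a j' q * affine_frame j' (Suc j) q) \<approx> (\<lambda>q. 0)" by simp
  then show "a j \<approx> (\<lambda>q. 0)"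
    using \<open>j < 2\<close> by (auto simp: numeral_2_eq_2 lessThan_Suc less_Suc_eq affine_frame_def)
qed

lemma indep_pole: "M.indep 2 pole_frame"
  unfolding M.indep_def
proof (intro allI impI, elim conjE)
  fix a j assume z: "\<forall>i<3. (\<lambda>q. \<Sum>j<2. a j q * pole_frame j i q) \<approx> (\<lambda>q. 0)" and "j < (2::nat)"
  then have "(\<lambda>q. \<Sum>j'<2. a j' q * pole_frame j' j q) \<approx> (\<lambda>q. 0)" by simp
  then show "a j \<approx> (\<lambda>q. 0)"
    using \<open>j < 2\<close> by (auto simp: numeral_2_eq_2 lessThan_Suc less_Suc_eq pole_frame_def)
qed

definition affine_part :: "'n pt set" where
  "affine_part = {p \<in> X. D p = 0}"

definition pole_part :: "'n pt set" where
  "pole_part = {p \<in> X. ordge p (\<lambda>q. inverse (x q)) 0}"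

lemma zopen_parts: "zopen X affine_part" "zopen X pole_part"
proof -
  have "affine_part = X - {p \<in> X. D p \<noteq> 0}" by (auto simp: affine_part_def)
  then show "zopen X affine_part" using zopen_diff_finite[OF zopen_X] D_fin by (simp add: finsupp_def)
  have "rat (\<lambda>q. inverse (x q))" using nz_inverse[OF x_nz] by (simp add: nz_iff)
  from rat_ordge_cofinite[OF this] have "finite {p \<in> X. \<not> ordge p (\<lambda>q. inverse (x q)) 0}" by (simp add: eventually_gen)
  moreover have "pole_part = X - {p \<in> X. \<not> ordge p (\<lambda>q. inverse (x q)) 0}" by (auto simp: pole_part_def)
  ultimately show "zopen X pole_part" using zopen_diff_finite[OF zopen_X] by simp
qed

lemma pole_in_pole_part: "p \<in> X \<Longrightarrow> D p > 0 \<Longrightarrow> p \<in> pole_part"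
  using ordge_mono[OF hasord_ordge[OF hasord_inverse[OF x_pole]], of p 0] by (simp add: pole_part_def)

lemma affine_bundle_frame:
  obtains e where "frame X (dual_span X L V) 2 affine_part e"
    "\<forall>j<2. \<forall>i<3. \<forall>\<^sub>F q in gen affine_part. trivial_coord affine_part (e j) i q = affine_frame j i q"
proof (rule M.frame_of_functions[OF zopen_parts(1) _ _ indep_affine])
  fix p assume "p \<in> affine_part"
  then have p: "p \<in> X" "D p = 0" by (auto simp: affine_part_def)
  note x0 = ordge_power0[OF x_regular[OF p]]
  show "syzygy_germ p (affine_frame j)" if "j < 2" for j
  proof -
    have "ordge p (\<lambda>q. - 1 * (x q ^ N + x q ^ (N + 1))) 0" "ordge p (\<lambda>q. - 1 * x q ^ (2 * N + 1)) 0"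
      by (intro ordge_cmult ordge_add x0)+
    then have "ordge p (affine_frame j i) 0" if "i < 3" for i
      using that \<open>j < 2\<close> ordge_const[OF p(1)] unfolding affine_frame_def[abs_def]
      by (auto simp: less_2_cases_iff numeral_3_eq_3 less_Suc_eq)
    then show ?thesis
      using \<open>j < 2\<close> unfolding syzygy_iff by (auto simp: affine_frame_def less_2_cases_iff)
  qed
  fix g assume "syzygy_germ p g"
  then have g: "ordge p (g 1) 0" "ordge p (g 2) 0"
    "(\<lambda>q. g 0 q + g 1 q * (x q ^ N + x q ^ (N + 1)) + g 2 q * x q ^ (2 * N + 1)) \<approx> (\<lambda>q. 0)"
    by (simp_all add: syzygy_iff)
  have "g i \<approx> (\<lambda>q. \<Sum>j<2. g (Suc j) q * affine_frame j i q)" if "i < 3" for i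
    using g(3)
  proof eventually_elim
    case (elim q)
    have "g 0 q = - (g 1 q * (x q ^ N + x q ^ (N + 1)) + g 2 q * x q ^ (2 * N + 1))"
      using elim by (simp add: add_eq_0_iff2 add.assoc)
    then show ?case using that
      by (auto simp: numeral_2_eq_2 numeral_3_eq_3 lessThan_Suc less_Suc_eq affine_frame_def algebra_simps)
  qed
  moreover have "\<forall>j<2. ordge p (g (Suc j)) 0" using g(1,2) by (simp add: numeral_2_eq_2 less_Suc_eq)
  ultimately show "\<exists>a. (\<forall>j<2. ordge p (a j) 0) \<and> (\<forall>i<3. g i \<approx> (\<lambda>q. \<Sum>j<2. a j q * affine_frame j i q))"
    by (intro exI[of _ "\<lambda>j. g (Suc j)"]) blast
qed

lemma pole_bundle_frame:
  obtains e where "frame X (dual_span X L V) 2 pole_part e"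
    "\<forall>j<2. \<forall>i<3. \<forall>\<^sub>F q in gen pole_part. trivial_coord pole_part (e j) i q = pole_frame j i q"
proof (rule M.frame_of_functions[OF zopen_parts(2) _ _ indep_pole])
  fix p assume "p \<in> pole_part"
  then have p: "p \<in> X" "ordge p (\<lambda>q. inverse (x q)) 0" by (auto simp: pole_part_def)
  note y0 = ordge_power0[OF p(2)]
  show "syzygy_germ p (pole_frame j)" if "j < 2" for j
  proof -
    have "ordge p (\<lambda>q. - 1 * (inverse (x q) ^ N + inverse (x q) ^ (N + 1))) 0"
      "ordge p (\<lambda>q. - 1 * inverse (x q) ^ (2 * N + 1)) 0"
      by (intro ordge_cmult ordge_add y0)+
    then have o: "ordge p (pole_frame j i) 0" if "i < 3" for i
      using that \<open>j < 2\<close> ordge_const[OF p(1)] unfolding pole_frame_def[abs_def]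
      by (auto simp: less_2_cases_iff numeral_3_eq_3 less_Suc_eq)
    have "(\<lambda>q. pole_frame j 0 q + pole_frame j 1 q * (x q ^ N + x q ^ (N + 1)) + pole_frame j 2 q * x q ^ (2 * N + 1))
        \<approx> (\<lambda>q. 0)"
      using nz_nonzero[OF x_nz]
    proof eventually_elim
      case (elim q)
      have "inverse (x q) ^ k * x q ^ (2 * N + 1) = x q ^ (2 * N + 1 - k)" if "k \<le> 2 * N + 1" for k
        using elim that by (simp add: power_inverse power_diff field_simps del: power_Suc)
      from this[of "2 * N + 1"] this[of N] this[of "N + 1"]
      have e: "inverse (x q) ^ (2 * N + 1) * x q ^ (2 * N + 1) = 1" "inverse (x q) ^ N * x q ^ (2 * N + 1) = x q ^ (N + 1)"
        "inverse (x q) ^ (N + 1) * x q ^ (2 * N + 1) = x q ^ N" by (simp_all add: mult_2 del: power_Suc)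
      show ?case
        using \<open>j < 2\<close> e unfolding pole_frame_def less_2_cases_iff
        by (auto simp: distrib_right simp del: power_Suc power_Suc2 power_add)
    qed
    then show ?thesis unfolding syzygy_iff using o[of 0] o[of 1] o[of 2] by simp
  qed
  fix g assume "syzygy_germ p g"
  then have g: "ordge p (g 0) 0" "ordge p (g 1) 0"
    "(\<lambda>q. g 0 q + g 1 q * (x q ^ N + x q ^ (N + 1)) + g 2 q * x q ^ (2 * N + 1)) \<approx> (\<lambda>q. 0)"
    by (simp_all add: syzygy_iff)
  have "g i \<approx> (\<lambda>q. \<Sum>j<2. g j q * pole_frame j i q)" if "i < 3" for i
    using g(3) nz_nonzero[OF x_nz]
  proof eventually_elim
    case (elim q)
    define t where "t = x q ^ N"
    have t: "t \<noteq> 0" "x q \<noteq> 0" using elim by (auto simp: t_def)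
    have pw: "x q ^ (N + 1) = x q * t" "x q ^ (2 * N + 1) = x q * t * t"
      by (simp_all add: t_def mult_2 power_add)
    have "g 0 q + g 1 q * (t + x q * t) = - (g 2 q * (x q * t * t))"
      using elim(1) unfolding pw t_def[symmetric] by (simp add: eq_neg_iff_add_eq_0)
    then have "g 2 q = - ((g 0 q + g 1 q * (t + x q * t)) / (x q * t * t))" using t by (simp add: field_simps)
    also have "\<dots> = - (g 0 q * inverse (x q) ^ (2 * N + 1) + g 1 q * (inverse (x q) ^ N + inverse (x q) ^ (N + 1)))"
      unfolding power_inverse pw t_def[symmetric] using t by (simp add: field_simps)
    finally show ?case using that
      by (auto simp: numeral_2_eq_2 numeral_3_eq_3 lessThan_Suc less_Suc_eq pole_frame_def algebra_simps)
  qed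
  then show "\<exists>a. (\<forall>j<2. ordge p (a j) 0) \<and> (\<forall>i<3. g i \<approx> (\<lambda>q. \<Sum>j<2. a j q * pole_frame j i q))"
    using g by (intro exI[of _ g]) (auto simp: less_2_cases_iff)
qed

lemma dual_span_bundle: "vector_bundle X (dual_span X L V) 2"
  unfolding vector_bundle_def
proof (intro conjI ballI)
  show "module_sheaf X (dual_span X L V)" by (rule M.module_sheaf)
  fix p assume p: "p \<in> X"
  show "\<exists>U e. p \<in> U \<and> frame X (dual_span X L V) 2 U e"
  proof (cases "D p = 0")
    case True
    then have "p \<in> affine_part" using p by (simp add: affine_part_def)
    then show ?thesis using affine_bundle_frame by metis
  next
    case False
    then have "p \<in> pole_part" using pole_in_pole_part[OF p] D_nonneg[OF p] by simp
    then show ?thesis using pole_bundle_frame by metis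
  qed
qed

lemma affine_part_nonempty: "affine_part \<noteq> {}"
proof
  assume "affine_part = {}"
  then have "{p \<in> X. D p \<noteq> 0} = X" by (auto simp: affine_part_def)
  then show False using D_fin infinite_X by (simp add: finsupp_def)
qed

text \<open>Near a pole of \<open>x\<close> the frame of the affine part is expressed through the
  frame of the pole part by a matrix of determinant \<open>x^(2N+1)\<close>, of order
  \<open>- (2 N + 1) D p\<close>; elsewhere it is itself a local frame. So its wedge product has
  divisor \<open>- (2 N + 1) D\<close>.\<close>

lemma dual_span_degree: "bundle_degree X (dual_span X L V) = - (4 * int N + 2)"
proof -
  obtain e where e: "frame X (dual_span X L V) 2 affine_part e"
    "\<forall>j<2. \<forall>i<3. \<forall>\<^sub>F q in gen affine_part. trivial_coord affine_part (e j) i q = affine_frame j i q"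
    by (rule affine_bundle_frame)
  have "bundle_degree X (dual_span X L V) = deg (\<lambda>p. - (2 * int N + 1) * D p)"
  proof (rule M.bundle_degreeI[OF e(1) affine_part_nonempty order_refl finsupp_cmult[OF D_fin]])
    fix p assume p: "p \<in> X"
    let ?ok = "\<lambda>U' e' A. p \<in> U' \<and> frame X (dual_span X L V) 2 U' e' \<and> (\<forall>j<2. \<forall>l<2. rat (A j l)) \<and>
      M.expresses 2 (\<lambda>j. trivial_coord affine_part (e j)) 2 (\<lambda>j. trivial_coord U' (e' j)) A \<and>
      hasord p (\<lambda>q. leibniz_det 2 (\<lambda>j l. A j l q)) (- (2 * int N + 1) * D p)"
    show "\<exists>U' e' A. ?ok U' e' A"
    proof (cases "D p = 0")
      case True
      then have "p \<in> affine_part" using p by (simp add: affine_part_def)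
      moreover have "hasord p (\<lambda>q. leibniz_det 2 (\<lambda>j l. if j = l then 1 else 0)) (- (2 * int N + 1) * D p)"
        using hasord_const[OF p, of 1] True leibniz_det_id[of 2] by simp
      ultimately have "?ok affine_part e (\<lambda>j l q. if j = l then 1 else 0)"
        using e(1) M.expresses_refl rat_const by simp
      then show ?thesis by (intro exI[of _ affine_part] exI[of _ e] exI[of _ "\<lambda>j l q. if j = l then 1 else 0"])
    next
      case False
      then have Dp: "D p > 0" using D_nonneg[OF p] by simp
      have pp: "p \<in> pole_part" by (rule pole_in_pole_part[OF p Dp])
      obtain e' where e': "frame X (dual_span X L V) 2 pole_part e'"
        "\<forall>j<2. \<forall>i<3. \<forall>\<^sub>F q in gen pole_part. trivial_coord pole_part (e' j) i q = pole_frame j i q"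
        by (rule pole_bundle_frame)
      \<comment> \<open>Entries 0 and 1 are the coordinates with respect to
        \<open>pole_frame\<close>, so the matrix consists of these two entries of
        \<open>affine_frame\<close>.\<close>
      define A where "A j l q = (if l = 0 then affine_frame j 0 q else if j = 0 then 1 else 0)" for j l :: nat and q
      have rx: "rat x" using x_nz by (simp add: nz_iff)
      have "rat (affine_frame j 0)" for j
        unfolding affine_frame_def[abs_def]
        by (cases "j = 0") (auto intro!: rat_add rat_mult rat_diff rat_power rat_uminus rx)
      then have "rat (A j l)" for j l
        unfolding A_def[abs_def] by (cases "l = 0"; cases "j = 0") (simp_all add: rat_const)
      moreover have "M.expresses 2 (\<lambda>j. trivial_coord affine_part (e j)) 2 (\<lambda>j. trivial_coord pole_part (e' j)) A"
        unfolding M.expresses_def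
      proof (intro allI impI)
        fix j i :: nat assume j: "j < 2" and i: "i < 3"
        have gp: "gen pole_part = gen X" using gen_zopen[OF zopen_parts(2)] pp by blast
        have "trivial_coord affine_part (e j) i \<approx> affine_frame j i"
          using e(2) j i gen_zopen[OF zopen_parts(1) affine_part_nonempty] by simp
        moreover have "trivial_coord pole_part (e' 0) i \<approx> pole_frame 0 i" "trivial_coord pole_part (e' 1) i \<approx> pole_frame 1 i"
          using e'(2) i gp by simp_all
        ultimately show "trivial_coord affine_part (e j) i \<approx> (\<lambda>q. \<Sum>l<2. A j l q * trivial_coord pole_part (e' l) i q)"
          using nz_nonzero[OF x_nz]
        proof eventually_elim
          case (elim q)
          have "(x q ^ N + x q ^ (N + 1)) * inverse (x q) ^ (2 * N + 1) = inverse (x q) ^ N + inverse (x q) ^ (N + 1)"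
            "x q ^ (2 * N + 1) * inverse (x q) ^ (2 * N + 1) = 1"
            using elim(4) by (simp_all add: power_inverse mult_2 mult_2_right power_add field_simps)
          then show ?case
            using j i elim unfolding less_2_cases_iff
            by (auto simp: numeral_3_eq_3 less_Suc_eq numeral_2_eq_2 lessThan_Suc A_def affine_frame_def pole_frame_def
                simp del: power_Suc)
        qed
      qed
      moreover have "hasord p (\<lambda>q. leibniz_det 2 (\<lambda>j l. A j l q)) (- (2 * int N + 1) * D p)"
      proof -
        have "\<beta> 2 \<approx> (\<lambda>q. leibniz_det 2 (\<lambda>j l. A j l q))"
          using \<beta>_eqs(3) by eventually_elim (simp add: numeral_2_eq_2 leibniz_det_2 A_def affine_frame_def)
        from hasord_cong[OF \<beta>_2_pole[OF p Dp] this] show ?thesis by (simp only: mult_minus_left)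
      qed
      ultimately have "?ok pole_part e' A" using pp e'(1) by simp
      then show ?thesis by (intro exI[of _ pole_part] exI[of _ e'] exI[of _ A])
    qed
  qed
  also have "\<dots> = - (4 * int N + 2)" using deg_cmult[of "- (2 * int N + 1)" D] D_deg by simp
  finally show ?thesis .
qed

lemma dual_span_slope: "slope X (dual_span X L V) = - (2 * real N + 1)"
  using dual_span_degree M.bundle_rank_eq[OF dual_span_bundle] by (simp add: slope_def)

text \<open>The coefficients \<open>c\<close> of the syzygy in \<open>span_poly_2\<close> are
  polynomials in \<open>x\<close> of degree at most \<open>N\<close>, with poles bounded by
  \<open>N D\<close>. A germ of O(-N D) vanishes enough to make all its products with them
  regular.\<close>

lemma dual_span_injection:
  fixes T :: "('n, 'k) sheaf"
  assumes "line_model X T (\<lambda>p. - int N * D p) \<kappa>"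
  shows "\<exists>\<phi>. sheaf_injection X T (dual_span X L V) \<phi>"
proof -
  interpret T: line_model X T "\<lambda>p. - int N * D p" \<kappa> by (rule assms)
  define c where "c i = ev (if i = 0 then monom ((- 1) ^ N) N else if i = 1 then - alt_poly N else 1)" for i :: nat
  have cord: "ordge p (c i) (- (int N * D p))" if "p \<in> X" for p i
    unfolding c_def using that by (intro ev_ordge) (auto simp: degree_alt_poly degree_monom_le)
  show ?thesis
  proof (rule T.multiplication_injection[OF dual_span_model])
    fix p f assume p: "p \<in> X" and f: "ordge p f (- (- int N * D p))"
    have "ordge p (\<lambda>q. f q * c i q) 0" for i using ordge_mult[OF f cord[OF p, of i]] by simp
    moreover have "c 0 q + c 1 q * (x q ^ N + x q ^ (N + 1)) + c 2 q * x q ^ (2 * N + 1) = 0" for q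
      using arg_cong[OF span_poly_2[of N], of "\<lambda>P. poly P (x q)"]
      by (simp add: c_def ev_def span_poly_def poly_monom)
    then have "f q * c 0 q + f q * c 1 q * (x q ^ N + x q ^ (N + 1)) + f q * c 2 q * x q ^ (2 * N + 1) = 0" for q
      by (metis (no_types, lifting) distrib_left mult.assoc mult_zero_right)
    ultimately show "syzygy_germ p (\<lambda>i q. f q * c i q)" unfolding syzygy_iff by simp
  next
    show "(2::nat) < 3" "nz (c 2)" unfolding c_def by (simp_all add: ev_nz)
  qed
qed

text \<open>The image of the injection is a line subbundle sheaf isomorphic to O(-N D), of slope
  \<open>- 2 N\<close> against \<open>- (2 N + 1)\<close> for the dual span.\<close>

lemma dual_span_unstable:
  fixes T :: "('n, 'k) sheaf"
  assumes "line_model X T (\<lambda>p. - int N * D p) \<kappa>" and inj: "sheaf_injection X T (dual_span X L V) \<phi>"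
  shows "\<not> semistable X (dual_span X L V)"
proof
  interpret T: line_model X T "\<lambda>p. - int N * D p" \<kappa> by (rule assms)
  let ?S = "\<lambda>U. \<phi> U ` carrier (Sec T U)"
  interpret S: sheaf_model X "sub_sheaf (dual_span X L V) ?S" 1 "line_germ (\<lambda>p. - int N * D p)"
    "\<lambda>U h. \<kappa> U (inv_into (carrier (Sec T U)) (\<phi> U) h)"
    by (rule T.image_model[OF inj M.module_sheaf])
  interpret S: proper_line_model X "sub_sheaf (dual_span X L V) ?S" "\<lambda>p. - int N * D p"
    "\<lambda>U h. \<kappa> U (inv_into (carrier (Sec T U)) (\<phi> U) h)"
    by unfold_locales (rule finsupp_cmult[OF D_fin])
  have "slope X (sub_sheaf (dual_span X L V) ?S) = - (2 * real N)"
    using S.bundle_degree_line deg_cmult[of "- int N" D] D_deg S.bundle_rank_eq[OF S.vector_bundle_1]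
    by (simp add: slope_def)
  moreover have sub: "\<phi> U ` carrier (Sec T U) \<subseteq> carrier (Sec (dual_span X L V) U)" if "zopen X U" for U
    using inj that unfolding sheaf_injection_def sheaf_morphism_def by blast
  moreover assume ss: "semistable X (dual_span X L V)"
  have "slope X (sub_sheaf (dual_span X L V) ?S) \<le> slope X (dual_span X L V)"
    using ss[unfolded semistable_def, THEN spec, of ?S, THEN spec, of 1] S.vector_bundle_1 sub by simp
  ultimately show False using dual_span_slope by simp
qed

end

text \<open>Polynomials in \<open>x\<close> of degree at most \<open>2 N + 1\<close> have poles
  bounded by \<open>(2 N + 1) D\<close>, so they are coordinates of sections of \<open>L\<close>.
  Independence holds because a polynomial in \<open>x\<close> vanishes generically only if it is
  zero.\<close>

lemma (in degree_two_pencil) pencil_system_exists: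
  fixes L :: "('n, 'm) sheaf"
  assumes L: "line_model X L (\<lambda>p. (2 * int N + 1) * D p) \<psi>" and N: "2 \<le> N"
  obtains V b where "pencil_system X D x N L \<psi> V b"
proof -
  interpret L: line_model X L "\<lambda>p. (2 * int N + 1) * D p" \<psi> by (rule L)
  have "\<exists>s. s \<in> carrier (Sec L X) \<and> \<psi> X s 0 \<approx> ev (span_poly N i)" for i
  proof -
    have "ordge p (ev (span_poly N i)) (- ((2 * int N + 1) * D p))" if "p \<in> X" for p
      using ev_ordge[OF that degree_span_poly, of N i] by (simp add: algebra_simps)
    from L.line_coord_surj[OF zopen_X this] show ?thesis by blast
  qed
  then obtain b where b: "\<And>i. b i \<in> carrier (Sec L X)" "\<And>i. \<psi> X (b i) 0 \<approx> ev (span_poly N i)" by metis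
  have indep: "c i = 0" if "(\<lambda>q. \<Sum>i<3. c i * \<psi> X (b i) 0 q) \<approx> (\<lambda>q. 0)" "i < 3" for c and i :: nat
  proof -
    have "\<forall>\<^sub>F q in gen X. \<forall>l\<in>{..<3}. \<psi> X (b l) 0 q = ev (span_poly N l) q"
      using b by (intro eventually_ball_finite) auto
    with that(1) have "ev (span_comb N c) \<approx> (\<lambda>q. 0)"
      by eventually_elim (simp add: ev_def span_comb_def poly_sum)
    then have "span_comb N c = 0" by (simp add: ev_0_iff)
    then have "c 0 = 0" "c 1 = 0" "c 2 = 0" using coeff_span_comb[of N c] N by auto
    then show ?thesis using that(2) by (auto simp: numeral_3_eq_3 less_Suc_eq numeral_2_eq_2)
  qed
  define V where "V = {s \<in> carrier (Sec L X). cspan 3 (\<lambda>i. \<psi> X (b i) 0) (\<psi> X s 0)}"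
  interpret S: section_space X L "\<lambda>p. (2 * int N + 1) * D p" \<psi> V b 3
    unfolding V_def by (rule L.section_spaceI, rule b(1)) (rule indep)
  have "pencil_system X D x N L \<psi> V b"
    by unfold_locales (use N b(2) in \<open>auto simp: S.\<beta>_def\<close>)
  then show ?thesis by (rule that)
qed

theorem theorem4p2:
  fixes X :: "('n::finite) pt set" and H :: "('n, 'm) sheaf" and g :: nat and n :: int
  assumes "smooth_projective_curve X" and "has_genus X g" and "g \<ge> 7"
    and "hyperelliptic_bundle X H"
    and "2 \<le> n" and "3 * n + 1 \<le> int g - 1"
  shows "\<exists>(L :: ('n, 'n pt set \<Rightarrow> 'm \<Rightarrow> 'n pt \<Rightarrow> complex) sheaf) V.
    coherent_system X L V 1 (4 * n + 2) 3 \<and> generated X L V \<and> linearly_stable X L V \<and>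
    \<not> semistable X (dual_span X L V) \<and>
    (\<exists>\<phi>. sheaf_injection X (tensor_power X H (- n)) (dual_span X L V) \<phi>) \<and>
    of_int (bundle_degree X (tensor_power X H (- n))) > slope X (dual_span X L V)"
proof -
  interpret smooth_curve X by unfold_locales (fact assms(1))
  obtain D x \<psi> where Dx: "degree_two_pencil X D x" and H: "line_model X H D \<psi>"
    using hyperelliptic_pencil[OF assms(4)] by blast
  interpret P: degree_two_pencil X D x by (rule Dx)
  interpret H: line_model X H D \<psi> by (rule H)
  define N where "N = nat n"
  have n: "n = int N" and N: "2 \<le> N" using assms(5) by (auto simp: N_def)
  obtain V b where "pencil_system X D x N (tensor_power X H (2 * int N + 1))
      (\<lambda>U s i. H.tensor_coord (2 * int N + 1) U s) V b"
    by (rule P.pencil_system_exists[OF H.tensor_power_line_model N])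
  then interpret S: pencil_system X D x N "tensor_power X H (2 * int N + 1)"
    "\<lambda>U s i. H.tensor_coord (2 * int N + 1) U s" V b .
  \<comment> \<open>Both tensor powers are presented by multiples of the same divisor
    \<open>D\<close>, the one for which L(D) is spanned by 1 and \<open>x\<close>; so their
    coordinates are rational functions that can be multiplied with one another.\<close>
  note T = H.tensor_power_line_model[of "- int N"]
  interpret T: line_model X "tensor_power X H (- int N)" "\<lambda>p. - int N * D p"
    "\<lambda>U s i. H.tensor_coord (- int N) U s" by (rule T)
  interpret T: proper_line_model X "tensor_power X H (- int N)" "\<lambda>p. - int N * D p"
    "\<lambda>U s i. H.tensor_coord (- int N) U s" ..
  obtain \<phi> where \<phi>: "sheaf_injection X (tensor_power X H (- int N))
      (dual_span X (tensor_power X H (2 * int N + 1)) V) \<phi>"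
    using S.dual_span_injection[OF T] by blast
  have "bundle_degree X (tensor_power X H (- int N)) = - (2 * int N)"
    using T.bundle_degree_line deg_cmult[of "- int N" D] P.D_deg by simp
  then have "real_of_int (bundle_degree X (tensor_power X H (- int N)))
      > slope X (dual_span X (tensor_power X H (2 * int N + 1)) V)"
    using S.dual_span_slope by simp
  then show ?thesis
    unfolding n using S.coherent_system S.generated S.linearly_stable S.dual_span_unstable[OF T \<phi>] \<phi> by blast
qed

end
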